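(* Let $1<p<\infty$, $1\le q<\infty$, $\alpha,\beta>0$ and let $q'$ be the exponent conjugate to $q$. Assume $m>\max(\alpha-\beta-1,\beta-1)$. Let $c=\{c_k^j:k\ge0,\ 1\le j\le d_k\}$ be a double indexed sequence of complex numbers with associated harmonic function $g=g_c$. Then $c\in M_H(B^{p,q}_\alpha,A^\infty_\beta)$ if and only if $$\sup_{0\le\rho<1}\ \sup_{y'\in\mathbb S}\ (1-\rho)^{m+1+\beta-\alpha}\left(\int_{\mathbb S}|\Lambda_{m+1}(g\ast P_{x'})(\rho y')|^{q'}\,dx'\right)^{1/q'}<\infty$$ (with the usual modification if $q'=\infty$).
   Context: $\mathbb B=\{x\in\mathbb R^n:|x|<1\}$ ($n\ge2$), $\mathbb S=\partial\mathbb B$, $dx'$ is surface measure on $\mathbb S$, and $h(\mathbb B)$ is the space of harmonic functions on $\mathbb B$. Points of $\mathbb B$ are written $x=rx'$, $0\le r<1$, $x'\in\mathbb S$. For each $k\ge0$, $Y^{(k)}_j$, $1\le j\le d_k$, is a fixed real-valued orthonormal basis (in $L^2(\mathbb S)$) of the space of spherical harmonics of order $k$. Each $f\in h(\mathbb B)$ has an expansion $f(rx')=\sum_{k\ge0}r^k\sum_{j=1}^{d_k}b_k^j(f)Y^{(k)}_j(x')$. For a double indexed sequence $c$ set $(c\ast f)(rx')=\sum_{k\ge0}\sum_{j=1}^{d_k}r^kc_k^jb_k^j(f)Y^{(k)}_j(x')$ if the series converges in $\mathbb B$; for $f,g\in h(\mathbb B)$ set $(f\ast g)(rx')=\sum_{k\ge0}\sum_{j=1}^{d_k}r^kb_k^j(f)b_k^j(g)Y^{(k)}_j(x')$,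 which is harmonic in $\mathbb B$. To $c$ is associated the harmonic function $g_c(rx')=\sum_{k\ge0}r^k\sum_{j=1}^{d_k}c_k^jY^{(k)}_j(x')$. For subspaces $X,Y$ of $h(\mathbb B)$, $M_H(X,Y)$ is the space of all double indexed sequences $c$ such that $c\ast f\in Y$ for every $f\in X$. $P_{y'}(x)=c_n\frac{1-|x|^2}{|x-y'|^n}$, $x\in\mathbb B$, $y'\in\mathbb S$, is the Poisson kernel of $\mathbb B$ ($c_n$ the usual normalizing constant). Fractional derivative: for real $t>0$ and $f\in h(\mathbb B)$, $$(\Lambda_tf)(rx')=\sum_{k=0}^\infty r^k\frac{\Gamma(k+n/2+t)}{\Gamma(k+n/2)\Gamma(t)}\sum_{j=1}^{d_k}b_k^j(f)Y^{(k)}_j(x'),$$ which is again harmonic in $\mathbb B$. $M_q(f,r)=(\int_{\mathbb S}|f(rx')|^q\,dx')^{1/q}$; for $0<p,q<\infty$, $\alpha>0$, $B^{p,q}_\alpha$ is the space of all $f\in h(\mathbb B)$ with $\left(\int_0^1M_q(f,r)^p(1-r^2)^{\alpha p-1}r^{n-1}\,dr\right)^{1/p}<\infty$; $A^\infty_\beta=\{f\in h(\mathbb B):\sup_{x\in\mathbb B}(1-|x|^2)^\beta|f(x)|<\infty\}$. *)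

theory Defs
  imports "HOL-Analysis.Analysis" "HOL-Probability.Essential_Supremum"
begin

text \<open>
  Twice continuously differentiable with vanishing Laplacian on an open set; \<open>D2 x\<close> is the second
  derivative (Hessian) of \<open>f\<close> at \<open>x\<close>, the Laplacian its trace.
\<close>

definition harmonic_on :: "'a::euclidean_space set \<Rightarrow> ('a \<Rightarrow> complex) \<Rightarrow> bool" where
  "harmonic_on S f \<longleftrightarrow> open S \<and>
     (\<exists>(D1 :: 'a \<Rightarrow> 'a \<Rightarrow>\<^sub>L complex) (D2 :: 'a \<Rightarrow> 'a \<Rightarrow>\<^sub>L 'a \<Rightarrow>\<^sub>L complex).
        (\<forall>x\<in>S. (f has_derivative blinfun_apply (D1 x)) (at x)) \<and>
        (\<forall>x\<in>S. (D1 has_derivative blinfun_apply (D2 x)) (at x)) \<and>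
        continuous_on S D2 \<and>
        (\<forall>x\<in>S. (\<Sum>e\<in>Basis. blinfun_apply (blinfun_apply (D2 x) e) e) = 0))"

text \<open>
  Only the values on the unit ball are relevant; two members agreeing there represent the same
  harmonic function, and everything below depends only on values in the ball.
\<close>

definition harmonic_ball :: "('a::euclidean_space \<Rightarrow> complex) set" where
  "harmonic_ball = {f. harmonic_on (ball 0 1) f}"

text \<open>
  The unnormalised surface measure, as \<open>n\<close> times the Lebesgue measure of the cone
  \<open>{r x'. 0 < r < 1, x' \<in> A}\<close>.
\<close>

definition surface :: "'a::euclidean_space measure" where
  "surface = scale_measure (of_nat DIM('a))
     (distr (restrict_space lborel (ball 0 1 - {0})) (restrict_space borel (sphere 0 1))
        (\<lambda>x. x /\<^sub>R norm x))"

text \<open>Powers of extended nonnegative reals; meant for exponents \<open>a > 0\<close> only.\<close>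

definition ennreal_powr :: "ennreal \<Rightarrow> real \<Rightarrow> ennreal" where
  "ennreal_powr x a = (if x = \<infinity> then \<infinity> else ennreal (enn2real x powr a))"

text \<open>The norm of \<open>L\<^sup>q\<close> of the sphere; the value \<open>\<infinity>\<close> of \<open>q\<close> is the essential supremum.\<close>

definition sphere_norm :: "ennreal \<Rightarrow> ('a::euclidean_space \<Rightarrow> complex) \<Rightarrow> ennreal" where
  "sphere_norm q u =
     (if q = \<infinity> then esssup surface (\<lambda>x. ennreal (cmod (u x)))
      else ennreal_powr (\<integral>\<^sup>+ x. ennreal (cmod (u x) powr enn2real q) \<partial>surface) (1 / enn2real q))"

definition integral_mean :: "real \<Rightarrow> ('a::euclidean_space \<Rightarrow> complex) \<Rightarrow> real \<Rightarrow> ennreal" where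
  "integral_mean q f r = sphere_norm (ennreal q) (\<lambda>x'. f (r *\<^sub>R x'))"

definition spherical_harmonics :: "nat \<Rightarrow> ('a::euclidean_space \<Rightarrow> complex) set" where
  "spherical_harmonics k =
     {u. \<exists>P. polynomial_function P \<and> (\<forall>t x. P (t *\<^sub>R x) = of_real (t ^ k) * P x) \<and>
             harmonic_on UNIV P \<and> (\<forall>x\<in>sphere 0 1. u x = P x)}"

text \<open>
  \<open>Y k j\<close> for \<open>1 \<le> j \<le> d k\<close>; the functions \<open>Y k j\<close> for other \<open>j\<close>, and all values off the unit
  sphere, are irrelevant.
\<close>

definition sh_orthonormal_basis ::
    "(nat \<Rightarrow> nat) \<Rightarrow> (nat \<Rightarrow> nat \<Rightarrow> 'a::euclidean_space \<Rightarrow> real) \<Rightarrow> bool" where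
  "sh_orthonormal_basis d Y \<longleftrightarrow> (\<forall>k.
     (\<forall>j\<in>{1..d k}. (\<lambda>x. complex_of_real (Y k j x)) \<in> spherical_harmonics k) \<and>
     (\<forall>i\<in>{1..d k}. \<forall>j\<in>{1..d k}.
        (LINT x|surface. Y k i x * Y k j x) = (if i = j then 1 else 0)) \<and>
     (\<forall>u\<in>spherical_harmonics k. \<exists>a. \<forall>x\<in>sphere 0 1.
        u x = (\<Sum>j=1..d k. a j * complex_of_real (Y k j x))))"

text \<open>
  The point \<open>x'\<close> of the sphere in \<open>x = r x'\<close>, \<open>r = norm x\<close>. At the origin it is arbitrary, but there
  only the order-0 term of an expansion survives, and that term is constant on the sphere.
\<close>

definition sphere_point :: "'a::euclidean_space \<Rightarrow> 'a" where
  "sphere_point x = (SOME x'. x' \<in> sphere 0 1 \<and> x = norm x *\<^sub>R x')"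

definition sh_term :: "(nat \<Rightarrow> nat) \<Rightarrow> (nat \<Rightarrow> nat \<Rightarrow> 'a::euclidean_space \<Rightarrow> real) \<Rightarrow>
    (nat \<Rightarrow> nat \<Rightarrow> complex) \<Rightarrow> 'a \<Rightarrow> nat \<Rightarrow> complex" where
  "sh_term d Y a x k =
     of_real (norm x ^ k) * (\<Sum>j=1..d k. a k j * of_real (Y k j (sphere_point x)))"

definition sh_convergent :: "(nat \<Rightarrow> nat) \<Rightarrow> (nat \<Rightarrow> nat \<Rightarrow> 'a::euclidean_space \<Rightarrow> real) \<Rightarrow>
    (nat \<Rightarrow> nat \<Rightarrow> complex) \<Rightarrow> bool" where
  "sh_convergent d Y a \<longleftrightarrow> (\<forall>x\<in>ball 0 1. summable (sh_term d Y a x))"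

definition sh_series :: "(nat \<Rightarrow> nat) \<Rightarrow> (nat \<Rightarrow> nat \<Rightarrow> 'a::euclidean_space \<Rightarrow> real) \<Rightarrow>
    (nat \<Rightarrow> nat \<Rightarrow> complex) \<Rightarrow> 'a \<Rightarrow> complex" where
  "sh_series d Y a x = (\<Sum>k. sh_term d Y a x k)"

text \<open>
  The coefficients \<open>b\<^sub>k\<^sup>j(f)\<close>. Requiring them to vanish at unused indices makes the family unique.
\<close>

definition sh_coeff :: "(nat \<Rightarrow> nat) \<Rightarrow> (nat \<Rightarrow> nat \<Rightarrow> 'a::euclidean_space \<Rightarrow> real) \<Rightarrow>
    ('a \<Rightarrow> complex) \<Rightarrow> nat \<Rightarrow> nat \<Rightarrow> complex" where
  "sh_coeff d Y f = (THE b.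
     (\<forall>k j. j \<notin> {1..d k} \<longrightarrow> b k j = 0) \<and> (\<forall>x\<in>ball 0 1. sh_term d Y b x sums f x))"

definition seq_conv :: "(nat \<Rightarrow> nat) \<Rightarrow> (nat \<Rightarrow> nat \<Rightarrow> 'a::euclidean_space \<Rightarrow> real) \<Rightarrow>
    (nat \<Rightarrow> nat \<Rightarrow> complex) \<Rightarrow> ('a \<Rightarrow> complex) \<Rightarrow> 'a \<Rightarrow> complex" where
  "seq_conv d Y c f = sh_series d Y (\<lambda>k j. c k j * sh_coeff d Y f k j)"

definition harm_conv :: "(nat \<Rightarrow> nat) \<Rightarrow> (nat \<Rightarrow> nat \<Rightarrow> 'a::euclidean_space \<Rightarrow> real) \<Rightarrow>
    ('a \<Rightarrow> complex) \<Rightarrow> ('a \<Rightarrow> complex) \<Rightarrow> 'a \<Rightarrow> complex" where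
  "harm_conv d Y f g = sh_series d Y (\<lambda>k j. sh_coeff d Y f k j * sh_coeff d Y g k j)"

definition multipliers :: "(nat \<Rightarrow> nat) \<Rightarrow> (nat \<Rightarrow> nat \<Rightarrow> 'a::euclidean_space \<Rightarrow> real) \<Rightarrow>
    ('a \<Rightarrow> complex) set \<Rightarrow> ('a \<Rightarrow> complex) set \<Rightarrow> (nat \<Rightarrow> nat \<Rightarrow> complex) set" where
  "multipliers d Y A B =
     {c. \<forall>f\<in>A. sh_convergent d Y (\<lambda>k j. c k j * sh_coeff d Y f k j) \<and> seq_conv d Y c f \<in> B}"

definition associated_harmonic :: "(nat \<Rightarrow> nat) \<Rightarrow> (nat \<Rightarrow> nat \<Rightarrow> 'a::euclidean_space \<Rightarrow> real) \<Rightarrow>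
    (nat \<Rightarrow> nat \<Rightarrow> complex) \<Rightarrow> ('a \<Rightarrow> complex) \<Rightarrow> bool" where
  "associated_harmonic d Y c g \<longleftrightarrow>
     g \<in> harmonic_ball \<and> (\<forall>x\<in>ball 0 1. sh_term d Y c x sums g x)"

definition frac_deriv :: "(nat \<Rightarrow> nat) \<Rightarrow> (nat \<Rightarrow> nat \<Rightarrow> 'a::euclidean_space \<Rightarrow> real) \<Rightarrow>
    real \<Rightarrow> ('a \<Rightarrow> complex) \<Rightarrow> 'a \<Rightarrow> complex" where
  "frac_deriv d Y t f = sh_series d Y (\<lambda>k j.
     of_real (Gamma (real k + real DIM('a) / 2 + t) / (Gamma (real k + real DIM('a) / 2) * Gamma t))
       * sh_coeff d Y f k j)"

text \<open>The constant makes the integral over the sphere of \<open>poisson y x\<close> with respect to \<open>y\<close> equal to 1.\<close>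

definition poisson :: "'a::euclidean_space \<Rightarrow> 'a \<Rightarrow> complex" where
  "poisson y x = of_real (1 / measure (surface :: 'a measure) (sphere 0 1)
     * ((1 - (norm x)\<^sup>2) / norm (x - y) ^ DIM('a)))"

definition B_space :: "real \<Rightarrow> real \<Rightarrow> real \<Rightarrow> ('a::euclidean_space \<Rightarrow> complex) set" where
  "B_space p q \<alpha> = {f \<in> harmonic_ball.
     ennreal_powr (\<integral>\<^sup>+ r \<in> {0<..<1}. ennreal_powr (integral_mean q f r) p
        * ennreal ((1 - r\<^sup>2) powr (\<alpha> * p - 1) * r ^ (DIM('a) - 1)) \<partial>lborel) (1 / p) < \<infinity>}"

definition A_inf :: "real \<Rightarrow> ('a::euclidean_space \<Rightarrow> complex) set" where
  "A_inf \<beta> = {f \<in> harmonic_ball.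
     (SUP x\<in>ball 0 1. ennreal ((1 - (norm x)\<^sup>2) powr \<beta> * cmod (f x))) < \<infinity>}"

end

theory Submission
 imports Defs "HOL-Computational_Algebra.Formal_Power_Series"
begin

text \<open>
Write \<open>\<kappa> = m + 1 + \<beta> - \<alpha>\<close>, and let a bounded measurable \<open>\<phi>\<close> on the sphere have moments
\<open>\<phi>\<^sub>k\<^sup>j = \<integral> \<phi> Y\<^sub>k\<^sup>j\<close>. Integrating \<open>\<phi>\<close> against the kernel \<open>\<Lambda>\<^sub>m\<^sub>+\<^sub>1 (g * P)\<close> turns the kernel into the
harmonic function with coefficients \<open>c\<^sub>k\<^sup>j \<phi>\<^sub>k\<^sup>j\<close>, differentiated fractionally. By duality of \<open>L\<^sup>q\<close>
and \<open>L\<^sup>q'\<close> on the sphere the supremum condition therefore says that this function is bounded by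
\<open>C (1 - \<rho>) powr (- \<kappa>)\<close> times the \<open>L\<^sup>q\<close> norm of \<open>\<phi>\<close>, with \<open>C\<close> independent of \<open>\<phi>\<close>
(\<open>sup_condition_iff\<close>).

The condition is sufficient because the means of \<open>f\<close> in the mixed norm space grow at most like
\<open>(1 - R) powr (- \<alpha>)\<close> (\<open>B_space_growth\<close>): using \<open>\<phi> = f (R \<cdot>)\<close> at a radius \<open>R\<close> half-way to the
boundary bounds \<open>\<Lambda>\<^sub>m\<^sub>+\<^sub>1 (c * f)\<close> by a multiple of \<open>(1 - r) powr (- (\<beta> + m + 1))\<close>, and undoing the
fractional derivative by a Beta integral (\<open>fractional_integration_bound\<close>) brings the exponent down
to \<open>- \<beta>\<close>.

For necessity choose an integer \<open>N\<close> above \<open>\<alpha>\<close> and \<open>m + 1\<close> and test the multiplier on the functions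
\<open>(1 - r) powr (N - \<alpha>)\<close> times an \<open>N\<close>-fold Euler type derivative of the Poisson integral of \<open>\<phi>\<close>, dilated
by \<open>r\<close>; the derivative multiplies the order \<open>k\<close> part by \<open>pochhammer (k + n/2) N\<close>. Each Euler step
costs one factor \<open>1 / (1 - r)\<close> in \<open>L\<^sup>q\<close> (\<open>pochhammer_growth\<close>), so every superposition of these
functions with weights \<open>\<plusminus> 3 powr (- n)\<close> lies in the mixed norm space
(\<open>test_superposition_in_B_space\<close>). Since the multiplier maps all of them to functions of finite
weighted supremum, a gliding hump argument (\<open>condensation_of_singularities\<close>) makes these suprema
uniformly bounded; no completeness of the spaces is needed. Evaluating at the radius \<open>r\<close> itself
gives the desired bound with \<open>N\<close> in place of \<open>m + 1\<close>, and a fractional integration of order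
\<open>N - m - 1\<close> finishes the proof.

All this rests on the expansion in spherical harmonics. The zonal polynomials are read off from the
generating function of the Poisson kernel. Green's identity on spheres shows that their moments
against a harmonic function are monomials in the radius (\<open>zonal_moment\<close>), which yields the
expansion; the addition theorem converts it to the given basis. Conversely a family of coefficients
of subexponential growth defines a harmonic function, which is locally its own Poisson integral.
\<close>

unbundle no vec_syntax
unbundle fps_syntax

section \<open>Zonal harmonic polynomials\<close>

text \<open>
 The binomial series of \<open>(1 - X) powr (- l)\<close>.
\<close>

definition neg_binomial :: "real \<Rightarrow> real fps" where
 "neg_binomial l = Abs_fps (\<lambda>m. pochhammer l m / fact m)"

lemma neg_binomial_shift: "neg_binomial l = (1 - fps_X) * neg_binomial (l + 1)"
proof (rule fps_ext)
 fix k
 show "neg_binomial l $ k = ((1 - fps_X) * neg_binomial (l + 1)) $ k"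
 proof (cases k)
  case 0
  then show ?thesis by (simp add: neg_binomial_def)
 next
  case (Suc i)
  have "((1 - fps_X) * neg_binomial (l + 1)) $ k
    = pochhammer (l+1) (Suc i) / fact (Suc i) - pochhammer (l+1) i / fact i"
   using Suc by (simp add: neg_binomial_def algebra_simps)
  also have "pochhammer (l+1) (Suc i) = pochhammer (l+1) i * (l + 1 + i)"
   by (simp add: pochhammer_Suc)
  also have "pochhammer (l+1) i * (l + 1 + i) / fact (Suc i) - pochhammer (l+1) i / fact i
    = l * pochhammer (l+1) i / fact (Suc i)"
   by (simp add: fact_Suc divide_simps del: of_nat_Suc) (simp add: algebra_simps)
  also have "\<dots> = neg_binomial l $ k"
   using Suc by (simp add: neg_binomial_def pochhammer_rec)
  finally show ?thesis ..
 qed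
qed

lemma fps_deriv_neg_binomial: "fps_deriv (neg_binomial l) = fps_const l * neg_binomial (l + 1)"
proof (rule fps_ext)
 fix k
 have "fps_deriv (neg_binomial l) $ k = real (Suc k) * (l * pochhammer (l + 1) k / (real (Suc k) * fact k))"
  by (simp add: neg_binomial_def pochhammer_rec fact_Suc del: of_nat_Suc)
 also have "\<dots> = l * pochhammer (l + 1) k / fact k"
  by (simp del: of_nat_Suc)
 finally show "fps_deriv (neg_binomial l) $ k = (fps_const l * neg_binomial (l + 1)) $ k"
  by (simp add: neg_binomial_def)
qed

text \<open>
 The series of \<open>(1 - 2 t X + s X\<^sup>2) powr (- l)\<close>, generating the Gegenbauer polynomials made
 homogeneous by \<open>s\<close>.
\<close>

definition gegenbauer :: "real \<Rightarrow> real \<Rightarrow> real \<Rightarrow> real fps" where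
 "gegenbauer l t s = neg_binomial l oo (fps_const (2 * t) * fps_X - fps_const s * fps_X^2)"

lemma gegenbauer_shift:
 "gegenbauer l t s = (1 - fps_const (2 * t) * fps_X + fps_const s * fps_X^2) * gegenbauer (l+1) t s"
proof -
 let ?w = "fps_const (2 * t) * fps_X - fps_const s * fps_X^2"
 have w: "?w $ 0 = 0" by (simp add: power2_eq_square)
 have "gegenbauer l t s = ((1 - fps_X) * neg_binomial (l + 1)) oo ?w"
  unfolding gegenbauer_def by (subst neg_binomial_shift) simp
 also have "\<dots> = ((1 - fps_X) oo ?w) * (neg_binomial (l+1) oo ?w)"
  by (rule fps_compose_mult_distrib[OF w])
 also have "(1 - fps_X) oo ?w = 1 - ?w"
  using w by (simp add: fps_compose_sub_distrib)
 finally show ?thesis by (simp add: gegenbauer_def algebra_simps)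
qed

lemma gegenbauer_nth_0 [simp]: "gegenbauer l t s $ 0 = 1"
 by (simp add: gegenbauer_def neg_binomial_def)

lemma fps_deriv_gegenbauer:
 "fps_deriv (gegenbauer l t s) =
  fps_const l * gegenbauer (l+1) t s * (fps_const (2 * t) - fps_const (2 * s) * fps_X)"
proof -
 let ?w = "fps_const (2 * t) * fps_X - fps_const s * fps_X^2"
 have w: "?w $ 0 = 0" by (simp add: power2_eq_square)
 have d: "fps_deriv ?w = fps_const (2 * t) - fps_const (2 * s) * fps_X"
 proof -
  have "fps_deriv (fps_X^2) = 2 * (fps_X :: real fps)"
   by (simp add: power2_eq_square)
  then show ?thesis
   by (simp add: fps_const_mult[symmetric] numeral_fps_const mult_ac del: fps_const_mult)
 qed
 have "fps_deriv (gegenbauer l t s) = (fps_deriv (neg_binomial l) oo ?w) * fps_deriv ?w"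
  unfolding gegenbauer_def using w by (rule fps_compose_deriv)
 also have "fps_deriv (neg_binomial l) oo ?w = fps_const l * gegenbauer (l+1) t s"
  by (simp add: fps_deriv_neg_binomial fps_compose_mult_distrib[OF w] gegenbauer_def)
 finally show ?thesis unfolding d .
qed

text \<open>
 Differentiating a generating function coefficient by coefficient treats all zonal polynomials at once:
 product and chain rule hold for formal series.
\<close>

definition fps_has_derivative ::
  "('a::real_normed_vector \<Rightarrow> real fps) \<Rightarrow> ('a \<Rightarrow> real fps) \<Rightarrow> 'a \<Rightarrow> bool" where
 "fps_has_derivative F F' x \<longleftrightarrow> (\<forall>k. ((\<lambda>x. F x $ k) has_derivative (\<lambda>h. F' h $ k)) (at x))"

lemma fps_has_derivative_const: "fps_has_derivative (\<lambda>_. c) (\<lambda>_. 0) x"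
 by (simp add: fps_has_derivative_def)

lemma fps_has_derivative_fps_const:
 "(f has_derivative f') (at x) \<Longrightarrow> fps_has_derivative (\<lambda>x. fps_const (f x)) (\<lambda>h. fps_const (f' h)) x"
 unfolding fps_has_derivative_def
proof
 fix k assume "(f has_derivative f') (at x)"
 then show "((\<lambda>x. fps_const (f x) $ k) has_derivative (\<lambda>h. fps_const (f' h) $ k)) (at x)"
  by (cases "k = 0") auto
qed

lemma fps_has_derivative_add:
 "fps_has_derivative F F' x \<Longrightarrow> fps_has_derivative G G' x \<Longrightarrow>
   fps_has_derivative (\<lambda>x. F x + G x) (\<lambda>h. F' h + G' h) x"
 by (auto simp: fps_has_derivative_def intro!: has_derivative_add)

lemma fps_has_derivative_diff:
 "fps_has_derivative F F' x \<Longrightarrow> fps_has_derivative G G' x \<Longrightarrow>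
   fps_has_derivative (\<lambda>x. F x - G x) (\<lambda>h. F' h - G' h) x"
 by (auto simp: fps_has_derivative_def intro!: has_derivative_diff)

lemma fps_has_derivative_mult:
 assumes "fps_has_derivative F F' x" "fps_has_derivative G G' x"
 shows "fps_has_derivative (\<lambda>x. F x * G x) (\<lambda>h. F' h * G x + F x * G' h) x"
 unfolding fps_has_derivative_def
proof
 fix k
 have "((\<lambda>x. \<Sum>i=0..k. F x $ i * G x $ (k-i)) has_derivative
   (\<lambda>h. \<Sum>i=0..k. F x $ i * G' h $ (k-i) + F' h $ i * G x $ (k-i))) (at x)"
  using assms by (intro has_derivative_sum has_derivative_mult) (auto simp: fps_has_derivative_def)
 then show "((\<lambda>x. (F x * G x) $ k) has_derivative (\<lambda>h. (F' h * G x + F x * G' h) $ k)) (at x)"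
  by (simp add: fps_mult_nth sum.distrib add.commute)
qed

lemma fps_has_derivative_power:
 assumes "fps_has_derivative F F' x"
 shows "fps_has_derivative (\<lambda>x. F x ^ i) (\<lambda>h. of_nat i * F x ^ (i - 1) * F' h) x"
proof (induction i)
 case 0
 then show ?case by (simp add: fps_has_derivative_const)
next
 case (Suc i)
 have "fps_has_derivative (\<lambda>x. F x * F x ^ i)
   (\<lambda>h. F' h * F x ^ i + F x * (of_nat i * F x ^ (i - 1) * F' h)) x"
  by (rule fps_has_derivative_mult[OF assms Suc])
 moreover have "(\<lambda>h. F' h * F x ^ i + F x * (of_nat i * F x ^ (i - 1) * F' h))
   = (\<lambda>h. of_nat (Suc i) * F x ^ (Suc i - 1) * F' h)"
  by (cases i) (auto simp: algebra_simps)
 ultimately show ?case by simp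
qed

lemma fps_compose_nth_truncate:
 assumes "(W :: real fps) $ 0 = 0" "k \<le> K"
 shows "(a oo W) $ k = (\<Sum>i\<le>K. fps_const (a $ i) * W ^ i) $ k"
proof -
 have "(a oo W) $ k = (\<Sum>i\<le>k. a $ i * (W ^ i) $ k)"
  by (simp add: fps_compose_nth atLeast0AtMost)
 also have "\<dots> = (\<Sum>i\<le>K. a $ i * (W ^ i) $ k)"
  using assms by (intro sum.mono_neutral_left) (auto simp: startsby_zero_power_prefix)
 finally show ?thesis by (simp add: fps_sum_nth)
qed

lemma fps_has_derivative_compose:
 assumes "fps_has_derivative W W' x" "\<And>x. W x $ 0 = 0"
 shows "fps_has_derivative (\<lambda>x. a oo W x) (\<lambda>h. (fps_deriv a oo W x) * W' h) x"
 unfolding fps_has_derivative_def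
proof
 fix k
 have "((\<lambda>x. \<Sum>i\<le>Suc k. a $ i * (W x ^ i) $ k) has_derivative
   (\<lambda>h. \<Sum>i\<le>Suc k. a $ i * (of_nat i * W x ^ (i - 1) * W' h) $ k)) (at x)"
  using fps_has_derivative_power[OF assms(1)]
  by (intro has_derivative_sum has_derivative_mult_right) (auto simp: fps_has_derivative_def)
 moreover have "(\<lambda>x. \<Sum>i\<le>Suc k. a $ i * (W x ^ i) $ k) = (\<lambda>x. (a oo W x) $ k)"
 proof
  fix x
  show "(\<Sum>i\<le>Suc k. a $ i * (W x ^ i) $ k) = (a oo W x) $ k"
   by (subst fps_compose_nth_truncate[of _ _ "Suc k", OF assms(2)]) (auto simp: fps_sum_nth)
 qed
 moreover have "(\<Sum>i\<le>Suc k. a $ i * (of_nat i * W x ^ (i - 1) * W' h) $ k)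
   = ((fps_deriv a oo W x) * W' h) $ k" for h
 proof -
  have "((fps_deriv a oo W x) * W' h) $ k
   = ((\<Sum>i\<le>k. fps_const (fps_deriv a $ i) * W x ^ i) * W' h) $ k"
   unfolding fps_mult_nth
   by (intro sum.cong refl arg_cong2[of _ _ _ _ "(*)"] fps_compose_nth_truncate[OF assms(2)]) auto
  also have "\<dots> = (\<Sum>i\<le>k. fps_deriv a $ i * (W x ^ i * W' h) $ k)"
   by (simp add: sum_distrib_right fps_sum_nth mult.assoc)
  also have "\<dots> = (\<Sum>i\<le>Suc k. a $ i * (of_nat i * W x ^ (i - 1) * W' h) $ k)"
   by (subst sum.atMost_Suc_shift) (simp add: fps_of_nat[symmetric] mult.assoc mult.left_commute del: of_nat_Suc)
  finally show ?thesis ..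
 qed
 ultimately show "((\<lambda>x. (a oo W x) $ k) has_derivative (\<lambda>h. ((fps_deriv a oo W x) * W' h) $ k)) (at x)"
  by simp
qed

lemma fps_has_derivative_gegenbauer:
 fixes x y :: "'a::euclidean_space"
 shows "fps_has_derivative (\<lambda>x. gegenbauer l (x \<bullet> y) (x \<bullet> x))
  (\<lambda>h. fps_const l * gegenbauer (l+1) (x \<bullet> y) (x \<bullet> x) *
   (fps_const (2 * (h \<bullet> y)) * fps_X - fps_const (2 * (x \<bullet> h)) * fps_X^2)) x"
proof -
 let ?W = "\<lambda>x. fps_const (2*(x \<bullet> y)) * fps_X - fps_const (x \<bullet> x) * fps_X^2"
 have "fps_has_derivative ?W
   (\<lambda>h. (fps_const (2 * (h \<bullet> y)) * fps_X + fps_const (2 * (x \<bullet> y)) * 0)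
    - (fps_const (x \<bullet> h + h \<bullet> x) * fps_X^2 + fps_const (x \<bullet> x) * 0)) x"
  by (intro fps_has_derivative_diff fps_has_derivative_mult fps_has_derivative_fps_const
    fps_has_derivative_const derivative_eq_intros refl) auto
 also have "(\<lambda>h. (fps_const (2 * (h \<bullet> y)) * fps_X + fps_const (2 * (x \<bullet> y)) * 0)
    - (fps_const (x \<bullet> h + h \<bullet> x) * fps_X^2 + fps_const (x \<bullet> x) * 0))
   = (\<lambda>h. fps_const (2 * (h \<bullet> y)) * fps_X - fps_const (2 * (x \<bullet> h)) * fps_X^2)"
  by (simp add: inner_commute)
 finally have W: "fps_has_derivative ?W \<dots> x" .
 have W0: "?W x $ 0 = 0" for x by (simp add: power2_eq_square)
 have c: "fps_deriv (neg_binomial l) oo ?W x = fps_const l * gegenbauer (l+1) (x \<bullet> y) (x \<bullet> x)"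
  by (simp add: fps_deriv_neg_binomial fps_compose_mult_distrib[OF W0] gegenbauer_def)
 show ?thesis
  using fps_has_derivative_compose[OF W W0, of "neg_binomial l"] unfolding c
  by (simp add: gegenbauer_def)
qed

definition fps_polynomial :: "('a::real_normed_vector \<Rightarrow> real fps) \<Rightarrow> bool" where
 "fps_polynomial F \<longleftrightarrow> (\<forall>k. real_polynomial_function (\<lambda>x. F x $ k))"

lemma fps_polynomial_const: "fps_polynomial (\<lambda>_. c)"
 by (simp add: fps_polynomial_def real_polynomial_function.intros(2))

lemma fps_polynomial_fps_const:
 "real_polynomial_function f \<Longrightarrow> fps_polynomial (\<lambda>x. fps_const (f x))"
 unfolding fps_polynomial_def
proof
 fix k assume "real_polynomial_function f"
 then show "real_polynomial_function (\<lambda>x. fps_const (f x) $ k)"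
  by (cases "k = 0") (auto intro: real_polynomial_function.intros(2))
qed

lemma fps_polynomial_add: "fps_polynomial F \<Longrightarrow> fps_polynomial G \<Longrightarrow> fps_polynomial (\<lambda>x. F x + G x)"
 by (auto simp: fps_polynomial_def intro: real_polynomial_function.intros(3))

lemma fps_polynomial_mult: "fps_polynomial F \<Longrightarrow> fps_polynomial G \<Longrightarrow> fps_polynomial (\<lambda>x. F x * G x)"
 by (auto simp: fps_polynomial_def fps_mult_nth
   intro!: real_polynomial_function_sum real_polynomial_function.intros(4))

lemma fps_polynomial_diff: "fps_polynomial F \<Longrightarrow> fps_polynomial G \<Longrightarrow> fps_polynomial (\<lambda>x. F x - G x)"
 by (auto simp: fps_polynomial_def intro!: real_polynomial_function_diff)

lemma fps_polynomial_uminus: "fps_polynomial F \<Longrightarrow> fps_polynomial (\<lambda>x. - F x)"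
 by (auto simp: fps_polynomial_def intro!: real_polynomial_function_minus)

lemma fps_polynomial_power: "fps_polynomial F \<Longrightarrow> fps_polynomial (\<lambda>x. F x ^ i)"
 by (induction i) (auto intro!: fps_polynomial_mult fps_polynomial_const)

lemma real_polynomial_function_inner:
 "real_polynomial_function (\<lambda>x::'a::euclidean_space. x \<bullet> y)"
 by (intro real_polynomial_function.intros(1) bounded_linear_inner_left)

lemma real_polynomial_function_inner_self:
 "real_polynomial_function (\<lambda>x::'a::euclidean_space. x \<bullet> x)"
 by (subst euclidean_inner)
  (intro real_polynomial_function_sum real_polynomial_function.intros(4) real_polynomial_function_inner finite_Basis)

lemma fps_polynomial_gegenbauer:
 fixes y :: "'a::euclidean_space"
 shows "fps_polynomial (\<lambda>x. gegenbauer l (x \<bullet> y) (x \<bullet> x))"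
proof -
 have "fps_polynomial (\<lambda>x. fps_const (2 * (x \<bullet> y)) * fps_X - fps_const (x \<bullet> x) * fps_X^2)"
  by (intro fps_polynomial_diff fps_polynomial_mult fps_polynomial_fps_const fps_polynomial_const
    real_polynomial_function.intros(4) real_polynomial_function.intros(2) real_polynomial_function_inner
    real_polynomial_function_inner_self)
 from fps_polynomial_power[OF this] show ?thesis
  unfolding fps_polynomial_def gegenbauer_def fps_compose_nth
  by (intro allI real_polynomial_function_sum real_polynomial_function.intros(4)
    real_polynomial_function.intros(2)) auto
qed

text \<open>
 Second derivatives are computed in coordinates; here they are assembled into the bounded linear maps that the
 definition of harmonicity asks for.
\<close>

lemma harmonic_onI:
 fixes f :: "'a::euclidean_space \<Rightarrow> complex"
 assumes "open S"
  and f: "\<And>x. x \<in> S \<Longrightarrow> (f has_derivative (\<lambda>h. \<Sum>e\<in>Basis. (h \<bullet> e) *\<^sub>R g e x)) (at x)"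
  and g: "\<And>x e. x \<in> S \<Longrightarrow> e \<in> Basis \<Longrightarrow>
   (g e has_derivative (\<lambda>h. \<Sum>e'\<in>Basis. (h \<bullet> e') *\<^sub>R G e e' x)) (at x)"
  and G: "\<And>e e'. e \<in> Basis \<Longrightarrow> e' \<in> Basis \<Longrightarrow> continuous_on S (G e e')"
  and trace: "\<And>x. x \<in> S \<Longrightarrow> (\<Sum>e\<in>Basis. G e e x) = 0"
 shows "harmonic_on S f"
proof -
 define p :: "'a \<Rightarrow> complex \<Rightarrow> 'a \<Rightarrow>\<^sub>L complex"
  where "p e z = blinfun_scaleR_left z o\<^sub>L blinfun_inner_left e" for e z
 have p_apply: "blinfun_apply (p e z) h = (h \<bullet> e) *\<^sub>R z" for e z h
  by (simp add: p_def inner_commute)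
 have p_lin: "bounded_linear (p e)" for e
  unfolding p_def by (intro bounded_linear_intros)
 define p2 :: "'a \<Rightarrow> 'a \<Rightarrow> complex \<Rightarrow> 'a \<Rightarrow>\<^sub>L 'a \<Rightarrow>\<^sub>L complex"
  where "p2 e e' z = blinfun_scaleR_left (p e z) o\<^sub>L blinfun_inner_left e'" for e e' z
 have p2_apply: "blinfun_apply (p2 e e' z) h = (h \<bullet> e') *\<^sub>R p e z" for e e' z h
  by (simp add: p2_def inner_commute)
 have p2_lin: "bounded_linear (p2 e e')" for e e'
  unfolding p2_def by (intro bounded_linear_intros p_lin)
 define D1 where "D1 x = (\<Sum>e\<in>Basis. p e (g e x))" for x
 define D2 where "D2 x = (\<Sum>e\<in>Basis. \<Sum>e'\<in>Basis. p2 e e' (G e e' x))" for x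
 have "blinfun_apply (D1 x) = (\<lambda>h. \<Sum>e\<in>Basis. (h \<bullet> e) *\<^sub>R g e x)" for x
  by (auto simp: D1_def blinfun.sum_left p_apply fun_eq_iff)
 then have "(f has_derivative blinfun_apply (D1 x)) (at x)" if "x \<in> S" for x
  using f[OF that] by simp
 moreover have "(D1 has_derivative blinfun_apply (D2 x)) (at x)" if "x \<in> S" for x
 proof -
  have "(D1 has_derivative (\<lambda>h. \<Sum>e\<in>Basis. p e (\<Sum>e'\<in>Basis. (h \<bullet> e') *\<^sub>R G e e' x))) (at x)"
   unfolding D1_def
   by (intro has_derivative_sum bounded_linear.has_derivative[OF p_lin] g[OF that])
  also have "(\<lambda>h. \<Sum>e\<in>Basis. p e (\<Sum>e'\<in>Basis. (h \<bullet> e') *\<^sub>R G e e' x)) = blinfun_apply (D2 x)"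
   by (auto simp: D2_def blinfun.sum_left p2_apply linear_sum[OF bounded_linear.linear[OF p_lin]]
     linear_scale[OF bounded_linear.linear[OF p_lin]] fun_eq_iff)
  finally show ?thesis .
 qed
 moreover have "continuous_on S D2"
  unfolding D2_def
  by (intro continuous_intros bounded_linear.continuous_on[OF p2_lin] G)
 moreover have "(\<Sum>e\<in>Basis. blinfun_apply (blinfun_apply (D2 x) e) e) = 0" if "x \<in> S" for x
 proof -
  have "blinfun_apply (blinfun_apply (D2 x) b) b = G b b x" if b: "b \<in> Basis" for b
  proof -
   have "blinfun_apply (blinfun_apply (D2 x) b) b
     = (\<Sum>e\<in>Basis. \<Sum>e'\<in>Basis. (b \<bullet> e') *\<^sub>R (b \<bullet> e) *\<^sub>R G e e' x)"
    by (simp add: D2_def blinfun.sum_left p2_apply p_apply blinfun.scaleR_left)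
   also have "\<dots> = (\<Sum>e\<in>Basis. \<Sum>e'\<in>Basis. if b = e' \<and> b = e then G e e' x else 0)"
    using b by (intro sum.cong refl) (auto simp: inner_Basis)
   also have "\<dots> = (\<Sum>e\<in>Basis. if b = e then G e b x else 0)"
    using b by (intro sum.cong refl) (auto simp: sum.delta')
   also have "\<dots> = G b b x" using b by simp
   finally show ?thesis .
  qed
  then show ?thesis using trace[OF that] by simp
 qed
 ultimately show ?thesis
  unfolding harmonic_on_def using \<open>open S\<close> by blast
qed

text \<open>
 For \<open>norm y = 1\<close> this is \<open>(1 - \<bar>X x\<bar>\<^sup>2) / \<bar>X x -
 y\<bar>\<^sup>n\<close>, the Poisson kernel along the ray through \<open>x\<close>, as a series in
 \<open>X\<close>; its coefficient of order \<open>k\<close> is homogeneous of degree \<open>k\<close> in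
 \<open>x\<close>.
\<close>

definition zonal_fps :: "'a::euclidean_space \<Rightarrow> 'a \<Rightarrow> real fps" where
 "zonal_fps x y = (1 - fps_const (x \<bullet> x) * fps_X^2) * gegenbauer (real DIM('a) / 2) (x \<bullet> y) (x \<bullet> x)"

definition zonal :: "nat \<Rightarrow> 'a::euclidean_space \<Rightarrow> 'a \<Rightarrow> real" where
 "zonal k x y = zonal_fps x y $ k"

lemma fps_polynomial_zonal: "fps_polynomial (\<lambda>x. zonal_fps x y)"
 unfolding zonal_fps_def
 by (intro fps_polynomial_gegenbauer fps_polynomial_diff fps_polynomial_mult fps_polynomial_fps_const
   fps_polynomial_const real_polynomial_function_inner_self)

lemma has_derivative_basis_expand:
 fixes D :: "'a::euclidean_space \<Rightarrow> 'b::real_normed_vector"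
 assumes "(f has_derivative D) F"
 shows "(f has_derivative (\<lambda>h. \<Sum>e\<in>Basis. (h \<bullet> e) *\<^sub>R D e)) F"
proof -
 have "linear D" using assms has_derivative_linear by blast
 then have "D h = (\<Sum>e\<in>Basis. (h \<bullet> e) *\<^sub>R D e)" for h
  by (metis (no_types, lifting) euclidean_representation linear_scale linear_sum sum.cong)
 then have "D = (\<lambda>h. \<Sum>e\<in>Basis. (h \<bullet> e) *\<^sub>R D e)" by blast
 then show ?thesis using assms by simp
qed

text \<open>
 With the derivatives of the generating function expressed by shifted Gegenbauer series, Laplace's equation
 for it reduces to the following polynomial identities.
\<close>

lemma zonal_identity_1: fixes xe ey X :: "'b::idom" shows "xe * (2 * ey * X - 2 * xe * X^2) = 2 * X * (xe*ey) - 2*X^2*(xe*xe)" by algebra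
lemma zonal_identity_2: fixes xe ey X :: "'b::idom" shows "(2 * ey * X - 2 * xe * X^2) * (2 * ey * X - 2 * xe * X^2) =  4 * X^2 * (ey*ey)
        - 8 * X^3 * (xe * ey) + 4 * X^4 * (xe*xe)" by algebra
lemma zonal_identity_3: fixes X xe :: "'b::idom" shows "- (2 * X^2) * H0 - (2 * xe * X^2) * (l0 * H1 * L)
   + (- (2 * xe * X^2)) * (l0 * H1 * L)
   + c * (l0 * (l1 * H2 * L) * L
   - l0 * H1 * (2 * X^2)) = - (2 * X^2 * H0 + 2 * X^2 * c * l0 * H1)
    - 4 * X^2 * l0 * H1 * (xe * L) + c * l0 * l1 * H2 * (L * L)" by algebra
lemma zonal_identity_4: fixes X :: "'b::idom" assumes "H1 = (1 - 2 * t * X + s * X^2) * H2" shows "- ((2*l0) * (2 * X^2 * ((1 - 2 * t * X + s * X^2) * H1) + 2 * X^2 * (1 - s * X^2) * l0 * H1))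
    - 4 * X^2 * l0 * H1 * (2 * t * X - 2 * s * X^2)
    + (1 - s * X^2) * l0 * (l0+1) * H2 * (4 * X^2 - 8 * t * X^3 + 4 * s * X^4) = 0" 
proof -
 have "(4 * X^2 - 8 * t * X^3 + 4 * s * X^4) = 4 * X^2 * (1 - 2 * t * X + s * X^2)" by algebra
 then have "H2 * (4 * X^2 - 8 * t * X^3 + 4 * s * X^4) = 4 * X^2 * H1" using assms by algebra
 then have *: "(1 - s * X^2) * l0 * (l0+1) * H2 * (4 * X^2 - 8 * t * X^3 + 4 * s * X^4) = (1 - s * X^2) * l0 * (l0+1) * (4*X^2*H1)" by (simp only: mult.assoc)
 show ?thesis unfolding * by algebra
qed

text \<open>
 The Poisson kernel is harmonic in \<open>x\<close> at every scale \<open>X\<close>. Carried out with formal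
 series, the computation of its Laplacian shows that each coefficient is harmonic.
\<close>

lemma harmonic_zonal:
 fixes y :: "'a::euclidean_space"
 assumes y: "norm y = 1"
 shows "harmonic_on UNIV (\<lambda>x. complex_of_real (zonal k x y))"
proof -
 define l where "l = real DIM('a) / 2"
 define H where "H i x = gegenbauer (l + real i) (x \<bullet> y) (x \<bullet> x)" for i :: nat and x :: 'a
 define c where "c x = 1 - fps_const (x \<bullet> x) * fps_X^2" for x :: 'a
 define L where "L x h = fps_const (2 * (h \<bullet> y)) * fps_X - fps_const (2 * (x \<bullet> h)) * fps_X^2" for x h :: 'a
 define l0 where "l0 = fps_const l"
 define l1 where "l1 = fps_const (l + 1)"
 have H_deriv: "fps_has_derivative (H i) (\<lambda>h. fps_const (l + real i) * H (Suc i) x * L x h) x" for i x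
  unfolding H_def L_def using fps_has_derivative_gegenbauer[of "l + real i" y x] by (simp add: add_ac)
 have H0_deriv: "fps_has_derivative (H 0) (\<lambda>h. l0 * H 1 x * L x h) x" for x
  using H_deriv[of 0 x] by (simp add: l0_def)
 have H1_deriv: "fps_has_derivative (H 1) (\<lambda>h. l1 * H 2 x * L x h) x" for x
  using H_deriv[of 1 x] by (simp add: l1_def numeral_2_eq_2)
 have sq: "((\<lambda>x. x \<bullet> x) has_derivative (\<lambda>h. 2 * (x \<bullet> h))) (at x)" for x :: 'a
  by (rule derivative_eq_intros refl | simp add: inner_commute)+
 have c_deriv: "fps_has_derivative c (\<lambda>h. - (fps_const (2 * (x \<bullet> h)) * fps_X^2)) x" for x
 proof -
  have "fps_has_derivative c (\<lambda>h. 0 - (fps_const (2 * (x \<bullet> h)) * fps_X^2 + fps_const (x \<bullet> x) * 0)) x"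
   unfolding c_def
   by (intro fps_has_derivative_diff fps_has_derivative_mult fps_has_derivative_fps_const
    fps_has_derivative_const sq)
  then show ?thesis by simp
 qed
 have L_deriv: "fps_has_derivative (\<lambda>x. L x e) (\<lambda>h. - (fps_const (2 * (h \<bullet> e)) * fps_X^2)) x" for e x
 proof -
  have "fps_has_derivative (\<lambda>x. L x e) (\<lambda>h. 0 - (fps_const (2 * (h \<bullet> e)) * fps_X^2 + fps_const (2 * (x \<bullet> e)) * 0)) x"
   unfolding L_def
   by (intro fps_has_derivative_diff fps_has_derivative_mult fps_has_derivative_fps_const
    fps_has_derivative_const derivative_eq_intros refl) auto
  then show ?thesis by simp
 qed
 define Z1 where "Z1 e x = - (fps_const (2 * (x \<bullet> e)) * fps_X^2) * H 0 x + c x * (l0 * H 1 x * L x e)" for e x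
 define Z2 where "Z2 e x h =
   - (fps_const (2 * (h \<bullet> e)) * fps_X^2) * H 0 x
   - (fps_const (2 * (x \<bullet> e)) * fps_X^2) * (l0 * H 1 x * L x h)
   + (- (fps_const (2 * (x \<bullet> h)) * fps_X^2)) * (l0 * H 1 x * L x e)
   + c x * (l0 * (l1 * H 2 x * L x h) * L x e
   - l0 * H 1 x * (fps_const (2 * (h \<bullet> e)) * fps_X^2))" for e x h
 have Z_deriv: "fps_has_derivative (\<lambda>x. zonal_fps x y) (\<lambda>h. Z1 h x) x" for x
 proof -
  have "fps_has_derivative (\<lambda>x. c x * H 0 x)
    (\<lambda>h. - (fps_const (2 * (x \<bullet> h)) * fps_X^2) * H 0 x + c x * (l0 * H 1 x * L x h)) x"
   by (intro fps_has_derivative_mult c_deriv H0_deriv)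
  then show ?thesis by (simp add: Z1_def c_def H_def l_def zonal_fps_def)
 qed
 have Z1_deriv: "fps_has_derivative (Z1 e) (\<lambda>h. Z2 e x h) x" for e x
 proof -
  have "fps_has_derivative (\<lambda>x. - 1 * (fps_const (2 * (x \<bullet> e)) * fps_X^2) * H 0 x + c x * (l0 * H 1 x * L x e))
    (\<lambda>h. ((0 * (fps_const (2 * (x \<bullet> e)) * fps_X^2) + (- 1) * (fps_const (2 * (h \<bullet> e)) * fps_X^2 + fps_const (2 * (x \<bullet> e)) * 0)) * H 0 x
     + - 1 * (fps_const (2 * (x \<bullet> e)) * fps_X^2) * (l0 * H 1 x * L x h))
    + (- (fps_const (2 * (x \<bullet> h)) * fps_X^2) * (l0 * H 1 x * L x e)
      + c x * ((0 * H 1 x + l0 * (l1 * H 2 x * L x h)) * L x e + l0 * H 1 x * (- (fps_const (2 * (h \<bullet> e)) * fps_X^2))))) x"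
   by (intro fps_has_derivative_add fps_has_derivative_mult fps_has_derivative_fps_const
    fps_has_derivative_const c_deriv H0_deriv H1_deriv L_deriv derivative_eq_intros refl) auto
  then show ?thesis unfolding Z1_def Z2_def by (simp add: algebra_simps)
 qed
 have poly: "fps_polynomial (\<lambda>x. Z2 e x e')" for e e'
 proof -
  have H: "fps_polynomial (H i)" for i
   unfolding H_def by (rule fps_polynomial_gegenbauer)
  show ?thesis
   unfolding Z2_def c_def L_def l0_def l1_def
   by (intro fps_polynomial_add fps_polynomial_diff fps_polynomial_uminus fps_polynomial_mult H
    fps_polynomial_const fps_polynomial_fps_const real_polynomial_function_inner
    real_polynomial_function_inner_self real_polynomial_function.intros(2,4))
 qed
 have trace: "(\<Sum>e\<in>Basis. Z2 e x e) = 0" for x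
 proof -
  define s where "s = fps_const (x \<bullet> x)"
  define t where "t = fps_const (x \<bullet> y)"
  define X where "X = (fps_X :: real fps)"
  have sum_L: "(\<Sum>e\<in>Basis. fps_const (x \<bullet> e) * L x e) = 2 * t * X - 2 * s * X^2"
   and sum_LL: "(\<Sum>e\<in>Basis. L x e * L x e) = 4 * X^2 - 8 * t * X^3 + 4 * s * X^4"
  proof -
   have c: "(\<Sum>e\<in>Basis. fps_const (f e)) = fps_const (\<Sum>e\<in>Basis. f e)" for f :: "'a \<Rightarrow> real"
    by (induction rule: infinite_finite_induct) (auto simp flip: fps_const_add)
   have xx: "(\<Sum>e\<in>Basis. fps_const (x \<bullet> e) * fps_const (x \<bullet> e)) = s"
    and xy: "(\<Sum>e\<in>Basis. fps_const (x \<bullet> e) * fps_const (e \<bullet> y)) = t"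
    and yy: "(\<Sum>e\<in>Basis. fps_const (e \<bullet> y) * fps_const (e \<bullet> y)) = 1"
   proof -
    have "(\<Sum>e\<in>Basis. (e \<bullet> y) * (e \<bullet> y)) = y \<bullet> y"
     by (subst euclidean_inner[of y y]) (simp only: inner_commute[of y])
    then show "(\<Sum>e\<in>Basis. fps_const (e \<bullet> y) * fps_const (e \<bullet> y)) = 1"
     using y by (simp add: c norm_eq_1)
    have "(\<Sum>e\<in>Basis. (x \<bullet> e) * (e \<bullet> y)) = x \<bullet> y"
     by (subst euclidean_inner[of x y]) (simp only: inner_commute[of y])
    then show "(\<Sum>e\<in>Basis. fps_const (x \<bullet> e) * fps_const (e \<bullet> y)) = t"
     by (simp add: c t_def)
    show "(\<Sum>e\<in>Basis. fps_const (x \<bullet> e) * fps_const (x \<bullet> e)) = s"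
     by (simp add: c s_def euclidean_inner[symmetric])
   qed
   have L: "L x e = 2 * fps_const (e \<bullet> y) * X - 2 * fps_const (x \<bullet> e) * X^2" for e
    by (simp add: L_def X_def fps_const_mult[symmetric] numeral_fps_const del: fps_const_mult)
   have "(\<Sum>e\<in>Basis. fps_const (x \<bullet> e) * L x e)
     = (\<Sum>e\<in>Basis. 2 * X * (fps_const (x \<bullet> e) * fps_const (e \<bullet> y))
        - 2 * X^2 * (fps_const (x \<bullet> e) * fps_const (x \<bullet> e)))"
    by (intro sum.cong refl) (simp only: L zonal_identity_1)
   also have "\<dots> = 2 * X * t - 2 * X^2 * s"
    by (simp only: sum_subtractf sum_distrib_left[symmetric] xx xy)
   finally show "(\<Sum>e\<in>Basis. fps_const (x \<bullet> e) * L x e) = 2 * t * X - 2 * s * X^2"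
    by (simp only: mult_ac)
   have "(\<Sum>e\<in>Basis. L x e * L x e)
     = (\<Sum>e\<in>Basis. 4 * X^2 * (fps_const (e \<bullet> y) * fps_const (e \<bullet> y))
        - 8 * X^3 * (fps_const (x \<bullet> e) * fps_const (e \<bullet> y))
        + 4 * X^4 * (fps_const (x \<bullet> e) * fps_const (x \<bullet> e)))"
    by (intro sum.cong refl) (simp only: L zonal_identity_2)
   also have "\<dots> = 4 * X^2 * 1 - 8 * X^3 * t + 4 * X^4 * s"
    by (simp only: sum_subtractf sum.distrib sum_distrib_left[symmetric] xx xy yy)
   finally show "(\<Sum>e\<in>Basis. L x e * L x e) = 4 * X^2 - 8 * t * X^3 + 4 * s * X^4"
    by (simp only: mult_ac mult_1_right mult_1_left)
  qed
  have n: "of_nat DIM('a) = 2 * l0"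
   by (simp add: l0_def l_def fps_of_nat[symmetric] numeral_fps_const)
  have l1: "l1 = l0 + 1" by (simp add: l0_def l1_def flip: fps_const_add)
  have c: "c x = 1 - s * X^2" by (simp add: c_def s_def X_def)
  have H0: "H 0 x = (1 - 2 * t * X + s * X^2) * H 1 x"
   and H1: "H 1 x = (1 - 2 * t * X + s * X^2) * H 2 x"
   unfolding H_def s_def t_def X_def
   using gegenbauer_shift[of l "x \<bullet> y" "x \<bullet> x"] gegenbauer_shift[of "l + 1" "x \<bullet> y" "x \<bullet> x"]
   by (simp_all add: fps_const_mult[symmetric] numeral_fps_const add_ac del: fps_const_mult)
  have "(\<Sum>e\<in>Basis. Z2 e x e) = (\<Sum>e\<in>Basis. - (2 * X^2 * H 0 x + 2 * X^2 * c x * l0 * H 1 x)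
    - 4 * X^2 * l0 * H 1 x * (fps_const (x \<bullet> e) * L x e) + c x * l0 * l1 * H 2 x * (L x e * L x e))"
  proof (intro sum.cong refl)
   fix e :: 'a assume "e \<in> Basis"
   then have 1: "e \<bullet> e = 1" by simp
   have *: "fps_const (2 * (x \<bullet> e)) = 2 * fps_const (x \<bullet> e)" "fps_const (2 * (e \<bullet> e)) = 2"
    using 1 by (simp_all add: fps_const_mult[symmetric] numeral_fps_const del: fps_const_mult)
   show "Z2 e x e = - (2 * X^2 * H 0 x + 2 * X^2 * c x * l0 * H 1 x)
    - 4 * X^2 * l0 * H 1 x * (fps_const (x \<bullet> e) * L x e) + c x * l0 * l1 * H 2 x * (L x e * L x e)"
    unfolding Z2_def * X_def[symmetric] by (rule zonal_identity_3)
  qed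
  also have "\<dots> = - (of_nat DIM('a) * (2 * X^2 * H 0 x + 2 * X^2 * c x * l0 * H 1 x))
    - 4 * X^2 * l0 * H 1 x * (2 * t * X - 2 * s * X^2)
    + c x * l0 * l1 * H 2 x * (4 * X^2 - 8 * t * X^3 + 4 * s * X^4)"
   by (simp only: sum.distrib sum_subtractf sum_distrib_left[symmetric] sum_L sum_LL sum_constant sum_negf mult_minus_right)
  also have "\<dots> = 0"
   unfolding n l1 c H0 by (rule zonal_identity_4[OF H1])
  finally show ?thesis .
 qed
 show ?thesis
 proof (rule harmonic_onI[where g = "\<lambda>e x. complex_of_real (Z1 e x $ k)" and G = "\<lambda>e e' x. complex_of_real (Z2 e x e' $ k)"])
  fix x :: 'a
  show "((\<lambda>x. complex_of_real (zonal k x y)) has_derivative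
    (\<lambda>h. \<Sum>e\<in>Basis. (h \<bullet> e) *\<^sub>R complex_of_real (Z1 e x $ k))) (at x)"
   using Z_deriv[of x] unfolding fps_has_derivative_def zonal_def
   by (intro has_derivative_basis_expand has_derivative_of_real) auto
  show "((\<lambda>x. complex_of_real (Z1 e x $ k)) has_derivative
    (\<lambda>h. \<Sum>e'\<in>Basis. (h \<bullet> e') *\<^sub>R complex_of_real (Z2 e x e' $ k))) (at x)" for e
   using Z1_deriv[of e x] unfolding fps_has_derivative_def
   by (intro has_derivative_basis_expand has_derivative_of_real) auto
  show "continuous_on UNIV (\<lambda>x. complex_of_real (Z2 e x e' $ k))" for e e'
   using poly[of e e'] unfolding fps_polynomial_def real_polynomial_function_eq
   by (intro continuous_on_of_real continuous_on_polymonial_function) blast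
  have "(\<Sum>e\<in>Basis. complex_of_real (Z2 e x e $ k)) = of_real ((\<Sum>e\<in>Basis. Z2 e x e) $ k)"
   by (simp add: fps_sum_nth)
  then show "(\<Sum>e\<in>Basis. complex_of_real (Z2 e x e $ k)) = 0"
   by (simp add: trace)
 qed auto
qed

section \<open>The generating function of the zonal polynomials\<close>

lemma real_polynomial_function_zonal: "real_polynomial_function (\<lambda>x. zonal k x y)"
 using fps_polynomial_zonal[of y] by (simp add: fps_polynomial_def zonal_def)

lemma zonal_0 [simp]: "zonal 0 x y = 1"
 by (simp add: zonal_def zonal_fps_def)

lemma fps_compose_linear_quadratic:
 "(fps_const a * fps_X - fps_const b * fps_X^2) oo (fps_const c * fps_X)
   = fps_const (c * a) * fps_X - fps_const (c\<^sup>2 * b) * (fps_X^2 :: real fps)"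
 "(1 - fps_const b * fps_X^2) oo (fps_const c * fps_X)
   = 1 - fps_const (c\<^sup>2 * b) * (fps_X^2 :: real fps)"
 by (rule fps_ext, rename_tac n, case_tac "n = 1"; case_tac "n = 2";
   simp add: fps_compose_linear fps_X_power_nth)+

lemma gegenbauer_scale:
 "gegenbauer l (c * t) (c\<^sup>2 * s) = gegenbauer l t s oo (fps_const c * fps_X)"
proof -
 let ?c = "fps_const c * fps_X :: real fps"
 let ?w = "fps_const (2 * t) * fps_X - fps_const s * fps_X^2"
 have "?w $ 0 = 0" by (simp add: power2_eq_square)
 moreover have "?c $ 0 = 0" by simp
 ultimately have "(neg_binomial l oo ?w) oo ?c = neg_binomial l oo (?w oo ?c)"
  by (subst fps_compose_assoc) auto
 also have "?w oo ?c = fps_const (2 * (c * t)) * fps_X - fps_const (c\<^sup>2 * s) * fps_X^2"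
  unfolding fps_compose_linear_quadratic by (simp only: mult.left_commute)
 finally show ?thesis unfolding gegenbauer_def ..
qed

lemma zonal_scale: "zonal k (c *\<^sub>R x) y = c ^ k * zonal k x y"
proof -
 let ?c = "fps_const c * fps_X :: real fps"
 have c0: "?c $ 0 = 0" by simp
 have sq: "(c *\<^sub>R x) \<bullet> (c *\<^sub>R x) = c\<^sup>2 * (x \<bullet> x)"
  by (simp add: power2_eq_square mult_ac)
 have "zonal_fps (c *\<^sub>R x) y = zonal_fps x y oo ?c"
  unfolding zonal_fps_def fps_compose_mult_distrib[OF c0] fps_compose_linear_quadratic
   gegenbauer_scale[symmetric] sq by simp
 then show ?thesis
  by (simp add: zonal_def fps_compose_linear)
qed

lemma zonal_commute: "norm x = 1 \<Longrightarrow> norm y = 1 \<Longrightarrow> zonal k x y = zonal k y x"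
 by (simp add: zonal_def zonal_fps_def norm_eq_1 inner_commute)

text \<open>
 The quotient of two solutions has derivative zero. This identifies series that are given by different closed
 forms.
\<close>

lemma fps_ODE_unique:
 fixes F G D E :: "'a::field_char_0 fps"
 assumes F: "D * fps_deriv F = E * F" and G: "D * fps_deriv G = E * G"
  and D: "D \<noteq> 0" and 0: "F $ 0 = G $ 0" "G $ 0 \<noteq> 0"
 shows "F = G"
proof -
 have "D * (fps_deriv F * G - F * fps_deriv G) = 0"
  using F G by algebra
 then have *: "fps_deriv F * G = F * fps_deriv G" using D by simp
 have "fps_deriv (F * inverse G) = (fps_deriv F * G - F * fps_deriv G) * (inverse G)\<^sup>2"
  using 0 by (simp add: fps_inverse_deriv algebra_simps power2_eq_square inverse_mult_eq_1')
 then have "fps_deriv (F * inverse G) = 0" using * by simp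
 then obtain c where c: "F * inverse G = fps_const c"
  by (metis fps_deriv_eq_0_iff)
 then have "(F * inverse G) $ 0 = c" by simp
 then have "c = 1" using 0 by simp
 have "F = F * inverse G * G" using 0 by (simp add: mult.assoc inverse_mult_eq_1)
 then show ?thesis using c \<open>c = 1\<close> by simp
qed

definition neg_binomial_coeff :: "real \<Rightarrow> nat \<Rightarrow> real" where
 "neg_binomial_coeff l n = pochhammer l n / fact n"

lemma neg_binomial_coeff_Suc:
 "real (Suc n) * neg_binomial_coeff l (Suc n) = (l + real n) * neg_binomial_coeff l n"
proof -
 have "real (Suc n) * neg_binomial_coeff l (Suc n)
   = real (Suc n) * (pochhammer l n * (l + real n) / (real (Suc n) * fact n))"
  by (simp add: neg_binomial_coeff_def pochhammer_Suc fact_Suc del: of_nat_Suc)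
 also have "\<dots> = (l + real n) * neg_binomial_coeff l n"
  by (simp add: neg_binomial_coeff_def del: of_nat_Suc)
 finally show ?thesis .
qed

lemma neg_binomial_coeff_nonneg: "l \<ge> 0 \<Longrightarrow> neg_binomial_coeff l n \<ge> 0"
 by (simp add: neg_binomial_coeff_def pochhammer_prod prod_nonneg)

definition complex_fps :: "real fps \<Rightarrow> complex fps" where
 "complex_fps F = Abs_fps (\<lambda>k. complex_of_real (F $ k))"

lemma complex_fps_simps:
 "complex_fps (F + G) = complex_fps F + complex_fps G"
 "complex_fps (F - G) = complex_fps F - complex_fps G"
 "complex_fps (F * G) = complex_fps F * complex_fps G"
 "complex_fps (fps_const c) = fps_const (of_real c)"
 "complex_fps fps_X = fps_X" "complex_fps 1 = 1"
 "complex_fps (fps_deriv F) = fps_deriv (complex_fps F)"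
 by (auto simp: complex_fps_def fps_eq_iff fps_mult_nth)

text \<open>
 Over the complex numbers \<open>1 - 2 X Re z + \<bar>z\<bar>\<^sup>2 X\<^sup>2 = (1 - z X) (1 - cnj z
 X)\<close>, so the generating function is a product of two binomial series; both sides solve the same first
 order differential equation.
\<close>

lemma gegenbauer_factor:
 fixes z :: complex
 shows "complex_of_real (gegenbauer l (Re z) ((cmod z)\<^sup>2) $ k) =
  (\<Sum>i\<le>k. (of_real (neg_binomial_coeff l i) * z ^ i) *
      (of_real (neg_binomial_coeff l (k-i)) * cnj z ^ (k - i)))"
proof -
 define A where "A u = Abs_fps (\<lambda>n. complex_of_real (neg_binomial_coeff l n) * u ^ n)" for u
 have A: "(1 - fps_const u * fps_X) * fps_deriv (A u) = fps_const (of_real l * u) * A u" for u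
 proof (rule fps_ext)
  fix n
  have *: "fps_deriv (A u) $ n = (of_real l + of_nat n) * of_real (neg_binomial_coeff l n) * u ^ Suc n" for n
   using arg_cong[OF neg_binomial_coeff_Suc[of n l], of complex_of_real]
   by (simp add: A_def)
  show "((1 - fps_const u * fps_X) * fps_deriv (A u)) $ n = (fps_const (of_real l * u) * A u) $ n"
  proof (cases n)
   case 0
   then show ?thesis using *[of 0] by (simp add: A_def algebra_simps)
  next
   case (Suc m)
   have "((1 - fps_const u * fps_X) * fps_deriv (A u)) $ n = fps_deriv (A u) $ n - u * fps_deriv (A u) $ m"
    using Suc by (simp add: algebra_simps)
   also have "fps_deriv (A u) $ m = of_nat n * of_real (neg_binomial_coeff l n) * u ^ n"
    using Suc by (simp add: A_def)
   finally show ?thesis unfolding * by (simp add: A_def algebra_simps)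
  qed
 qed
 let ?t = "Re z" and ?s = "(cmod z)\<^sup>2"
 define D where "D = (1 - fps_const z * fps_X) * (1 - fps_const (cnj z) * fps_X)"
 define E where "E = fps_const (complex_of_real l) * (fps_const (of_real (2 * ?t)) - fps_const (of_real (2 * ?s)) * fps_X)"
 define G where "G = complex_fps (gegenbauer l ?t ?s)"
 have zz: "fps_const z + fps_const (cnj z) = fps_const (of_real (2 * ?t))"
  "fps_const z * fps_const (cnj z) = fps_const (of_real ?s)"
  by (simp_all add: complex_add_cnj complex_norm_square[symmetric])
 have E: "E = fps_const (of_real l) * (fps_const z + fps_const (cnj z) - 2 * (fps_const z * fps_const (cnj z)) * fps_X)"
  unfolding zz E_def by (simp add: numeral_fps_const)
 have D: "D = complex_fps (1 - fps_const (2 * ?t) * fps_X + fps_const ?s * fps_X^2)"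
 proof -
  have "D = 1 - (fps_const z + fps_const (cnj z)) * fps_X + (fps_const z * fps_const (cnj z)) * fps_X^2"
   unfolding D_def by algebra
  then show ?thesis unfolding zz by (simp only: complex_fps_simps power2_eq_square)
 qed
 have "D * fps_deriv (A z * A (cnj z)) = E * (A z * A (cnj z))"
 proof -
  have "D * fps_deriv (A z * A (cnj z)) =
    ((1 - fps_const z * fps_X) * fps_deriv (A z)) * ((1 - fps_const (cnj z) * fps_X) * A (cnj z))
    + ((1 - fps_const (cnj z) * fps_X) * fps_deriv (A (cnj z))) * ((1 - fps_const z * fps_X) * A z)"
   unfolding D_def fps_deriv_mult by algebra
  also have "\<dots> = fps_const (of_real l) * fps_const z * A z * ((1 - fps_const (cnj z) * fps_X) * A (cnj z))
    + fps_const (of_real l) * fps_const (cnj z) * A (cnj z) * ((1 - fps_const z * fps_X) * A z)"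
   unfolding A by (simp only: fps_const_mult)
  also have "\<dots> = E * (A z * A (cnj z))"
   unfolding E by algebra
  finally show ?thesis .
 qed
 moreover have "D * fps_deriv G = E * G"
 proof -
  have "D * fps_deriv G = complex_fps ((1 - fps_const (2 * ?t) * fps_X + fps_const ?s * fps_X^2)
    * fps_deriv (gegenbauer l ?t ?s))"
   unfolding D G_def by (simp only: complex_fps_simps)
  also have "(1 - fps_const (2 * ?t) * fps_X + fps_const ?s * fps_X^2) * fps_deriv (gegenbauer l ?t ?s)
    = fps_const l * (fps_const (2 * ?t) - fps_const (2 * ?s) * fps_X) * gegenbauer l ?t ?s"
   unfolding fps_deriv_gegenbauer by (subst gegenbauer_shift[of l]) (simp only: mult_ac)
  also have "complex_fps \<dots> = E * G"
   unfolding E_def G_def by (simp only: complex_fps_simps)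
  finally show ?thesis .
 qed
 moreover have "D $ 0 = 1" by (simp add: D_def)
 then have "D \<noteq> 0" by auto
 moreover have "(A z * A (cnj z)) $ 0 = G $ 0" "G $ 0 \<noteq> 0"
  by (simp_all add: A_def G_def complex_fps_def neg_binomial_coeff_def)
 ultimately have "A z * A (cnj z) = G"
  using fps_ODE_unique by blast
 then have "G $ k = (A z * A (cnj z)) $ k" by simp
 then show ?thesis
  by (simp add: G_def complex_fps_def A_def fps_mult_nth atLeast0AtMost)
qed

lemma neg_binomial_sums:
 fixes z :: complex
 assumes "cmod z < 1"
 shows "(\<lambda>n. of_real (neg_binomial_coeff l n) * z ^ n) sums ((1 - z) powr of_real (- l))"
proof -
 have "(\<lambda>n. (complex_of_real (-l) gchoose n) * (-z)^n) sums ((1 + (-z)) powr of_real (-l))"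
  using assms by (intro gen_binomial_complex) auto
 also have "(\<lambda>n. (complex_of_real (-l) gchoose n) * (-z)^n) = (\<lambda>n. of_real (neg_binomial_coeff l n) * z ^ n)"
  by (simp add: gbinomial_pochhammer neg_binomial_coeff_def fun_eq_iff power_minus[of z]
    pochhammer_of_real)
 finally show ?thesis by simp
qed

lemma neg_binomial_summable:
 assumes "0 \<le> l" "0 \<le> r" "r < 1"
 shows "summable (\<lambda>n. neg_binomial_coeff l n * r ^ n)"
proof -
 have "summable (\<lambda>n. of_real (neg_binomial_coeff l n) * complex_of_real r ^ n)"
  using neg_binomial_sums[of "of_real r" l] assms by (auto simp: sums_iff)
 then have "summable (\<lambda>n. complex_of_real (neg_binomial_coeff l n * r ^ n))" by simp
 then show ?thesis by (rule summable_complex_of_real[THEN iffD1])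
qed

lemma gegenbauer_sums:
 assumes "0 \<le> l" "cmod z < 1"
 shows "(\<lambda>k. gegenbauer l (Re z) ((cmod z)\<^sup>2) $ k) sums (cmod (1 - z) powr (- 2 * l))"
proof -
 define u where "u = (1 - z) powr of_real (- l)"
 let ?a = "\<lambda>n. of_real (neg_binomial_coeff l n) * z ^ n"
 let ?b = "\<lambda>n. of_real (neg_binomial_coeff l n) * cnj z ^ n"
 have n: "summable (\<lambda>n. norm (?a n))" "summable (\<lambda>n. norm (?b n))"
  using neg_binomial_summable[of l "cmod z"] assms
  by (simp_all add: norm_mult norm_power neg_binomial_coeff_nonneg)
 have a: "?a sums u" unfolding u_def by (rule neg_binomial_sums[OF assms(2)])
 have b: "?b sums cnj u"
  using sums_cnj[THEN iffD2, OF a] by simp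
 have "(\<lambda>k. \<Sum>i\<le>k. ?a i * ?b (k - i)) sums (u * cnj u)"
  using Cauchy_product_sums[OF n] sums_unique[OF a] sums_unique[OF b] by simp
 then have "(\<lambda>k. complex_of_real (gegenbauer l (Re z) ((cmod z)\<^sup>2) $ k)) sums of_real ((cmod u)\<^sup>2)"
  unfolding gegenbauer_factor complex_norm_square .
 then have "(\<lambda>k. gegenbauer l (Re z) ((cmod z)\<^sup>2) $ k) sums (cmod u)\<^sup>2"
  by (simp only: sums_of_real_iff)
 also have "cmod u = cmod (1 - z) powr (-l)"
  unfolding u_def powr_def[of "1 - z"] using assms(2) by (auto simp: powr_def)
 also have "\<dots>\<^sup>2 = cmod (1 - z) powr (- 2 * l)"
  by (simp add: power2_eq_square flip: powr_add)
 finally show ?thesis .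
qed

text \<open>
 A plane through \<open>x\<close> and \<open>y\<close> is a copy of the complex plane, with \<open>y\<close>
 in the place of 1.
\<close>

lemma ex_complex_inner:
 fixes x y :: "'a::real_inner"
 assumes "norm y = 1"
 obtains z where "Re z = x \<bullet> y" "cmod z = norm x" "cmod (1 - z) = norm (x - y)"
proof
 define z where "z = Complex (x \<bullet> y) (sqrt ((norm x)\<^sup>2 - (x \<bullet> y)\<^sup>2))"
 have "\<bar>x \<bullet> y\<bar> \<le> norm x" using Cauchy_Schwarz_ineq2[of x y] assms by simp
 then have "(x \<bullet> y)\<^sup>2 \<le> (norm x)\<^sup>2" by (metis abs_le_square_iff abs_norm_cancel)
 then have "(Im z)\<^sup>2 = (norm x)\<^sup>2 - (x \<bullet> y)\<^sup>2" by (simp add: z_def)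
 moreover show re: "Re z = x \<bullet> y" by (simp add: z_def)
 ultimately have n: "(Re z)\<^sup>2 + (Im z)\<^sup>2 = (norm x)\<^sup>2" by simp
 then show "cmod z = norm x" by (simp add: cmod_def)
 have "(Re (1 - z))\<^sup>2 + (Im (1 - z))\<^sup>2 = (norm (x - y))\<^sup>2"
 proof -
  have "(Re (1 - z))\<^sup>2 + (Im (1 - z))\<^sup>2 = 1 - 2 * Re z + ((Re z)\<^sup>2 + (Im z)\<^sup>2)"
   by (simp add: power2_eq_square algebra_simps)
  also have "\<dots> = 1 - 2 * (x \<bullet> y) + (norm x)\<^sup>2" by (simp only: n) (simp only: re)
  also have "\<dots> = (norm (x - y))\<^sup>2"
   using assms unfolding power2_norm_eq_inner norm_eq_1
   by (simp add: inner_diff inner_commute algebra_simps)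
  finally show ?thesis .
 qed
 then show "cmod (1 - z) = norm (x - y)" unfolding cmod_def by simp
qed

text \<open>
 The factorisation over the complex numbers gives convergence for \<open>norm x < 1\<close>, as a Cauchy
 product of two binomial series.
\<close>

lemma zonal_sums:
 fixes x y :: "'a::euclidean_space"
 assumes y: "norm y = 1" and x: "norm x < 1"
 shows "(\<lambda>k. zonal k x y) sums ((1 - (norm x)\<^sup>2) / norm (x - y) ^ DIM('a))"
proof -
 obtain z where z: "Re z = x \<bullet> y" "cmod z = norm x" "cmod (1 - z) = norm (x - y)"
  using ex_complex_inner[OF y] by blast
 let ?l = "real DIM('a) / 2"
 let ?G = "gegenbauer ?l (x \<bullet> y) (x \<bullet> x)"
 have "x \<noteq> y" using x y by auto
 have "(\<lambda>k. ?G $ k) sums (norm (x - y) powr (- 2 * ?l))"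
  using gegenbauer_sums[of ?l z] x unfolding z by (simp add: power2_norm_eq_inner)
 also have "norm (x - y) powr (- 2 * ?l) = 1 / norm (x - y) ^ DIM('a)"
  using \<open>x \<noteq> y\<close> by (simp add: powr_minus_divide powr_realpow)
 finally have G: "(\<lambda>k. ?G $ k) sums (1 / norm (x - y) ^ DIM('a))" .
 have "(\<lambda>k. (fps_X^2 * ?G) $ k) sums (1 / norm (x - y) ^ DIM('a))"
  by (subst sums_zero_iff_shift[symmetric, of 2]) (use G in \<open>auto simp: fps_X_power_mult_nth\<close>)
 from sums_diff[OF G sums_mult[OF this, of "x \<bullet> x"]]
 have "(\<lambda>k. (?G - fps_const (x \<bullet> x) * (fps_X^2 * ?G)) $ k)
   sums (1 / norm (x - y) ^ DIM('a) - (x \<bullet> x) * (1 / norm (x - y) ^ DIM('a)))" by simp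
 also have "?G - fps_const (x \<bullet> x) * (fps_X^2 * ?G) = zonal_fps x y"
  by (simp add: zonal_fps_def algebra_simps)
 finally show ?thesis
  by (simp add: zonal_def power2_norm_eq_inner diff_divide_distrib)
qed

text \<open>
 On unit vectors the coefficients are dominated by those of a product of two binomial series, whose radius of
 convergence is 1.
\<close>

lemma zonal_bound:
 assumes R: "0 < R" "R < 1"
 obtains C where "C \<ge> 0"
  "\<And>k x y. norm x = 1 \<Longrightarrow> norm y = 1 \<Longrightarrow> \<bar>zonal k (x :: 'a::euclidean_space) y\<bar> \<le> C / R ^ k"
proof -
 let ?l = "real DIM('a) / 2"
 let ?a = "neg_binomial_coeff ?l"
 define A where "A k = (\<Sum>i\<le>k. ?a i * ?a (k - i))" for k
 have A0: "A k \<ge> 0" for k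
  unfolding A_def by (intro sum_nonneg mult_nonneg_nonneg neg_binomial_coeff_nonneg) auto
 have s: "summable (\<lambda>k. norm (?a k * R ^ k))"
  using neg_binomial_summable[of ?l R] R by (simp add: neg_binomial_coeff_nonneg abs_mult)
 have "(\<lambda>k. \<Sum>i\<le>k. (?a i * R ^ i) * (?a (k - i) * R ^ (k - i))) = (\<lambda>k. A k * R ^ k)"
  unfolding A_def by (auto simp: sum_distrib_right fun_eq_iff power_add[symmetric] intro!: sum.cong)
 then have "summable (\<lambda>k. A k * R ^ k)"
  using Cauchy_product_sums[OF s s] by (simp add: sums_iff)
 then have "Bseq (\<lambda>k. A k * R ^ k)"
  using convergent_imp_Bseq convergent_def summable_LIMSEQ_zero by blast
 then obtain B where B: "B > 0" "\<And>k. norm (A k * R ^ k) \<le> B"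
  by (auto simp: Bseq_def)
 have AB: "A k \<le> B / R ^ k" for k
  using B(2)[of k] R A0[of k] by (simp add: field_simps abs_mult)
 have G: "\<bar>gegenbauer ?l (x \<bullet> y) (x \<bullet> x) $ k\<bar> \<le> A k" if xy: "norm x = 1" "norm y = 1" for x y :: 'a and k
 proof -
  obtain z where z: "Re z = x \<bullet> y" "cmod z = norm x"
   using ex_complex_inner[OF xy(2)] by blast
  have "\<bar>gegenbauer ?l (x \<bullet> y) (x \<bullet> x) $ k\<bar> = cmod (complex_of_real (gegenbauer ?l (Re z) ((cmod z)\<^sup>2) $ k))"
   unfolding z by (simp add: power2_norm_eq_inner)
  also have "\<dots> \<le> (\<Sum>i\<le>k. norm ((of_real (?a i) * z ^ i) * (of_real (?a (k-i)) * cnj z ^ (k - i))))"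
   unfolding gegenbauer_factor by (rule norm_sum)
  also have "\<dots> = A k"
   unfolding A_def using z xy
   by (auto simp: norm_mult norm_power neg_binomial_coeff_nonneg intro!: sum.cong)
  finally show ?thesis .
 qed
 show ?thesis
 proof
  show "2 * B \<ge> 0" using B by simp
  fix k :: nat and x y :: 'a assume xy: "norm x = 1" "norm y = 1"
  let ?g = "gegenbauer ?l (x \<bullet> y) (x \<bullet> x)"
  have "\<bar>zonal k x y\<bar> = \<bar>(?g - fps_X^2 * ?g) $ k\<bar>"
   using xy by (simp add: zonal_def zonal_fps_def algebra_simps norm_eq_1)
  also have "\<dots> \<le> \<bar>?g $ k\<bar> + \<bar>(fps_X^2 * ?g) $ k\<bar>"
   by simp
  also have "\<bar>(fps_X^2 * ?g) $ k\<bar> \<le> B / R ^ k"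
  proof (cases "k < 2")
   case True
   then show ?thesis using B R by (simp add: fps_X_power_mult_nth)
  next
   case False
   have "\<bar>(fps_X^2 * ?g) $ k\<bar> \<le> A (k - 2)"
    using G[OF xy, of "k - 2"] False by (simp add: fps_X_power_mult_nth)
   also have "\<dots> \<le> B / R ^ (k - 2)" by (rule AB)
   also have "\<dots> \<le> B / R ^ k"
    using B R by (intro divide_left_mono power_decreasing mult_pos_pos) auto
   finally show ?thesis .
  qed
  also have "\<bar>?g $ k\<bar> \<le> B / R ^ k" using G[OF xy] AB order_trans by blast
  finally show "\<bar>zonal k x y\<bar> \<le> 2 * B / R ^ k" by simp
 qed
qed

unbundle no fps_syntax

section \<open>Surface measure and integrals over balls\<close>

lemmas bochner_integral_cong = Bochner_Integration.integral_cong
 and bochner_integral_nonneg = Bochner_Integration.integral_nonneg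
 and bochner_integral_diff = Bochner_Integration.integral_diff
 and bochner_integral_sum = Bochner_Integration.integral_sum

lemma space_surface [simp]: "space (surface :: 'a::euclidean_space measure) = sphere 0 1"
 by (simp add: surface_def space_scale_measure space_restrict_space)

lemma sets_surface [measurable_cong]:
 "sets (surface :: 'a::euclidean_space measure) = sets (restrict_space borel (sphere 0 1))"
 by (simp add: surface_def)

lemma sphere_projection_measurable [measurable]:
 "(\<lambda>x::'a::euclidean_space. x /\<^sub>R norm x) \<in>
   measurable (restrict_space lborel (ball 0 1 - {0})) (restrict_space borel (sphere 0 1))"
 by (rule measurable_restrict_space2)
  (auto simp: space_restrict_space intro!: measurable_restrict_space1)

lemma surface_eq_density:
 "(surface :: 'a::euclidean_space measure) =
   density (distr (restrict_space lborel (ball 0 1 - {0})) (restrict_space borel (sphere 0 1))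
    (\<lambda>x. x /\<^sub>R norm x)) (\<lambda>_. ennreal (real DIM('a)))"
 unfolding surface_def by (rule measure_eqI) (auto simp: emeasure_density_const ennreal_of_nat_eq_real_of_nat)

lemma integral_surface:
 fixes f :: "'a::euclidean_space \<Rightarrow> 'b::{banach, second_countable_topology}"
 assumes f: "f \<in> borel_measurable surface"
 shows "(LINT x|surface. f x) = real DIM('a) *\<^sub>R (LINT x:ball 0 1 - {0}|lborel. f (x /\<^sub>R norm x))"
proof -
 have f': "f \<in> borel_measurable (restrict_space borel (sphere 0 1))"
  using f by (simp cong: measurable_cong_sets add: sets_surface)
 have "(LINT x|surface. f x)
   = (LINT x|distr (restrict_space lborel (ball 0 1 - {0})) (restrict_space borel (sphere 0 1))
    (\<lambda>x. x /\<^sub>R norm x). real DIM('a) *\<^sub>R f x)"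
  unfolding surface_eq_density by (rule integral_density) (use f' in auto)
 also have "\<dots> = real DIM('a) *\<^sub>R (LINT x|restrict_space lborel (ball 0 1 - {0}). f (x /\<^sub>R norm x))"
  by (subst integral_distr) (use f' in \<open>auto intro!: borel_measurable_scaleR\<close>)
 also have "(LINT x|restrict_space lborel (ball 0 1 - {0}). f (x /\<^sub>R norm x))
   = (LINT x:ball 0 1 - {0}|lborel. f (x /\<^sub>R norm x))"
  unfolding set_lebesgue_integral_def by (rule integral_restrict_space) auto
 finally show ?thesis .
qed

lemma emeasure_surface:
 "emeasure (surface :: 'a::euclidean_space measure) (sphere 0 1)
   = ennreal (real DIM('a) * measure lborel (ball (0::'a) 1))"
proof -
 let ?M = "distr (restrict_space lborel (ball (0::'a) 1 - {0})) (restrict_space borel (sphere 0 1)) (\<lambda>x. x /\<^sub>R norm x)"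
 have "emeasure (surface :: 'a measure) (sphere 0 1) = ennreal (real DIM('a)) * emeasure ?M (sphere 0 1)"
  by (simp add: surface_def ennreal_of_nat_eq_real_of_nat)
 also have "emeasure ?M (sphere 0 1) = emeasure (restrict_space lborel (ball (0::'a) 1 - {0})) (ball 0 1 - {0})"
  by (subst emeasure_distr) (auto simp: space_restrict_space sets_restrict_space intro!: arg_cong[of _ _ "emeasure _"])
 also have "\<dots> = emeasure lborel (ball (0::'a) 1 - {0})"
  by (simp add: emeasure_restrict_space)
 also have "\<dots> = emeasure lborel (ball (0::'a) 1)"
  by (rule emeasure_Diff_null_set) auto
 also have "\<dots> = ennreal (measure lborel (ball (0::'a) 1))"
  by (rule emeasure_eq_ennreal_measure) (use emeasure_lborel_ball_finite[of "0::'a" 1] in auto)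
 finally show ?thesis by (simp add: ennreal_mult)
qed

interpretation surface: finite_measure "surface :: 'a::euclidean_space measure"
 by (rule finite_measureI) (simp add: emeasure_surface)

definition surface_area :: "'a::euclidean_space itself \<Rightarrow> real" where
 "surface_area _ = measure (surface :: 'a measure) (sphere 0 1)"

lemma surface_area: "surface_area TYPE('a::euclidean_space) = real DIM('a) * measure lborel (ball (0::'a) 1)"
 by (simp add: surface_area_def measure_def emeasure_surface)

lemma surface_area_pos [simp]: "surface_area TYPE('a::euclidean_space) > 0"
proof -
 have "measure lborel (ball (0::'a) 1) > 0"
  using content_ball_pos[of 1 "0::'a"] by (simp add: measure_completion)
 then show ?thesis by (simp add: surface_area)
qed

lemma continuous_measurable_surface:
 fixes f :: "'a::euclidean_space \<Rightarrow> 'b::topological_space"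
 shows "continuous_on (sphere 0 1) f \<Longrightarrow> f \<in> borel_measurable surface"
 using borel_measurable_continuous_on_restrict[of "sphere 0 1" f]
 by (simp cong: measurable_cong_sets add: sets_surface)

lemma integrable_surface_bounded:
 fixes f :: "'a::euclidean_space \<Rightarrow> 'b::{banach, second_countable_topology}"
 assumes "f \<in> borel_measurable surface" "\<And>x. x \<in> sphere 0 1 \<Longrightarrow> norm (f x) \<le> B"
 shows "integrable surface f"
 by (rule surface.integrable_const_bound[of _ B]) (use assms in auto)

lemma integrable_surface_continuous:
 fixes f :: "'a::euclidean_space \<Rightarrow> 'b::{banach, second_countable_topology}"
 assumes "continuous_on (sphere 0 1) f"
 shows "integrable surface f"
proof -
 have "bounded (f ` sphere 0 1)"
  using assms by (intro compact_imp_bounded compact_continuous_image) auto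
 then obtain B where "\<And>x. x \<in> sphere 0 1 \<Longrightarrow> norm (f x) \<le> B"
  by (metis bounded_iff imageI)
 then show ?thesis
  using integrable_surface_bounded continuous_measurable_surface assms by blast
qed

lemma lborel_integral_scale:
 fixes f :: "'a::euclidean_space \<Rightarrow> 'b::{banach, second_countable_topology}"
 assumes f: "f \<in> borel_measurable borel" and c: "c > 0"
 shows "integral\<^sup>L lborel f = c ^ DIM('a) *\<^sub>R (LINT x|lborel. f (c *\<^sub>R x))"
proof -
 have "integral\<^sup>L lborel f = integral\<^sup>L (density (distr lborel borel (\<lambda>x. 0 + c *\<^sub>R x)) (\<lambda>_. \<bar>c\<bar>^DIM('a))) f"
  using lborel_affine[of c "0::'a"] c by simp
 also have "\<dots> = (LINT x|distr lborel borel (\<lambda>x. 0 + c *\<^sub>R x). c ^ DIM('a) *\<^sub>R f x)"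
  by (subst integral_density) (use f c in auto)
 also have "\<dots> = (LINT x|lborel. c ^ DIM('a) *\<^sub>R f (c *\<^sub>R x))"
  by (subst integral_distr) (use f in auto)
 finally show ?thesis by simp
qed

lemma lborel_integral_translate:
 fixes f :: "'a::euclidean_space \<Rightarrow> 'b::{banach, second_countable_topology}"
 assumes f: "f \<in> borel_measurable borel"
 shows "(LINT x|lborel. f (x + c)) = integral\<^sup>L lborel f"
proof -
 have "integral\<^sup>L lborel f = integral\<^sup>L (distr lborel borel ((+) c)) f"
  by (simp add: lborel_distr_plus)
 also have "\<dots> = (LINT x|lborel. f (x + c))"
  by (subst integral_distr) (use f in \<open>auto simp: add.commute\<close>)
 finally show ?thesis ..
qed

text \<open>
 Translation invariance makes the integrals of the difference quotients vanish, and compact support allows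
 passing to the limit.
\<close>

lemma integral_directional_derivative:
 fixes w g :: "'a::euclidean_space \<Rightarrow> complex"
 assumes w: "\<And>x. ((\<lambda>t. w (x + t *\<^sub>R e)) has_vector_derivative g x) (at 0)"
  and cont: "continuous_on UNIV w" "continuous_on UNIV g"
  and supp: "\<And>x. norm x \<ge> 1 \<Longrightarrow> w x = 0" "\<And>x. norm x \<ge> 1 \<Longrightarrow> g x = 0"
 shows "integral\<^sup>L lborel g = 0"
proof -
 have meas: "w \<in> borel_measurable borel" "g \<in> borel_measurable borel"
  using cont by (auto intro: borel_measurable_continuous_onI)
 have "bounded (g ` cball 0 1)"
  using cont by (intro compact_imp_bounded compact_continuous_image) (auto intro: continuous_on_subset)
 then obtain B0 where B0: "\<And>x. x \<in> cball 0 1 \<Longrightarrow> norm (g x) \<le> B0"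
  by (metis bounded_iff imageI)
 have B: "norm (g x) \<le> max B0 0" for x
  using B0[of x] supp(2)[of x] by (cases "norm x \<ge> 1") auto
 have deriv: "((\<lambda>t. w (x + t *\<^sub>R e)) has_vector_derivative g (x + s *\<^sub>R e)) (at s)" for x s
 proof -
  have "((\<lambda>t. w (x + s *\<^sub>R e + t *\<^sub>R e)) has_vector_derivative g (x + s *\<^sub>R e)) (at 0)" by (rule w)
  then have "((\<lambda>t. w (x + s *\<^sub>R e + t *\<^sub>R e)) has_vector_derivative g (x + s *\<^sub>R e)) (at (s - s))" by simp
  moreover have "((\<lambda>t. t - s) has_real_derivative 1) (at s)"
   by (auto intro!: derivative_eq_intros)
  ultimately have "(((\<lambda>t. w (x + s *\<^sub>R e + t *\<^sub>R e)) \<circ> (\<lambda>t. t - s)) has_vector_derivative 1 *\<^sub>R g (x + s *\<^sub>R e)) (at s)"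
   by (intro vector_diff_chain_at) (auto simp: has_real_derivative_iff_has_vector_derivative)
  then show ?thesis by (simp add: o_def algebra_simps)
 qed
 have lip: "norm (w (x + t *\<^sub>R e) - w x) \<le> max B0 0 * t" if "t \<ge> 0" for x t
 proof -
  have "norm (w (x + t *\<^sub>R e) - w (x + 0 *\<^sub>R e)) \<le> max B0 0 * norm (t - 0)"
  proof (rule differentiable_bound[where S = UNIV and f = "\<lambda>t. w (x + t *\<^sub>R e)"])
   show "((\<lambda>t. w (x + t *\<^sub>R e)) has_derivative (\<lambda>h. h *\<^sub>R g (x + s *\<^sub>R e))) (at s within UNIV)" for s
    using deriv[of x s] by (simp add: has_vector_derivative_def)
   show "onorm (\<lambda>h. h *\<^sub>R g (x + s *\<^sub>R e)) \<le> max B0 0" for s :: real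
    using B[of "x + s *\<^sub>R e"] by (intro onorm_bound) (auto simp: mult.commute mult_left_mono)
  qed auto
  then show ?thesis using that by simp
 qed
 define t where "t n = inverse (real (Suc n))" for n
 have t: "t n > 0" "t n \<le> 1" for n by (auto simp: t_def inverse_le_1_iff)
 define q where "q n x = (1 / t n) *\<^sub>R (w (x + t n *\<^sub>R e) - w x)" for n x
 have w_int: "integrable lborel w"
 proof -
  have "integrable lborel (\<lambda>x. indicator (cball 0 1) x *\<^sub>R w x)"
   using borel_integrable_compact[of "cball 0 1" w] cont by (auto intro: continuous_on_subset)
  moreover have "indicator (cball 0 1) x *\<^sub>R w x = w x" for x
   using supp(1)[of x] by (auto simp: indicator_def)
  ultimately show ?thesis by simp
 qed
 have w_int': "integrable lborel (\<lambda>x. w (x + c))" for c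
 proof -
  have "integrable (distr lborel borel ((+) c)) w" using w_int by (simp add: lborel_distr_plus)
  then show ?thesis by (subst (asm) integrable_distr_eq) (use meas in \<open>auto simp: add.commute\<close>)
 qed
 have "integral\<^sup>L lborel (q n) = 0" for n
  unfolding q_def using w_int w_int' by (simp add: lborel_integral_translate meas)
 moreover have "(\<lambda>n. integral\<^sup>L lborel (q n)) \<longlonglongrightarrow> integral\<^sup>L lborel g"
 proof (rule integral_dominated_convergence)
  show "integrable lborel (\<lambda>x. max B0 0 * indicator (cball (0::'a) (1 + norm e)) x)"
   using emeasure_lborel_cball_finite[of "0::'a" "1 + norm e"]
   by (intro integrable_mult_right integrable_real_indicator) auto
  show "AE x in lborel. norm (q n x) \<le> max B0 0 * indicator (cball 0 (1 + norm e)) x" for n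
  proof (rule AE_I2)
   fix x
   show "norm (q n x) \<le> max B0 0 * indicator (cball 0 (1 + norm e)) x"
   proof (cases "x \<in> cball 0 (1 + norm e)")
    case True
    have "norm (q n x) = norm (w (x + t n *\<^sub>R e) - w x) / t n"
     using t[of n] by (simp add: q_def del: scaleR_right_diff_distrib)
    also have "\<dots> \<le> max B0 0"
     using lip[of "t n" x] t[of n] by (simp add: pos_divide_le_eq)
    finally show ?thesis using True by simp
   next
    case False
    then have x: "norm x > 1 + norm e" by auto
    have "t n * norm e \<le> 1 * norm e" using t[of n] by (intro mult_right_mono) auto
    then have "norm (t n *\<^sub>R e) \<le> norm e" using t[of n] by simp
    moreover have "norm x \<le> norm (x + t n *\<^sub>R e) + norm (t n *\<^sub>R e)"
     using norm_triangle_ineq4[of "x + t n *\<^sub>R e" "t n *\<^sub>R e"] by simp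
    ultimately have "norm (x + t n *\<^sub>R e) \<ge> 1" using x by linarith
    moreover have "norm x \<ge> 1" using x norm_ge_zero[of e] by linarith
    ultimately show ?thesis using supp(1) False by (simp add: q_def)
   qed
  qed
  show "AE x in lborel. (\<lambda>n. q n x) \<longlonglongrightarrow> g x"
  proof (rule AE_I2)
   fix x
   have "((\<lambda>h. norm (w (x + h *\<^sub>R e) - w x - h *\<^sub>R g x) / norm h) \<longlongrightarrow> 0) (at 0)"
    using w[of x] by (simp add: has_vector_derivative_def has_derivative_at)
   moreover have "filterlim t (at 0) sequentially"
    unfolding filterlim_at t_def using LIMSEQ_inverse_real_of_nat by auto
   ultimately have "(\<lambda>n. norm (w (x + t n *\<^sub>R e) - w x - t n *\<^sub>R g x) / norm (t n)) \<longlonglongrightarrow> 0"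
    by (rule filterlim_compose)
   also have "(\<lambda>n. norm (w (x + t n *\<^sub>R e) - w x - t n *\<^sub>R g x) / norm (t n)) = (\<lambda>n. norm (q n x - g x))"
   proof
    fix n
    have "q n x - g x = (1 / t n) *\<^sub>R (w (x + t n *\<^sub>R e) - w x - t n *\<^sub>R g x)"
     using t[of n] unfolding q_def by (subst scaleR_diff_right[of _ _ "t n *\<^sub>R g x"]) simp
    then show "norm (w (x + t n *\<^sub>R e) - w x - t n *\<^sub>R g x) / norm (t n) = norm (q n x - g x)"
     by (simp del: scaleR_right_diff_distrib)
   qed
   finally show "(\<lambda>n. q n x) \<longlonglongrightarrow> g x"
    by (intro LIM_zero_cancel[of _ "g x"] tendsto_norm_zero_cancel[of "\<lambda>n. q n x - g x"])
  qed
  note meas[measurable]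
  show "q n \<in> borel_measurable lborel" for n
   unfolding q_def by measurable
 qed (use meas in auto)
 ultimately show ?thesis by (simp add: LIMSEQ_const_iff)
qed

lemma radial_projection_near:
 fixes x :: "'a::real_normed_vector"
 assumes "x \<noteq> 0" shows "dist x ((s / norm x) *\<^sub>R x) = \<bar>norm x - s\<bar>"
proof -
 have "x - (s / norm x) *\<^sub>R x = ((norm x - s) / norm x) *\<^sub>R x"
  using assms by (simp add: diff_divide_distrib scaleR_diff_left)
 then show ?thesis using assms by (simp add: dist_norm)
qed

lemma integral_ball_radial_projection:
 fixes h :: "'a::euclidean_space \<Rightarrow> complex"
 assumes h: "continuous_on (sphere 0 1) h" and s: "s > 0"
 shows "(LINT x:ball 0 s - {0}|lborel. h (x /\<^sub>R norm x)) = (s ^ DIM('a) / DIM('a)) *\<^sub>R (LINT x|surface. h x)"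
proof -
 let ?f = "\<lambda>x. indicator (ball 0 s - {0}) x *\<^sub>R h (x /\<^sub>R norm x)"
 have c: "continuous_on (ball 0 s - {0}) (\<lambda>x. h (x /\<^sub>R norm x))"
  by (rule continuous_on_compose2[OF h]) (auto intro!: continuous_intros simp: field_simps split: if_splits)
 have "?f \<in> borel_measurable borel"
  by (rule borel_measurable_continuous_on_indicator) (use c in auto)
 from lborel_integral_scale[OF this s]
 have "integral\<^sup>L lborel ?f = s ^ DIM('a) *\<^sub>R (LINT x|lborel. ?f (s *\<^sub>R x))" .
 also have "(\<lambda>x. ?f (s *\<^sub>R x)) = (\<lambda>x. indicator (ball 0 1 - {0}) x *\<^sub>R h (x /\<^sub>R norm x))"
  using s by (auto simp: indicator_def fun_eq_iff field_simps)
 also have "(LINT x|lborel. indicator (ball 0 1 - {0}) x *\<^sub>R h (x /\<^sub>R norm x)) = (1 / DIM('a)) *\<^sub>R (LINT x|surface. h x)"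
  using integral_surface[OF continuous_measurable_surface[OF h]] by (simp add: set_lebesgue_integral_def)
 finally show ?thesis by (simp add: set_lebesgue_integral_def)
qed

lemma set_integrable_continuous_cball:
 fixes h :: "'a::euclidean_space \<Rightarrow> complex"
 assumes "continuous_on (ball 0 1) h" "s < 1"
 shows "set_integrable lborel (ball 0 s) h"
proof -
 have "set_integrable lborel (cball 0 s) h"
  unfolding set_integrable_def using assms
  by (intro borel_integrable_compact) (auto intro: continuous_on_subset)
 then show ?thesis
  by (rule set_integrable_subset) auto
qed

text \<open>
 On a thin annulus \<open>h\<close> is close to its value at the radial projection to the sphere of radius
 \<open>s\<close>, and the integral of the projected function is explicit.
\<close>

lemma solid_integral_annulus:
 fixes h :: "'a::euclidean_space \<Rightarrow> complex"
 assumes h: "continuous_on (ball 0 1) h" and r: "0 < r" "r \<le> t" "t < 1" and s: "0 < s" "s < 1"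
  and e: "\<And>x. r \<le> norm x \<Longrightarrow> norm x < t \<Longrightarrow> norm (h x - h ((s / norm x) *\<^sub>R x)) \<le> e"
  and "e \<ge> 0"
 shows "norm ((LINT x:ball 0 t|lborel. h x) - (LINT x:ball 0 r|lborel. h x)
   - ((t ^ DIM('a) - r ^ DIM('a)) / DIM('a)) *\<^sub>R (LINT z|surface. h (s *\<^sub>R z)))
  \<le> e * (t ^ DIM('a) - r ^ DIM('a)) * measure lborel (ball (0::'a) 1)"
proof -
 let ?A = "ball (0::'a) t - ball 0 r"
 let ?p = "\<lambda>x::'a. h (s *\<^sub>R (x /\<^sub>R norm x))"
 have hs: "continuous_on (sphere 0 1) (\<lambda>z. h (s *\<^sub>R z))"
  using s by (intro continuous_on_compose2[OF h] continuous_intros) auto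
 have pint: "set_integrable lborel (ball 0 u - {0}) ?p" for u
 proof -
  have "bounded ((\<lambda>z. h (s *\<^sub>R z)) ` sphere 0 1)"
   using hs by (intro compact_imp_bounded compact_continuous_image) auto
  then obtain B where B: "\<And>z. z \<in> sphere 0 1 \<Longrightarrow> norm (h (s *\<^sub>R z)) \<le> B"
   by (metis (no_types, lifting) bounded_iff imageI)
  have "continuous_on (ball 0 u - {0}) ?p"
   using s by (intro continuous_on_compose2[OF h] continuous_intros) (auto simp: field_simps split: if_splits)
  then have m: "(\<lambda>x. indicator (ball 0 u - {0}) x *\<^sub>R ?p x) \<in> borel_measurable borel"
   by (intro borel_measurable_continuous_on_indicator) auto
  show ?thesis
   unfolding set_integrable_def
  proof (rule Bochner_Integration.integrable_bound)
   show "integrable lborel (\<lambda>x. B * indicator (ball (0::'a) u) x)"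
    using emeasure_lborel_ball_finite[of "0::'a" u]
    by (intro integrable_mult_right integrable_real_indicator) auto
   have "B \<ge> 0"
    using B[of "SOME i. i \<in> Basis"] norm_ge_zero order_trans SOME_Basis by (metis mem_sphere_0 norm_Basis)
   then show "AE x in lborel. norm (indicator (ball 0 u - {0}) x *\<^sub>R ?p x) \<le> norm (B * indicator (ball (0::'a) u) x)"
   proof (intro AE_I2)
    fix x :: 'a
    have "norm (?p x) \<le> B" if "x \<noteq> 0" using B[of "x /\<^sub>R norm x"] that by simp
    then show "norm (indicator (ball 0 u - {0}) x *\<^sub>R ?p x) \<le> norm (B * indicator (ball (0::'a) u) x)"
     using \<open>B \<ge> 0\<close> by (auto simp: indicator_def)
   qed
  qed (use m in auto)
 qed
 have A: "?A \<subseteq> ball 0 t" "?A \<subseteq> ball 0 t - {0}" using r by auto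
 have hA: "set_integrable lborel ?A h"
  by (rule set_integrable_subset[OF set_integrable_continuous_cball[OF h \<open>t < 1\<close>]]) auto
 have pA: "set_integrable lborel ?A ?p"
  by (rule set_integrable_subset[OF pint[of t]]) (use A in auto)
 have diffA: "(LINT x:ball 0 t|lborel. h x) - (LINT x:ball 0 r|lborel. h x) = (LINT x:?A|lborel. h x)"
 proof -
  have "(LINT x:ball 0 r \<union> ?A|lborel. h x) = (LINT x:ball 0 r|lborel. h x) + (LINT x:?A|lborel. h x)"
   using r by (intro set_integral_Un hA set_integrable_continuous_cball[OF h]) auto
  moreover have "ball 0 r \<union> ?A = ball 0 t" using r by auto
  ultimately show ?thesis by simp
 qed
 have "(LINT x:(ball 0 r - {0}) \<union> ?A|lborel. ?p x) = (LINT x:ball 0 r - {0}|lborel. ?p x) + (LINT x:?A|lborel. ?p x)"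
  by (intro set_integral_Un pint pA) auto
 moreover have "(ball 0 r - {0}) \<union> ?A = ball 0 t - {0}" using r by auto
 ultimately have E: "(LINT x:ball 0 t - {0}|lborel. ?p x) = (LINT x:ball 0 r - {0}|lborel. ?p x) + (LINT x:?A|lborel. ?p x)"
  by simp
 have "0 < t" using r by simp
 have pdiff: "((t ^ DIM('a) - r ^ DIM('a)) / DIM('a)) *\<^sub>R (LINT z|surface. h (s *\<^sub>R z)) = (LINT x:?A|lborel. ?p x)"
  unfolding diff_divide_distrib scaleR_diff_left
   integral_ball_radial_projection[OF hs r(1), symmetric] integral_ball_radial_projection[OF hs \<open>0 < t\<close>, symmetric] E
  by (rule add_diff_cancel_left')
 have "(LINT x:?A|lborel. h x) - (LINT x:?A|lborel. ?p x) = (LINT x:?A|lborel. h x - ?p x)"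
  using hA pA by (simp add: set_integral_diff)
 also have "norm \<dots> \<le> (LINT x:?A|lborel. norm (h x - ?p x))"
  by (rule set_integral_norm_bound) (intro set_integral_diff hA pA)
 also have "\<dots> \<le> (LINT x:?A|lborel. e)"
 proof (rule set_integral_mono)
  show "set_integrable lborel ?A (\<lambda>x. norm (h x - ?p x))"
   using set_integral_diff(1)[OF hA pA] by (rule set_integrable_norm)
  show "set_integrable lborel ?A (\<lambda>x. e)"
   unfolding set_integrable_def
   by (auto intro!: integrable_real_indicator intro: emeasure_lborel_ball_finite emeasure_Diff_null_set
     le_less_trans[OF emeasure_mono[of _ "ball 0 t"]])
  show "norm (h x - ?p x) \<le> e" if "x \<in> ?A" for x
   using e[of x] that by (auto simp: divide_inverse)
 qed
 also have "\<dots> = e * measure lborel ?A"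
  by (simp add: set_lebesgue_integral_def measure_def mult.commute)
 also have "measure lborel ?A = measure lborel (ball (0::'a) t) - measure lborel (ball (0::'a) r)"
  using r emeasure_lborel_ball_finite[of "0::'a" t] by (intro measure_Diff) auto
 also have "measure lborel (ball (0::'a) u) = u ^ DIM('a) * measure lborel (ball (0::'a) 1)" if "u \<ge> 0" for u
  using that content_ball[of u "0::'a"] content_ball[of 1 "0::'a"] by (simp add: measure_completion)
 from this[of t] this[of r]
 have "measure lborel (ball (0::'a) t) - measure lborel (ball (0::'a) r) = (t ^ DIM('a) - r ^ DIM('a)) * measure lborel (ball (0::'a) 1)"
  using r by (simp add: algebra_simps)
 finally show ?thesis
  unfolding diffA pdiff by (simp add: mult_ac)
qed

text \<open>
 Polar coordinates in differential form: surface integrals are derivatives of volume integrals.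
\<close>

lemma has_vector_derivative_solid_integral:
 fixes h :: "'a::euclidean_space \<Rightarrow> complex"
 assumes h: "continuous_on (ball 0 1) h" and s: "0 < s" "s < 1"
 shows "((\<lambda>t. LINT x:ball 0 t|lborel. h x) has_vector_derivative
   s ^ (DIM('a) - 1) *\<^sub>R (LINT z|surface. h (s *\<^sub>R z))) (at s)"
proof -
 define n where "n = DIM('a)"
 have n: "n > 0" by (simp add: n_def)
 define V where "V = measure lborel (ball (0::'a) 1)"
 define M where "M = (LINT z|surface. h (s *\<^sub>R z))"
 define I where "I t = (LINT x:ball 0 t|lborel. h x)" for t
 define P where "P t = (t ^ n / n) *\<^sub>R M" for t :: real
 have V0: "V \<ge> 0" by (simp add: V_def)
 define b where "b = (1 + s) / 2"
 have b: "s < b" "b < 1" using s by (auto simp: b_def)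
 have uc: "uniformly_continuous_on (cball 0 b) h"
  using h b by (intro compact_uniformly_continuous) (auto intro: continuous_on_subset)
 have P: "(P has_derivative (\<lambda>x. x *\<^sub>R (s ^ (n - 1) *\<^sub>R M))) (at s)"
 proof -
  have "((\<lambda>t. t ^ n / n) has_real_derivative (n * s ^ (n - 1) / n)) (at s)"
   by (auto intro!: derivative_eq_intros)
  then have "((\<lambda>t. t ^ n / n) has_vector_derivative s ^ (n - 1)) (at s)"
   using n by (simp add: has_real_derivative_iff_has_vector_derivative)
  then have "(P has_vector_derivative s ^ (n - 1) *\<^sub>R M) (at s)"
   unfolding P_def
   by (rule bounded_linear.has_vector_derivative[OF bounded_linear_scaleR_left])
  then show ?thesis by (simp add: has_vector_derivative_def)
 qed
 have IP: "((\<lambda>t. I t - P t) has_derivative (\<lambda>x. 0)) (at s)"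
  unfolding has_derivative_at_alt
 proof (intro conjI allI impI)
  show "bounded_linear (\<lambda>x::real. 0::complex)" by (rule bounded_linear_zero)
  fix e :: real assume "e > 0"
  define e' where "e' = e / (real n * (V + 1))"
  have e': "e' > 0" using \<open>e > 0\<close> n V0 by (simp add: e'_def)
  obtain d where d: "d > 0" "\<And>x x'. x \<in> cball 0 b \<Longrightarrow> x' \<in> cball 0 b \<Longrightarrow> dist x' x < d \<Longrightarrow> dist (h x') (h x) < e'"
   using uc e' unfolding uniformly_continuous_on_def by metis
  define d' where "d' = min d (min (b - s) (s / 2))"
  have d': "d' > 0" "d' \<le> d" "d' \<le> b - s" "d' \<le> s / 2"
  proof -
   show "d' > 0" using d s b by (simp add: d'_def)
   show "d' \<le> d" "d' \<le> b - s" "d' \<le> s / 2" unfolding d'_def by linarith+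
  qed
  have key: "norm (I t - I r - ((t ^ n - r ^ n) / n) *\<^sub>R M) \<le> e * (t - r)"
   if rt: "r \<le> t" "\<bar>t - s\<bar> < d'" "\<bar>r - s\<bar> < d'" for r t
  proof -
   have r: "0 < r" "t < b" using rt d' s by linarith+
   have "norm (I t - I r - ((t ^ n - r ^ n) / n) *\<^sub>R M) \<le> e' * (t ^ n - r ^ n) * V"
    unfolding I_def M_def V_def n_def
   proof (rule solid_integral_annulus[OF h r(1) rt(1) _ s])
    show "t < 1" using r b by simp
    fix x :: 'a assume x: "r \<le> norm x" "norm x < t"
    then have x0: "x \<noteq> 0" using r by auto
    have "\<bar>norm x - s\<bar> < d'" using x rt by linarith
    then have "dist x ((s / norm x) *\<^sub>R x) < d" using radial_projection_near[OF x0, of s] d' by simp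
    moreover have "(s / norm x) *\<^sub>R x \<in> cball 0 b" "x \<in> cball 0 b" using s b x r x0 by auto
    ultimately show "norm (h x - h ((s / norm x) *\<^sub>R x)) \<le> e'"
     using d(2) by (metis dist_norm less_imp_le)
   qed (use e' in auto)
   also have "t ^ n - r ^ n \<le> n * (t - r)"
   proof -
    have "t ^ n - r ^ n = (t - r) * (\<Sum>i<n. r ^ (n - Suc i) * t ^ i)"
     by (simp add: power_diff_sumr2 mult.commute)
    also have "\<dots> \<le> (t - r) * (\<Sum>i<n. 1)"
    proof (intro mult_left_mono sum_mono)
     have "0 \<le> r" "r \<le> 1" "0 \<le> t" "t \<le> 1" using r b rt by linarith+
     then show "r ^ (n - Suc i) * t ^ i \<le> 1" for i
      by (intro mult_le_one power_le_one) auto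
    qed (use rt in auto)
    finally show ?thesis by (simp add: mult.commute)
   qed
   then have "e' * (t ^ n - r ^ n) * V \<le> e' * (n * (t - r)) * V"
    using e' V0 by (intro mult_right_mono mult_left_mono) auto
   also have "\<dots> \<le> e' * (n * (t - r)) * (V + 1)"
    using e' V0 rt by (intro mult_left_mono) auto
   also have "\<dots> = e * (t - r)"
   proof -
    have "real n * (V + 1) \<noteq> 0" using n V0 by simp
    then have "e' * (real n * (V + 1)) = e" using nonzero_eq_divide_eq[of "real n * (V + 1)" e' e] e'_def by blast
    then show ?thesis by (metis mult.assoc mult.commute)
   qed
   finally show ?thesis .
  qed
  show "\<exists>d>0. \<forall>y. norm (y - s) < d \<longrightarrow> norm (I y - P y - (I s - P s) - 0) \<le> e * norm (y - s)"
  proof (intro exI conjI allI impI)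
   show "d' > 0" by (rule d')
   fix y assume y: "norm (y - s) < d'"
   have eq: "I u - P u - (I v - P v) = I u - I v - ((u ^ n - v ^ n) / n) *\<^sub>R M" for u v
    by (simp add: P_def diff_divide_distrib scaleR_diff_left)
   show "norm (I y - P y - (I s - P s) - 0) \<le> e * norm (y - s)"
   proof (cases "s \<le> y")
    case True
    then show ?thesis using key[of s y] y d' unfolding diff_0_right eq by simp
   next
    case False
    then have "norm (I s - P s - (I y - P y)) \<le> e * (s - y)"
     using key[of y s] y d' unfolding eq by simp
    then show ?thesis using False by (simp add: norm_minus_commute)
   qed
  qed
 qed
 have "((\<lambda>t. (I t - P t) + P t) has_derivative (\<lambda>x. 0 + x *\<^sub>R (s ^ (n - 1) *\<^sub>R M))) (at s)"
  by (intro has_derivative_add IP P)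
 then show ?thesis
  by (simp add: has_vector_derivative_def I_def M_def n_def)
qed

section \<open>Green's identity on spheres\<close>

lemma has_real_derivative_pos_part_sq:
 "((\<lambda>t. (max 0 t)\<^sup>2) has_real_derivative 2 * max 0 t) (at (t::real))"
proof -
 consider "t > 0" | "t < 0" | "t = 0" by linarith
 then show ?thesis
 proof cases
  case 1
  have "((\<lambda>t. t\<^sup>2) has_real_derivative 2 * max 0 t) (at t)"
   using 1 by (auto intro!: derivative_eq_intros)
  then show ?thesis
   by (rule has_field_derivative_transform_within_open[of _ _ _ "{0<..}"]) (use 1 in auto)
 next
  case 2
  have "((\<lambda>t. 0) has_real_derivative 2 * max 0 t) (at t)"
   using 2 by (auto intro!: derivative_eq_intros)
  then show ?thesis
   by (rule has_field_derivative_transform_within_open[of _ _ _ "{..<0}"]) (use 2 in auto)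
 next
  case 3
  have "((\<lambda>h::real. (max 0 h)\<^sup>2 / h) \<longlongrightarrow> 0) (at 0)"
  proof (rule tendsto_sandwich)
   show "\<forall>\<^sub>F h::real in at 0. (max 0 h)\<^sup>2 / h \<le> \<bar>h\<bar>" "\<forall>\<^sub>F h::real in at 0. 0 \<le> (max 0 h)\<^sup>2 / h"
    by (intro always_eventually allI; simp add: max_def power2_eq_square)+
   show "((\<lambda>h::real. \<bar>h\<bar>) \<longlongrightarrow> 0) (at 0)"
    by (intro tendsto_rabs_zero tendsto_ident_at)
  qed simp
  then show ?thesis using 3 by (simp add: DERIV_def)
 qed
qed

lemma blinfun_basis_sum:
 fixes x :: "'a::euclidean_space"
 shows "(\<Sum>e\<in>Basis. (x \<bullet> e) *\<^sub>R blinfun_apply D e) = blinfun_apply D x"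
proof -
 have "blinfun_apply D x = blinfun_apply D (\<Sum>e\<in>Basis. (x \<bullet> e) *\<^sub>R e)"
  by (simp add: euclidean_representation)
 then show ?thesis by (simp add: blinfun.sum_right blinfun.scaleR_right)
qed

lemma has_vector_derivative_along_line:
 assumes "(f has_derivative f') (at x)"
 shows "((\<lambda>t. f (x + t *\<^sub>R e)) has_vector_derivative f' e) (at 0)"
proof -
 have "((\<lambda>t. x + t *\<^sub>R e) has_derivative (\<lambda>t. t *\<^sub>R e)) (at 0)"
  by (auto intro!: derivative_eq_intros)
 then have "((\<lambda>t. f (x + t *\<^sub>R e)) has_derivative (\<lambda>t. f' (t *\<^sub>R e))) (at 0)"
  using assms by (intro has_derivative_compose[of "\<lambda>t. x + t *\<^sub>R e" _ 0 UNIV f]) auto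
 then show ?thesis
  using linear_scale[OF has_derivative_linear[OF assms]] by (simp add: has_vector_derivative_def)
qed

text \<open>
 The field \<open>u \<nabla>v - v \<nabla>u\<close> is free of divergence. Multiplied by the continuously
 differentiable cutoff \<open>(max 0 (s\<^sup>2 - \<bar>x\<bar>\<^sup>2))\<^sup>2\<close> its divergence
 integrates to zero, and only the gradient of the cutoff contributes.
\<close>

lemma weighted_wronskian_integral:
 fixes u v :: "'a::euclidean_space \<Rightarrow> complex"
 assumes Du: "\<And>x. x \<in> ball 0 1 \<Longrightarrow> (u has_derivative blinfun_apply (Du x)) (at x)"
  and Dv: "\<And>x. x \<in> ball 0 1 \<Longrightarrow> (v has_derivative blinfun_apply (Dv x)) (at x)"
  and Du2: "\<And>x. x \<in> ball 0 1 \<Longrightarrow> (Du has_derivative blinfun_apply (Du2 x)) (at x)"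
  and Dv2: "\<And>x. x \<in> ball 0 1 \<Longrightarrow> (Dv has_derivative blinfun_apply (Dv2 x)) (at x)"
  and contu: "continuous_on (ball 0 1) Du2" and contv: "continuous_on (ball 0 1) Dv2"
  and lapu: "\<And>x. x \<in> ball 0 1 \<Longrightarrow> (\<Sum>e\<in>Basis. blinfun_apply (blinfun_apply (Du2 x) e) e) = 0"
  and lapv: "\<And>x. x \<in> ball 0 1 \<Longrightarrow> (\<Sum>e\<in>Basis. blinfun_apply (blinfun_apply (Dv2 x) e) e) = 0"
  and s: "0 < s" "s < 1"
 shows "(LINT x:ball 0 s|lborel. of_real (s\<^sup>2 - x \<bullet> x) * (u x * Dv x x - v x * Du x x)) = 0"
proof -
 define m where "m x = max 0 (s\<^sup>2 - x \<bullet> x)" for x :: 'a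
 define w where "w e x = (if norm x < 1 then of_real ((m x)\<^sup>2) * (u x * Dv x e - v x * Du x e) else 0)" for e x
 define g where "g e x = (if norm x < 1 then of_real ((m x)\<^sup>2) * (u x * Dv2 x e e - v x * Du2 x e e)
   + of_real (- 4 * m x * (x \<bullet> e)) * (u x * Dv x e - v x * Du x e) else 0)" for e x
 have m0: "m x = 0" if "norm x \<ge> s" for x
  using power_mono[OF that, of 2] s by (simp add: m_def power2_norm_eq_inner)
 have cu: "continuous_on (ball 0 1) u" and cv: "continuous_on (ball 0 1) v"
  and cDu: "continuous_on (ball 0 1) Du" and cDv: "continuous_on (ball 0 1) Dv"
  by (meson Du Dv Du2 Dv2 continuous_at_imp_continuous_on has_derivative_continuous)+
 have cm: "continuous_on A m" for A
  unfolding m_def by (intro continuous_intros)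
 have cover: "UNIV = ball (0::'a) 1 \<union> - cball 0 s" using s by auto
 have cw: "continuous_on UNIV (w e)" for e
  unfolding cover
 proof (rule continuous_on_open_Un)
  have "continuous_on (ball 0 1) (\<lambda>x. of_real ((m x)\<^sup>2) * (u x * Dv x e - v x * Du x e))"
   by (intro continuous_intros cm cu cv cDu cDv)
  then show "continuous_on (ball 0 1) (w e)"
   by (rule continuous_on_eq) (auto simp: w_def)
  show "continuous_on (- cball 0 s) (w e)"
   by (rule continuous_on_eq[of _ "\<lambda>_. 0"]) (auto simp: w_def m0)
 qed auto
 have cg: "continuous_on UNIV (g e)" for e
  unfolding cover
 proof (rule continuous_on_open_Un)
  have "continuous_on (ball 0 1) (\<lambda>x. of_real ((m x)\<^sup>2) * (u x * Dv2 x e e - v x * Du2 x e e)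
   + of_real (- 4 * m x * (x \<bullet> e)) * (u x * Dv x e - v x * Du x e))"
   by (intro continuous_intros cm cu cv cDu cDv contu contv)
  then show "continuous_on (ball 0 1) (g e)"
   by (rule continuous_on_eq) (auto simp: g_def)
  show "continuous_on (- cball 0 s) (g e)"
   by (rule continuous_on_eq[of _ "\<lambda>_. 0"]) (auto simp: g_def m0)
 qed auto
 have deriv: "((\<lambda>t. w e (x + t *\<^sub>R e)) has_vector_derivative g e x) (at 0)" for e x
 proof (cases "norm x < 1")
  case True
  then have x: "x \<in> ball 0 1" by simp
  have mm: "((\<lambda>t. (m (x + t *\<^sub>R e))\<^sup>2) has_real_derivative (2 * m x * (- 2 * (x \<bullet> e)))) (at 0)"
  proof -
   have "((\<lambda>t. s\<^sup>2 - (x + t *\<^sub>R e) \<bullet> (x + t *\<^sub>R e)) has_real_derivative (- 2 * (x \<bullet> e))) (at 0)"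
    by (simp add: inner_add_left inner_add_right)
     (auto intro!: derivative_eq_intros simp: inner_commute)
   from DERIV_chain2[OF has_real_derivative_pos_part_sq this]
   show ?thesis by (simp add: m_def)
  qed
  have a: "((\<lambda>t. blinfun_apply (Dv (x + t *\<^sub>R e)) e) has_vector_derivative Dv2 x e e) (at 0)"
   by (rule bounded_linear.has_vector_derivative[OF blinfun.bounded_linear_left
      has_vector_derivative_along_line[OF Dv2[OF x]]])
  have b: "((\<lambda>t. blinfun_apply (Du (x + t *\<^sub>R e)) e) has_vector_derivative Du2 x e e) (at 0)"
   by (rule bounded_linear.has_vector_derivative[OF blinfun.bounded_linear_left
      has_vector_derivative_along_line[OF Du2[OF x]]])
  note du = has_vector_derivative_along_line[OF Du[OF x], of e]
  note dv = has_vector_derivative_along_line[OF Dv[OF x], of e]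
  have "((\<lambda>t. complex_of_real ((m (x + t *\<^sub>R e))\<^sup>2) * (u (x + t *\<^sub>R e) * Dv (x + t *\<^sub>R e) e - v (x + t *\<^sub>R e) * Du (x + t *\<^sub>R e) e))
   has_vector_derivative
    complex_of_real ((m (x + 0 *\<^sub>R e))\<^sup>2) * ((u (x + 0 *\<^sub>R e) * Dv2 x e e + Du x e * Dv (x + 0 *\<^sub>R e) e)
     - (v (x + 0 *\<^sub>R e) * Du2 x e e + Dv x e * Du (x + 0 *\<^sub>R e) e))
    + complex_of_real (2 * m x * (- 2 * (x \<bullet> e))) * (u (x + 0 *\<^sub>R e) * Dv (x + 0 *\<^sub>R e) e - v (x + 0 *\<^sub>R e) * Du (x + 0 *\<^sub>R e) e)) (at 0)"
   by (intro has_vector_derivative_mult has_vector_derivative_diff has_vector_derivative_of_real mm a b du dv)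
  also have "complex_of_real ((m (x + 0 *\<^sub>R e))\<^sup>2) * ((u (x + 0 *\<^sub>R e) * Dv2 x e e + Du x e * Dv (x + 0 *\<^sub>R e) e)
     - (v (x + 0 *\<^sub>R e) * Du2 x e e + Dv x e * Du (x + 0 *\<^sub>R e) e))
    + complex_of_real (2 * m x * (- 2 * (x \<bullet> e))) * (u (x + 0 *\<^sub>R e) * Dv (x + 0 *\<^sub>R e) e - v (x + 0 *\<^sub>R e) * Du (x + 0 *\<^sub>R e) e)
    = g e x"
   using True by (simp add: g_def mult.commute)
  finally have "((\<lambda>t. complex_of_real ((m (x + t *\<^sub>R e))\<^sup>2) * (u (x + t *\<^sub>R e) * Dv (x + t *\<^sub>R e) e - v (x + t *\<^sub>R e) * Du (x + t *\<^sub>R e) e))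
   has_vector_derivative g e x) (at 0)" .
  then show ?thesis
  proof (rule has_vector_derivative_transform_within_open)
   show "open ((\<lambda>t. x + t *\<^sub>R e) -` ball 0 1)"
    by (intro open_vimage continuous_intros) auto
  qed (use True in \<open>auto simp: w_def\<close>)
 next
  case False
  have "((\<lambda>t. 0) has_vector_derivative g e x) (at 0)"
   using False by (simp add: g_def)
  then show ?thesis
  proof (rule has_vector_derivative_transform_within_open)
   show "open ((\<lambda>t. x + t *\<^sub>R e) -` (- cball 0 s))"
    by (intro open_vimage continuous_intros) auto
  qed (use False s in \<open>auto simp: w_def m0\<close>)
 qed
 have int: "integrable lborel (g e)" and zero: "integral\<^sup>L lborel (g e) = 0" for e
 proof -
  show "integral\<^sup>L lborel (g e) = 0"
   by (rule integral_directional_derivative[OF deriv cw cg]) (auto simp: w_def g_def)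
  have "integrable lborel (\<lambda>x. indicator (cball 0 1) x *\<^sub>R g e x)"
   using borel_integrable_compact[of "cball 0 1" "g e"] cg[of e] by (auto intro: continuous_on_subset)
  moreover have "indicator (cball 0 1) x *\<^sub>R g e x = g e x" for x
   by (auto simp: indicator_def g_def)
  ultimately show "integrable lborel (g e)" by simp
 qed
 have "(\<Sum>e\<in>Basis. g e x) = -4 * (indicator (ball 0 s) x *\<^sub>R (of_real (s\<^sup>2 - x \<bullet> x) * (u x * Dv x x - v x * Du x x)))" for x
 proof (cases "norm x < s")
  case True
  then have x: "x \<in> ball 0 1" and mx: "m x = s\<^sup>2 - x \<bullet> x"
   using s power_strict_mono[OF True, of 2] by (auto simp: m_def power2_norm_eq_inner)
  have "(\<Sum>e\<in>Basis. g e x) = of_real ((m x)\<^sup>2) * (u x * (\<Sum>e\<in>Basis. Dv2 x e e) - v x * (\<Sum>e\<in>Basis. Du2 x e e))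
    + of_real (- 4 * m x) * (u x * (\<Sum>e\<in>Basis. (x \<bullet> e) *\<^sub>R blinfun_apply (Dv x) e) - v x * (\<Sum>e\<in>Basis. (x \<bullet> e) *\<^sub>R blinfun_apply (Du x) e))"
   using x by (simp add: g_def sum.distrib sum_subtractf sum_negf sum_distrib_left sum_distrib_right scaleR_conv_of_real algebra_simps)
  also have "\<dots> = of_real (- 4 * m x) * (u x * Dv x x - v x * Du x x)"
   by (simp add: lapu[OF x] lapv[OF x] blinfun_basis_sum)
  finally show ?thesis using True by (simp add: mx) (simp add: algebra_simps)
 next
  case False
  then have "g e x = 0" for e by (simp add: g_def m0)
  then show ?thesis using False by simp
 qed
 moreover have "(LINT x|lborel. (\<Sum>e\<in>Basis. g e x)) = 0"
  by (simp add: int zero)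
 ultimately have "(LINT x|lborel. - 4 * (indicator (ball 0 s) x *\<^sub>R (of_real (s\<^sup>2 - x \<bullet> x) * (u x * Dv x x - v x * Du x x)))) = 0"
  by (simp only:)
 then show ?thesis
  unfolding set_lebesgue_integral_def integral_mult_right_zero by simp
qed

text \<open>
 The solid identity reads \<open>t\<^sup>2 A t = B t\<close> for the integrals of the radial Wronskian and of
 its product with \<open>\<bar>x\<bar>\<^sup>2\<close> over balls. Differentiating gives \<open>A t =
 0\<close>, and differentiating once more leaves Green's identity on the sphere.
\<close>

lemma harmonic_wronskian_sphere:
 fixes u v :: "'a::euclidean_space \<Rightarrow> complex"
 assumes u: "harmonic_on (ball 0 1) u" and v: "harmonic_on (ball 0 1) v"
  and u': "\<And>x. x \<in> ball 0 1 \<Longrightarrow> (u has_derivative u' x) (at x)"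
  and v': "\<And>x. x \<in> ball 0 1 \<Longrightarrow> (v has_derivative v' x) (at x)"
  and s: "0 < s" "s < 1"
 shows "(LINT z|surface. u (s *\<^sub>R z) * v' (s *\<^sub>R z) z - v (s *\<^sub>R z) * u' (s *\<^sub>R z) z) = 0"
proof -
 obtain Du Du2 where Du: "\<And>x. x \<in> ball 0 1 \<Longrightarrow> (u has_derivative blinfun_apply (Du x)) (at x)"
  "\<And>x. x \<in> ball 0 1 \<Longrightarrow> (Du has_derivative blinfun_apply (Du2 x)) (at x)"
  "continuous_on (ball 0 1) Du2"
  "\<And>x. x \<in> ball 0 1 \<Longrightarrow> (\<Sum>e\<in>Basis. blinfun_apply (blinfun_apply (Du2 x) e) e) = 0"
  using u unfolding harmonic_on_def by blast
 obtain Dv Dv2 where Dv: "\<And>x. x \<in> ball 0 1 \<Longrightarrow> (v has_derivative blinfun_apply (Dv x)) (at x)"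
  "\<And>x. x \<in> ball 0 1 \<Longrightarrow> (Dv has_derivative blinfun_apply (Dv2 x)) (at x)"
  "continuous_on (ball 0 1) Dv2"
  "\<And>x. x \<in> ball 0 1 \<Longrightarrow> (\<Sum>e\<in>Basis. blinfun_apply (blinfun_apply (Dv2 x) e) e) = 0"
  using v unfolding harmonic_on_def by blast
 define h where "h x = u x * Dv x x - v x * Du x x" for x
 define n where "n = DIM('a)"
 have ch: "continuous_on (ball 0 1) h"
  unfolding h_def
  by (intro continuous_intros; meson Du Dv continuous_at_imp_continuous_on has_derivative_continuous)
 have ch2: "continuous_on (ball 0 1) (\<lambda>x. of_real (x \<bullet> x) * h x)"
  by (intro continuous_intros ch)
 define A where "A t = (LINT x:ball 0 t|lborel. h x)" for t
 define B where "B t = (LINT x:ball 0 t|lborel. of_real (x \<bullet> x) * h x)" for t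
 define M where "M t = (LINT z|surface. h (t *\<^sub>R z))" for t
 have eq: "B t = t\<^sup>2 *\<^sub>R A t" if "0 < t" "t < 1" for t
 proof -
  have "0 = (LINT x:ball 0 t|lborel. of_real (t\<^sup>2 - x \<bullet> x) * h x)"
   unfolding h_def using weighted_wronskian_integral[OF Du(1) Dv(1) Du(2) Dv(2) Du(3) Dv(3) Du(4) Dv(4) that] by simp
  also have "\<dots> = (LINT x:ball 0 t|lborel. t\<^sup>2 *\<^sub>R h x - of_real (x \<bullet> x) * h x)"
   by (intro set_lebesgue_integral_cong) (auto simp: algebra_simps scaleR_conv_of_real)
  also have "\<dots> = t\<^sup>2 *\<^sub>R A t - B t"
   unfolding A_def B_def using that
   by (subst set_integral_diff)
    (auto intro!: set_integrable_scaleR_right set_integrable_continuous_cball ch ch2)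
  finally show ?thesis by simp
 qed
 have dA: "(A has_vector_derivative t ^ (n - 1) *\<^sub>R M t) (at t)" if "0 < t" "t < 1" for t
  unfolding A_def M_def n_def by (rule has_vector_derivative_solid_integral[OF ch that])
 have dB: "(B has_vector_derivative t ^ (n - 1) *\<^sub>R (t\<^sup>2 *\<^sub>R M t)) (at t)" if "0 < t" "t < 1" for t
 proof -
  have "(LINT z|surface. of_real ((t *\<^sub>R z) \<bullet> (t *\<^sub>R z)) * h (t *\<^sub>R z)) = (LINT z|surface. t\<^sup>2 *\<^sub>R h (t *\<^sub>R z))"
  proof (rule bochner_integral_cong)
   fix z :: 'a assume "z \<in> space surface"
   then have "z \<bullet> z = 1" by (simp add: norm_eq_1)
   then show "of_real ((t *\<^sub>R z) \<bullet> (t *\<^sub>R z)) * h (t *\<^sub>R z) = t\<^sup>2 *\<^sub>R h (t *\<^sub>R z)"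
    by (simp add: scaleR_conv_of_real power2_eq_square)
  qed simp
  also have "\<dots> = t\<^sup>2 *\<^sub>R M t" by (simp add: M_def)
  finally show ?thesis
   using has_vector_derivative_solid_integral[OF ch2 that] unfolding B_def n_def by simp
 qed
 have A0: "A t = 0" if t: "0 < t" "t < 1" for t
 proof -
  have "((\<lambda>t. t\<^sup>2 *\<^sub>R A t) has_vector_derivative (t\<^sup>2 *\<^sub>R (t ^ (n - 1) *\<^sub>R M t) + (2 * t) *\<^sub>R A t)) (at t)"
   by (intro has_vector_derivative_scaleR dA t) (auto intro!: derivative_eq_intros)
  then have "(B has_vector_derivative (t\<^sup>2 *\<^sub>R (t ^ (n - 1) *\<^sub>R M t) + (2 * t) *\<^sub>R A t)) (at t)"
   by (rule has_vector_derivative_transform_within_open[of _ _ _ "{0<..<1}"]) (use t eq in auto)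
  from vector_derivative_unique_at[OF this dB[OF t]]
  show ?thesis using t by (simp add: mult.commute)
 qed
 have "(A has_vector_derivative 0) (at s)"
  by (rule has_vector_derivative_transform_within_open[of "\<lambda>_. 0" _ _ "{0<..<1}"]) (use s A0 in auto)
 from vector_derivative_unique_at[OF this dA[OF s]] have "M s = 0" using s by simp
 have "u' x = blinfun_apply (Du x)" "v' x = blinfun_apply (Dv x)" if "x \<in> ball 0 1" for x
  using has_derivative_unique[OF u'[OF that] Du(1)[OF that]] has_derivative_unique[OF v'[OF that] Dv(1)[OF that]] by auto
 then have "M s = (LINT z|surface. s *\<^sub>R (u (s *\<^sub>R z) * v' (s *\<^sub>R z) z - v (s *\<^sub>R z) * u' (s *\<^sub>R z) z))"
  unfolding M_def using s
  by (intro bochner_integral_cong) (auto simp: h_def blinfun.scaleR_right scaleR_diff_right)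
 also have "\<dots> = s *\<^sub>R (LINT z|surface. u (s *\<^sub>R z) * v' (s *\<^sub>R z) z - v (s *\<^sub>R z) * u' (s *\<^sub>R z) z)"
  by simp
 finally show ?thesis using \<open>M s = 0\<close> s by simp
qed

lemma surface_integral_norm_le:
 fixes f :: "'a::euclidean_space \<Rightarrow> 'b::{banach, second_countable_topology}"
 assumes "f \<in> borel_measurable surface" "\<And>z. z \<in> sphere 0 1 \<Longrightarrow> norm (f z) \<le> c"
 shows "norm (LINT z|surface. f z) \<le> c * surface_area TYPE('a)"
proof -
 have f: "integrable surface f" by (rule integrable_surface_bounded[OF assms])
 have "norm (LINT z|surface. f z) \<le> (LINT z|surface. norm (f z))"
  by (rule integral_norm_bound)
 also have "\<dots> \<le> (LINT z|(surface :: 'a measure). c)"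
  by (rule integral_mono) (use f assms in auto)
 finally show ?thesis by (simp add: surface_area_def mult.commute)
qed

text \<open>
 Differentiation under the integral sign; the partial derivatives of the kernel are uniformly continuous near
 \<open>x\<close> because the sphere is compact.
\<close>

lemma has_derivative_surface_integral:
 fixes K :: "'b::euclidean_space \<Rightarrow> 'a::euclidean_space \<Rightarrow> complex"
 assumes U: "open U" "x \<in> U"
  and K: "\<And>x z. x \<in> U \<Longrightarrow> z \<in> sphere 0 1 \<Longrightarrow>
   ((\<lambda>x. K x z) has_derivative (\<lambda>h. \<Sum>e\<in>Basis. (h \<bullet> e) *\<^sub>R Kd e x z)) (at x)"
  and Kd: "\<And>e. e \<in> Basis \<Longrightarrow> continuous_on (U \<times> sphere 0 1) (\<lambda>(x, z). Kd e x z)"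
  and Kc: "\<And>x. x \<in> U \<Longrightarrow> continuous_on (sphere 0 1) (K x)"
  and \<phi>: "\<phi> \<in> borel_measurable surface" "\<And>z. z \<in> sphere 0 1 \<Longrightarrow> cmod (\<phi> z) \<le> B"
 shows "((\<lambda>x. LINT z|surface. K x z * \<phi> z) has_derivative
   (\<lambda>h. \<Sum>e\<in>Basis. (h \<bullet> e) *\<^sub>R (LINT z|surface. Kd e x z * \<phi> z))) (at x)"
proof -
 let ?S = "sphere (0::'a) 1"
 have int: "integrable surface (\<lambda>z. f z * \<phi> z)" if f: "continuous_on ?S f" for f
 proof -
  have "bounded (f ` ?S)"
   using f by (intro compact_imp_bounded compact_continuous_image) auto
  then obtain C where C: "\<And>z. z \<in> ?S \<Longrightarrow> cmod (f z) \<le> C"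
   by (metis bounded_iff imageI)
  show ?thesis
  proof (rule integrable_surface_bounded)
   show "(\<lambda>z. f z * \<phi> z) \<in> borel_measurable surface"
    using \<phi>(1) continuous_measurable_surface[OF f] by measurable
   fix z assume z: "z \<in> ?S"
   have "norm (f z * \<phi> z) \<le> C * B"
    unfolding norm_mult using C[OF z] \<phi>(2)[OF z] by (intro mult_mono) (auto intro: order_trans[OF norm_ge_zero])
   then show "norm (f z * \<phi> z) \<le> C * B" .
  qed
 qed
 have Kdc: "continuous_on ?S (Kd e y)" if "e \<in> Basis" "y \<in> U" for e y
 proof -
  have "continuous_on ?S (\<lambda>z. case (y, z) of (x, z) \<Rightarrow> Kd e x z)"
   by (rule continuous_on_compose2[OF Kd[OF that(1)]])
    (use that in \<open>auto intro!: continuous_on_Pair continuous_on_const continuous_on_id\<close>)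
  then show ?thesis by simp
 qed
 obtain r where r: "r > 0" "cball x r \<subseteq> U" using U open_contains_cball by blast
 have ev: "\<forall>\<^sub>F y in nhds x. \<forall>e\<in>Basis. \<forall>z\<in>?S. cmod (Kd e y z - Kd e x z) < \<epsilon>" if "\<epsilon> > 0" for \<epsilon>
 proof (rule eventually_ball_finite)
  show "\<forall>e\<in>Basis. \<forall>\<^sub>F y in nhds x. \<forall>z\<in>?S. cmod (Kd e y z - Kd e x z) < \<epsilon>"
  proof
   fix e :: 'b assume e: "e \<in> Basis"
   have "uniformly_continuous_on (cball x r \<times> ?S) (\<lambda>(x, z). Kd e x z)"
    using r by (intro compact_uniformly_continuous compact_Times)
     (auto intro: continuous_on_subset[OF Kd[OF e]])
   then obtain d where d: "d > 0" "\<And>a b. a \<in> cball x r \<times> ?S \<Longrightarrow> b \<in> cball x r \<times> ?S \<Longrightarrow> dist b a < d \<Longrightarrow>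
     dist (case b of (x, z) \<Rightarrow> Kd e x z) (case a of (x, z) \<Rightarrow> Kd e x z) < \<epsilon>"
    using \<open>\<epsilon> > 0\<close> unfolding uniformly_continuous_on_def by metis
   have "\<forall>z\<in>?S. cmod (Kd e y z - Kd e x z) < \<epsilon>" if y: "dist y x < min d r" for y
   proof
    fix z assume z: "z \<in> ?S"
    have "dist (y, z) (x, z) < d" using y by (simp add: dist_Pair_Pair)
    moreover have "(y, z) \<in> cball x r \<times> ?S" "(x, z) \<in> cball x r \<times> ?S"
     using y z r by (auto simp: dist_commute)
    ultimately have "dist (Kd e y z) (Kd e x z) < \<epsilon>" using d(2) by fastforce
    then show "cmod (Kd e y z - Kd e x z) < \<epsilon>" by (simp add: dist_norm)
   qed
   then show "\<forall>\<^sub>F y in nhds x. \<forall>z\<in>?S. cmod (Kd e y z - Kd e x z) < \<epsilon>"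
    unfolding eventually_nhds_metric using d(1) r(1) by (intro exI[of _ "min d r"]) auto
  qed
 qed simp
 define I where "I y = (LINT z|surface. K y z * \<phi> z)" for y
 define L where "L h = (\<Sum>e\<in>Basis. (h \<bullet> e) *\<^sub>R (LINT z|surface. Kd e x z * \<phi> z))" for h
 define \<sigma> where "\<sigma> = surface_area TYPE('a)"
 have \<sigma>: "\<sigma> > 0" by (simp add: \<sigma>_def)
 have "B \<ge> 0"
  using \<phi>(2)[of "SOME i. i \<in> Basis"] norm_ge_zero order_trans SOME_Basis by (metis mem_sphere_0 norm_Basis)
 have "(I has_derivative L) (at x)"
  unfolding has_derivative_at_alt
 proof (intro conjI allI impI)
  show "bounded_linear L"
   unfolding L_def by (intro bounded_linear_intros)
  fix \<epsilon> :: real assume "\<epsilon> > 0"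
  define \<epsilon>' where "\<epsilon>' = \<epsilon> / (DIM('b) * (B + 1) * \<sigma>)"
  have e': "\<epsilon>' > 0" using \<open>\<epsilon> > 0\<close> \<open>B \<ge> 0\<close> \<sigma> by (simp add: \<epsilon>'_def)
  obtain d where d: "d > 0" "\<And>y e z. dist y x < d \<Longrightarrow> e \<in> Basis \<Longrightarrow> z \<in> ?S \<Longrightarrow> cmod (Kd e y z - Kd e x z) < \<epsilon>'"
   using ev[OF e'] unfolding eventually_nhds_metric by blast
  show "\<exists>d>0. \<forall>y. norm (y - x) < d \<longrightarrow> norm (I y - I x - L (y - x)) \<le> \<epsilon> * norm (y - x)"
  proof (intro exI conjI allI impI)
   show "min d r > 0" using d r by simp
   fix y assume y: "norm (y - x) < min d r"
   have yU: "y \<in> U" using y r by (auto simp: dist_norm norm_minus_commute)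
   define D where "D z = K y z - K x z - (\<Sum>e\<in>Basis. ((y - x) \<bullet> e) *\<^sub>R Kd e x z)" for z
   have D: "cmod (D z) \<le> norm (y - x) * (DIM('b) * \<epsilon>')" if z: "z \<in> ?S" for z
   proof -
    define F' where "F' y h = (\<Sum>e\<in>Basis. (h \<bullet> e) *\<^sub>R Kd e y z)" for y h
    have 1: "x + t *\<^sub>R (y - x) \<in> ball x (min d r)" if "t \<in> {0..1}" for t
    proof -
     have "t * norm (y - x) \<le> 1 * norm (y - x)" using that by (intro mult_right_mono) auto
     moreover have "dist x (x + t *\<^sub>R (y - x)) = norm (t *\<^sub>R (y - x))"
      unfolding dist_norm diff_add_eq_diff_diff_swap[symmetric] by (metis add_diff_cancel_left' norm_minus_commute)
     moreover have "norm (t *\<^sub>R (y - x)) = t * norm (y - x)"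
      using that unfolding norm_scaleR by simp
     ultimately show ?thesis using y unfolding mem_ball by linarith
    qed
    have 2: "((\<lambda>y. K y z) has_derivative F' y) (at y within ball x (min d r))"
     if "y \<in> ball x (min d r)" for y
    proof -
     have "y \<in> U" using that r by auto
     from has_derivative_at_withinI[OF K[OF this z]]
     show ?thesis unfolding F'_def[abs_def] .
    qed
    have 3: "onorm (F' y' - F' x) \<le> DIM('b) * \<epsilon>'" if y': "y' \<in> ball x (min d r)" for y'
    proof (rule onorm_bound)
     fix v :: 'b
     have *: "dist y' x < d" using y' by (simp add: dist_commute)
     have "norm ((F' y' - F' x) v)
       = norm (\<Sum>e\<in>Basis. (v \<bullet> e) *\<^sub>R (Kd e y' z - Kd e x z))"
      unfolding F'_def fun_diff_def by (simp only: sum_subtractf scaleR_diff_right)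
     also have "\<dots> \<le> (\<Sum>e\<in>Basis. norm ((v \<bullet> e) *\<^sub>R (Kd e y' z - Kd e x z)))"
      by (rule norm_sum)
     also have "\<dots> \<le> (\<Sum>e\<in>(Basis :: 'b set). norm v * \<epsilon>')"
      unfolding norm_scaleR using d(2)[OF * _ z] e'
      by (intro sum_mono mult_mono) (auto simp: Basis_le_norm less_imp_le)
     finally show "norm ((F' y' - F' x) v) \<le> DIM('b) * \<epsilon>' * norm v" by (simp add: mult_ac)
    qed (use e' in auto)
    have 4: "x \<in> ball x (min d r)" using d r by simp
    from differentiable_bound_linearization[OF 1 2 3 4]
    show ?thesis unfolding D_def F'_def .
   qed
   have "I y - I x - L (y - x) = (LINT z|surface. D z * \<phi> z)"
   proof -
    have 1: "integrable surface (\<lambda>z. K y z * \<phi> z)" "integrable surface (\<lambda>z. K x z * \<phi> z)"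
     by (intro int Kc yU U)+
    have 2: "integrable surface (\<lambda>z. ((y - x) \<bullet> e) *\<^sub>R (Kd e x z * \<phi> z))" if "e \<in> Basis" for e
     by (intro integrable_scaleR_right int Kdc that U)
    have "(LINT z|surface. D z * \<phi> z) = (LINT z|surface. K y z * \<phi> z - K x z * \<phi> z - (\<Sum>e\<in>Basis. ((y - x) \<bullet> e) *\<^sub>R (Kd e x z * \<phi> z)))"
     by (intro bochner_integral_cong) (simp_all only: D_def left_diff_distrib sum_distrib_right mult_scaleR_left)
    also have "\<dots> = I y - I x - L (y - x)"
     using 1 2 unfolding I_def L_def
     by (subst bochner_integral_diff; (intro Bochner_Integration.integrable_diff Bochner_Integration.integrable_sum)?; simp)+
    finally show ?thesis ..
   qed
   also have "norm \<dots> \<le> norm (y - x) * (DIM('b) * \<epsilon>') * B * surface_area TYPE('a)"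
   proof (rule surface_integral_norm_le)
    have "continuous_on ?S D"
     unfolding D_def by (intro continuous_intros Kc Kdc yU U)
    then show "(\<lambda>z. D z * \<phi> z) \<in> borel_measurable surface"
     using int borel_measurable_integrable by blast
    show "norm (D z * \<phi> z) \<le> norm (y - x) * (DIM('b) * \<epsilon>') * B" if "z \<in> ?S" for z
     unfolding norm_mult using that D[of z] \<phi>(2)[of z] e' by (intro mult_mono) auto
   qed
   also have "\<dots> = norm (y - x) * (DIM('b) * \<epsilon>' * B * \<sigma>)"
    by (simp add: \<sigma>_def)
   also have "\<dots> \<le> norm (y - x) * (DIM('b) * \<epsilon>' * (B + 1) * \<sigma>)"
    using e' \<sigma> by (intro mult_left_mono mult_right_mono) auto
   also have "DIM('b) * \<epsilon>' * (B + 1) * \<sigma> = \<epsilon>"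
   proof -
    have c: "DIM('b) * (B + 1) * \<sigma> \<noteq> 0" using \<sigma> \<open>B \<ge> 0\<close> by auto
    have "\<epsilon>' * (DIM('b) * (B + 1) * \<sigma>) = \<epsilon>"
     using nonzero_eq_divide_eq[OF c, of \<epsilon>' \<epsilon>] \<epsilon>'_def by simp
    then show ?thesis by (simp only: mult_ac)
   qed
   finally show "norm (I y - I x - L (y - x)) \<le> \<epsilon> * norm (y - x)" by (simp add: mult.commute)
  qed
 qed
 then show ?thesis unfolding I_def L_def .
qed

section \<open>Zonal moments and the Poisson integral\<close>

text \<open>
 The growth of coefficients for which an expansion converges in the whole open unit ball.
\<close>

definition subexponential :: "(nat \<Rightarrow> 'b::real_normed_vector) \<Rightarrow> bool" where
 "subexponential c \<longleftrightarrow> (\<forall>R. 0 < R \<longrightarrow> R < 1 \<longrightarrow> (\<exists>C. \<forall>k. norm (c k) \<le> C / R ^ k))"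

lemma subexponentialI:
 assumes "\<And>R. 0 < R \<Longrightarrow> R < 1 \<Longrightarrow> \<exists>C. \<forall>k. norm (c k) \<le> C / R ^ k"
 shows "subexponential c"
 using assms by (auto simp: subexponential_def)

lemma subexponentialE:
 assumes "subexponential c" "0 < R" "R < 1"
 obtains C where "C \<ge> 0" "\<And>k. norm (c k) \<le> C / R ^ k"
proof -
 obtain C where C: "\<And>k. norm (c k) \<le> C / R ^ k"
  using assms by (auto simp: subexponential_def)
 have "norm (c 0) \<le> C" using C[of 0] by simp
 then have "C \<ge> 0" using norm_ge_zero order_trans by blast
 then show thesis using that C by blast
qed

lemma subexponential_mono:
 assumes "subexponential a" "\<And>k. norm (b k) \<le> norm (a k)"
 shows "subexponential b"
 using assms unfolding subexponential_def by (meson order_trans)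

lemma subexponential_mult:
 fixes a b :: "nat \<Rightarrow> 'b::real_normed_algebra"
 assumes a: "subexponential a" and b: "subexponential b"
 shows "subexponential (\<lambda>k. a k * b k)"
proof (rule subexponentialI)
 fix R :: real assume R: "0 < R" "R < 1"
 define S where "S = sqrt R"
 have S: "0 < S" "S < 1" "S * S = R" using R by (auto simp: S_def)
 obtain A where A: "A \<ge> 0" "\<And>k. norm (a k) \<le> A / S ^ k" using subexponentialE[OF a S(1,2)] by blast
 obtain B where B: "B \<ge> 0" "\<And>k. norm (b k) \<le> B / S ^ k" using subexponentialE[OF b S(1,2)] by blast
 have "norm (a k * b k) \<le> (A * B) / R ^ k" for k
 proof -
  have "norm (a k * b k) \<le> norm (a k) * norm (b k)" by (rule norm_mult_ineq)
  also have "\<dots> \<le> (A / S ^ k) * (B / S ^ k)"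
   using A B S by (intro mult_mono) auto
  also have "\<dots> = (A * B) / R ^ k" by (simp add: S(3)[symmetric] power_mult_distrib)
  finally show ?thesis .
 qed
 then show "\<exists>C. \<forall>k. norm (a k * b k) \<le> C / R ^ k" by blast
qed

lemma subexponential_const: "subexponential (\<lambda>_. c)"
proof (rule subexponentialI)
 fix R :: real assume R: "0 < R" "R < 1"
 have "norm c \<le> norm c / R ^ k" for k
  using R power_le_one[of R k] by (simp add: le_divide_eq mult_left_le)
 then show "\<exists>C. \<forall>k. norm c \<le> C / R ^ k" by blast
qed

lemma subexponential_sum:
 fixes a b :: "nat \<Rightarrow> 'b::real_normed_vector"
 assumes a: "subexponential a" and b: "subexponential b"
 shows "subexponential (\<lambda>k. a k + b k)"
proof (rule subexponentialI)
 fix R :: real assume R: "0 < R" "R < 1"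
 obtain A where A: "\<And>k. norm (a k) \<le> A / R ^ k" using subexponentialE[OF a R] by metis
 obtain B where B: "\<And>k. norm (b k) \<le> B / R ^ k" using subexponentialE[OF b R] by metis
 have "norm (a k + b k) \<le> (A + B) / R ^ k" for k
  using norm_triangle_ineq[of "a k" "b k"] A[of k] B[of k] by (simp add: add_divide_distrib)
 then show "\<exists>C. \<forall>k. norm (a k + b k) \<le> C / R ^ k" by blast
qed

lemma subexponential_summable:
 assumes c: "subexponential c" and r: "0 \<le> r" "r < 1"
 shows "summable (\<lambda>k. norm (c k) * r ^ k)"
proof -
 define R where "R = (1 + r) / 2"
 have R: "0 < R" "R < 1" "r < R" using r by (auto simp: R_def)
 obtain C where C: "C \<ge> 0" "\<And>k. norm (c k) \<le> C / R ^ k" using subexponentialE[OF c R(1,2)] by blast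
 show ?thesis
 proof (rule summable_comparison_test)
  show "summable (\<lambda>k. C * (r / R) ^ k)"
   using r R by (intro summable_mult summable_geometric) auto
  have "norm (norm (c k) * r ^ k) \<le> C * (r / R) ^ k" for k
   using mult_right_mono[OF C(2)[of k], of "r ^ k"] r by (simp add: power_divide)
  then show "\<exists>N. \<forall>n\<ge>N. norm (norm (c n) * r ^ n) \<le> C * (r / R) ^ n" by blast
 qed
qed

definition zonal_sup :: "'a::euclidean_space itself \<Rightarrow> nat \<Rightarrow> real" where
 "zonal_sup _ k = (SUP (x, y) \<in> sphere (0::'a) 1 \<times> sphere 0 1. \<bar>zonal k x y\<bar>)"

lemma sphere_nonempty [simp]: "sphere (0::'a::euclidean_space) 1 \<noteq> {}"
 using SOME_Basis[where 'a='a] by (metis empty_iff mem_sphere_0 norm_Basis)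

lemma zonal_le_sup:
 assumes "x \<in> sphere (0::'a::euclidean_space) 1" "y \<in> sphere 0 1"
 shows "\<bar>zonal k x y\<bar> \<le> zonal_sup TYPE('a) k"
proof -
 obtain C where C: "\<And>k x y. norm x = 1 \<Longrightarrow> norm y = 1 \<Longrightarrow> \<bar>zonal k (x :: 'a) y\<bar> \<le> C / (1/2) ^ k"
 proof -
  have "0 < (1/2::real)" "(1/2::real) < 1" by auto
  from zonal_bound[OF this, where 'a='a] show thesis using that by metis
 qed
 have "bdd_above ((\<lambda>(x, y). \<bar>zonal k x y\<bar>) ` (sphere (0::'a) 1 \<times> sphere 0 1))"
  using C by (intro bdd_aboveI[of _ "C / (1/2) ^ k"]) auto
 then have "(case (x, y) of (x, y) \<Rightarrow> \<bar>zonal k x y\<bar>) \<le> zonal_sup TYPE('a) k"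
  unfolding zonal_sup_def using assms by (intro cSUP_upper) auto
 then show ?thesis by simp
qed

lemma subexponential_zonal_sup: "subexponential (zonal_sup TYPE('a::euclidean_space))"
proof (rule subexponentialI)
 fix R :: real assume R: "0 < R" "R < 1"
 obtain C where C: "\<And>k x y. norm x = 1 \<Longrightarrow> norm y = 1 \<Longrightarrow> \<bar>zonal k (x :: 'a) y\<bar> \<le> C / R ^ k"
  using zonal_bound[OF R] by metis
 obtain e where e: "e \<in> sphere (0::'a) 1" using sphere_nonempty by blast
 have "zonal_sup TYPE('a) k \<le> C / R ^ k" for k
  unfolding zonal_sup_def using C by (intro cSUP_least) auto
 moreover have "zonal_sup TYPE('a) k \<ge> 0" for k
  using zonal_le_sup[OF e e, of k] by linarith
 ultimately show "\<exists>C. \<forall>k. norm (zonal_sup TYPE('a) k) \<le> C / R ^ k" by auto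
qed

lemma continuous_on_zonal: "continuous_on A (\<lambda>z. zonal k z y)"
 using real_polynomial_function_zonal[of k y] real_polynomial_function_eq continuous_on_polymonial_function
 by blast

lemma harmonic_on_subset: "harmonic_on S f \<Longrightarrow> open T \<Longrightarrow> T \<subseteq> S \<Longrightarrow> harmonic_on T f"
 unfolding harmonic_on_def by (meson continuous_on_subset subsetD)

lemma harmonic_on_imp_continuous: "harmonic_on S f \<Longrightarrow> continuous_on S f"
 unfolding harmonic_on_def by (meson continuous_at_imp_continuous_on has_derivative_continuous)

lemma has_vector_derivative_along_ray:
 assumes "(f has_derivative f') (at (s *\<^sub>R z))"
 shows "((\<lambda>t. f (t *\<^sub>R z)) has_vector_derivative f' z) (at s)"
proof -
 have "((\<lambda>t. t *\<^sub>R z) has_derivative (\<lambda>t. t *\<^sub>R z)) (at s)"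
  by (auto intro!: derivative_eq_intros)
 then have "((\<lambda>t. f (t *\<^sub>R z)) has_derivative (\<lambda>t. f' (t *\<^sub>R z))) (at s)"
  using assms by (intro has_derivative_compose[of "\<lambda>t. t *\<^sub>R z" _ s UNIV f]) auto
 then show ?thesis
  using linear_scale[OF has_derivative_linear[OF assms]] by (simp add: has_vector_derivative_def)
qed

text \<open>
 Green's identity against the zonal polynomial, whose radial derivative is known by homogeneity, says that the
 moment \<open>F\<close> satisfies \<open>a F' = k F\<close>.
\<close>

lemma zonal_moment:
 fixes f :: "'a::euclidean_space \<Rightarrow> complex"
 assumes f: "harmonic_on (ball 0 1) f" and y: "norm y = 1"
 obtains C where "\<And>a. 0 < a \<Longrightarrow> a < 1 \<Longrightarrow>
  (LINT z|surface. f (a *\<^sub>R z) * of_real (zonal k z y)) = of_real (a ^ k) * C"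
proof -
 obtain Df where Df: "\<And>x. x \<in> ball 0 1 \<Longrightarrow> (f has_derivative blinfun_apply (Df x)) (at x)"
  and cDf: "continuous_on (ball 0 1) Df"
  using f unfolding harmonic_on_def
  by (metis (no_types, lifting) continuous_at_imp_continuous_on has_derivative_continuous)
 have cf: "continuous_on (ball 0 1) f" using f by (rule harmonic_on_imp_continuous)
 define v where "v x = complex_of_real (zonal k x y)" for x
 have v: "harmonic_on (ball 0 1) v"
  unfolding v_def by (rule harmonic_on_subset[OF harmonic_zonal[OF y]]) auto
 obtain Dv where Dv: "\<And>x. x \<in> ball 0 1 \<Longrightarrow> (v has_derivative blinfun_apply (Dv x)) (at x)"
  using v unfolding harmonic_on_def by blast
 define F where "F a = (LINT z|surface. f (a *\<^sub>R z) * of_real (zonal k z y))" for a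
 define F1 where "F1 a = (LINT z|surface. Df (a *\<^sub>R z) z * of_real (zonal k z y))" for a
 have vray: "v (t *\<^sub>R z) = of_real (t ^ k) * v z" for t z by (simp add: v_def zonal_scale)
 have Dvray: "Dv (s *\<^sub>R z) z = of_real (real k * s ^ (k - 1)) * v z" if "z \<in> sphere 0 1" "0 < s" "s < 1" for s z
 proof -
  have "((\<lambda>t. v (t *\<^sub>R z)) has_vector_derivative Dv (s *\<^sub>R z) z) (at s)"
   by (rule has_vector_derivative_along_ray[OF Dv]) (use that in auto)
  moreover have "((\<lambda>t. v (t *\<^sub>R z)) has_vector_derivative of_real (real k * s ^ (k - 1)) * v z) (at s)"
   unfolding vray by (rule has_vector_derivative_mult_left, rule has_vector_derivative_of_real)
    (auto intro!: derivative_eq_intros)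
  ultimately show ?thesis by (rule vector_derivative_unique_at)
 qed
 have sub: "s *\<^sub>R z \<in> ball 0 1" if "z \<in> sphere 0 1" "0 < s" "s < 1" for s and z :: 'a
  using that by simp
 have cfs: "continuous_on (sphere 0 1) (\<lambda>z. f (s *\<^sub>R z))" if "0 < s" "s < 1" for s
  by (rule continuous_on_compose2[OF cf]) (use that in \<open>auto intro!: continuous_intros\<close>)
 have cDfs: "continuous_on (sphere 0 1) (\<lambda>z. blinfun_apply (Df (s *\<^sub>R z)) z)" if "0 < s" "s < 1" for s
  by (rule blinfun.continuous_on, rule continuous_on_compose2[OF cDf])
   (use that in \<open>auto intro!: continuous_intros\<close>)
 have cz: "continuous_on (sphere 0 1) (\<lambda>z. complex_of_real (zonal k z y))"
  by (intro continuous_on_of_real continuous_on_zonal)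
 have dF: "(F has_vector_derivative F1 s) (at s)" if s: "0 < s" "s < 1" for s
 proof -
  have "(F has_derivative (\<lambda>h. \<Sum>e\<in>Basis. (h \<bullet> e) *\<^sub>R F1 s)) (at s)"
   unfolding F_def F1_def
  proof (rule has_derivative_surface_integral[where U = "{0<..<1}" and K = "\<lambda>a z. f (a *\<^sub>R z)"
     and Kd = "\<lambda>e a z. Df (a *\<^sub>R z) z" and B = "zonal_sup TYPE('a) k"])
   fix a :: real and z :: 'a assume *: "a \<in> {0<..<1}" "z \<in> sphere 0 1"
   show "((\<lambda>a. f (a *\<^sub>R z)) has_derivative (\<lambda>h. \<Sum>e\<in>Basis. (h \<bullet> e) *\<^sub>R Df (a *\<^sub>R z) z)) (at a)"
    using has_vector_derivative_along_ray[OF Df[OF sub[OF *(2), of a]]] *(1)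
    by (simp add: has_vector_derivative_def)
  next
   show "continuous_on ({0<..<1} \<times> sphere 0 1) (\<lambda>(a, z). blinfun_apply (Df (a *\<^sub>R z)) z)"
    unfolding case_prod_unfold
    by (rule blinfun.continuous_on, rule continuous_on_compose2[OF cDf])
     (auto intro!: continuous_intros)
   show "(\<lambda>z. complex_of_real (zonal k z y)) \<in> borel_measurable surface"
    by (rule continuous_measurable_surface[OF cz])
   show "continuous_on (sphere 0 1) (\<lambda>z. f (a *\<^sub>R z))" if "a \<in> {0<..<1}" for a
    using that by (intro cfs) auto
   show "cmod (complex_of_real (zonal k z y)) \<le> zonal_sup TYPE('a) k" if "z \<in> sphere 0 1" for z
    using zonal_le_sup[OF that, of y k] y by simp
  qed (use s in auto)
  then show ?thesis by (simp add: has_vector_derivative_def)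
 qed
 have ode: "of_real (real k * s ^ (k - 1)) * F s = of_real (s ^ k) * F1 s" if s: "0 < s" "s < 1" for s
 proof -
  have "0 = (LINT z|surface. f (s *\<^sub>R z) * Dv (s *\<^sub>R z) z - v (s *\<^sub>R z) * Df (s *\<^sub>R z) z)"
   using harmonic_wronskian_sphere[OF f v Df Dv s] by simp
  also have "\<dots> = (LINT z|surface. of_real (real k * s ^ (k - 1)) * (f (s *\<^sub>R z) * of_real (zonal k z y))
    - of_real (s ^ k) * (Df (s *\<^sub>R z) z * of_real (zonal k z y)))"
   using s by (intro bochner_integral_cong refl) (simp add: Dvray vray, simp add: v_def mult_ac)
  also have "\<dots> = of_real (real k * s ^ (k - 1)) * F s - of_real (s ^ k) * F1 s"
  proof -
   have "integrable surface (\<lambda>z. f (s *\<^sub>R z) * of_real (zonal k z y))"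
    "integrable surface (\<lambda>z. Df (s *\<^sub>R z) z * of_real (zonal k z y))"
    by (intro integrable_surface_continuous continuous_on_mult cz cfs cDfs s)+
   then show ?thesis unfolding F_def F1_def
    by (subst bochner_integral_diff) (auto intro!: integrable_mult_right simp del: of_real_mult of_real_power)
  qed
  finally show ?thesis by simp
 qed
 have "\<exists>c. \<forall>s\<in>{0<..<1}. inverse (s ^ k) *\<^sub>R F s = c"
 proof (rule has_derivative_zero_constant)
  show "convex {0<..<1::real}" by simp
  fix s :: real assume "s \<in> {0<..<1}"
  then have s: "0 < s" "s < 1" by auto
  have "((\<lambda>s. inverse (s ^ k)) has_real_derivative (- (inverse (s ^ k) * (real k * s ^ (k - 1)) * inverse (s ^ k)))) (at s)"
   using s by (auto intro!: derivative_eq_intros)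
  from has_vector_derivative_scaleR[OF this dF[OF s]]
  have "((\<lambda>s. inverse (s ^ k) *\<^sub>R F s) has_vector_derivative
   (inverse (s ^ k) *\<^sub>R F1 s + (- (inverse (s ^ k) * (real k * s ^ (k - 1)) * inverse (s ^ k))) *\<^sub>R F s)) (at s)" .
  also have "inverse (s ^ k) *\<^sub>R F1 s + (- (inverse (s ^ k) * (real k * s ^ (k - 1)) * inverse (s ^ k))) *\<^sub>R F s = 0"
  proof -
   have "F1 s = inverse (s ^ k) *\<^sub>R (s ^ k *\<^sub>R F1 s)" using s by simp
   also have "s ^ k *\<^sub>R F1 s = (real k * s ^ (k - 1)) *\<^sub>R F s"
    using ode[OF s] by (simp add: scaleR_conv_of_real)
   finally show ?thesis by (simp add: mult_ac)
  qed
  finally show "((\<lambda>s. inverse (s ^ k) *\<^sub>R F s) has_derivative (\<lambda>h. 0)) (at s within {0<..<1})"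
   by (simp add: has_vector_derivative_def has_derivative_at_withinI)
 qed
 then obtain c where c: "\<And>s. s \<in> {0<..<1} \<Longrightarrow> inverse (s ^ k) *\<^sub>R F s = c" by blast
 show thesis
 proof
  fix a :: real assume a: "0 < a" "a < 1"
  then have "F a = a ^ k *\<^sub>R (inverse (a ^ k) *\<^sub>R F a)" by simp
  also have "\<dots> = of_real (a ^ k) * c" using c[of a] a by (simp add: scaleR_conv_of_real)
  finally show "(LINT z|surface. f (a *\<^sub>R z) * of_real (zonal k z y)) = of_real (a ^ k) * c"
   by (simp add: F_def)
 qed
qed

lemma harmonic_on_const: "harmonic_on UNIV (\<lambda>_::'a::euclidean_space. c)"
 by (rule harmonic_onI[where g = "\<lambda>_ _. 0" and G = "\<lambda>_ _ _. 0"]) auto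

lemma zonal_mean:
 assumes "norm (y::'a::euclidean_space) = 1"
 shows "(LINT z|surface. complex_of_real (zonal k z y)) = (if k = 0 then of_real (surface_area TYPE('a)) else 0)"
proof (cases "k = 0")
 case True
 then show ?thesis by (simp add: surface_area_def scaleR_conv_of_real)
next
 case False
 obtain C where C: "\<And>a. 0 < a \<Longrightarrow> a < 1 \<Longrightarrow>
  (LINT z|surface. 1 * complex_of_real (zonal k z y)) = of_real (a ^ k) * C"
  using zonal_moment[OF harmonic_on_subset[OF harmonic_on_const[of 1] open_ball subset_UNIV] assms, of k] by blast
 have "complex_of_real ((1/2) ^ k) * C = of_real ((1/4) ^ k) * C"
  using C[of "1/2"] C[of "1/4"] by simp
 moreover have "(1/2) ^ k \<noteq> ((1/4) ^ k :: real)"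
  using power_strict_mono[of "1/4" "1/2::real" k] False by simp
 ultimately have "C = 0" by (metis mult_cancel_right of_real_eq_iff)
 then show ?thesis using C[of "1/2"] False by simp
qed

lemma surface_integral_sums:
 fixes h :: "nat \<Rightarrow> 'a::euclidean_space \<Rightarrow> complex"
 assumes m: "\<And>k. h k \<in> borel_measurable surface"
  and b: "\<And>k z. z \<in> sphere 0 1 \<Longrightarrow> norm (h k z) \<le> M k" and M: "summable M"
 shows "(\<lambda>k. LINT z|surface. h k z) sums (LINT z|surface. (\<Sum>k. h k z))"
proof (rule sums_integral)
 show i: "integrable surface (h k)" for k by (rule integrable_surface_bounded[OF m b])
 show "AE z in surface. summable (\<lambda>k. norm (h k z))"
  using b by (intro AE_I2 summable_comparison_test'[OF M]) auto
 show "summable (\<lambda>k. LINT z|surface. norm (h k z))"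
 proof (rule summable_comparison_test'[OF summable_mult2[OF M, of "surface_area TYPE('a)"]])
  show "norm (LINT z|surface. norm (h k z)) \<le> M k * surface_area TYPE('a)" for k
   by (rule surface_integral_norm_le) (use m b in auto)
 qed
qed

text \<open>
 The Poisson kernel times the area of the sphere, which makes the zonal polynomials its expansion
 coefficients.
\<close>

definition poisson_ratio :: "'a::euclidean_space \<Rightarrow> 'a \<Rightarrow> real" where
 "poisson_ratio x z = (1 - (norm x)\<^sup>2) / norm (x - z) ^ DIM('a)"

lemma poisson_ratio_nonneg: "norm x \<le> 1 \<Longrightarrow> poisson_ratio x z \<ge> 0"
 by (simp add: poisson_ratio_def power_le_one)

lemma continuous_on_poisson_ratio:
 "norm x < 1 \<Longrightarrow> continuous_on (sphere 0 1) (poisson_ratio x)"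
 unfolding poisson_ratio_def by (intro continuous_intros) auto

definition bounded_measurable :: "('a::euclidean_space \<Rightarrow> complex) \<Rightarrow> bool" where
 "bounded_measurable u \<longleftrightarrow> u \<in> borel_measurable surface \<and> (\<exists>B. \<forall>z\<in>sphere 0 1. cmod (u z) \<le> B)"

lemma bounded_measurableE:
 assumes "bounded_measurable (u :: 'a::euclidean_space \<Rightarrow> complex)"
 obtains B where "B \<ge> 0" "\<And>z. z \<in> sphere 0 1 \<Longrightarrow> cmod (u z) \<le> B" "u \<in> borel_measurable surface"
proof -
 obtain B where B: "\<And>z. z \<in> sphere 0 1 \<Longrightarrow> cmod (u z) \<le> B" and m: "u \<in> borel_measurable surface"
  using assms unfolding bounded_measurable_def by blast
 obtain e where "e \<in> sphere (0::'a) 1" using sphere_nonempty by blast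
 then have "B \<ge> 0" using B[of e] norm_ge_zero order_trans by blast
 then show thesis using that B m by blast
qed

lemma bounded_measurableI:
 "u \<in> borel_measurable surface \<Longrightarrow> (\<And>z. z \<in> sphere 0 1 \<Longrightarrow> cmod (u z) \<le> B) \<Longrightarrow> bounded_measurable u"
 unfolding bounded_measurable_def by blast

lemma weighted_zonal_integral_sums:
 fixes \<phi> :: "'a::euclidean_space \<Rightarrow> complex" and w :: "nat \<Rightarrow> real"
 assumes \<phi>: "bounded_measurable \<phi>" and w: "subexponential w"
  and y: "y \<in> sphere 0 1" and b: "0 \<le> b" "b < 1"
 shows "(\<lambda>k. of_real (w k * b ^ k) * (LINT z|surface. \<phi> z * of_real (zonal k z y)))
   sums (LINT z|surface. of_real (\<Sum>k. w k * b ^ k * zonal k y z) * \<phi> z)"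
proof -
 let ?h = "\<lambda>k z. of_real (w k * b ^ k) * (\<phi> z * of_real (zonal k z y))"
 obtain B where B: "B \<ge> 0" "\<And>z. z \<in> sphere 0 1 \<Longrightarrow> cmod (\<phi> z) \<le> B" and m: "\<phi> \<in> borel_measurable surface"
  using bounded_measurableE[OF \<phi>] by blast
 have sw: "summable (\<lambda>k. norm (w k * zonal_sup TYPE('a) k) * b ^ k)"
  by (intro subexponential_summable subexponential_mult w subexponential_zonal_sup b)
 have "(\<lambda>k. LINT z|surface. ?h k z) sums (LINT z|surface. (\<Sum>k. ?h k z))"
 proof (rule surface_integral_sums)
  have "(\<lambda>z. complex_of_real (zonal k z y)) \<in> borel_measurable surface" for k
   by (intro continuous_measurable_surface continuous_on_of_real continuous_on_zonal)
  then show "?h k \<in> borel_measurable surface" for k using m by measurable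
  show "summable (\<lambda>k. B * (norm (w k * zonal_sup TYPE('a) k) * b ^ k))"
   by (rule summable_mult[OF sw])
  show "norm (?h k z) \<le> B * (norm (w k * zonal_sup TYPE('a) k) * b ^ k)" if z: "z \<in> sphere 0 1" for k z
  proof -
   have "norm (?h k z) = \<bar>w k\<bar> * b ^ k * (cmod (\<phi> z) * \<bar>zonal k z y\<bar>)"
    using b by (simp add: norm_mult norm_power abs_mult)
   also have "\<dots> \<le> \<bar>w k\<bar> * b ^ k * (B * \<bar>zonal_sup TYPE('a) k\<bar>)"
    using B(2)[OF z] zonal_le_sup[OF z y, of k] b B(1) by (intro mult_left_mono mult_mono) auto
   finally show ?thesis by (simp add: mult_ac abs_mult)
  qed
 qed
 moreover have "(LINT z|surface. (\<Sum>k. ?h k z)) = (LINT z|surface. of_real (\<Sum>k. w k * b ^ k * zonal k y z) * \<phi> z)"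
 proof (rule bochner_integral_cong[OF refl])
  fix z :: 'a assume "z \<in> space surface"
  then have z: "z \<in> sphere 0 1" by simp
  have "summable (\<lambda>k. w k * b ^ k * zonal k y z)"
  proof (rule summable_comparison_test'[OF sw])
   show "norm (w k * b ^ k * zonal k y z) \<le> norm (w k * zonal_sup TYPE('a) k) * b ^ k" for k
   proof -
    have "norm (w k * b ^ k * zonal k y z) = (\<bar>w k\<bar> * b ^ k) * \<bar>zonal k y z\<bar>"
     using b by (simp add: abs_mult)
    also have "\<dots> \<le> (\<bar>w k\<bar> * b ^ k) * \<bar>zonal_sup TYPE('a) k\<bar>"
     using zonal_le_sup[OF y z, of k] b by (intro mult_left_mono) auto
    finally show ?thesis by (simp add: abs_mult mult_ac)
   qed
  qed
  then have "(\<lambda>k. w k * b ^ k * zonal k y z) sums (\<Sum>k. w k * b ^ k * zonal k y z)"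
   by (rule summable_sums)
  then have *: "(\<lambda>k. complex_of_real (w k * b ^ k * zonal k y z) * \<phi> z) sums (of_real (\<Sum>k. w k * b ^ k * zonal k y z) * \<phi> z)"
   by (intro sums_mult2 sums_of_real)
  have h: "?h k z = complex_of_real (w k * b ^ k * zonal k y z) * \<phi> z" for k
  proof -
   have "zonal k y z = zonal k z y" using z y by (intro zonal_commute) auto
   then show ?thesis by (simp add: mult_ac)
  qed
  show "(\<Sum>k. ?h k z) = of_real (\<Sum>k. w k * b ^ k * zonal k y z) * \<phi> z"
   unfolding h using * by (rule sums_unique[symmetric])
 qed
 ultimately show ?thesis by simp
qed

lemma poisson_integral_sums:
 fixes \<phi> :: "'a::euclidean_space \<Rightarrow> complex"
 assumes \<phi>: "\<phi> \<in> borel_measurable surface" "\<And>z. z \<in> sphere 0 1 \<Longrightarrow> cmod (\<phi> z) \<le> B"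
  and y: "y \<in> sphere 0 1" and b: "0 \<le> b" "b < 1"
 shows "(\<lambda>k. of_real (b ^ k) * (LINT z|surface. \<phi> z * of_real (zonal k z y)))
   sums (LINT z|surface. of_real (poisson_ratio (b *\<^sub>R y) z) * \<phi> z)"
proof -
 have "bounded_measurable \<phi>" using \<phi> by (rule bounded_measurableI)
 from weighted_zonal_integral_sums[OF this subexponential_const[of "1 :: real"] y b]
 have s: "(\<lambda>k. of_real (b ^ k) * (LINT z|surface. \<phi> z * of_real (zonal k z y)))
   sums (LINT z|surface. of_real (\<Sum>k. b ^ k * zonal k y z) * \<phi> z)" by simp
 have P: "(\<Sum>k. b ^ k * zonal k y z) = poisson_ratio (b *\<^sub>R y) z" if "z \<in> sphere 0 1" for z
  using zonal_sums[of z "b *\<^sub>R y"] that y b by (simp add: poisson_ratio_def zonal_scale sums_iff)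
 have "(LINT z|surface. of_real (\<Sum>k. b ^ k * zonal k y z) * \<phi> z)
   = (LINT z|surface. of_real (poisson_ratio (b *\<^sub>R y) z) * \<phi> z)"
  by (intro bochner_integral_cong refl) (simp only: P space_surface)
 with s show ?thesis by (simp only:)
qed

text \<open>
 Only the zonal polynomial of order 0 has a nonzero mean.
\<close>

lemma poisson_ratio_mean:
 assumes x: "norm (x::'a::euclidean_space) < 1"
 shows "(LINT z|surface. poisson_ratio x z) = surface_area TYPE('a)"
proof -
 obtain b y where by': "x = b *\<^sub>R y" "0 \<le> b" "b < 1" "y \<in> sphere 0 1"
 proof (cases "x = 0")
  case True
  obtain e where "e \<in> sphere (0::'a) 1" using sphere_nonempty by blast
  then show thesis using that[of 0 e] True by simp
 next
  case False
  then show thesis using that[of "norm x" "x /\<^sub>R norm x"] x by simp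
 qed
 have "(\<lambda>k. of_real (b ^ k) * (LINT z|surface. 1 * complex_of_real (zonal k z y)))
   sums (LINT z|surface. of_real (poisson_ratio (b *\<^sub>R y) z) * 1)"
  by (rule poisson_integral_sums[where B = 1]) (use by' in auto)
 moreover have "(\<lambda>k. of_real (b ^ k) * (LINT z|surface. 1 * complex_of_real (zonal k z y)))
   sums of_real (surface_area TYPE('a))"
 proof -
  have y: "norm y = 1" using by' by simp
  have "of_real (b ^ k) * (LINT z|surface. 1 * complex_of_real (zonal k z y))
    = (if k = 0 then complex_of_real (surface_area TYPE('a)) else 0)" for k
   unfolding mult_1_left zonal_mean[OF y] by (cases "k = 0") auto
  then show ?thesis using sums_single[of 0 "\<lambda>_. complex_of_real (surface_area TYPE('a))"] by presburger
 qed
 ultimately have "(LINT z|surface. complex_of_real (poisson_ratio x z)) = of_real (surface_area TYPE('a))"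
  using by'(1) sums_unique2 by fastforce
 then show ?thesis by (simp only: integral_complex_of_real of_real_eq_iff)
qed

text \<open>
 The kernel is nonnegative, has constant mass, and tends to 0 uniformly away from \<open>y\<close>.
\<close>

lemma poisson_approximate_identity:
 fixes \<phi> :: "'a::euclidean_space \<Rightarrow> complex"
 assumes \<phi>: "continuous_on (sphere 0 1) \<phi>" and y: "y \<in> sphere 0 1"
 shows "((\<lambda>b. LINT z|surface. of_real (poisson_ratio (b *\<^sub>R y) z) * \<phi> z)
   \<longlongrightarrow> of_real (surface_area TYPE('a)) * \<phi> y) (at_left 1)"
proof -
 define \<sigma> where "\<sigma> = surface_area TYPE('a)"
 have \<sigma>: "\<sigma> > 0" by (simp add: \<sigma>_def)
 have "bounded (\<phi> ` sphere 0 1)"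
  using \<phi> by (intro compact_imp_bounded compact_continuous_image) auto
 then obtain B where B: "\<And>z. z \<in> sphere 0 1 \<Longrightarrow> cmod (\<phi> z) \<le> B" by (metis bounded_iff imageI)
 have B0: "B \<ge> 0" using B[OF y] norm_ge_zero order_trans by blast
 show ?thesis
  unfolding \<sigma>_def[symmetric]
 proof (rule tendstoI)
  fix e :: real assume "e > 0"
  define e' where "e' = e / (2 * \<sigma>)"
  have e': "e' > 0" using \<open>e > 0\<close> \<sigma> by (simp add: e'_def)
  obtain d where d: "d > 0" "\<And>z. z \<in> sphere 0 1 \<Longrightarrow> dist z y < d \<Longrightarrow> dist (\<phi> z) (\<phi> y) < e'"
   using \<phi> e' y unfolding continuous_on_iff by metis
  define T where "T b = 2 * B * ((1 - b\<^sup>2) / (d - (1 - b)) ^ DIM('a))" for b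
  have "(T \<longlongrightarrow> 2 * B * ((1 - 1\<^sup>2) / (d - (1 - 1)) ^ DIM('a))) (at_left 1)"
   unfolding T_def using d by (intro tendsto_intros) auto
  then have "\<forall>\<^sub>F b in at_left 1. T b < e'"
   by (rule order_tendstoD) (use e' in simp)
  moreover have "\<forall>\<^sub>F b in at_left 1. b > max 0 (1 - d) \<and> b < (1::real)"
   using eventually_at_left_real[of "max 0 (1 - d)" 1] d by (auto elim: eventually_mono)
  ultimately show "\<forall>\<^sub>F b in at_left 1. dist (LINT z|surface. of_real (poisson_ratio (b *\<^sub>R y) z) * \<phi> z) (of_real \<sigma> * \<phi> y) < e"
  proof eventually_elim
   case (elim b)
   then have b: "0 < b" "b < 1" "1 - d < b" by auto
   let ?P = "poisson_ratio (b *\<^sub>R y)"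
   have nb: "norm (b *\<^sub>R y) < 1" using b y by simp
   have cP: "continuous_on (sphere 0 1) ?P" by (rule continuous_on_poisson_ratio[OF nb])
   have iP: "integrable surface ?P" by (rule integrable_surface_continuous[OF cP])
   have "(LINT z|surface. of_real (?P z) * \<phi> z) - of_real \<sigma> * \<phi> y
     = (LINT z|surface. of_real (?P z) * \<phi> z) - (LINT z|surface. of_real (?P z)) * \<phi> y"
    by (simp add: integral_complex_of_real poisson_ratio_mean[OF nb] \<sigma>_def)
   also have "\<dots> = (LINT z|surface. of_real (?P z) * (\<phi> z - \<phi> y))"
   proof -
    have "integrable surface (\<lambda>z. of_real (?P z) * \<phi> z)" "integrable surface (\<lambda>z. of_real (?P z) * \<phi> y)"
     by (intro integrable_surface_continuous continuous_intros cP \<phi>)+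
    then show ?thesis by (simp add: right_diff_distrib)
   qed
   also have "norm \<dots> \<le> (LINT z|surface. norm (of_real (?P z) * (\<phi> z - \<phi> y)))"
    by (rule integral_norm_bound)
   also have "\<dots> \<le> (LINT z|surface. ?P z * e' + T b)"
   proof (rule integral_mono)
    show "integrable surface (\<lambda>z. norm (of_real (?P z) * (\<phi> z - \<phi> y)))"
     by (intro integrable_norm integrable_surface_continuous continuous_intros cP \<phi>)
    show "integrable surface (\<lambda>z. ?P z * e' + T b)" using iP by simp
    fix z :: 'a assume "z \<in> space surface"
    then have z: "z \<in> sphere 0 1" by simp
    have P0: "?P z \<ge> 0" using nb by (intro poisson_ratio_nonneg) simp
    have T0: "T b \<ge> 0" using b B0 by (auto simp: T_def power_le_one)
    show "norm (of_real (?P z) * (\<phi> z - \<phi> y)) \<le> ?P z * e' + T b"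
    proof (cases "dist z y < d")
     case True
     have "norm (of_real (?P z) * (\<phi> z - \<phi> y)) \<le> ?P z * e'"
      using d(2)[OF z True] P0 by (simp add: norm_mult dist_norm mult_left_mono)
     then show ?thesis using T0 by simp
    next
     case False
     have "d \<le> dist z y" using False by simp
     also have "\<dots> \<le> norm (b *\<^sub>R y - z) + norm (y - b *\<^sub>R y)"
      using norm_triangle_ineq[of "b *\<^sub>R y - z" "y - b *\<^sub>R y"] by (simp add: dist_norm norm_minus_commute)
     also have "norm (y - b *\<^sub>R y) = 1 - b"
     proof -
      have "y - b *\<^sub>R y = (1 - b) *\<^sub>R y" by (simp add: scaleR_diff_left)
      then show ?thesis using b y by simp
     qed
     finally have D: "d - (1 - b) \<le> norm (b *\<^sub>R y - z)" by simp
     have "?P z = (1 - b\<^sup>2) / norm (b *\<^sub>R y - z) ^ DIM('a)"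
      using y b by (simp add: poisson_ratio_def)
     also have "\<dots> \<le> (1 - b\<^sup>2) / (d - (1 - b)) ^ DIM('a)"
      using D b by (intro divide_left_mono power_mono mult_pos_pos zero_less_power) (auto simp: power_le_one)
     finally have "?P z \<le> (1 - b\<^sup>2) / (d - (1 - b)) ^ DIM('a)" .
     moreover have "norm (\<phi> z - \<phi> y) \<le> 2 * B"
      using norm_triangle_ineq4[of "\<phi> z" "\<phi> y"] B[OF z] B[OF y] by linarith
     ultimately have "?P z * norm (\<phi> z - \<phi> y) \<le> ((1 - b\<^sup>2) / (d - (1 - b)) ^ DIM('a)) * (2 * B)"
      using P0 B0 by (intro mult_mono) auto
     then have "norm (of_real (?P z) * (\<phi> z - \<phi> y)) \<le> T b"
      using P0 by (simp add: norm_mult T_def mult_ac)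
     moreover have "?P z * e' \<ge> 0" using P0 e' by simp
     ultimately show ?thesis by linarith
    qed
   qed
   also have "\<dots> = \<sigma> * e' + \<sigma> * T b"
    using iP by (simp add: poisson_ratio_mean[OF nb] \<sigma>_def surface_area_def)
   also have "\<dots> < \<sigma> * e' + \<sigma> * e'"
    using elim \<sigma> by (intro add_strict_left_mono mult_strict_left_mono) auto
   also have "\<dots> = e" using \<sigma> by (simp add: e'_def)
   finally show ?case by (simp add: dist_norm)
  qed
 qed
qed

section \<open>Expansion of harmonic functions in spherical harmonics\<close>

lemma subexponential_of_power_bound:
 assumes a: "subexponential a"
  and c: "\<And>R. 0 < R \<Longrightarrow> R < 1 \<Longrightarrow> \<exists>B. \<forall>k. norm (c k) \<le> B * norm (a k) / R ^ k"
 shows "subexponential c"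
proof (rule subexponentialI)
 fix R :: real assume R: "0 < R" "R < 1"
 define S where "S = sqrt R"
 have S: "0 < S" "S < 1" "S * S = R" using R by (auto simp: S_def)
 obtain A where A: "A \<ge> 0" "\<And>k. norm (a k) \<le> A / S ^ k" using subexponentialE[OF a S(1,2)] by blast
 obtain B where B: "\<And>k. norm (c k) \<le> B * norm (a k) / S ^ k" using c[OF S(1,2)] by blast
 have "norm (c k) \<le> (\<bar>B\<bar> * A) / R ^ k" for k
 proof -
  have "norm (c k) \<le> B * norm (a k) / S ^ k" by (rule B)
  also have "\<dots> \<le> \<bar>B\<bar> * (A / S ^ k) / S ^ k"
   using A S by (intro divide_right_mono mult_mono) auto
  also have "\<dots> = (\<bar>B\<bar> * A) / R ^ k" by (simp add: S(3)[symmetric] power_mult_distrib)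
  finally show ?thesis .
 qed
 then show "\<exists>C. \<forall>k. norm (c k) \<le> C / R ^ k" by blast
qed

lemma power_series_tendsto:
 fixes c :: "nat \<Rightarrow> complex"
 assumes c: "summable (\<lambda>k. norm (c k) * r ^ k)" and a: "0 \<le> a" "a < r"
 shows "((\<lambda>b. \<Sum>k. of_real (b ^ k) * c k) \<longlongrightarrow> (\<Sum>k. of_real (a ^ k) * c k)) (at a within A)"
proof -
 have "summable (\<lambda>k. norm (c k * of_real r ^ k))"
  using c a by (simp add: norm_mult norm_power)
 then have "summable (\<lambda>k. c k * of_real r ^ k)" by (rule summable_norm_cancel)
 then have "isCont (\<lambda>x. \<Sum>k. c k * x ^ k) (of_real a)"
  by (rule isCont_powser) (use a in simp)
 moreover have "((\<lambda>b. complex_of_real b) \<longlongrightarrow> of_real a) (at a within A)"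
  by (intro tendsto_intros)
 ultimately have "((\<lambda>b. \<Sum>k. c k * of_real b ^ k) \<longlongrightarrow> (\<Sum>k. c k * of_real a ^ k)) (at a within A)"
  by (rule isCont_tendsto_compose)
 then show ?thesis by (simp add: mult.commute)
qed

lemma power_series_zero:
 fixes e :: "nat \<Rightarrow> complex"
 assumes e: "\<And>a::real. 0 < a \<Longrightarrow> a < 1 \<Longrightarrow> (\<lambda>k. of_real (a ^ k) * e k) sums 0"
 shows "e k = 0"
proof (induction k rule: less_induct)
 case (less k)
 define g where "g n = e (n + k)" for n
 have g: "(\<lambda>n. of_real (a ^ n) * g n) sums 0" if a: "0 < a" "a < 1" for a :: real
 proof -
  have "(\<lambda>n. of_real (a ^ (n + k)) * e (n + k)) sums 0"
   using less e[OF a] by (subst sums_zero_iff_shift) auto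
  then have "(\<lambda>n. of_real (inverse (a ^ k)) * (of_real (a ^ (n + k)) * e (n + k))) sums (of_real (inverse (a ^ k)) * 0)"
   by (rule sums_mult)
  moreover have "of_real (inverse (a ^ k)) * (of_real (a ^ (n + k)) * e (n + k)) = of_real (a ^ n) * g n" for n
   using a by (simp add: g_def power_add)
  ultimately show ?thesis by simp
 qed
 have "summable (\<lambda>n. g n * (1/2) ^ n)" using g[of "1/2"] by (simp add: sums_iff mult.commute)
 then have "summable (\<lambda>n. norm (g n * (1/4) ^ n))"
  by (rule powser_insidea) simp
 then have "summable (\<lambda>n. norm (g n) * (1/4) ^ n)" by (simp add: norm_mult norm_power)
 then have "((\<lambda>b. \<Sum>n. of_real (b ^ n) * g n) \<longlongrightarrow> (\<Sum>n. of_real (0 ^ n) * g n)) (at_right 0)"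
  by (rule power_series_tendsto) auto
 moreover have "\<forall>\<^sub>F b in at_right 0. (\<Sum>n. of_real (b ^ n) * g n) = 0"
  using eventually_at_right_real[of 0 1] by (rule eventually_mono) (use g in \<open>auto simp: sums_iff\<close>)
 ultimately have "((\<lambda>b::real. 0) \<longlongrightarrow> (\<Sum>n. of_real (0 ^ n) * g n)) (at_right 0)"
  using tendsto_cong by force
 then have "(\<Sum>n. of_real (0 ^ n) * g n) = 0"
  using tendsto_const_iff[of "at_right (0::real)"] by (metis trivial_limit_at_right_real)
 moreover have "(\<lambda>n. of_real (0 ^ n) * g n) sums g 0"
  using powser_sums_zero[of g] by (simp add: mult.commute)
 ultimately show ?case by (simp add: sums_iff g_def)
qed

lemma power_series_unique:
 fixes c c' :: "nat \<Rightarrow> complex"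
 assumes "\<And>a::real. 0 < a \<Longrightarrow> a < 1 \<Longrightarrow> (\<lambda>k. of_real (a ^ k) * c k) sums f a"
  and "\<And>a::real. 0 < a \<Longrightarrow> a < 1 \<Longrightarrow> (\<lambda>k. of_real (a ^ k) * c' k) sums f a"
 shows "c = c'"
proof
 fix k
 have "(\<lambda>k. of_real (a ^ k) * (c k - c' k)) sums 0" if "0 < a" "a < 1" for a :: real
  using sums_diff[OF assms(1)[OF that] assms(2)[OF that]] by (simp add: right_diff_distrib)
 from power_series_zero[of "\<lambda>k. c k - c' k", OF this] show "c k = c' k" by simp
qed

lemma bounded_on_sphere:
 fixes f :: "'a::euclidean_space \<Rightarrow> complex"
 assumes "continuous_on (ball 0 1) f" "0 \<le> R" "R < 1"
 obtains B where "B \<ge> 0" "\<And>z. z \<in> sphere 0 1 \<Longrightarrow> cmod (f (R *\<^sub>R z)) \<le> B"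
  "continuous_on (sphere 0 1) (\<lambda>z. f (R *\<^sub>R z))"
proof -
 have c: "continuous_on (sphere 0 1) (\<lambda>z. f (R *\<^sub>R z))"
  by (rule continuous_on_compose2[OF assms(1)]) (use assms in \<open>auto intro!: continuous_intros\<close>)
 then have "bounded ((\<lambda>z. f (R *\<^sub>R z)) ` sphere 0 1)"
  by (intro compact_imp_bounded compact_continuous_image) auto
 then obtain B where B: "\<And>z. z \<in> sphere 0 1 \<Longrightarrow> cmod (f (R *\<^sub>R z)) \<le> B"
  by (metis (no_types, lifting) bounded_iff imageI)
 obtain e where "e \<in> sphere (0::'a) 1" using sphere_nonempty by blast
 then have "B \<ge> 0" using B[of e] norm_ge_zero order_trans by blast
 then show thesis using that B c by blast
qed

text \<open>
 Since the moments are monomials in the radius \<open>a\<close>, the Poisson integral of \<open>f (a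
 \<cdot>)\<close> at \<open>b y\<close> is a power series in \<open>a b\<close>. Its limit for \<open>b
 \<longlongrightarrow> 1\<close> is the value of \<open>f\<close> at \<open>a y\<close>, by the approximate
 identity on the one hand and by continuity of the power series on the other.
\<close>

lemma harmonic_zonal_expansion:
 fixes f :: "'a::euclidean_space \<Rightarrow> complex"
 assumes f: "harmonic_on (ball 0 1) f" and y: "y \<in> sphere 0 1"
 obtains C :: "nat \<Rightarrow> complex" where
  "\<And>k a. 0 < a \<Longrightarrow> a < 1 \<Longrightarrow> (LINT z|surface. f (a *\<^sub>R z) * of_real (zonal k z y)) = of_real (a ^ k) * C k"
  "\<And>a. 0 \<le> a \<Longrightarrow> a < 1 \<Longrightarrow> (\<lambda>k. of_real (a ^ k) * C k) sums (of_real (surface_area TYPE('a)) * f (a *\<^sub>R y))"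
proof -
 define \<sigma> where "\<sigma> = surface_area TYPE('a)"
 have cf: "continuous_on (ball 0 1) f" using f by (rule harmonic_on_imp_continuous)
 have ny: "norm y = 1" using y by simp
 have "\<forall>k. \<exists>C. \<forall>a. 0 < a \<longrightarrow> a < 1 \<longrightarrow> (LINT z|surface. f (a *\<^sub>R z) * of_real (zonal k z y)) = of_real (a ^ k) * C"
  using zonal_moment[OF f ny] by metis
 then obtain C where C: "\<And>k a. 0 < a \<Longrightarrow> a < 1 \<Longrightarrow> (LINT z|surface. f (a *\<^sub>R z) * of_real (zonal k z y)) = of_real (a ^ k) * C k"
  by metis
 have sub: "subexponential C"
 proof (rule subexponential_of_power_bound[OF subexponential_zonal_sup[where 'a='a]])
  fix R :: real assume R: "0 < R" "R < 1"
  obtain B where B: "B \<ge> 0" "\<And>z. z \<in> sphere 0 1 \<Longrightarrow> cmod (f (R *\<^sub>R z)) \<le> B"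
   and c: "continuous_on (sphere 0 1) (\<lambda>z. f (R *\<^sub>R z))"
   using bounded_on_sphere[OF cf, of R] R by auto
  have "norm (C k) \<le> (B * \<sigma>) * norm (zonal_sup TYPE('a) k) / R ^ k" for k
  proof -
   have "R ^ k * norm (C k) = norm (LINT z|surface. f (R *\<^sub>R z) * of_real (zonal k z y))"
    using R by (simp add: C norm_mult norm_power)
   also have "\<dots> \<le> (B * norm (zonal_sup TYPE('a) k)) * \<sigma>"
    unfolding \<sigma>_def
   proof (rule surface_integral_norm_le)
    show "(\<lambda>z. f (R *\<^sub>R z) * complex_of_real (zonal k z y)) \<in> borel_measurable surface"
     by (intro continuous_measurable_surface continuous_on_mult c continuous_on_of_real continuous_on_zonal)
    show "norm (f (R *\<^sub>R z) * complex_of_real (zonal k z y)) \<le> B * norm (zonal_sup TYPE('a) k)" if z: "z \<in> sphere 0 1" for z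
     unfolding norm_mult using B(2)[OF z] zonal_le_sup[OF z y, of k] B(1) by (intro mult_mono) auto
   qed
   finally show ?thesis using R by (simp add: field_simps)
  qed
  then show "\<exists>B. \<forall>k. norm (C k) \<le> B * norm (zonal_sup TYPE('a) k) / R ^ k" by blast
 qed
 have pos: "(\<lambda>k. of_real (a ^ k) * C k) sums (of_real \<sigma> * f (a *\<^sub>R y))" if a: "0 < a" "a < 1" for a
 proof -
  obtain B where B: "B \<ge> 0" "\<And>z. z \<in> sphere 0 1 \<Longrightarrow> cmod (f (a *\<^sub>R z)) \<le> B"
   and c: "continuous_on (sphere 0 1) (\<lambda>z. f (a *\<^sub>R z))"
   using bounded_on_sphere[OF cf, of a] a by auto
  define r where "r = (1 + a) / 2"
  have r: "a < r" "r < 1" "0 \<le> r" using a by (auto simp: r_def)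
  have sum_r: "summable (\<lambda>k. norm (C k) * r ^ k)" by (rule subexponential_summable[OF sub r(3,2)])
  have H: "(\<Sum>k. of_real ((a * b) ^ k) * C k) = (LINT z|surface. of_real (poisson_ratio (b *\<^sub>R y) z) * f (a *\<^sub>R z))"
   if b: "0 \<le> b" "b < 1" for b
  proof -
   have "(\<lambda>k. of_real (b ^ k) * (LINT z|surface. f (a *\<^sub>R z) * of_real (zonal k z y)))
     sums (LINT z|surface. of_real (poisson_ratio (b *\<^sub>R y) z) * f (a *\<^sub>R z))"
    by (rule poisson_integral_sums[OF continuous_measurable_surface[OF c] B(2) y b])
   moreover have "of_real (b ^ k) * (LINT z|surface. f (a *\<^sub>R z) * of_real (zonal k z y)) = of_real ((a * b) ^ k) * C k" for k
    unfolding C[OF a] by (simp add: power_mult_distrib mult_ac)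
   ultimately show ?thesis by (simp add: sums_iff)
  qed
  have "((\<lambda>b. LINT z|surface. of_real (poisson_ratio (b *\<^sub>R y) z) * f (a *\<^sub>R z)) \<longlongrightarrow> of_real \<sigma> * f (a *\<^sub>R y)) (at_left 1)"
   unfolding \<sigma>_def by (rule poisson_approximate_identity[OF c y])
  moreover have "\<forall>\<^sub>F b in at_left 1. (LINT z|surface. of_real (poisson_ratio (b *\<^sub>R y) z) * f (a *\<^sub>R z)) = (\<Sum>k. of_real ((a * b) ^ k) * C k)"
   using eventually_at_left_real[OF zero_less_one] by (rule eventually_mono) (rule H[symmetric]; simp)
  ultimately have 1: "((\<lambda>b. \<Sum>k. of_real ((a * b) ^ k) * C k) \<longlongrightarrow> of_real \<sigma> * f (a *\<^sub>R y)) (at_left 1)"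
   using tendsto_cong by force
  have "((\<lambda>b. \<Sum>k. of_real (b ^ k) * C k) \<longlongrightarrow> (\<Sum>k. of_real (a ^ k) * C k)) (at a)"
   by (rule power_series_tendsto[OF sum_r]) (use a r in auto)
  then have "isCont (\<lambda>b. \<Sum>k. of_real (b ^ k) * C k) a" by (simp add: isCont_def)
  moreover have "((\<lambda>b. a * b) \<longlongrightarrow> a) (at_left 1)" by (rule tendsto_eq_intros refl | simp)+
  ultimately have 2: "((\<lambda>b. \<Sum>k. of_real ((a * b) ^ k) * C k) \<longlongrightarrow> (\<Sum>k. of_real (a ^ k) * C k)) (at_left 1)"
   by (rule isCont_tendsto_compose)
  have "(\<Sum>k. of_real (a ^ k) * C k) = of_real \<sigma> * f (a *\<^sub>R y)"
   using tendsto_unique[OF _ 2 1] by simp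
  moreover have "summable (\<lambda>k. of_real (a ^ k) * C k)"
  proof (rule summable_norm_cancel)
   show "summable (\<lambda>k. norm (of_real (a ^ k) * C k))"
    using subexponential_summable[OF sub, of a] a by (simp add: norm_mult norm_power mult.commute)
  qed
  ultimately show ?thesis by (simp add: sums_iff)
 qed
 have zero: "(\<lambda>k. of_real (0 ^ k) * C k) sums (of_real \<sigma> * f (0 *\<^sub>R y))"
 proof -
  have sum: "summable (\<lambda>k. norm (C k) * (1/2) ^ k)" by (rule subexponential_summable[OF sub]) auto
  have "((\<lambda>b. \<Sum>k. of_real (b ^ k) * C k) \<longlongrightarrow> (\<Sum>k. of_real (0 ^ k) * C k)) (at_right 0)"
   by (rule power_series_tendsto[OF sum]) auto
  moreover have "\<forall>\<^sub>F b in at_right 0. (\<Sum>k. of_real (b ^ k) * C k) = of_real \<sigma> * f (b *\<^sub>R y)"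
   using eventually_at_right_real[of 0 1] by (rule eventually_mono) (use pos in \<open>auto simp: sums_iff\<close>)
  ultimately have 1: "((\<lambda>b. of_real \<sigma> * f (b *\<^sub>R y)) \<longlongrightarrow> (\<Sum>k. of_real (0 ^ k) * C k)) (at_right 0)"
   using tendsto_cong by force
  have "isCont f 0" using cf by (simp add: continuous_on_eq_continuous_at)
  moreover have "((\<lambda>b. b *\<^sub>R y) \<longlongrightarrow> 0) (at_right 0)" by (rule tendsto_eq_intros refl | simp)+
  ultimately have "((\<lambda>b. f (b *\<^sub>R y)) \<longlongrightarrow> f 0) (at_right 0)" by (rule isCont_tendsto_compose)
  then have 2: "((\<lambda>b. of_real \<sigma> * f (b *\<^sub>R y)) \<longlongrightarrow> of_real \<sigma> * f 0) (at_right 0)" by (intro tendsto_intros)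
  have "(\<Sum>k. of_real (0 ^ k) * C k) = of_real \<sigma> * f (0 *\<^sub>R y)"
   using tendsto_unique[OF _ 1 2] by simp
  moreover have "(\<lambda>k. of_real (0 ^ k) * C k) sums C 0"
   using powser_sums_zero[of C] by (simp add: mult.commute)
  ultimately show ?thesis by (simp add: sums_iff)
 qed
 show thesis
 proof (rule that[OF C])
  show "(\<lambda>k. of_real (a ^ k) * C k) sums (of_real (surface_area TYPE('a)) * f (a *\<^sub>R y))" if "0 \<le> a" "a < 1" for a
   using pos[of a] zero that unfolding \<sigma>_def by (cases "a = 0") auto
 qed
qed

text \<open>
 For a homogeneous harmonic polynomial the expansion can only have its term of order \<open>k\<close>.
\<close>

lemma spherical_harmonic_reproduce:
 fixes u :: "'a::euclidean_space \<Rightarrow> complex"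
 assumes u: "u \<in> spherical_harmonics k" and y: "y \<in> sphere 0 1"
 shows "(LINT z|surface. u z * of_real (zonal l z y)) = (if l = k then of_real (surface_area TYPE('a)) * u y else 0)"
proof -
 obtain P where P: "\<And>t x. P (t *\<^sub>R x) = of_real (t ^ k) * P x" "harmonic_on UNIV P" "\<And>x. x \<in> sphere 0 1 \<Longrightarrow> u x = P x"
  using u unfolding spherical_harmonics_def by blast
 have "harmonic_on (ball 0 1) P" using P(2) by (rule harmonic_on_subset) auto
 from harmonic_zonal_expansion[OF this y]
 obtain C where C: "\<And>k a. 0 < a \<Longrightarrow> a < 1 \<Longrightarrow> (LINT z|surface. P (a *\<^sub>R z) * of_real (zonal k z y)) = of_real (a ^ k) * C k"
  and s: "\<And>a. 0 \<le> a \<Longrightarrow> a < 1 \<Longrightarrow> (\<lambda>k. of_real (a ^ k) * C k) sums (of_real (surface_area TYPE('a)) * P (a *\<^sub>R y))"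
  by blast
 have "C = (\<lambda>l. if l = k then of_real (surface_area TYPE('a)) * P y else 0)"
 proof (rule power_series_unique)
  fix a :: real assume a: "0 < a" "a < 1"
  show "(\<lambda>k. of_real (a ^ k) * C k) sums (of_real (surface_area TYPE('a)) * P (a *\<^sub>R y))"
   using a by (intro s) auto
  show "(\<lambda>l. of_real (a ^ l) * (if l = k then of_real (surface_area TYPE('a)) * P y else 0)) sums (of_real (surface_area TYPE('a)) * P (a *\<^sub>R y))"
   using sums_single[of k "\<lambda>l. of_real (a ^ l) * (of_real (surface_area TYPE('a)) * P y)"]
   by (simp add: P(1) if_distrib mult_ac cong: if_cong)
 qed
 moreover have "of_real ((1/2) ^ k) * (LINT z|surface. u z * of_real (zonal l z y)) = of_real ((1/2) ^ l) * C l"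
 proof -
  have "of_real ((1/2) ^ k) * (LINT z|surface. u z * of_real (zonal l z y))
    = (LINT z|surface. of_real ((1/2) ^ k) * (u z * of_real (zonal l z y)))"
   by (rule integral_mult_right_zero[symmetric])
  also have "\<dots> = (LINT z|surface. P ((1/2) *\<^sub>R z) * of_real (zonal l z y))"
   by (intro bochner_integral_cong refl) (simp add: P(1,3))
  finally show ?thesis by (simp add: C)
 qed
 ultimately show ?thesis using P(3)[OF y] by (auto split: if_splits)
qed

lemma zonal_spherical_harmonic:
 assumes "y \<in> sphere (0::'a::euclidean_space) 1"
 shows "(\<lambda>x. complex_of_real (zonal k x y)) \<in> spherical_harmonics k"
proof -
 have "polynomial_function (\<lambda>x. complex_of_real (zonal k x y))"
 proof -
  have "real_polynomial_function (\<lambda>x. f (complex_of_real (zonal k x y)))" if "bounded_linear f" for f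
  proof -
   have "f (complex_of_real t) = f 1 * t" for t
    using linear_scale[OF bounded_linear.linear[OF that], of t 1] by (simp add: scaleR_conv_of_real mult.commute)
   then show ?thesis
    using real_polynomial_function_zonal[of k y] by (simp add: real_polynomial_function.intros)
  qed
  then show ?thesis by (simp add: polynomial_function_def o_def)
 qed
 then show ?thesis
  unfolding spherical_harmonics_def using harmonic_zonal[of y k] assms
  by (auto simp: zonal_scale intro!: exI[of _ "\<lambda>x. complex_of_real (zonal k x y)"])
qed

lemma sphere_point:
 fixes x :: "'a::euclidean_space"
 shows "sphere_point x \<in> sphere 0 1" "x = norm x *\<^sub>R sphere_point x"
proof -
 have "\<exists>x'. x' \<in> sphere 0 1 \<and> x = norm x *\<^sub>R x'"
 proof (cases "x = 0")
  case True
  then show ?thesis using sphere_nonempty[where 'a='a] by fastforce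
 next
  case False
  then show ?thesis by (intro exI[of _ "x /\<^sub>R norm x"]) auto
 qed
 from someI_ex[OF this] show "sphere_point x \<in> sphere 0 1" "x = norm x *\<^sub>R sphere_point x"
  unfolding sphere_point_def by blast+
qed

lemma sphere_point_scale:
 assumes "y \<in> sphere 0 1" "a > 0"
 shows "sphere_point (a *\<^sub>R y) = (y :: 'a::euclidean_space)"
 using sphere_point(2)[of "a *\<^sub>R y"] assms by simp

lemma surface_area_nonzero [simp]: "surface_area TYPE('a::euclidean_space) \<noteq> 0"
 by (metis less_irrefl surface_area_pos)

locale sh_basis =
 fixes d :: "nat \<Rightarrow> nat" and Y :: "nat \<Rightarrow> nat \<Rightarrow> 'a::euclidean_space \<Rightarrow> real"
 assumes basis: "sh_orthonormal_basis d Y"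
begin

lemma Y_harmonic: "j \<in> {1..d k} \<Longrightarrow> (\<lambda>x. complex_of_real (Y k j x)) \<in> spherical_harmonics k"
 using basis unfolding sh_orthonormal_basis_def by blast

lemma Y_orthonormal: "i \<in> {1..d k} \<Longrightarrow> j \<in> {1..d k} \<Longrightarrow>
  (LINT x|surface. Y k i x * Y k j x) = (if i = j then 1 else 0)"
 using basis unfolding sh_orthonormal_basis_def by blast

lemma Y_span: "u \<in> spherical_harmonics k \<Longrightarrow>
  \<exists>a. \<forall>x\<in>sphere 0 1. u x = (\<Sum>j=1..d k. a j * complex_of_real (Y k j x))"
 using basis unfolding sh_orthonormal_basis_def by blast

lemma continuous_on_Y: "j \<in> {1..d k} \<Longrightarrow> continuous_on (sphere 0 1) (Y k j)"
proof -
 assume j: "j \<in> {1..d k}"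
 obtain P where P: "polynomial_function P" "\<And>x. x \<in> sphere 0 1 \<Longrightarrow> complex_of_real (Y k j x) = P x"
  using Y_harmonic[OF j] unfolding spherical_harmonics_def by blast
 have "continuous_on (sphere 0 1) (\<lambda>x. Re (P x))"
  using P(1) by (intro continuous_intros continuous_on_polymonial_function)
 then show ?thesis
  by (rule continuous_on_eq) (simp add: P(2)[symmetric])
qed

lemma integral_basis_sum:
 assumes i: "i \<in> {1..d k}"
 shows "(LINT x|surface. (\<Sum>j=1..d k. a j * complex_of_real (Y k j x)) * of_real (Y k i x)) = a i"
proof -
 have int: "integrable surface (\<lambda>x. a j * complex_of_real (Y k j x) * of_real (Y k i x))" if "j \<in> {1..d k}" for j
  using that i by (intro integrable_surface_continuous continuous_intros continuous_on_Y)
 have "(LINT x|surface. (\<Sum>j=1..d k. a j * complex_of_real (Y k j x)) * of_real (Y k i x))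
   = (\<Sum>j=1..d k. (LINT x|surface. a j * complex_of_real (Y k j x) * of_real (Y k i x)))"
  unfolding sum_distrib_right by (rule bochner_integral_sum[OF int])
 also have "\<dots> = (\<Sum>j=1..d k. if j = i then a j else 0)"
 proof (rule sum.cong)
  fix j assume j: "j \<in> {1..d k}"
  have "(LINT x|surface. a j * complex_of_real (Y k j x) * of_real (Y k i x))
    = a j * (LINT x|surface. complex_of_real (Y k j x * Y k i x))"
   by (simp add: mult.assoc)
  also have "(LINT x|surface. complex_of_real (Y k j x * Y k i x)) = of_real (LINT x|surface. Y k j x * Y k i x)"
   by (rule integral_complex_of_real)
  finally show "(LINT x|surface. a j * complex_of_real (Y k j x) * of_real (Y k i x)) = (if j = i then a j else 0)"
   using Y_orthonormal[OF j i] by simp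
 qed simp
 also have "\<dots> = a i" using i by simp
 finally show ?thesis .
qed

lemma basis_unique:
 assumes "\<And>x. x \<in> sphere 0 1 \<Longrightarrow> (\<Sum>j=1..d k. a j * complex_of_real (Y k j x)) = (\<Sum>j=1..d k. b j * complex_of_real (Y k j x))"
  and i: "i \<in> {1..d k}"
 shows "a i = b i"
proof -
 have "a i = (LINT x|surface. (\<Sum>j=1..d k. a j * complex_of_real (Y k j x)) * of_real (Y k i x))"
  using integral_basis_sum[OF i] by simp
 also have "\<dots> = (LINT x|surface. (\<Sum>j=1..d k. b j * complex_of_real (Y k j x)) * of_real (Y k i x))"
  by (intro bochner_integral_cong refl) (simp add: assms(1) del: One_nat_def)
 also have "\<dots> = b i" by (rule integral_basis_sum[OF i])
 finally show ?thesis .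
qed

text \<open>
 The zonal polynomial is a spherical harmonic in \<open>x\<close>, and its coordinates are found by the
 reproducing property.
\<close>

lemma addition_theorem:
 assumes x: "x \<in> sphere 0 1" and y: "y \<in> sphere 0 1"
 shows "zonal k x y = (surface_area TYPE('a)) * (\<Sum>j=1..d k. Y k j x * Y k j y)"
proof -
 obtain a where a: "\<And>x. x \<in> sphere 0 1 \<Longrightarrow> complex_of_real (zonal k x y) = (\<Sum>j=1..d k. a j * complex_of_real (Y k j x))"
  using Y_span[OF zonal_spherical_harmonic[OF y, of k]] by blast
 have "a i = of_real ((surface_area TYPE('a)) * Y k i y)" if i: "i \<in> {1..d k}" for i
 proof -
  have "a i = (LINT x|surface. (\<Sum>j=1..d k. a j * complex_of_real (Y k j x)) * of_real (Y k i x))"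
   using integral_basis_sum[OF i] by simp
  also have "\<dots> = (LINT x|surface. complex_of_real (Y k i x) * complex_of_real (zonal k x y))"
   by (intro bochner_integral_cong refl) (simp add: a mult.commute del: One_nat_def)
  also have "\<dots> = of_real ((surface_area TYPE('a)) * Y k i y)"
   using spherical_harmonic_reproduce[OF Y_harmonic[OF i] y, of k] by simp
  finally show ?thesis .
 qed
 then have "complex_of_real (zonal k x y) = of_real (\<Sum>j=1..d k. ((surface_area TYPE('a)) * Y k j y) * Y k j x)"
  unfolding a[OF x] by simp
 then show ?thesis
  unfolding of_real_eq_iff by (simp add: sum_distrib_left mult_ac)
qed

text \<open>
 On the diagonal the addition theorem bounds the square of \<open>Y k j\<close> by the quotient; \<open>t
 \<le> 1 + t\<^sup>2\<close> avoids a root.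
\<close>

definition Y_bound :: "nat \<Rightarrow> real" where
 "Y_bound k = 1 + zonal_sup TYPE('a) k / (surface_area TYPE('a))"

lemma Y_le_bound:
 assumes j: "j \<in> {1..d k}" and x: "x \<in> sphere 0 1"
 shows "\<bar>Y k j x\<bar> \<le> Y_bound k"
proof -
 have "(Y k j x)\<^sup>2 \<le> (\<Sum>j=1..d k. Y k j x * Y k j x)"
  using j by (auto simp: power2_eq_square intro!: member_le_sum)
 also have "\<dots> = zonal k x x / (surface_area TYPE('a))"
  using addition_theorem[OF x x] by simp
 also have "\<dots> \<le> zonal_sup TYPE('a) k / (surface_area TYPE('a))"
  using zonal_le_sup[OF x x, of k] by (intro divide_right_mono) (auto intro: less_imp_le)
 finally have "(Y k j x)\<^sup>2 \<le> zonal_sup TYPE('a) k / (surface_area TYPE('a))" .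
 moreover have "\<bar>Y k j x\<bar> \<le> 1 + (Y k j x)\<^sup>2"
  using zero_le_power2[of "\<bar>Y k j x\<bar> - 1/2"] by (simp add: power2_eq_square algebra_simps)
 ultimately show ?thesis by (simp add: Y_bound_def)
qed

lemma Y_bound_nonneg: "Y_bound k \<ge> 0"
proof -
 obtain e where e: "e \<in> sphere (0::'a) 1" using sphere_nonempty by blast
 have "zonal_sup TYPE('a) k \<ge> 0" using zonal_le_sup[OF e e, of k] by linarith
 then show ?thesis by (simp add: Y_bound_def less_imp_le)
qed

text \<open>
 Integrate the addition theorem over the diagonal.
\<close>

lemma dim_le: "real (d k) \<le> zonal_sup TYPE('a) k"
proof -
 let ?area = "surface_area TYPE('a)"
 have "real (d k) = (\<Sum>j=1..d k. (LINT x|surface. Y k j x * Y k j x))"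
  by (simp add: Y_orthonormal)
 also have "\<dots> = (LINT x|surface. (\<Sum>j=1..d k. Y k j x * Y k j x))"
  by (rule bochner_integral_sum[symmetric])
   (intro integrable_surface_continuous continuous_intros continuous_on_Y)
 also have "\<dots> = (LINT x|(surface :: 'a measure). zonal k x x / ?area)"
  by (intro bochner_integral_cong refl) (simp add: addition_theorem del: One_nat_def)
 also have "\<dots> \<le> norm \<dots>" unfolding real_norm_def by (rule abs_ge_self)
 also have "\<dots> \<le> (zonal_sup TYPE('a) k / ?area) * ?area"
 proof (rule surface_integral_norm_le)
  have "continuous_on (sphere 0 1) (\<lambda>x. \<Sum>j=1..d k. Y k j x * Y k j x)"
   by (intro continuous_intros continuous_on_Y)
  then have "continuous_on (sphere 0 1) (\<lambda>x::'a. zonal k x x / ?area)"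
   by (rule continuous_on_eq) (simp add: addition_theorem del: One_nat_def)
  then show "(\<lambda>x::'a. zonal k x x / ?area) \<in> borel_measurable surface"
   by (rule continuous_measurable_surface)
  show "norm (zonal k z z / ?area) \<le> zonal_sup TYPE('a) k / ?area" if "z \<in> sphere 0 1" for z :: 'a
   using zonal_le_sup[OF that that, of k] by (simp add: divide_right_mono less_imp_le)
 qed
 also have "(zonal_sup TYPE('a) k / ?area) * ?area = zonal_sup TYPE('a) k"
  using surface_area_pos[where 'a='a] by simp
 finally show ?thesis .
qed

lemma subexponential_dim: "subexponential (\<lambda>k. real (d k))"
 by (rule subexponential_mono[OF subexponential_zonal_sup[where 'a='a]])
  (metis dim_le abs_ge_self norm_of_nat order_trans real_norm_def)

lemma subexponential_Y_bound: "subexponential Y_bound"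
proof -
 have "subexponential (\<lambda>k. 1 + zonal_sup TYPE('a) k * (1 / (surface_area TYPE('a))))"
  by (intro subexponential_sum subexponential_mult subexponential_const subexponential_zonal_sup)
 then show ?thesis by (simp add: Y_bound_def[abs_def])
qed

definition row :: "(nat \<Rightarrow> nat \<Rightarrow> complex) \<Rightarrow> nat \<Rightarrow> real" where
 "row a k = (\<Sum>j=1..d k. cmod (a k j))"

lemma row_nonneg: "row a k \<ge> 0"
 by (simp add: row_def sum_nonneg)

definition part :: "(nat \<Rightarrow> nat \<Rightarrow> complex) \<Rightarrow> nat \<Rightarrow> 'a \<Rightarrow> complex" where
 "part a k y = (\<Sum>j=1..d k. a k j * of_real (Y k j y))"

lemma norm_part_le: "y \<in> sphere 0 1 \<Longrightarrow> cmod (part a k y) \<le> row a k * Y_bound k"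
 unfolding part_def row_def sum_distrib_right
 by (rule order_trans[OF norm_sum]) (auto simp: norm_mult intro!: sum_mono mult_left_mono Y_le_bound)

lemma sh_term_eq: "sh_term d Y a x k = of_real (norm x ^ k) * part a k (sphere_point x)"
 by (simp add: sh_term_def part_def)

lemma sh_term_polar:
 assumes "y \<in> sphere 0 1" "r > 0"
 shows "sh_term d Y a (r *\<^sub>R y) k = of_real (r ^ k) * part a k y"
 using assms by (simp add: sh_term_eq sphere_point_scale)

lemma sh_expansion_unique:
 assumes a: "\<And>x. x \<in> ball 0 1 \<Longrightarrow> sh_term d Y a x sums f x"
  and b: "\<And>x. x \<in> ball 0 1 \<Longrightarrow> sh_term d Y b x sums f x"
  and j: "j \<in> {1..d k}"
 shows "a k j = b k j"
proof (rule basis_unique[OF _ j])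
 fix y :: 'a assume y: "y \<in> sphere 0 1"
 have "(\<lambda>k. part a k y) = (\<lambda>k. part b k y)"
 proof (rule power_series_unique)
  fix r :: real assume r: "0 < r" "r < 1"
  then have x: "r *\<^sub>R y \<in> ball 0 1" using y by simp
  show "(\<lambda>k. of_real (r ^ k) * part a k y) sums f (r *\<^sub>R y)"
   using a[OF x] y r sh_term_polar[OF y r(1), of a] by (simp add: sums_def)
  show "(\<lambda>k. of_real (r ^ k) * part b k y) sums f (r *\<^sub>R y)"
   using b[OF x] y r sh_term_polar[OF y r(1), of b] by (simp add: sums_def)
 qed
 then show "(\<Sum>j=1..d k. a k j * complex_of_real (Y k j y)) = (\<Sum>j=1..d k. b k j * complex_of_real (Y k j y))"
  by (simp add: part_def fun_eq_iff)
qed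

lemma sh_coeff_eq:
 assumes b: "\<And>x. x \<in> ball 0 1 \<Longrightarrow> sh_term d Y b x sums f x"
 shows "sh_coeff d Y f k j = (if j \<in> {1..d k} then b k j else 0)"
proof -
 define b' where "b' k j = (if j \<in> {1..d k} then b k j else 0)" for k j
 have t: "sh_term d Y b' = sh_term d Y b"
  by (auto simp: sh_term_def b'_def fun_eq_iff intro!: sum.cong)
 have "sh_coeff d Y f = b'"
  unfolding sh_coeff_def
 proof (rule the_equality)
  show "(\<forall>k j. j \<notin> {1..d k} \<longrightarrow> b' k j = 0) \<and> (\<forall>x\<in>ball 0 1. sh_term d Y b' x sums f x)"
   using b unfolding t by (auto simp: b'_def)
  fix a assume a: "(\<forall>k j. j \<notin> {1..d k} \<longrightarrow> a k j = 0) \<and> (\<forall>x\<in>ball 0 1. sh_term d Y a x sums f x)"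
  have "a k j = b' k j" for k j
   using a b sh_expansion_unique[of a f b j k] by (cases "j \<in> {1..d k}") (auto simp: b'_def)
  then show "a = b'" by blast
 qed
 then show ?thesis by (simp add: b'_def)
qed

lemma sh_coeff_outside:
 assumes "\<And>x. x \<in> ball 0 1 \<Longrightarrow> sh_term d Y b x sums f x"
 shows "row (sh_coeff d Y f) = row b" "part (sh_coeff d Y f) = part b"
  "sh_term d Y (sh_coeff d Y f) = sh_term d Y b"
 using sh_coeff_eq[OF assms] by (auto simp: row_def part_def sh_term_def fun_eq_iff intro!: sum.cong)

text \<open>
 The zonal expansion in the given basis. The second part recovers the coefficients from any sphere inside the
 ball, the third is the bound that results from this.
\<close>

theorem harmonic_expansion:
 assumes f: "harmonic_on (ball 0 1) f"
 shows "\<And>x. x \<in> ball 0 1 \<Longrightarrow> sh_term d Y (sh_coeff d Y f) x sums f x"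
  and "\<And>R k j. 0 < R \<Longrightarrow> R < 1 \<Longrightarrow> j \<in> {1..d k} \<Longrightarrow>
   (LINT z|surface. f (R *\<^sub>R z) * of_real (Y k j z)) = of_real (R ^ k) * sh_coeff d Y f k j"
  and "subexponential (row (sh_coeff d Y f))"
proof -
 let ?area = "surface_area TYPE('a)"
 have cf: "continuous_on (ball 0 1) f" using f by (rule harmonic_on_imp_continuous)
 define mom where "mom R k j = (LINT z|surface. f (R *\<^sub>R z) * complex_of_real (Y k j z))" for R k j
 define b where "b k j = of_real (2 ^ k) * mom (1/2) k j" for k j
 have cR: "continuous_on (sphere 0 1) (\<lambda>z. f (R *\<^sub>R z))" if "0 < R" "R < 1" for R
  using bounded_on_sphere[OF cf, of R] that by auto
 have zon: "(LINT z|surface. f (R *\<^sub>R z) * of_real (zonal k z y)) = of_real ?area * (\<Sum>j=1..d k. mom R k j * of_real (Y k j y))"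
  if R: "0 < R" "R < 1" and y: "y \<in> sphere 0 1" for R k y
 proof -
  have "(LINT z|surface. f (R *\<^sub>R z) * of_real (zonal k z y))
    = (LINT z|surface. (\<Sum>j=1..d k. (of_real ?area * of_real (Y k j y)) * (f (R *\<^sub>R z) * of_real (Y k j z))))"
   by (intro bochner_integral_cong refl)
    (simp add: addition_theorem[OF _ y] sum_distrib_left mult_ac)
  also have "\<dots> = (\<Sum>j=1..d k. (LINT z|surface. (of_real ?area * of_real (Y k j y)) * (f (R *\<^sub>R z) * of_real (Y k j z))))"
   by (rule bochner_integral_sum)
    (intro integrable_surface_continuous continuous_intros cR continuous_on_Y R)
  also have "\<dots> = of_real ?area * (\<Sum>j=1..d k. mom R k j * of_real (Y k j y))"
   unfolding integral_mult_right_zero by (simp add: mom_def sum_distrib_left mult_ac)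
  finally show ?thesis .
 qed
 have polar: "(\<lambda>k. of_real (a ^ k) * part b k y) sums f (a *\<^sub>R y)"
  and momb: "\<And>R. 0 < R \<Longrightarrow> R < 1 \<Longrightarrow> (\<Sum>j=1..d k. mom R k j * of_real (Y k j y)) = (\<Sum>j=1..d k. (of_real (R ^ k) * b k j) * of_real (Y k j y))"
  if a: "0 \<le> a" "a < 1" and y: "y \<in> sphere 0 1" for a y k
 proof -
  obtain C where C: "\<And>k a. 0 < a \<Longrightarrow> a < 1 \<Longrightarrow> (LINT z|surface. f (a *\<^sub>R z) * of_real (zonal k z y)) = of_real (a ^ k) * C k"
   and s: "\<And>a. 0 \<le> a \<Longrightarrow> a < 1 \<Longrightarrow> (\<lambda>k. of_real (a ^ k) * C k) sums (of_real ?area * f (a *\<^sub>R y))"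
   using harmonic_zonal_expansion[OF f y] by blast
  have Cb: "C k = of_real ?area * part b k y" for k
  proof -
   have "C k = of_real (2 ^ k) * (of_real ((1/2) ^ k) * C k)"
    by (simp add: power_divide)
   also have "of_real ((1/2) ^ k) * C k = of_real ?area * (\<Sum>j=1..d k. mom (1/2) k j * of_real (Y k j y))"
    using C[of "1/2" k] zon[of "1/2" y k] y by simp
   finally show ?thesis by (simp add: part_def b_def sum_distrib_left mult_ac)
  qed
  have s0: "complex_of_real ?area \<noteq> 0" using surface_area_pos[where 'a='a] by simp
  have "(\<lambda>k. of_real ?area * (of_real (a ^ k) * part b k y)) sums (of_real ?area * f (a *\<^sub>R y))"
   using s[OF a] unfolding Cb by (simp add: mult_ac)
  then show "(\<lambda>k. of_real (a ^ k) * part b k y) sums f (a *\<^sub>R y)"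
   using s0 by (subst (asm) sums_mult_iff) auto
  fix R :: real assume R: "0 < R" "R < 1"
  have "of_real ?area * (\<Sum>j=1..d k. mom R k j * of_real (Y k j y)) = of_real ?area * (of_real (R ^ k) * part b k y)"
   using zon[OF R y, of k] C[OF R, of k] unfolding Cb by (simp add: mult_ac)
  then show "(\<Sum>j=1..d k. mom R k j * of_real (Y k j y)) = (\<Sum>j=1..d k. (of_real (R ^ k) * b k j) * of_real (Y k j y))"
   unfolding mult_left_cancel[OF s0] by (simp add: part_def sum_distrib_left mult.assoc)
 qed
 have sums: "sh_term d Y b x sums f x" if "x \<in> ball 0 1" for x
 proof -
  have "(\<lambda>k. of_real (norm x ^ k) * part b k (sphere_point x)) sums f (norm x *\<^sub>R sphere_point x)"
   by (rule polar) (use that sphere_point in auto)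
  then show ?thesis using sphere_point(2)[of x] unfolding sums_def sh_term_eq by simp
 qed
 have mom: "mom R k j = of_real (R ^ k) * b k j" if "0 < R" "R < 1" "j \<in> {1..d k}" for R k j
  by (rule basis_unique[OF _ that(3)]) (rule momb[of 0], use that in auto)
 show "sh_term d Y (sh_coeff d Y f) x sums f x" if "x \<in> ball 0 1" for x
  using sums that sh_coeff_outside(3)[OF sums] by auto
 show "(LINT z|surface. f (R *\<^sub>R z) * of_real (Y k j z)) = of_real (R ^ k) * sh_coeff d Y f k j"
  if "0 < R" "R < 1" "j \<in> {1..d k}" for R k j
  using mom[OF that] sh_coeff_eq[OF sums, of k j] that by (simp add: mom_def)
 have "subexponential (row b)"
 proof (rule subexponential_of_power_bound[OF subexponential_mult[OF subexponential_dim subexponential_Y_bound]])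
  fix R :: real assume R: "0 < R" "R < 1"
  obtain B where B: "B \<ge> 0" "\<And>z. z \<in> sphere 0 1 \<Longrightarrow> cmod (f (R *\<^sub>R z)) \<le> B"
   using bounded_on_sphere[OF cf, of R] R by auto
  have "norm (row b k) \<le> (B * ?area) * norm (real (d k) * Y_bound k) / R ^ k" for k
  proof -
   have "cmod (b k j) \<le> (B * Y_bound k) * ?area / R ^ k" if j: "j \<in> {1..d k}" for j
   proof -
    have "R ^ k * cmod (b k j) = cmod (mom R k j)"
     using mom[OF R j] R by (simp add: norm_mult norm_power)
    also have "\<dots> \<le> (B * Y_bound k) * ?area"
     unfolding mom_def
    proof (rule surface_integral_norm_le)
     show "(\<lambda>z. f (R *\<^sub>R z) * complex_of_real (Y k j z)) \<in> borel_measurable surface"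
      by (intro continuous_measurable_surface continuous_on_mult cR R continuous_on_of_real continuous_on_Y j)
     show "norm (f (R *\<^sub>R z) * complex_of_real (Y k j z)) \<le> B * Y_bound k" if z: "z \<in> sphere 0 1" for z
      unfolding norm_mult using B(2)[OF z] Y_le_bound[OF j z] B(1) by (intro mult_mono) auto
    qed
    finally show ?thesis using R by (simp add: field_simps)
   qed
   then have "row b k \<le> (\<Sum>j=1..d k. (B * Y_bound k) * ?area / R ^ k)"
    unfolding row_def by (intro sum_mono)
   then show ?thesis using row_nonneg[of b k] Y_bound_nonneg[of k] by (simp add: abs_mult mult_ac)
  qed
  then show "\<exists>B. \<forall>k. norm (row b k) \<le> B * norm (real (d k) * Y_bound k) / R ^ k" by blast
 qed
 then show "subexponential (row (sh_coeff d Y f))"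
  using sh_coeff_outside(1)[OF sums] by simp
qed

end

section \<open>Harmonicity of expansions with subexponential coefficients\<close>

lemma continuous_on_surface_integral:
 fixes K :: "'b::euclidean_space \<Rightarrow> 'a::euclidean_space \<Rightarrow> complex"
 assumes K: "continuous_on (U \<times> sphere 0 1) (\<lambda>(x, z). K x z)"
  and \<phi>: "\<phi> \<in> borel_measurable surface" "\<And>z. z \<in> sphere 0 1 \<Longrightarrow> cmod (\<phi> z) \<le> B"
 shows "continuous_on U (\<lambda>x. LINT z|surface. K x z * \<phi> z)"
 unfolding continuous_on_sequentially
proof (intro allI ballI impI, elim conjE)
 fix X a assume a: "a \<in> U" and X: "\<forall>n. X n \<in> U" "X \<longlonglongrightarrow> a"
 let ?T = "insert a (range X) \<times> sphere (0::'a) 1"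
 have "compact ?T" by (intro compact_Times compact_sequence_with_limit X) auto
 then have "bounded ((\<lambda>(x, z). K x z) ` ?T)"
  by (intro compact_imp_bounded compact_continuous_image continuous_on_subset[OF K]) (use a X in auto)
 then obtain C where C: "\<And>x z. x \<in> insert a (range X) \<Longrightarrow> z \<in> sphere 0 1 \<Longrightarrow> cmod (K x z) \<le> C"
  unfolding bounded_iff by fastforce
 have m: "(\<lambda>z. K x z * \<phi> z) \<in> borel_measurable surface" if "x \<in> U" for x
 proof -
  have "continuous_on (sphere 0 1) (\<lambda>z. case (x, z) of (x, z) \<Rightarrow> K x z)"
   by (rule continuous_on_compose2[OF K])
    (use that in \<open>auto intro!: continuous_on_Pair continuous_on_const continuous_on_id\<close>)
  then show ?thesis using continuous_measurable_surface[of "K x"] \<phi>(1) by (intro borel_measurable_times) auto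
 qed
 have "(\<lambda>n. LINT z|surface. K (X n) z * \<phi> z) \<longlonglongrightarrow> (LINT z|surface. K a z * \<phi> z)"
 proof (rule integral_dominated_convergence[where w = "\<lambda>_. C * B"])
  show "AE z in surface. (\<lambda>n. K (X n) z * \<phi> z) \<longlonglongrightarrow> K a z * \<phi> z"
  proof (rule AE_I2)
   fix z :: 'a assume "z \<in> space surface"
   then have "(\<lambda>n. case (X n, z) of (x, z) \<Rightarrow> K x z) \<longlonglongrightarrow> (case (a, z) of (x, z) \<Rightarrow> K x z)"
    by (intro continuous_on_tendsto_compose[OF K] tendsto_Pair X(2) tendsto_const) (use X a in auto)
   then show "(\<lambda>n. K (X n) z * \<phi> z) \<longlonglongrightarrow> K a z * \<phi> z" by (auto intro: tendsto_mult_right)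
  qed
  show "AE z in surface. norm (K (X n) z * \<phi> z) \<le> C * B" for n
   by (rule AE_I2, unfold norm_mult, rule mult_mono) (use C \<phi>(2) in \<open>auto intro: order_trans[OF norm_ge_zero]\<close>)
 qed (use m a X in auto)
 then show "((\<lambda>x. LINT z|surface. K x z * \<phi> z) \<circ> X) \<longlonglongrightarrow> (LINT z|surface. K a z * \<phi> z)"
  by (simp add: o_def)
qed

lemma harmonic_on_eq:
 assumes H: "harmonic_on S f" and eq: "\<And>x. x \<in> S \<Longrightarrow> f x = g x"
 shows "harmonic_on S g"
proof -
 obtain D1 D2 where D: "open S" "\<And>x. x \<in> S \<Longrightarrow> (f has_derivative blinfun_apply (D1 x)) (at x)"
  "\<And>x. x \<in> S \<Longrightarrow> (D1 has_derivative blinfun_apply (D2 x)) (at x)" "continuous_on S D2"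
  "\<And>x. x \<in> S \<Longrightarrow> (\<Sum>e\<in>Basis. blinfun_apply (blinfun_apply (D2 x) e) e) = 0"
  using H unfolding harmonic_on_def by blast
 have "(g has_derivative blinfun_apply (D1 x)) (at x)" if "x \<in> S" for x
  by (rule has_derivative_transform_within_open[OF D(2)[OF that] D(1) that]) (rule eq)
 then show ?thesis unfolding harmonic_on_def using D by blast
qed

lemma poisson_ratio_powr:
 fixes x z :: "'a::euclidean_space"
 assumes "x \<noteq> z"
 shows "poisson_ratio x z = (1 - x \<bullet> x) * ((x - z) \<bullet> (x - z)) powr (- (real DIM('a) / 2))"
proof -
 have n0: "norm (x - z) > 0" using assms by simp
 have "(x - z) \<bullet> (x - z) = norm (x - z) powr 2"
  using n0 by (simp add: power2_norm_eq_inner[symmetric])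
 then have "((x - z) \<bullet> (x - z)) powr (- (real DIM('a) / 2)) = norm (x - z) powr (2 * - (real DIM('a) / 2))"
  by (simp only: powr_powr)
 also have "\<dots> = 1 / norm (x - z) ^ DIM('a)"
  using n0 by (simp add: powr_minus_divide powr_realpow)
 finally show ?thesis by (simp add: poisson_ratio_def power2_norm_eq_inner)
qed

text \<open>
 The Poisson kernel is harmonic in \<open>x\<close> for fixed \<open>z\<close>, and two differentiations under
 the integral sign are justified.
\<close>

lemma poisson_integral_harmonic:
 fixes \<phi> :: "'a::euclidean_space \<Rightarrow> complex"
 assumes \<phi>: "\<phi> \<in> borel_measurable surface" "\<And>z. z \<in> sphere 0 1 \<Longrightarrow> cmod (\<phi> z) \<le> B"
 shows "harmonic_on (ball 0 1) (\<lambda>x. LINT z|surface. of_real (poisson_ratio x z) * \<phi> z)"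
proof -
 define l where "l = real DIM('a) / 2"
 define D where "D x z = (x - z) \<bullet> (x - z)" for x z :: 'a
 define N where "N x = 1 - x \<bullet> x" for x :: 'a
 define K where "K x z = N x * D x z powr (- l)" for x z
 define K1 where "K1 e x z = - 2 * (x \<bullet> e) * D x z powr (- l)
   + N x * ((- l) * D x z powr (- l - 1) * (2 * ((x - z) \<bullet> e)))" for e x z
 define K2 where "K2 e e' x z = (- 2 * (e' \<bullet> e) * D x z powr (- l)
    + - 2 * (x \<bullet> e) * ((- l) * D x z powr (- l - 1) * (2 * ((x - z) \<bullet> e'))))
   + ((- 2 * (x \<bullet> e')) * ((- l) * D x z powr (- l - 1) * (2 * ((x - z) \<bullet> e)))
    + N x * ((- l) * ((- l - 1) * D x z powr (- l - 1 - 1) * (2 * ((x - z) \<bullet> e'))) * (2 * ((x - z) \<bullet> e))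
      + (- l) * D x z powr (- l - 1) * (2 * (e' \<bullet> e))))" for e e' x z
 have ne: "x \<noteq> z" if "x \<in> ball 0 1" "z \<in> sphere 0 1" for x z :: 'a using that by auto
 have Dpos: "D x z > 0" if "x \<in> ball 0 1" "z \<in> sphere 0 1" for x z
  using ne[OF that] by (simp add: D_def)
 have dD: "((\<lambda>x. D x z powr a) has_derivative (\<lambda>h. a * D x z powr (a - 1) * (2 * ((x - z) \<bullet> h)))) (at x)"
  if "x \<in> ball 0 1" "z \<in> sphere 0 1" for x z a
 proof -
  have "((\<lambda>x. D x z) has_derivative (\<lambda>h. 2 * ((x - z) \<bullet> h))) (at x)"
   unfolding D_def by (rule derivative_eq_intros refl | simp add: inner_commute)+
  moreover have "((\<lambda>t. t powr a) has_real_derivative a * D x z powr (a - 1)) (at (D x z))"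
   using Dpos[OF that] by (rule has_real_derivative_powr)
  ultimately have "((\<lambda>x. D x z powr a) has_derivative (\<lambda>h. a * D x z powr (a - 1) * (2 * ((x - z) \<bullet> h)))) (at x)"
   unfolding has_field_derivative_def by (rule has_derivative_compose)
  then show ?thesis .
 qed
 have dN: "(N has_derivative (\<lambda>h. - 2 * (x \<bullet> h))) (at x)" for x
  unfolding N_def by (rule derivative_eq_intros refl | simp add: inner_commute)+
 have dK: "((\<lambda>x. K x z) has_derivative (\<lambda>h. K1 h x z)) (at x)"
  if "x \<in> ball 0 1" "z \<in> sphere 0 1" for x z
 proof -
  have "((\<lambda>x. K x z) has_derivative (\<lambda>h. N x * (- l * D x z powr (- l - 1) * (2 * ((x - z) \<bullet> h))) + - 2 * (x \<bullet> h) * D x z powr (- l))) (at x)"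
   unfolding K_def by (rule has_derivative_mult[OF dN dD[OF that]])
  then show ?thesis unfolding K1_def by (simp add: add.commute)
 qed
 have dK1: "((\<lambda>x. K1 e x z) has_derivative (\<lambda>h. K2 e h x z)) (at x)"
  if "x \<in> ball 0 1" "z \<in> sphere 0 1" for e x z
 proof -
  have 1: "((\<lambda>x. - 2 * (x \<bullet> e)) has_derivative (\<lambda>h. - 2 * (h \<bullet> e))) (at x)"
   by (auto intro!: derivative_eq_intros)
  have 2: "((\<lambda>x. 2 * ((x - z) \<bullet> e)) has_derivative (\<lambda>h. 2 * (h \<bullet> e))) (at x)"
   by (auto intro!: derivative_eq_intros)
  have 3: "((\<lambda>x. (- l) * D x z powr (- l - 1) * (2 * ((x - z) \<bullet> e))) has_derivative
    (\<lambda>h. (- l) * D x z powr (- l - 1) * (2 * (h \<bullet> e)) + (- l) * ((- l - 1) * D x z powr (- l - 1 - 1) * (2 * ((x - z) \<bullet> h))) * (2 * ((x - z) \<bullet> e)))) (at x)"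
   by (rule has_derivative_mult[OF has_derivative_mult_right[OF dD[OF that]] 2])
  have "((\<lambda>x. K1 e x z) has_derivative (\<lambda>h. (- 2 * (x \<bullet> e) * ((- l) * D x z powr (- l - 1) * (2 * ((x - z) \<bullet> h))) + - 2 * (h \<bullet> e) * D x z powr (- l))
    + (N x * ((- l) * D x z powr (- l - 1) * (2 * (h \<bullet> e)) + (- l) * ((- l - 1) * D x z powr (- l - 1 - 1) * (2 * ((x - z) \<bullet> h))) * (2 * ((x - z) \<bullet> e)))
     + - 2 * (x \<bullet> h) * ((- l) * D x z powr (- l - 1) * (2 * ((x - z) \<bullet> e)))))) (at x)"
   unfolding K1_def
   by (rule has_derivative_add[OF has_derivative_mult[OF 1 dD[OF that]] has_derivative_mult[OF dN 3]])
  then show ?thesis unfolding K2_def by (simp only: add_ac)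
 qed
 have cD: "continuous_on (ball 0 1 \<times> sphere 0 1) (\<lambda>p. D (fst p) (snd p) powr a)" for a
 proof (rule continuous_on_powr)
  show "continuous_on (ball 0 1 \<times> sphere 0 1) (\<lambda>p. D (fst p) (snd p))"
   unfolding D_def by (intro continuous_intros)
  show "\<forall>p\<in>ball 0 1 \<times> sphere 0 1. D (fst p) (snd p) \<noteq> 0" using Dpos by fastforce
 qed (intro continuous_intros)
 have cN: "continuous_on (ball 0 1 \<times> sphere (0::'a) 1) (\<lambda>p. N (fst p))"
  unfolding N_def by (intro continuous_intros)
 note cont_rules = cD cN continuous_on_of_real continuous_on_add continuous_on_mult continuous_on_const
  continuous_on_inner continuous_on_diff continuous_on_fst continuous_on_snd continuous_on_id
 have cK1: "continuous_on (ball 0 1 \<times> sphere 0 1) (\<lambda>(x, z). complex_of_real (K1 e x z))" for e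
  unfolding K1_def case_prod_unfold by (intro cont_rules)
 have cK2: "continuous_on (ball 0 1 \<times> sphere 0 1) (\<lambda>(x, z). complex_of_real (K2 e e' x z))" for e e'
  unfolding K2_def case_prod_unfold by (intro cont_rules)
 have slice: "continuous_on (sphere 0 1) (f x)" if "continuous_on (ball 0 1 \<times> sphere (0::'a) 1) (\<lambda>(x, z). complex_of_real (f' x z))"
   "x \<in> ball (0::'a) 1" "f = (\<lambda>x z. complex_of_real (f' x z))" for f f' x
 proof -
  have "continuous_on (sphere 0 1) (\<lambda>z. case (x, z) of (x, z) \<Rightarrow> complex_of_real (f' x z))"
   by (rule continuous_on_compose2[OF that(1)])
    (use that in \<open>auto intro!: continuous_on_Pair continuous_on_const continuous_on_id\<close>)
  then show ?thesis using that(3) by simp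
 qed
 have cK: "continuous_on (sphere 0 1) (\<lambda>z. complex_of_real (K x z))" if "x \<in> ball 0 1" for x
 proof -
  have "continuous_on (ball 0 1 \<times> sphere (0::'a) 1) (\<lambda>(x, z). complex_of_real (K x z))"
   unfolding K_def case_prod_unfold by (intro cont_rules)
  from slice[OF this that refl] show ?thesis .
 qed
 have trace: "(\<Sum>e\<in>Basis. K2 e e x z) = 0" if "x \<in> ball 0 1" "z \<in> sphere 0 1" for x z
 proof -
  have n: "real DIM('a) = 2 * l" by (simp add: l_def)
  let ?A = "D x z powr (- l - 1)"
  have step: "D x z powr a = D x z * D x z powr (a - 1)" for a
  proof -
   have "D x z powr a = D x z powr (1 + (a - 1))" by simp
   also have "\<dots> = D x z powr 1 * D x z powr (a - 1)" by (rule powr_add)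
   finally show ?thesis using Dpos[OF that] by simp
  qed
  have A: "D x z powr (- l) = D x z * ?A" "?A = D x z * D x z powr (- l - 1 - 1)"
   by (rule step)+
  have s1: "(\<Sum>e\<in>Basis. (x \<bullet> e) * ((x - z) \<bullet> e)) = x \<bullet> (x - z)"
   and s2: "(\<Sum>e\<in>Basis. ((x - z) \<bullet> e) * ((x - z) \<bullet> e)) = D x z"
   unfolding D_def by (rule euclidean_inner[symmetric])+
  have "(\<Sum>e\<in>Basis. K2 e e x z) = (\<Sum>e\<in>Basis. (- 2 * D x z powr (- l) - 2 * l * N x * ?A)
    + 8 * l * ?A * ((x \<bullet> e) * ((x - z) \<bullet> e))
    + 4 * l * (l + 1) * N x * D x z powr (- l - 1 - 1) * (((x - z) \<bullet> e) * ((x - z) \<bullet> e)))"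
   by (intro sum.cong refl) (simp add: K2_def algebra_simps)
  also have "\<dots> = real DIM('a) * (- 2 * D x z powr (- l) - 2 * l * N x * ?A)
    + 8 * l * ?A * (x \<bullet> (x - z))
    + 4 * l * (l + 1) * N x * D x z powr (- l - 1 - 1) * D x z"
   by (simp only: sum.distrib sum_distrib_left[symmetric] s1 s2 sum_constant)
  also have "\<dots> = 4 * l * ?A * (2 * (x \<bullet> (x - z)) + N x - D x z)"
  proof -
   have "4 * l * (l + 1) * N x * D x z powr (- l - 1 - 1) * D x z = 4 * l * (l + 1) * N x * ?A"
    unfolding A(2) by (simp only: mult_ac)
   then show ?thesis unfolding A(1) n by (simp add: algebra_simps)
  qed
  also have "2 * (x \<bullet> (x - z)) + N x - D x z = 0"
   using that by (simp add: N_def D_def inner_diff inner_commute norm_eq_1)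
  finally show ?thesis by simp
 qed
 have int2: "integrable surface (\<lambda>z. complex_of_real (K2 e e' x z) * \<phi> z)" if "x \<in> ball 0 1" for e e' x
 proof -
  have c: "continuous_on (sphere 0 1) (\<lambda>z. complex_of_real (K2 e e' x z))" by (rule slice[OF cK2 that refl])
  then have "bounded ((\<lambda>z. complex_of_real (K2 e e' x z)) ` sphere 0 1)"
   by (intro compact_imp_bounded compact_continuous_image) auto
  then obtain C where C: "\<And>z. z \<in> sphere 0 1 \<Longrightarrow> cmod (complex_of_real (K2 e e' x z)) \<le> C"
   by (metis (no_types, lifting) bounded_iff imageI)
  show ?thesis
  proof (rule integrable_surface_bounded)
   show "(\<lambda>z. complex_of_real (K2 e e' x z) * \<phi> z) \<in> borel_measurable surface"
    using \<phi>(1) continuous_measurable_surface[OF c] by measurable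
   show "norm (complex_of_real (K2 e e' x z) * \<phi> z) \<le> C * B" if z: "z \<in> sphere 0 1" for z
    unfolding norm_mult using C[OF z] \<phi>(2)[OF z] by (intro mult_mono) (auto intro: order_trans[OF norm_ge_zero])
  qed
 qed
 have H: "harmonic_on (ball 0 1) (\<lambda>x. LINT z|surface. of_real (K x z) * \<phi> z)"
 proof (rule harmonic_onI[where g = "\<lambda>e x. LINT z|surface. of_real (K1 e x z) * \<phi> z"
    and G = "\<lambda>e e' x. LINT z|surface. of_real (K2 e e' x z) * \<phi> z"])
  fix x :: 'a assume x: "x \<in> ball 0 1"
  show "((\<lambda>x. LINT z|surface. of_real (K x z) * \<phi> z) has_derivative
    (\<lambda>h. \<Sum>e\<in>Basis. (h \<bullet> e) *\<^sub>R (LINT z|surface. of_real (K1 e x z) * \<phi> z))) (at x)"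
   by (rule has_derivative_surface_integral[OF _ x _ cK1 cK \<phi>])
    (auto intro!: has_derivative_basis_expand has_derivative_of_real dK)
  show "((\<lambda>x. LINT z|surface. of_real (K1 e x z) * \<phi> z) has_derivative
    (\<lambda>h. \<Sum>e'\<in>Basis. (h \<bullet> e') *\<^sub>R (LINT z|surface. of_real (K2 e e' x z) * \<phi> z))) (at x)" for e
   by (rule has_derivative_surface_integral[OF _ x _ cK2 slice[OF cK1 _ refl] \<phi>])
    (auto intro!: has_derivative_basis_expand has_derivative_of_real dK1)
  have "(\<Sum>e\<in>Basis. LINT z|surface. of_real (K2 e e x z) * \<phi> z) = (LINT z|surface. (\<Sum>e\<in>Basis. of_real (K2 e e x z) * \<phi> z))"
   by (rule bochner_integral_sum[symmetric]) (rule int2[OF x])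
  also have "\<dots> = (LINT z|(surface :: 'a measure). 0)"
  proof (rule bochner_integral_cong[OF refl])
   fix z :: 'a assume "z \<in> space surface"
   then have "z \<in> sphere 0 1" by simp
   then have "complex_of_real (\<Sum>e\<in>Basis. K2 e e x z) * \<phi> z = 0" using trace[OF x] by simp
   then show "(\<Sum>e\<in>Basis. of_real (K2 e e x z) * \<phi> z) = 0" by (simp add: sum_distrib_right)
  qed
  finally show "(\<Sum>e\<in>Basis. LINT z|surface. of_real (K2 e e x z) * \<phi> z) = 0" by simp
 next
  show "continuous_on (ball 0 1) (\<lambda>x. LINT z|surface. of_real (K2 e e' x z) * \<phi> z)" for e e'
   by (rule continuous_on_surface_integral[OF cK2 \<phi>])
 qed simp
 have "(LINT z|surface. of_real (poisson_ratio x z) * \<phi> z) = (LINT z|surface. of_real (K x z) * \<phi> z)" if "x \<in> ball 0 1" for x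
 proof (rule bochner_integral_cong[OF refl])
  fix z :: 'a assume "z \<in> space surface"
  then have "x \<noteq> z" using ne that by simp
  then show "of_real (poisson_ratio x z) * \<phi> z = of_real (K x z) * \<phi> z"
   by (simp add: poisson_ratio_powr K_def N_def D_def l_def)
 qed
 then show ?thesis by (intro harmonic_on_eq[OF H]) simp
qed

text \<open>
 Derivatives on an open set are unique, so local choices of them agree.
\<close>

lemma harmonic_on_locally:
 assumes S: "open S" and loc: "\<And>x. x \<in> S \<Longrightarrow> \<exists>T. x \<in> T \<and> T \<subseteq> S \<and> harmonic_on T f"
 shows "harmonic_on S f"
proof -
 define D1 where "D1 x = (THE D. (f has_derivative blinfun_apply D) (at x))" for x
 define D2 where "D2 x = (THE D. (D1 has_derivative blinfun_apply D) (at x))" for x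
 have "(f has_derivative blinfun_apply (D1 x)) (at x) \<and> (D1 has_derivative blinfun_apply (D2 x)) (at x)
   \<and> isCont D2 x \<and> (\<Sum>e\<in>Basis. blinfun_apply (blinfun_apply (D2 x) e) e) = 0"
  if x: "x \<in> S" for x
 proof -
  obtain T where T: "x \<in> T" "T \<subseteq> S" "harmonic_on T f" using loc[OF x] by blast
  obtain E1 E2 where E: "open T" "\<And>x. x \<in> T \<Longrightarrow> (f has_derivative blinfun_apply (E1 x)) (at x)"
   "\<And>x. x \<in> T \<Longrightarrow> (E1 has_derivative blinfun_apply (E2 x)) (at x)" "continuous_on T E2"
   "\<And>x. x \<in> T \<Longrightarrow> (\<Sum>e\<in>Basis. blinfun_apply (blinfun_apply (E2 x) e) e) = 0"
   using T(3) unfolding harmonic_on_def by blast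
  have 1: "D1 y = E1 y" if "y \<in> T" for y
   unfolding D1_def
  proof (rule the_equality)
   show E: "(f has_derivative blinfun_apply (E1 y)) (at y)" by (rule E(2)[OF that])
   fix D assume "(f has_derivative blinfun_apply D) (at y)"
   from has_derivative_unique[OF this E] show "D = E1 y" by (simp add: blinfun_apply_inject)
  qed
  have d1: "(D1 has_derivative blinfun_apply (E2 y)) (at y)" if "y \<in> T" for y
   by (rule has_derivative_transform_within_open[OF E(3)[OF that] E(1) that]) (simp add: 1)
  have 2: "D2 y = E2 y" if "y \<in> T" for y
   unfolding D2_def
  proof (rule the_equality)
   show E: "(D1 has_derivative blinfun_apply (E2 y)) (at y)" by (rule d1[OF that])
   fix D assume "(D1 has_derivative blinfun_apply D) (at y)"
   from has_derivative_unique[OF this E] show "D = E2 y" by (simp add: blinfun_apply_inject)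
  qed
  have "continuous_on T D2" using E(4) by (rule continuous_on_eq) (simp add: 2)
  then have "isCont D2 x" using E(1) T(1) by (simp add: continuous_on_eq_continuous_at)
  then show ?thesis using E(2,5)[OF T(1)] d1[OF T(1)] by (simp add: 1 2 T(1))
 qed
 then show ?thesis
  unfolding harmonic_on_def using S
  by (intro conjI exI[of _ D1] exI[of _ D2]) (auto intro: continuous_at_imp_continuous_on)
qed

lemma harmonic_on_scale:
 fixes f :: "'a::euclidean_space \<Rightarrow> complex"
 assumes f: "harmonic_on S f" and T: "open T" "\<And>x. x \<in> T \<Longrightarrow> c *\<^sub>R x \<in> S"
 shows "harmonic_on T (\<lambda>x. f (c *\<^sub>R x))"
proof -
 obtain D1 D2 where D: "\<And>x. x \<in> S \<Longrightarrow> (f has_derivative blinfun_apply (D1 x)) (at x)"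
   "\<And>x. x \<in> S \<Longrightarrow> (D1 has_derivative blinfun_apply (D2 x)) (at x)" "continuous_on S D2"
   "\<And>x. x \<in> S \<Longrightarrow> (\<Sum>e\<in>Basis. blinfun_apply (blinfun_apply (D2 x) e) e) = 0"
  using f unfolding harmonic_on_def by blast
 have sc: "((\<lambda>x. c *\<^sub>R x) has_derivative (\<lambda>h. c *\<^sub>R h)) (at x)" for x :: 'a
  by (auto intro!: derivative_eq_intros)
 have "((\<lambda>x. f (c *\<^sub>R x)) has_derivative blinfun_apply (c *\<^sub>R D1 (c *\<^sub>R x))) (at x)" if "x \<in> T" for x
  using has_derivative_compose[OF sc D(1)[OF T(2)[OF that]]]
  by (rule has_derivative_eq_rhs) (simp add: fun_eq_iff blinfun.scaleR_right blinfun.scaleR_left)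
 moreover have "((\<lambda>x. c *\<^sub>R D1 (c *\<^sub>R x)) has_derivative blinfun_apply (c\<^sup>2 *\<^sub>R D2 (c *\<^sub>R x))) (at x)" if "x \<in> T" for x
  using has_derivative_scaleR_right[OF has_derivative_compose[OF sc D(2)[OF T(2)[OF that]]], of c]
  by (rule has_derivative_eq_rhs) (simp add: fun_eq_iff blinfun.scaleR_right blinfun.scaleR_left power2_eq_square)
 moreover have "continuous_on T (\<lambda>x. c\<^sup>2 *\<^sub>R D2 (c *\<^sub>R x))"
  by (intro continuous_intros continuous_on_compose2[OF D(3)]) (use T in auto)
 moreover have "(\<Sum>e\<in>Basis. blinfun_apply (blinfun_apply (c\<^sup>2 *\<^sub>R D2 (c *\<^sub>R x)) e) e) = 0" if "x \<in> T" for x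
  using D(4)[OF T(2)[OF that]] by (simp add: blinfun.scaleR_left scaleR_right.sum[symmetric])
 ultimately show ?thesis
  unfolding harmonic_on_def using T(1)
  by (intro conjI exI[of _ "\<lambda>x. c *\<^sub>R D1 (c *\<^sub>R x)"] exI[of _ "\<lambda>x. c\<^sup>2 *\<^sub>R D2 (c *\<^sub>R x)"]) auto
qed

context sh_basis
begin

abbreviation series :: "(nat \<Rightarrow> nat \<Rightarrow> complex) \<Rightarrow> 'a \<Rightarrow> complex" where
 "series \<equiv> sh_series d Y"

lemma part_0: "y \<in> sphere 0 1 \<Longrightarrow> z \<in> sphere 0 1 \<Longrightarrow> part a 0 y = part a 0 z"
proof -
 assume y: "y \<in> sphere 0 1" and z: "z \<in> sphere 0 1"
 have "Y 0 j y = Y 0 j z" if j: "j \<in> {1..d 0}" for j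
 proof -
  obtain P where P: "\<And>t x. P (t *\<^sub>R x) = of_real (t ^ 0) * P x" "\<And>x. x \<in> sphere 0 1 \<Longrightarrow> complex_of_real (Y 0 j x) = P x"
   using Y_harmonic[OF j] unfolding spherical_harmonics_def by blast
  have "P y = P z" using P(1)[of 0 y] P(1)[of 0 z] by simp
  then show ?thesis using P(2)[OF y] P(2)[OF z] by (metis of_real_eq_iff)
 qed
 then show ?thesis by (simp add: part_def)
qed

lemma measurable_part: "part a k \<in> borel_measurable surface"
proof -
 have "continuous_on (sphere 0 1) (part a k)"
  unfolding part_def[abs_def] by (intro continuous_intros continuous_on_Y)
 then show ?thesis by (rule continuous_measurable_surface)
qed

lemma part_summable:
 assumes a: "subexponential (row a)" and r: "0 \<le> r" "r < 1"
 shows "summable (\<lambda>k. r ^ k * (row a k * Y_bound k))"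
 using subexponential_summable[OF subexponential_mult[OF a subexponential_Y_bound] r] row_nonneg Y_bound_nonneg
 by (simp add: mult_ac abs_mult)

lemma norm_term_le:
 assumes "y \<in> sphere 0 1" "0 \<le> r"
 shows "norm (of_real (r ^ k) * part a k y) \<le> r ^ k * (row a k * Y_bound k)"
 using norm_part_le[OF assms(1), of a k] assms(2) by (simp add: norm_mult norm_power mult_left_mono)

lemma sh_series_sums:
 assumes a: "subexponential (row a)" and x: "x \<in> ball 0 1"
 shows "sh_term d Y a x sums series a x"
proof -
 have "summable (sh_term d Y a x)"
 proof (rule summable_comparison_test'[OF part_summable[OF a, of "norm x"]])
  show "norm (sh_term d Y a x k) \<le> norm x ^ k * (row a k * Y_bound k)" for k
   unfolding sh_term_eq by (rule norm_term_le) (use sphere_point in auto)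
 qed (use x in auto)
 then show ?thesis by (simp add: sh_series_def summable_sums)
qed

lemma sh_series_polar:
 assumes a: "subexponential (row a)" and y: "y \<in> sphere 0 1" and r: "0 \<le> r" "r < 1"
 shows "(\<lambda>k. of_real (r ^ k) * part a k y) sums series a (r *\<^sub>R y)"
proof -
 have "of_real (r ^ k) * part a k y = sh_term d Y a (r *\<^sub>R y) k" for k
 proof (cases "r = 0")
  case True
  then show ?thesis
   using part_0[OF y sphere_point(1), of a 0] by (cases "k = 0") (auto simp: sh_term_eq)
 next
  case False
  then show ?thesis using r y sh_term_polar[OF y, of r a k] by simp
 qed
 then show ?thesis using sh_series_sums[OF a, of "r *\<^sub>R y"] y r by (simp add: sums_def)
qed

lemma sh_series_bound:
 assumes a: "subexponential (row a)" and r: "0 \<le> r" "r < 1"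
 obtains B where "\<And>y. y \<in> sphere 0 1 \<Longrightarrow> cmod (series a (r *\<^sub>R y)) \<le> B"
proof
 fix y :: 'a assume y: "y \<in> sphere 0 1"
 have s: "summable (\<lambda>k. norm (of_real (r ^ k) * part a k y))"
  by (rule summable_comparison_test'[OF part_summable[OF a r]])
   (use norm_term_le[OF y r(1)] in auto)
 have "cmod (series a (r *\<^sub>R y)) \<le> (\<Sum>k. norm (of_real (r ^ k) * part a k y))"
  using sums_unique[OF sh_series_polar[OF a y r]] summable_norm[OF s] by simp
 also have "\<dots> \<le> (\<Sum>k. r ^ k * (row a k * Y_bound k))"
  by (rule suminf_le[OF norm_term_le[OF y r(1)] s part_summable[OF a r]])
 finally show "cmod (series a (r *\<^sub>R y)) \<le> (\<Sum>k. r ^ k * (row a k * Y_bound k))" .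
qed

lemma measurable_sh_series:
 assumes a: "subexponential (row a)" and r: "0 \<le> r" "r < 1"
 shows "(\<lambda>y. series a (r *\<^sub>R y)) \<in> borel_measurable surface"
proof (rule borel_measurable_LIMSEQ_metric)
 show "(\<lambda>y. \<Sum>k<n. of_real (r ^ k) * part a k y) \<in> borel_measurable surface" for n
  using measurable_part by measurable
 show "(\<lambda>n. \<Sum>k<n. of_real (r ^ k) * part a k y) \<longlonglongrightarrow> series a (r *\<^sub>R y)" if "y \<in> space surface" for y
  using sh_series_polar[OF a _ r, of y] that by (simp add: sums_def)
qed

lemma part_reproduce:
 assumes y: "y \<in> sphere 0 1"
 shows "(LINT z|surface. part a k z * of_real (zonal l z y)) = (if l = k then of_real (surface_area TYPE('a)) * part a k y else 0)"
proof -
 have "(LINT z|surface. part a k z * of_real (zonal l z y))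
   = (LINT z|surface. (\<Sum>j=1..d k. a k j * (of_real (Y k j z) * of_real (zonal l z y))))"
  by (simp add: part_def sum_distrib_right mult.assoc)
 also have "\<dots> = (\<Sum>j=1..d k. (LINT z|surface. a k j * (of_real (Y k j z) * of_real (zonal l z y))))"
  by (rule bochner_integral_sum)
   (intro integrable_surface_continuous continuous_intros continuous_on_Y continuous_on_zonal)
 also have "\<dots> = (\<Sum>j=1..d k. a k j * (if l = k then of_real (surface_area TYPE('a)) * of_real (Y k j y) else 0))"
  unfolding integral_mult_right_zero
  by (intro sum.cong refl arg_cong2[of _ _ _ _ "(*)"] spherical_harmonic_reproduce Y_harmonic y)
 also have "\<dots> = (if l = k then of_real (surface_area TYPE('a)) * part a k y else 0)"
  by (auto simp: part_def sum_distrib_left mult_ac)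
 finally show ?thesis .
qed

lemma sh_series_zonal_moment:
 assumes a: "subexponential (row a)" and r: "0 \<le> r" "r < 1" and y: "y \<in> sphere 0 1"
 shows "(LINT z|surface. series a (r *\<^sub>R z) * of_real (zonal l z y))
   = of_real (surface_area TYPE('a)) * (of_real (r ^ l) * part a l y)"
proof -
 let ?h = "\<lambda>k z. of_real (r ^ k) * part a k z * of_real (zonal l z y)"
 have "(\<lambda>k. LINT z|surface. ?h k z) sums (LINT z|surface. (\<Sum>k. ?h k z))"
 proof (rule surface_integral_sums)
  have "(\<lambda>z. complex_of_real (zonal l z y)) \<in> borel_measurable surface"
   by (intro continuous_measurable_surface continuous_on_of_real continuous_on_zonal)
  then show "?h k \<in> borel_measurable surface" for k using measurable_part by measurable
  show "summable (\<lambda>k. (r ^ k * (row a k * Y_bound k)) * zonal_sup TYPE('a) l)"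
   by (intro summable_mult2 part_summable a r)
  show "norm (?h k z) \<le> (r ^ k * (row a k * Y_bound k)) * zonal_sup TYPE('a) l" if z: "z \<in> sphere 0 1" for k z
   unfolding norm_mult[of "_ * _"] using norm_term_le[OF z r(1), of k a] zonal_le_sup[OF z y, of l] r
   by (intro mult_mono mult_nonneg_nonneg row_nonneg Y_bound_nonneg) auto
 qed
 moreover have "(LINT z|surface. (\<Sum>k. ?h k z)) = (LINT z|surface. series a (r *\<^sub>R z) * of_real (zonal l z y))"
 proof (rule bochner_integral_cong[OF refl])
  fix z :: 'a assume "z \<in> space surface"
  then have "(\<lambda>k. ?h k z) sums (series a (r *\<^sub>R z) * of_real (zonal l z y))"
   by (intro sums_mult2 sh_series_polar a r) simp
  then show "(\<Sum>k. ?h k z) = series a (r *\<^sub>R z) * of_real (zonal l z y)" by (simp add: sums_iff)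
 qed
 moreover have "(LINT z|surface. ?h k z) = (if k = l then of_real (surface_area TYPE('a)) * (of_real (r ^ l) * part a l y) else 0)" for k
  using part_reproduce[OF y, of a k l] by (auto simp: mult.assoc)
 ultimately show ?thesis
  using sums_unique2[OF _ sums_single[of l "\<lambda>_. of_real (surface_area TYPE('a)) * (of_real (r ^ l) * part a l y)"]] by simp
qed

text \<open>
 On a smaller ball the series is the Poisson integral of its own boundary values, by comparing zonal moments.
\<close>

lemma sh_series_poisson:
 assumes a: "subexponential (row a)" and R: "0 \<le> R" "R < 1" and x: "x \<in> ball 0 1"
 shows "(LINT z|surface. of_real (poisson_ratio x z) * series a (R *\<^sub>R z))
   = of_real (surface_area TYPE('a)) * series a (R *\<^sub>R x)"
proof -
 define b where "b = norm x"
 define y where "y = sphere_point x"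
 have y: "y \<in> sphere 0 1" and xy: "x = b *\<^sub>R y" and b: "0 \<le> b" "b < 1"
  using sphere_point[of x] x by (auto simp: b_def y_def)
 obtain B where B: "\<And>y. y \<in> sphere 0 1 \<Longrightarrow> cmod (series a (R *\<^sub>R y)) \<le> B"
  using sh_series_bound[OF a R] by blast
 have "(\<lambda>k. of_real (b ^ k) * (LINT z|surface. series a (R *\<^sub>R z) * of_real (zonal k z y)))
   sums (LINT z|surface. of_real (poisson_ratio (b *\<^sub>R y) z) * series a (R *\<^sub>R z))"
  by (rule poisson_integral_sums[OF measurable_sh_series[OF a R] B y b])
 moreover have "of_real (b ^ k) * (LINT z|surface. series a (R *\<^sub>R z) * of_real (zonal k z y))
   = of_real (surface_area TYPE('a)) * (of_real ((R * b) ^ k) * part a k y)" for k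
  unfolding sh_series_zonal_moment[OF a R y] by (simp add: power_mult_distrib mult_ac)
 moreover have "(\<lambda>k. of_real ((R * b) ^ k) * part a k y) sums series a ((R * b) *\<^sub>R y)"
  by (rule sh_series_polar[OF a y]) (use R b in \<open>auto intro: le_less_trans[OF mult_left_le_one_le]\<close>)
 from sums_mult[OF this, of "of_real (surface_area TYPE('a))"]
 have "(\<lambda>k. of_real (surface_area TYPE('a)) * (of_real ((R * b) ^ k) * part a k y)) sums (of_real (surface_area TYPE('a)) * series a ((R * b) *\<^sub>R y))" .
 ultimately show ?thesis unfolding xy by (simp add: sums_iff)
qed

text \<open>
 Being a Poisson integral on every smaller ball, the series is harmonic there, and harmonicity is local.
\<close>

theorem sh_series_harmonic:
 assumes a: "subexponential (row a)"
 shows "harmonic_on (ball 0 1) (series a)"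
proof (rule harmonic_on_locally)
 fix x :: 'a assume x: "x \<in> ball 0 1"
 define R where "R = (1 + norm x) / 2"
 have R: "0 < R" "R < 1" "norm x < R" using x by (auto simp: R_def add_pos_nonneg)
 obtain B where B: "\<And>y. y \<in> sphere 0 1 \<Longrightarrow> cmod (series a (R *\<^sub>R y)) \<le> B"
  using sh_series_bound[OF a, of R] R by (metis less_imp_le)
 have sub: "(1 / R) *\<^sub>R x \<in> ball 0 1" if "x \<in> ball 0 R" for x :: 'a using that R by simp
 have "harmonic_on (ball 0 1) (\<lambda>x. LINT z|surface. of_real (poisson_ratio x z) * (of_real (1 / surface_area TYPE('a)) * series a (R *\<^sub>R z)))"
 proof (rule poisson_integral_harmonic)
  show "(\<lambda>z. of_real (1 / surface_area TYPE('a)) * series a (R *\<^sub>R z)) \<in> borel_measurable surface"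
   using measurable_sh_series[OF a less_imp_le[OF R(1)] R(2)] by measurable
  show "cmod (of_real (1 / surface_area TYPE('a)) * series a (R *\<^sub>R z)) \<le> \<bar>1 / surface_area TYPE('a)\<bar> * B" if "z \<in> sphere 0 1" for z
   unfolding norm_mult norm_of_real using B[OF that] by (intro mult_left_mono) auto
 qed
 from harmonic_on_scale[OF this _ sub, of "ball 0 R"]
 have "harmonic_on (ball 0 R) (\<lambda>x. LINT z|surface. of_real (poisson_ratio ((1 / R) *\<^sub>R x) z) * (of_real (1 / surface_area TYPE('a)) * series a (R *\<^sub>R z)))"
  by simp
 then have "harmonic_on (ball 0 R) (series a)"
 proof (rule harmonic_on_eq)
  fix x :: 'a assume x: "x \<in> ball 0 R"
  have "(LINT z|surface. of_real (poisson_ratio ((1 / R) *\<^sub>R x) z) * (of_real (1 / surface_area TYPE('a)) * series a (R *\<^sub>R z)))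
    = of_real (1 / surface_area TYPE('a)) * (LINT z|surface. of_real (poisson_ratio ((1 / R) *\<^sub>R x) z) * series a (R *\<^sub>R z))"
   by (subst integral_mult_right_zero[symmetric]) (simp add: mult_ac)
  also have "\<dots> = series a x"
   using sh_series_poisson[OF a _ _ sub[OF x], of R] R by simp
  finally show "(LINT z|surface. of_real (poisson_ratio ((1 / R) *\<^sub>R x) z) * (of_real (1 / surface_area TYPE('a)) * series a (R *\<^sub>R z)))
    = series a x" .
 qed
 then show "\<exists>T. x \<in> T \<and> T \<subseteq> ball 0 1 \<and> harmonic_on T (series a)"
  using R x by (intro exI[of _ "ball 0 R"]) auto
qed simp

end

section \<open>Lebesgue norms on the sphere, Poisson averages and duality\<close>

lemma bounded_measurable_continuous: "continuous_on (sphere 0 1) u \<Longrightarrow> bounded_measurable u"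
proof -
 assume u: "continuous_on (sphere 0 1) u"
 then have "bounded (u ` sphere 0 1)"
  by (intro compact_imp_bounded compact_continuous_image) auto
 then obtain B where "\<And>z. z \<in> sphere 0 1 \<Longrightarrow> cmod (u z) \<le> B" by (metis bounded_iff imageI)
 then show ?thesis using continuous_measurable_surface[OF u] bounded_measurableI by blast
qed

lemma integrable_cmod_powr:
 assumes "bounded_measurable u" "q \<ge> 0"
 shows "integrable surface (\<lambda>z. cmod (u z) powr q)"
proof -
 obtain B where B: "B \<ge> 0" "\<And>z. z \<in> sphere 0 1 \<Longrightarrow> cmod (u z) \<le> B" and [measurable]: "u \<in> borel_measurable surface"
  using bounded_measurableE[OF assms(1)] by blast
 show ?thesis
 proof (rule integrable_surface_bounded)
  show "(\<lambda>z. cmod (u z) powr q) \<in> borel_measurable surface" by measurable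
  show "norm (cmod (u z) powr q) \<le> B powr q" if "z \<in> sphere 0 1" for z
   using B(2)[OF that] assms(2) by (simp add: powr_mono2)
 qed
qed

definition sphere_Lq :: "real \<Rightarrow> ('a::euclidean_space \<Rightarrow> complex) \<Rightarrow> real" where
 "sphere_Lq q u = (LINT z|surface. cmod (u z) powr q) powr (1 / q)"

lemma sphere_Lq_nonneg: "sphere_Lq q u \<ge> 0"
 by (simp add: sphere_Lq_def)

lemma sphere_Lq_powr:
 assumes "q > 0"
 shows "sphere_Lq q u powr q = (LINT z|surface. cmod (u z) powr q)"
 using assms by (simp add: sphere_Lq_def powr_powr bochner_integral_nonneg)

lemma sphere_norm_finite:
 assumes u: "bounded_measurable u" and q: "q > 0"
 shows "sphere_norm (ennreal q) u = ennreal (sphere_Lq q u)"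
proof -
 have "(\<integral>\<^sup>+ x. ennreal (cmod (u x) powr q) \<partial>surface) = ennreal (LINT z|surface. cmod (u z) powr q)"
  by (rule nn_integral_eq_integral) (use integrable_cmod_powr[OF u] q in auto)
 then show ?thesis
  using q by (simp add: sphere_norm_def ennreal_powr_def sphere_Lq_def)
qed

lemma sphere_Lq_le:
 assumes q: "q > 0" and u: "bounded_measurable u" and C: "C \<ge> 0"
  and I: "(LINT z|surface. cmod (u z) powr q) \<le> C powr q"
 shows "sphere_Lq q u \<le> C"
proof -
 have "sphere_Lq q u \<le> (C powr q) powr (1 / q)"
  unfolding sphere_Lq_def using I q by (intro powr_mono2) auto
 then show ?thesis using C q by (simp add: powr_powr)
qed

lemma powr_tangent:
 fixes s t q :: real
 assumes q: "q \<ge> 1" and s: "s \<ge> 0" and t: "t \<ge> 0"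
 shows "s powr q + q * s powr (q - 1) * (t - s) \<le> t powr q"
proof (cases "q = 1")
 case True
 then show ?thesis using s t by (cases "s = 0") auto
next
 case False
 then have q1: "q > 1" using q by simp
 define r where "r = q / (q - 1)"
 have r: "r > 1" "1 / r + 1 / q = 1" using q1 by (auto simp: r_def field_simps)
 have "s powr (q - 1) * t \<le> (s powr (q - 1)) powr r / r + t powr q / q"
  using Youngs_inequality[of r q "s powr (q - 1)" t] r q1 t by auto
 also have "(s powr (q - 1)) powr r = s powr q"
  using q1 by (simp add: powr_powr r_def)
 finally have "q * (s powr (q - 1) * t) \<le> q * (s powr q / r + t powr q / q)"
  using q1 by (intro mult_left_mono) auto
 also have "\<dots> = (q - 1) * s powr q + t powr q"
  using q1 by (simp add: r_def field_simps)
 finally have 1: "q * (s powr (q - 1) * t) \<le> (q - 1) * s powr q + t powr q" .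
 have "s powr (q - 1) * s = s powr q"
  using s powr_add[of s "q - 1" 1] by (cases "s = 0") auto
 then show ?thesis using 1 by (simp add: algebra_simps)
qed

text \<open>
 Integrate the inequality of \<open>t powr q\<close> with its tangent at the mean.
\<close>

lemma jensen_powr:
 fixes k \<phi> :: "'b \<Rightarrow> real"
 assumes k: "integrable M k" "\<And>z. z \<in> space M \<Longrightarrow> k z \<ge> 0" "(LINT z|M. k z) = 1"
  and \<phi>: "\<phi> \<in> borel_measurable M" "\<And>z. z \<in> space M \<Longrightarrow> 0 \<le> \<phi> z" "\<And>z. z \<in> space M \<Longrightarrow> \<phi> z \<le> B"
  and q: "q \<ge> 1"
 shows "(LINT z|M. k z * \<phi> z) powr q \<le> (LINT z|M. k z * \<phi> z powr q)"
proof -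
 define s where "s = (LINT z|M. k z * \<phi> z)"
 note [measurable] = \<phi>(1) borel_measurable_integrable[OF k(1)]
 have i1: "integrable M (\<lambda>z. k z * \<phi> z)"
 proof (rule Bochner_Integration.integrable_bound[OF integrable_mult_left[OF k(1), of B]])
  show "AE z in M. norm (k z * \<phi> z) \<le> norm (k z * B)"
   using k(2) \<phi>(2,3) by (intro AE_I2) (auto simp: abs_mult intro!: mult_left_mono order_trans[OF _ abs_ge_self])
 qed measurable
 have i2: "integrable M (\<lambda>z. k z * \<phi> z powr q)"
 proof (rule Bochner_Integration.integrable_bound[OF integrable_mult_left[OF k(1), of "B powr q"]])
  show "AE z in M. norm (k z * \<phi> z powr q) \<le> norm (k z * B powr q)"
   using k(2) \<phi>(2,3) q by (intro AE_I2) (auto simp: abs_mult intro!: mult_left_mono powr_mono2)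
 qed measurable
 have s0: "s \<ge> 0" unfolding s_def using k(2) \<phi>(2) by (intro bochner_integral_nonneg) auto
 have "s powr q = (LINT z|M. (s powr q - q * s powr (q - 1) * s) * k z + q * s powr (q - 1) * (k z * \<phi> z))"
  using i1 k(1,3) by (simp add: s_def[symmetric])
 also have "\<dots> \<le> (LINT z|M. k z * \<phi> z powr q)"
 proof (rule integral_mono)
  show "integrable M (\<lambda>z. (s powr q - q * s powr (q - 1) * s) * k z + q * s powr (q - 1) * (k z * \<phi> z))"
   using i1 k(1) by simp
  show "integrable M (\<lambda>z. k z * \<phi> z powr q)" by (rule i2)
  fix z assume z: "z \<in> space M"
  have "k z * (s powr q + q * s powr (q - 1) * (\<phi> z - s)) \<le> k z * \<phi> z powr q"
   using powr_tangent[OF q s0 \<phi>(2)[OF z]] k(2)[OF z] by (rule mult_left_mono)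
  then show "(s powr q - q * s powr (q - 1) * s) * k z + q * s powr (q - 1) * (k z * \<phi> z) \<le> k z * \<phi> z powr q"
   by (simp add: algebra_simps)
 qed
 finally show ?thesis by (simp add: s_def)
qed

lemma measurable_id_surface [measurable]: "(\<lambda>x. x) \<in> measurable surface borel"
 by (rule continuous_measurable_surface) (intro continuous_intros)

lemma poisson_ratio_swap:
 assumes "norm y = 1" "norm (z :: 'a::euclidean_space) = 1"
 shows "poisson_ratio (b *\<^sub>R y) z = poisson_ratio (b *\<^sub>R z) y"
proof -
 have "(norm (b *\<^sub>R y - z))\<^sup>2 = (norm (b *\<^sub>R z - y))\<^sup>2"
  using assms unfolding power2_norm_eq_inner norm_eq_1 by (simp add: inner_diff inner_commute)
 then have "norm (b *\<^sub>R y - z) = norm (b *\<^sub>R z - y)" by (simp add: power2_eq_iff_nonneg)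
 then show ?thesis using assms by (simp add: poisson_ratio_def)
qed

definition poisson_avg :: "real \<Rightarrow> ('a::euclidean_space \<Rightarrow> complex) \<Rightarrow> 'a \<Rightarrow> real" where
 "poisson_avg b u y = (LINT z|surface. poisson_ratio (b *\<^sub>R y) z * cmod (u z)) / surface_area TYPE('a)"

lemma measurable_poisson_ratio [measurable]:
 "(\<lambda>p. poisson_ratio (b *\<^sub>R fst p) (snd p)) \<in> borel_measurable (surface \<Otimes>\<^sub>M surface)"
proof -
 have f: "(\<lambda>p::'a\<times>'a. fst p) \<in> measurable (surface \<Otimes>\<^sub>M surface) borel"
  by (rule measurable_compose[OF measurable_fst measurable_id_surface])
 have s: "(\<lambda>p::'a\<times>'a. snd p) \<in> measurable (surface \<Otimes>\<^sub>M surface) borel"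
  by (rule measurable_compose[OF measurable_snd measurable_id_surface])
 note [measurable] = f s
 show ?thesis unfolding poisson_ratio_def by measurable
qed

text \<open>
 Jensen for the probability density \<open>poisson_ratio / surface_area\<close>, then exchange of integrals;
 the kernel is symmetric, hence has the same mass in both variables.
\<close>

lemma poisson_avg_contraction:
 fixes u :: "'a::euclidean_space \<Rightarrow> complex"
 assumes u: "bounded_measurable u" and b: "0 \<le> b" "b < 1" and q: "q \<ge> 1"
 shows "(\<integral>\<^sup>+ y. ennreal (poisson_avg b u y powr q) \<partial>surface) \<le> ennreal (LINT z|surface. cmod (u z) powr q)"
proof -
 let ?\<sigma> = "surface_area TYPE('a)"
 let ?P = "\<lambda>y z :: 'a. poisson_ratio (b *\<^sub>R y) z"
 have \<sigma>: "?\<sigma> > 0" by simp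
 obtain B where B: "B \<ge> 0" "\<And>z. z \<in> sphere 0 1 \<Longrightarrow> cmod (u z) \<le> B" and [measurable]: "u \<in> borel_measurable surface"
  using bounded_measurableE[OF u] by blast
 interpret pair_sigma_finite "surface :: 'a measure" "surface :: 'a measure" ..
 have nb: "norm (b *\<^sub>R y) < 1" if "y \<in> sphere 0 1" for y :: 'a using that b by simp
 have iP: "integrable surface (?P y)" if "y \<in> sphere 0 1" for y
  by (rule integrable_surface_continuous[OF continuous_on_poisson_ratio[OF nb[OF that]]])
 have P0: "?P y z \<ge> 0" if "y \<in> sphere 0 1" for y z
  using nb[OF that] by (intro poisson_ratio_nonneg) simp
 have iPu: "integrable surface (\<lambda>z. ?P y z / ?\<sigma> * cmod (u z) powr q)" if y: "y \<in> sphere 0 1" for y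
 proof (rule Bochner_Integration.integrable_bound[OF integrable_mult_left[OF integrable_divide[OF iP[OF y]], of "?\<sigma>" "B powr q"]])
  show "(\<lambda>z. ?P y z / ?\<sigma> * cmod (u z) powr q) \<in> borel_measurable surface"
   using borel_measurable_integrable[OF iP[OF y]] by measurable
  show "AE z in surface. norm (?P y z / ?\<sigma> * cmod (u z) powr q) \<le> norm (?P y z / ?\<sigma> * B powr q)"
   using B q by (intro AE_I2) (auto simp: abs_mult intro!: mult_left_mono powr_mono2 divide_right_mono)
 qed
 have "(\<integral>\<^sup>+ y. ennreal (poisson_avg b u y powr q) \<partial>surface)
   \<le> (\<integral>\<^sup>+ y. (\<integral>\<^sup>+ z. ennreal (?P y z / ?\<sigma> * cmod (u z) powr q) \<partial>surface) \<partial>surface)"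
 proof (rule nn_integral_mono)
  fix y :: 'a assume "y \<in> space surface"
  then have y: "y \<in> sphere 0 1" by simp
  have "poisson_avg b u y powr q = (LINT z|surface. ?P y z / ?\<sigma> * cmod (u z)) powr q"
   by (simp add: poisson_avg_def)
  also have "\<dots> \<le> (LINT z|surface. ?P y z / ?\<sigma> * cmod (u z) powr q)"
  proof (rule jensen_powr[where B = B])
   show "(LINT z|surface. ?P y z / ?\<sigma>) = 1" by (simp add: poisson_ratio_mean[OF nb[OF y]])
  qed (use iP[OF y] P0[OF y] \<sigma> B q in \<open>auto intro: divide_nonneg_pos\<close>)
  finally have "ennreal (poisson_avg b u y powr q) \<le> ennreal (LINT z|surface. ?P y z / ?\<sigma> * cmod (u z) powr q)"
   by (rule ennreal_leI)
  also have "\<dots> = (\<integral>\<^sup>+ z. ennreal (?P y z / ?\<sigma> * cmod (u z) powr q) \<partial>surface)"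
   by (rule nn_integral_eq_integral[symmetric, OF iPu[OF y]]) (use P0[OF y] \<sigma> in \<open>auto intro!: AE_I2 mult_nonneg_nonneg divide_nonneg_pos\<close>)
  finally show "ennreal (poisson_avg b u y powr q) \<le> (\<integral>\<^sup>+ z. ennreal (?P y z / ?\<sigma> * cmod (u z) powr q) \<partial>surface)" .
 qed
 also have "\<dots> = (\<integral>\<^sup>+ z. (\<integral>\<^sup>+ y. ennreal (?P y z / ?\<sigma> * cmod (u z) powr q) \<partial>surface) \<partial>surface)"
 proof -
  have "(\<lambda>p. ennreal (?P (fst p) (snd p) / ?\<sigma> * cmod (u (snd p)) powr q)) \<in> borel_measurable (surface \<Otimes>\<^sub>M surface)"
   by measurable
  from Fubini[OF this] show ?thesis by simp
 qed
 also have "\<dots> = (\<integral>\<^sup>+ z. ennreal (cmod (u z) powr q) \<partial>surface)"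
 proof (rule nn_integral_cong)
  fix z :: 'a assume "z \<in> space surface"
  then have z: "z \<in> sphere 0 1" by simp
  have "(\<integral>\<^sup>+ y. ennreal (?P y z / ?\<sigma> * cmod (u z) powr q) \<partial>surface)
    = (\<integral>\<^sup>+ y. ennreal (?P z y * (cmod (u z) powr q / ?\<sigma>)) \<partial>surface)"
  proof (rule nn_integral_cong)
   fix y :: 'a assume "y \<in> space surface"
   then have "?P y z = ?P z y" using z by (intro poisson_ratio_swap) auto
   then show "ennreal (?P y z / ?\<sigma> * cmod (u z) powr q) = ennreal (?P z y * (cmod (u z) powr q / ?\<sigma>))"
    by simp
  qed
  also have "\<dots> = ennreal (LINT y|surface. ?P z y * (cmod (u z) powr q / ?\<sigma>))"
   by (rule nn_integral_eq_integral) (use iP[OF z] P0[OF z] \<sigma> in \<open>auto intro!: AE_I2 mult_nonneg_nonneg divide_nonneg_pos simp: less_imp_le\<close>)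
  also have "(LINT y|surface. ?P z y * (cmod (u z) powr q / ?\<sigma>)) = cmod (u z) powr q"
   using \<sigma> by (simp add: poisson_ratio_mean[OF nb[OF z]])
  finally show "(\<integral>\<^sup>+ y. ennreal (?P y z / ?\<sigma> * cmod (u z) powr q) \<partial>surface) = ennreal (cmod (u z) powr q)" .
 qed
 also have "\<dots> = ennreal (LINT z|surface. cmod (u z) powr q)"
  by (rule nn_integral_eq_integral[OF integrable_cmod_powr[OF u]]) (use q in auto)
 finally show ?thesis .
qed

lemma sphere_Lq_le_poisson_avg:
 fixes u h :: "'a::euclidean_space \<Rightarrow> complex"
 assumes u: "bounded_measurable u" and h: "bounded_measurable h" and b: "0 \<le> b" "b < 1" and q: "q \<ge> 1" and C: "C \<ge> 0"
  and le: "\<And>y. y \<in> sphere 0 1 \<Longrightarrow> cmod (h y) \<le> C * poisson_avg b u y"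
 shows "sphere_Lq q h \<le> C * sphere_Lq q u"
proof (rule sphere_Lq_le)
 have "ennreal (LINT y|surface. cmod (h y) powr q) = (\<integral>\<^sup>+ y. ennreal (cmod (h y) powr q) \<partial>surface)"
  by (rule nn_integral_eq_integral[symmetric, OF integrable_cmod_powr[OF h]]) (use q in auto)
 also have "\<dots> \<le> (\<integral>\<^sup>+ y. ennreal (C powr q) * ennreal (poisson_avg b u y powr q) \<partial>surface)"
 proof (rule nn_integral_mono)
  fix y :: 'a assume "y \<in> space surface"
  then have y: "y \<in> sphere 0 1" by simp
  have a0: "poisson_avg b u y \<ge> 0"
   unfolding poisson_avg_def using y b
   by (intro divide_nonneg_pos bochner_integral_nonneg mult_nonneg_nonneg poisson_ratio_nonneg) auto
  have "cmod (h y) powr q \<le> (C * poisson_avg b u y) powr q"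
   using le[OF y] q by (intro powr_mono2) auto
  also have "\<dots> = C powr q * poisson_avg b u y powr q" using C a0 by (simp add: powr_mult)
  finally show "ennreal (cmod (h y) powr q) \<le> ennreal (C powr q) * ennreal (poisson_avg b u y powr q)"
   by (simp add: ennreal_mult[symmetric] ennreal_leI)
 qed
 also have "\<dots> \<le> ennreal (C powr q) * ennreal (LINT z|surface. cmod (u z) powr q)"
 proof (cases "C = 0")
  case True
  then show ?thesis using q by simp
 next
  case False
  obtain B where [measurable]: "u \<in> borel_measurable surface"
   using bounded_measurableE[OF u] by blast
  have "(\<lambda>p. ennreal (poisson_ratio (b *\<^sub>R fst p) (snd p) * cmod (u (snd p)))) \<in> borel_measurable (surface \<Otimes>\<^sub>M surface)"
   by measurable
  have "(\<lambda>y. LINT z|surface. poisson_ratio (b *\<^sub>R y) z * cmod (u z)) \<in> borel_measurable surface"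
   by (rule surface.borel_measurable_lebesgue_integral) (simp add: case_prod_unfold)
  then have "(\<lambda>y. ennreal (poisson_avg b u y powr q)) \<in> borel_measurable surface"
   unfolding poisson_avg_def by measurable
  then show ?thesis
   using poisson_avg_contraction[OF u b q] by (simp add: nn_integral_cmult mult_left_mono)
 qed
 also have "\<dots> = ennreal ((C * sphere_Lq q u) powr q)"
  using C q sphere_Lq_nonneg[of q u] sphere_Lq_powr[of q u]
  by (simp add: powr_mult ennreal_mult[symmetric] bochner_integral_nonneg)
 finally show "(LINT y|surface. cmod (h y) powr q) \<le> (C * sphere_Lq q u) powr q"
  by (subst (asm) ennreal_le_iff) auto
qed (use q h C in \<open>auto simp: sphere_Lq_nonneg\<close>)

lemma subexponential_of_nat: "subexponential (\<lambda>k. real k)"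
proof (rule subexponentialI)
 fix R :: real assume R: "0 < R" "R < 1"
 have "real k * R ^ k \<le> 1 / (1 - R)" for k
 proof -
  have "real k * R ^ k = (\<Sum>i<k. R ^ k)" by simp
  also have "\<dots> \<le> (\<Sum>i<k. R ^ i)"
   using R by (intro sum_mono power_decreasing) auto
  also have "\<dots> = (1 - R ^ k) / (1 - R)" using R by (simp add: sum_gp_strict)
  also have "\<dots> \<le> 1 / (1 - R)" using R by (intro divide_right_mono) auto
  finally show ?thesis .
 qed
 then have "norm (real k) \<le> (1 / (1 - R)) / R ^ k" for k
  using R by (subst pos_le_divide_eq) auto
 then show "\<exists>C. \<forall>k. norm (real k) \<le> C / R ^ k" by blast
qed

text \<open>
 The series is \<open>b d/db + c\<close> applied to the Poisson kernel, and the logarithmic derivative of the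
 kernel in \<open>b\<close> is at most of order \<open>1 / (1 - b)\<close>.
\<close>

lemma poisson_euler_bound:
 fixes y z :: "'a::euclidean_space"
 assumes y: "y \<in> sphere 0 1" and z: "z \<in> sphere 0 1" and b: "0 \<le> b" "b < 1" and c: "c \<ge> 0"
 shows "\<bar>\<Sum>k. (real k + c) * b ^ k * zonal k y z\<bar> \<le> (c + real DIM('a) + 2) / (1 - b) * poisson_ratio (b *\<^sub>R y) z"
proof -
 define n where "n = real DIM('a)"
 define l where "l = n / 2"
 define t where "t = y \<bullet> z"
 define D where "D s = 1 - 2 * s * t + s\<^sup>2" for s :: real
 define p where "p s = (1 - s\<^sup>2) * D s powr (- l)" for s
 have t1: "\<bar>t\<bar> \<le> 1" using Cauchy_Schwarz_ineq2[of y z] y z by (simp add: t_def)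
 then have t2: "t\<^sup>2 \<le> 1" by (simp add: abs_square_le_1)
 have Dsq: "D s = (s - t)\<^sup>2 + (1 - t\<^sup>2)" for s by (simp add: D_def power2_eq_square algebra_simps)
 have Dlow: "(1 - s)\<^sup>2 \<le> D s" if "0 \<le> s" for s
 proof -
  have "s * t \<le> s * 1" using t1 that by (intro mult_left_mono) auto
  then show ?thesis by (simp add: D_def power2_eq_square algebra_simps)
 qed
 have Dpos: "D s > 0" if "0 \<le> s" "s < 1" for s
  using Dlow[OF that(1)] zero_less_power[of "1 - s" 2] that by linarith
 have dist: "norm (s *\<^sub>R y - z) = sqrt (D s)" for s
 proof -
  have "(norm (s *\<^sub>R y - z))\<^sup>2 = D s"
   using y z unfolding power2_norm_eq_inner D_def t_def
   by (simp add: inner_diff norm_eq_1 inner_commute power2_eq_square algebra_simps)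
  then show ?thesis by (metis norm_ge_zero real_sqrt_unique)
 qed
 have pk: "poisson_ratio (s *\<^sub>R y) z = p s" if s: "0 \<le> s" "s < 1" for s
 proof -
  have ne: "s *\<^sub>R y \<noteq> z" using dist[of s] Dpos[OF s] by auto
  have "(s *\<^sub>R y - z) \<bullet> (s *\<^sub>R y - z) = D s"
   using dist[of s] Dpos[OF s] by (simp add: power2_norm_eq_inner[symmetric])
  moreover have "(s *\<^sub>R y) \<bullet> (s *\<^sub>R y) = s\<^sup>2" using y by (simp add: norm_eq_1 power2_eq_square)
  ultimately show ?thesis unfolding poisson_ratio_powr[OF ne] p_def l_def n_def by simp
 qed
 have sums: "(\<lambda>k. zonal k y z * s ^ k) sums p s" if s: "0 \<le> s" "s < 1" for s
 proof -
  have "(\<lambda>k. zonal k (s *\<^sub>R y) z) sums poisson_ratio (s *\<^sub>R y) z"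
   unfolding poisson_ratio_def by (rule zonal_sums) (use y z s in auto)
  then show ?thesis unfolding pk[OF s] by (simp add: zonal_scale mult.commute)
 qed
 define r where "r = (1 + b) / 2"
 have r: "b < r" "r < 1" "0 \<le> r" using b by (auto simp: r_def)
 define c' where "c' k = zonal k y z" for k
 have smr: "summable (\<lambda>k. c' k * r ^ k)" using sums[OF r(3,2)] by (simp add: sums_iff c'_def)
 have ext: "summable (\<lambda>k. c' k * x ^ k)" if "norm x < r" for x :: real
  by (rule powser_inside[OF smr]) (use that in simp)
 have deriv: "((\<lambda>x. \<Sum>k. c' k * x ^ k) has_real_derivative (\<Sum>k. diffs c' k * b ^ k)) (at b)"
  by (rule termdiffs_strong[OF smr]) (use b r in simp)
 have sd: "summable (\<lambda>k. diffs c' k * b ^ k)"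
  by (rule termdiff_converges[of _ r]) (use b r ext in auto)
 define P' where "P' = (\<Sum>k. diffs c' k * b ^ k)"
 have sk: "(\<lambda>k. real k * c' k * b ^ (k - Suc 0)) sums P'"
  unfolding P'_def by (rule diffs_equiv[OF sd])
 have P'_eq: "P' = - 2 * b * D b powr (- l) + (1 - b\<^sup>2) * ((- l) * D b powr (- l - 1) * (2 * (b - t)))" if "b > 0"
 proof -
  have dD: "(D has_real_derivative (2 * (b - t))) (at b)"
   unfolding D_def by (auto intro!: derivative_eq_intros)
  have "((\<lambda>s. D s powr (- l)) has_real_derivative ((- l) * D b powr (- l - 1) * (2 * (b - t)))) (at b)"
   by (rule DERIV_chain2[OF has_real_derivative_powr dD]) (rule Dpos[OF b])
  moreover have "((\<lambda>s. 1 - s\<^sup>2) has_real_derivative (- 2 * b)) (at b)"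
   by (auto intro!: derivative_eq_intros)
  ultimately have "((\<lambda>s. (1 - s\<^sup>2) * D s powr (- l)) has_real_derivative (- 2 * b * D b powr (- l) + ((- l) * D b powr (- l - 1) * (2 * (b - t))) * (1 - b\<^sup>2))) (at b)"
   by (intro DERIV_mult)
  then have "(p has_real_derivative (- 2 * b * D b powr (- l) + ((- l) * D b powr (- l - 1) * (2 * (b - t))) * (1 - b\<^sup>2))) (at b)"
   unfolding p_def .
  moreover have "(p has_real_derivative P') (at b)"
   using deriv unfolding P'_def[symmetric]
  proof (rule has_field_derivative_transform_within_open[of _ _ _ "{0<..<1}"])
   show "(\<Sum>k. c' k * x ^ k) = p x" if "x \<in> {0<..<1}" for x
    using sums[of x] that by (simp add: sums_iff c'_def)
  qed (use b that in auto)
  ultimately have "P' = - 2 * b * D b powr (- l) + ((- l) * D b powr (- l - 1) * (2 * (b - t))) * (1 - b\<^sup>2)"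
   by (rule DERIV_unique[symmetric])
  then show ?thesis by (simp add: mult_ac)
 qed
 have p0: "p b \<ge> 0" using pk[OF b] poisson_ratio_nonneg[of "b *\<^sub>R y" z] y b by simp
 have bP': "\<bar>b * P'\<bar> \<le> (n + 2) / (1 - b) * p b"
 proof (cases "b = 0")
  case True
  then show ?thesis using p0 by (simp add: n_def)
 next
  case False
  then have b0: "b > 0" using b by simp
  have A: "D b powr (- l - 1) = D b powr (- l) / D b"
   using Dpos[OF b] by (simp add: powr_diff)
  have ob: "1 - b\<^sup>2 > 0" using b by (simp add: power_less_one_iff abs_square_less_1)
  have e1: "- 2 * b * D b powr (- l) = - (2 * b / (1 - b\<^sup>2)) * p b"
   using ob by (simp add: p_def)
  have e2: "(1 - b\<^sup>2) * ((- l) * D b powr (- l - 1) * (2 * (b - t))) = - (n * ((b - t) / D b)) * p b"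
   unfolding A using Dpos[OF b] by (simp add: p_def l_def field_simps)
  have "b * P' = - (b * (2 * b / (1 - b\<^sup>2)) + b * (n * ((b - t) / D b))) * p b"
   unfolding P'_eq[OF b0] e1 e2 by (simp add: algebra_simps)
  then have "\<bar>b * P'\<bar> = \<bar>b * (2 * b / (1 - b\<^sup>2)) + b * (n * ((b - t) / D b))\<bar> * p b"
   by (simp only: abs_mult abs_minus_cancel abs_of_nonneg[OF p0])
  also have "\<dots> \<le> ((n + 2) / (1 - b)) * p b"
  proof (rule mult_right_mono[OF _ p0])
   have "b * (2 * b / (1 - b\<^sup>2)) \<le> 2 / (1 - b)"
   proof -
    have f: "1 - b\<^sup>2 = (1 - b) * (1 + b)" by (simp add: power2_eq_square algebra_simps)
    have "b * b \<le> 1" using b by (simp add: mult_le_one)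
    then have "b * (2 * b / (1 - b\<^sup>2)) \<le> 2 / ((1 - b) * (1 + b))"
     unfolding f using b by (simp add: divide_right_mono)
    also have "\<dots> \<le> 2 / (1 - b)"
     using b by (intro divide_left_mono mult_pos_pos) (auto simp: mult_left_le)
    finally show ?thesis .
   qed
   moreover have "b * (2 * b / (1 - b\<^sup>2)) \<ge> 0" using b ob by simp
   moreover have "\<bar>(b - t) / D b\<bar> \<le> 1 / (1 - b)"
   proof -
    have s1: "\<bar>b - t\<bar> \<le> sqrt (D b)"
     using Dsq[of b] t2 by (intro real_le_rsqrt) simp
    have s2: "1 - b \<le> sqrt (D b)"
     using Dlow[OF b(1)] by (intro real_le_rsqrt) simp
    have "\<bar>(b - t) / D b\<bar> = \<bar>b - t\<bar> / (sqrt (D b) * sqrt (D b))"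
     using Dpos[OF b] by simp
    also have "\<dots> \<le> sqrt (D b) / (sqrt (D b) * sqrt (D b))"
     by (intro divide_right_mono s1) simp
    also have "\<dots> = 1 / sqrt (D b)"
    proof -
     have "w / (w * w) = 1 / w" if "w \<noteq> 0" for w :: real using that by simp
     then show ?thesis using Dpos[OF b] by (metis less_irrefl real_sqrt_gt_0_iff)
    qed
    also have "\<dots> \<le> 1 / (1 - b)"
     using s2 b Dpos[OF b] by (intro divide_left_mono mult_pos_pos) auto
    finally show ?thesis .
   qed
   then have "\<bar>b * (n * ((b - t) / D b))\<bar> \<le> 1 * (n * (1 / (1 - b)))"
    unfolding abs_mult using b by (intro mult_mono mult_nonneg_nonneg) (auto simp: n_def)
   ultimately have "\<bar>b * (2 * b / (1 - b\<^sup>2)) + b * (n * ((b - t) / D b))\<bar> \<le> 2 / (1 - b) + n * (1 / (1 - b))"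
    by linarith
   also have "\<dots> = (n + 2) / (1 - b)" by (simp add: add_divide_distrib)
   finally show "\<bar>b * (2 * b / (1 - b\<^sup>2)) + b * (n * ((b - t) / D b))\<bar> \<le> (n + 2) / (1 - b)" .
  qed
  finally show ?thesis .
 qed
 have "(\<lambda>k. b * (real k * c' k * b ^ (k - Suc 0))) sums (b * P')"
  by (rule sums_mult[OF sk])
 moreover have "b * (real k * c' k * b ^ (k - Suc 0)) = real k * b ^ k * zonal k y z" for k
  by (cases k) (auto simp: c'_def)
 ultimately have "(\<lambda>k. real k * b ^ k * zonal k y z) sums (b * P')" by simp
 from sums_add[OF this sums_mult[OF sums[OF b], of c]]
 have "(\<lambda>k. (real k + c) * b ^ k * zonal k y z) sums (b * P' + c * p b)"
  by (simp add: algebra_simps)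
 then have "\<bar>\<Sum>k. (real k + c) * b ^ k * zonal k y z\<bar> = \<bar>b * P' + c * p b\<bar>"
  by (simp add: sums_iff)
 also have "\<dots> \<le> (n + 2) / (1 - b) * p b + c * p b"
  using abs_triangle_ineq[of "b * P'" "c * p b"] bP' abs_of_nonneg[OF mult_nonneg_nonneg[OF c p0]] by linarith
 also have "c * p b \<le> c / (1 - b) * p b"
  using b c p0 by (intro mult_right_mono) (simp_all add: le_divide_eq mult_left_le)
 finally show ?thesis unfolding pk[OF b] n_def by (simp add: add_divide_distrib distrib_right)
qed

text \<open>
 Young's inequality after normalising both factors.
\<close>

lemma holder_surface:
 fixes u v :: "'a::euclidean_space \<Rightarrow> complex"
 assumes u: "bounded_measurable u" and v: "bounded_measurable v"
  and q: "q > 1" "r > 1" "1 / q + 1 / r = 1"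
 shows "(LINT z|surface. cmod (u z) * cmod (v z)) \<le> sphere_Lq q u * sphere_Lq r v"
proof -
 let ?I = "LINT z|surface. cmod (u z) * cmod (v z)"
 have meas: "u \<in> borel_measurable surface" "v \<in> borel_measurable surface"
  using u v by (auto simp: bounded_measurable_def)
 obtain A where A: "A \<ge> 0" "\<And>z. z \<in> sphere 0 1 \<Longrightarrow> cmod (u z) \<le> A" using bounded_measurableE[OF u] by metis
 obtain B where B: "B \<ge> 0" "\<And>z. z \<in> sphere 0 1 \<Longrightarrow> cmod (v z) \<le> B" using bounded_measurableE[OF v] by metis
 have int: "integrable surface (\<lambda>z. cmod (u z) * cmod (v z))"
 proof (rule integrable_surface_bounded)
  show "(\<lambda>z. cmod (u z) * cmod (v z)) \<in> borel_measurable surface" using meas by measurable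
  show "norm (cmod (u z) * cmod (v z)) \<le> A * B" if "z \<in> sphere 0 1" for z
   using A B that by (auto intro!: mult_mono)
 qed
 have main: "?I \<le> (sphere_Lq q u + e) * (sphere_Lq r v + e)" if e: "e > 0" for e
 proof -
  define a where "a = sphere_Lq q u + e"
  define b where "b = sphere_Lq r v + e"
  have ab: "a > 0" "b > 0" using e sphere_Lq_nonneg[of q u] sphere_Lq_nonneg[of r v] by (auto simp: a_def b_def)
  have "?I / (a * b) = (LINT z|surface. (cmod (u z) / a) * (cmod (v z) / b))" by simp
  also have "\<dots> \<le> (LINT z|surface. (1 / (a powr q * q)) * cmod (u z) powr q + (1 / (b powr r * r)) * cmod (v z) powr r)"
  proof (rule integral_mono)
   show "integrable surface (\<lambda>z. (cmod (u z) / a) * (cmod (v z) / b))"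
    using integrable_divide[OF int, of "a * b"] by simp
   show "integrable surface (\<lambda>z. (1 / (a powr q * q)) * cmod (u z) powr q + (1 / (b powr r * r)) * cmod (v z) powr r)"
    using u v q by (intro Bochner_Integration.integrable_add integrable_mult_right integrable_cmod_powr) auto
   fix z :: 'a
   have "(cmod (u z) / a) * (cmod (v z) / b) \<le> (cmod (u z) / a) powr q / q + (cmod (v z) / b) powr r / r"
    using q ab by (intro Youngs_inequality) auto
   also have "\<dots> = (1 / (a powr q * q)) * cmod (u z) powr q + (1 / (b powr r * r)) * cmod (v z) powr r"
    using ab by (simp add: powr_divide)
   finally show "(cmod (u z) / a) * (cmod (v z) / b) \<le> (1 / (a powr q * q)) * cmod (u z) powr q + (1 / (b powr r * r)) * cmod (v z) powr r" .
  qed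
  also have "\<dots> = (1 / (a powr q * q)) * sphere_Lq q u powr q + (1 / (b powr r * r)) * sphere_Lq r v powr r"
   using integrable_cmod_powr[OF u, of q] integrable_cmod_powr[OF v, of r] q by (simp add: sphere_Lq_powr)
  also have "\<dots> \<le> (1 / (a powr q * q)) * a powr q + (1 / (b powr r * r)) * b powr r"
   using q e sphere_Lq_nonneg[of q u] sphere_Lq_nonneg[of r v]
   by (intro add_mono mult_left_mono powr_mono2) (auto simp: a_def b_def)
  also have "\<dots> = 1" using ab q by simp
  finally show ?thesis using ab by (simp add: pos_divide_le_eq a_def b_def)
 qed
 have "((\<lambda>e. (sphere_Lq q u + e) * (sphere_Lq r v + e)) \<longlongrightarrow> (sphere_Lq q u + 0) * (sphere_Lq r v + 0)) (at_right 0)"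
  by (intro tendsto_intros)
 moreover have "\<forall>\<^sub>F e in at_right 0. ?I \<le> (sphere_Lq q u + e) * (sphere_Lq r v + e)"
  using eventually_at_right_less by (rule eventually_mono) (rule main)
 ultimately show ?thesis
  using tendsto_lowerbound trivial_limit_at_right_real by fastforce
qed

lemma conjugate_exponent_cases:
 assumes q: "1 \<le> q" and q': "1 / ennreal q + 1 / q' = 1"
 obtains "q = 1" "q' = \<infinity>" | r where "q > 1" "r > 1" "1 / q + 1 / r = 1" "q' = ennreal r"
proof (cases "q = 1")
 case True
 then have "1 + 1 / q' = 1 + 0" using q' by simp
 then have "1 / q' = 0" by (subst (asm) ennreal_add_left_cancel) auto
 then have "q' = \<infinity>" by (simp add: divide_ennreal_def)
 then show thesis using that(1) True by blast
next
 case False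
 then have q1: "q > 1" using q by simp
 have e1: "1 / ennreal q = ennreal (1 / q)"
  using q by (simp add: divide_ennreal[symmetric] ennreal_1[symmetric] del: ennreal_1)
 have "q' \<noteq> \<infinity>"
 proof
  assume "q' = \<infinity>"
  then have "ennreal (1 / q) = ennreal 1" using q' e1 by simp
  then have "1 / q = 1" using q by (subst (asm) ennreal_inj) auto
  then show False using q1 by simp
 qed
 moreover have "q' \<noteq> 0"
 proof
  assume "q' = 0"
  then have "1 / q' = \<infinity>" by (simp add: divide_ennreal_def)
  then show False using q' by simp
 qed
 ultimately obtain r where r: "q' = ennreal r" "r > 0"
  by (cases q') (auto simp: less_le)
 have e2: "1 / q' = ennreal (1 / r)"
  using r by (simp add: divide_ennreal[symmetric] ennreal_1[symmetric] del: ennreal_1)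
 have "ennreal (1 / q + 1 / r) = ennreal 1"
  using q' e1 e2 q r by (simp add: ennreal_plus)
 then have s: "1 / q + 1 / r = 1" using q r by (subst (asm) ennreal_inj) auto
 moreover have "r > 1"
 proof -
  have "1 / q > 0" using q by simp
  then have "1 / r < 1" using s by linarith
  then show ?thesis using r(2) by (simp add: divide_less_eq)
 qed
 ultimately show thesis using that(2) q1 r by blast
qed

lemma bounded_measurable_mult_integrable:
 assumes "bounded_measurable u" "bounded_measurable v"
 shows "integrable surface (\<lambda>z. u z * v z)"
proof -
 obtain A where A: "A \<ge> 0" "\<And>z. z \<in> sphere 0 1 \<Longrightarrow> cmod (u z) \<le> A" and [measurable]: "u \<in> borel_measurable surface"
  using bounded_measurableE[OF assms(1)] by blast
 obtain B where B: "B \<ge> 0" "\<And>z. z \<in> sphere 0 1 \<Longrightarrow> cmod (v z) \<le> B" and [measurable]: "v \<in> borel_measurable surface"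
  using bounded_measurableE[OF assms(2)] by blast
 show ?thesis
 proof (rule integrable_surface_bounded)
  show "(\<lambda>z. u z * v z) \<in> borel_measurable surface" by measurable
  show "norm (u z * v z) \<le> A * B" if "z \<in> sphere 0 1" for z
   unfolding norm_mult using A B that by (intro mult_mono) auto
 qed
qed

lemma sphere_norm_duality_upper:
 fixes k \<phi> :: "'a::euclidean_space \<Rightarrow> complex"
 assumes q: "1 \<le> q" "1 / ennreal q + 1 / q' = 1"
  and k: "bounded_measurable k" and \<phi>: "bounded_measurable \<phi>"
  and A: "A \<ge> 0" "sphere_norm q' k \<le> ennreal A"
 shows "cmod (LINT z|surface. \<phi> z * k z) \<le> A * sphere_Lq q \<phi>"
proof -
 have int: "integrable surface (\<lambda>z. \<phi> z * k z)"
  by (rule bounded_measurable_mult_integrable[OF \<phi> k])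
 then have inta: "integrable surface (\<lambda>z. cmod (\<phi> z) * cmod (k z))"
  using integrable_norm[OF int] by (simp add: norm_mult)
 have 1: "cmod (LINT z|surface. \<phi> z * k z) \<le> (LINT z|surface. cmod (\<phi> z) * cmod (k z))"
  using integral_norm_bound[of surface "\<lambda>z. \<phi> z * k z"] by (simp add: norm_mult)
 from q show ?thesis
 proof (cases rule: conjugate_exponent_cases)
  case 1
  have "AE z in surface. ennreal (cmod (k z)) \<le> sphere_norm q' k"
   unfolding sphere_norm_def using 1(2) esssup_AE by simp
  then have ae: "AE z in surface. cmod (k z) \<le> A"
  proof eventually_elim
   case (elim z)
   then have "ennreal (cmod (k z)) \<le> ennreal A" using A(2) by (rule order_trans)
   then show ?case using A(1) by (simp add: ennreal_le_iff)
  qed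
  have "(LINT z|surface. cmod (\<phi> z) * cmod (k z)) \<le> (LINT z|surface. cmod (\<phi> z) powr 1 * A)"
  proof (rule integral_mono_AE[OF inta])
   show "integrable surface (\<lambda>z. cmod (\<phi> z) powr 1 * A)"
    by (intro integrable_mult_left integrable_cmod_powr \<phi>) simp
   show "AE z in surface. cmod (\<phi> z) * cmod (k z) \<le> cmod (\<phi> z) powr 1 * A"
    using ae by eventually_elim (auto intro: mult_left_mono)
  qed
  also have "\<dots> = A * sphere_Lq q \<phi>"
   using 1(1) by (simp add: sphere_Lq_def bochner_integral_nonneg)
  finally show ?thesis using \<open>cmod (LINT z|surface. \<phi> z * k z) \<le> _\<close> by linarith
 next
  case (2 r)
  have h: "(LINT z|surface. cmod (\<phi> z) * cmod (k z)) \<le> sphere_Lq q \<phi> * sphere_Lq r k"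
   by (rule holder_surface[OF \<phi> k 2(1,2,3)])
  have "sphere_Lq r k \<le> A"
   using A sphere_norm_finite[OF k, of r] 2 by (simp add: ennreal_le_iff)
  then have "sphere_Lq q \<phi> * sphere_Lq r k \<le> sphere_Lq q \<phi> * A"
   by (intro mult_left_mono sphere_Lq_nonneg)
  then have "cmod (LINT z|surface. \<phi> z * k z) \<le> sphere_Lq q \<phi> * A"
   using 1 h by linarith
  then show ?thesis by (simp add: mult.commute)
 qed
qed

text \<open>
 Test with \<open>cnj k\<close> times \<open>\<bar>k\<bar> powr (r - 2)\<close>, where \<open>r\<close> is the
 conjugate exponent. If it is infinite, testing with the conjugate phase of \<open>k\<close> on the set where
 \<open>\<bar>k\<bar> > A\<close> shows that this set is null.
\<close>

lemma sphere_norm_duality_lower: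
 fixes k :: "'a::euclidean_space \<Rightarrow> complex"
 assumes q: "1 \<le> q" "1 / ennreal q + 1 / q' = 1"
  and k: "bounded_measurable k" and A: "A \<ge> 0"
  and dual: "\<And>\<phi>. bounded_measurable \<phi> \<Longrightarrow> cmod (LINT z|surface. \<phi> z * k z) \<le> A * sphere_Lq q \<phi>"
 shows "sphere_norm q' k \<le> ennreal A"
proof -
 obtain B where B: "B \<ge> 0" "\<And>z. z \<in> sphere 0 1 \<Longrightarrow> cmod (k z) \<le> B" and m[measurable]: "k \<in> borel_measurable surface"
  using bounded_measurableE[OF k] by blast
 have kk: "k z * cnj (k z) = (complex_of_real (cmod (k z)))\<^sup>2" "cnj (k z) * k z = (complex_of_real (cmod (k z)))\<^sup>2" for z
  using complex_norm_square[of "k z"] by (simp_all add: mult.commute)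
 have cnj_k[measurable]: "(\<lambda>z. cnj (k z)) \<in> borel_measurable surface"
  by (rule measurable_compose[OF m borel_measurable_continuous_onI]) (intro continuous_intros)
 from q show ?thesis
 proof (cases rule: conjugate_exponent_cases)
  case 1
  show ?thesis
  proof (rule ccontr)
   assume "\<not> ?thesis"
   then have "ennreal A < esssup surface (\<lambda>z. ennreal (cmod (k z)))"
    using 1(2) by (simp add: sphere_norm_def not_le)
   then have "emeasure surface {z \<in> space surface. ennreal (cmod (k z)) > ennreal A} > 0"
    by (intro esssup_pos_measure) measurable
   moreover have "{z \<in> space surface. ennreal (cmod (k z)) > ennreal A} = {z \<in> space surface. cmod (k z) > A}"
    using A by (auto simp: ennreal_less_iff)
   ultimately have pos: "emeasure surface {z \<in> space surface. cmod (k z) > A} > 0" by simp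
   define \<phi> where "\<phi> z = (if cmod (k z) > A then cnj (sgn (k z)) else 0)" for z
   have S[measurable]: "{z \<in> space surface. cmod (k z) > A} \<in> sets surface" by measurable
   have \<phi>m: "\<phi> \<in> borel_measurable surface"
    unfolding \<phi>_def sgn_div_norm complex_cnj_scaleR by measurable
   have \<phi>: "bounded_measurable \<phi>"
    by (rule bounded_measurableI[OF \<phi>m, of 1]) (auto simp: \<phi>_def norm_sgn)
   have c\<phi>: "cmod (\<phi> z) = (if cmod (k z) > A then 1 else 0)" for z
    using A by (auto simp: \<phi>_def norm_sgn)
   have \<phi>k: "\<phi> z * k z = of_real (cmod (\<phi> z) * cmod (k z))" for z
   proof (cases "cmod (k z) > A")
    case True
    then have "k z \<noteq> 0" using A by auto
    moreover have "cnj (sgn (k z)) * k z = of_real ((cmod (k z))\<^sup>2 / cmod (k z))"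
     by (simp add: sgn_div_norm scaleR_conv_of_real divide_inverse kk mult_ac)
    ultimately show ?thesis using True c\<phi>[of z] by (simp add: \<phi>_def power2_eq_square)
   next
    case False
    then show ?thesis by (simp add: \<phi>_def)
   qed
   have i1: "integrable surface (\<lambda>z. cmod (\<phi> z) * cmod (k z))"
    using integrable_norm[OF bounded_measurable_mult_integrable[OF \<phi> k]] by (simp add: norm_mult)
   have i2: "integrable surface (\<lambda>z. cmod (\<phi> z))"
    using integrable_cmod_powr[OF \<phi>, of 1] by simp
   have "(LINT z|surface. cmod (\<phi> z) * cmod (k z)) = cmod (LINT z|surface. \<phi> z * k z)"
    unfolding \<phi>k integral_complex_of_real norm_of_real
    by (rule abs_of_nonneg[symmetric]) (auto intro: bochner_integral_nonneg)
   also have "\<dots> \<le> A * sphere_Lq q \<phi>" by (rule dual[OF \<phi>])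
   also have "sphere_Lq q \<phi> = (LINT z|surface. cmod (\<phi> z))"
    using 1(1) by (simp add: sphere_Lq_def bochner_integral_nonneg)
   finally have "(LINT z|surface. cmod (\<phi> z) * cmod (k z) - A * cmod (\<phi> z)) \<le> 0"
    using i1 i2 by simp
   moreover have nn: "0 \<le> cmod (\<phi> z) * cmod (k z) - A * cmod (\<phi> z)" for z
    unfolding c\<phi> by auto
   then have "(LINT z|surface. cmod (\<phi> z) * cmod (k z) - A * cmod (\<phi> z)) \<ge> 0"
    by (intro bochner_integral_nonneg)
   ultimately have "(LINT z|surface. cmod (\<phi> z) * cmod (k z) - A * cmod (\<phi> z)) = 0" by simp
   then have "AE z in surface. cmod (\<phi> z) * cmod (k z) - A * cmod (\<phi> z) = 0"
    using i1 i2 nn by (subst (asm) integral_nonneg_eq_0_iff_AE) auto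
   then have "AE z in surface. \<not> (cmod (k z) > A)"
    by eventually_elim (auto simp: c\<phi> split: if_splits)
   then have "emeasure surface {z \<in> space surface. cmod (k z) > A} = 0"
    using AE_iff_measurable[OF S, of "\<lambda>z. \<not> cmod (k z) > A"] by simp
   then show False using pos by simp
  qed
 next
  case (2 r)
  define \<phi> where "\<phi> z = (if k z = 0 then 0 else cnj (k z) * of_real (cmod (k z) powr (r - 2)))" for z
  have r: "(r - 1) * q = r" "r > 1" using 2 by (auto simp: field_simps)
  have c\<phi>: "cmod (\<phi> z) = cmod (k z) powr (r - 1)" for z
  proof (cases "k z = 0")
   case False
   then have "cmod (\<phi> z) = cmod (k z) powr 1 * cmod (k z) powr (r - 2)"
    by (simp add: \<phi>_def norm_mult)
   also have "\<dots> = cmod (k z) powr (1 + (r - 2))" by (rule powr_add[symmetric])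
   also have "1 + (r - 2) = r - 1" by simp
   finally show ?thesis .
  qed (simp add: \<phi>_def)
  have \<phi>m: "\<phi> \<in> borel_measurable surface" unfolding \<phi>_def by measurable
  have \<phi>: "bounded_measurable \<phi>"
   by (rule bounded_measurableI[OF \<phi>m, of "B powr (r - 1)"]) (use r B in \<open>auto simp: c\<phi> intro!: powr_mono2\<close>)
  have \<phi>k: "\<phi> z * k z = of_real (cmod (k z) powr r)" for z
  proof (cases "k z = 0")
   case False
   have "\<phi> z * k z = of_real ((cmod (k z))\<^sup>2 * cmod (k z) powr (r - 2))"
    using False by (simp add: \<phi>_def kk mult_ac)
   also have "(cmod (k z))\<^sup>2 * cmod (k z) powr (r - 2) = cmod (k z) powr r"
    using False by (simp add: powr_diff powr_numeral)
   finally show ?thesis .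
  qed (simp add: \<phi>_def)
  define K where "K = (LINT z|surface. cmod (k z) powr r)"
  have K0: "K \<ge> 0" unfolding K_def by (intro bochner_integral_nonneg) simp
  have "K = cmod (LINT z|surface. \<phi> z * k z)"
   unfolding \<phi>k integral_complex_of_real norm_of_real K_def[symmetric] using K0 by simp
  also have "\<dots> \<le> A * sphere_Lq q \<phi>" by (rule dual[OF \<phi>])
  also have "sphere_Lq q \<phi> = K powr (1 / q)"
   by (simp add: sphere_Lq_def c\<phi> powr_powr r K_def)
  finally have KA: "K \<le> A * K powr (1 / q)" .
  have "sphere_Lq r k \<le> A"
  proof (cases "K = 0")
   case True
   then show ?thesis using A by (simp add: sphere_Lq_def K_def)
  next
   case False
   then have Kp: "K > 0" using K0 by simp
   have "K powr (1 / r) * K powr (1 / q) = K"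
    using Kp 2(3) by (simp flip: powr_add add: add.commute)
   then have "K powr (1 / r) * K powr (1 / q) \<le> A * K powr (1 / q)" using KA by simp
   then have "K powr (1 / r) \<le> A" using Kp by simp
   then show ?thesis by (simp add: sphere_Lq_def K_def)
  qed
  then show ?thesis
   using sphere_norm_finite[OF k, of r] 2 by (simp add: ennreal_leI)
 qed
qed

section \<open>Fractional integration and condensation of singularities\<close>

lemma nn_integral_powr_from_0:
 assumes a: "a > -1" and c: "c \<ge> 0"
 shows "(\<integral>\<^sup>+ x. ennreal (indicator {0..c} x * x powr a) \<partial>lborel) = ennreal (c powr (a + 1) / (a + 1))"
proof (rule nn_integral_has_integral_lborel)
 have "((\<lambda>x. x powr a) has_integral (c powr (a + 1) / (a + 1))) {0..c}"
  by (rule has_integral_powr_from_0[OF a c])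
 then have "((\<lambda>x. if x \<in> {0..c} then x powr a else 0) has_integral (c powr (a + 1) / (a + 1))) UNIV"
  by (simp only: has_integral_restrict_UNIV)
 also have "(\<lambda>x. if x \<in> {0..c} then x powr a else 0) = (\<lambda>x. indicator {0..c} x * x powr a)"
  by (auto simp: indicator_def fun_eq_iff)
 finally show "((\<lambda>x. indicator {0..c} x * x powr a) has_integral (c powr (a + 1) / (a + 1))) UNIV" .
qed auto

text \<open>
 Split at \<open>t = \<rho>\<close>: below, \<open>1 - t \<rho> \<ge> 1 - t\<close>; above, \<open>1 - t
 \<rho> \<ge> 1 - \<rho>\<close>.
\<close>

lemma nn_integral_weight_bound:
 assumes k: "\<kappa> > 0" and t: "\<tau> > 0" and r: "0 \<le> \<rho>" "\<rho> < 1"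
 shows "(\<integral>\<^sup>+ t \<in> {0<..<1}. ennreal ((1 - t) powr (\<tau> - 1) * (1 - t * \<rho>) powr (- (\<kappa> + \<tau>))) \<partial>lborel)
   \<le> ennreal ((1 / \<tau> + 1 / \<kappa>) * (1 - \<rho>) powr (- \<kappa>))"
proof -
 let ?e = "- (\<kappa> + \<tau>)"
 let ?f = "\<lambda>t. ennreal (indicator {0..\<rho>} t * (1 - t) powr (- \<kappa> - 1))"
 let ?g = "\<lambda>t. ennreal ((1 - \<rho>) powr ?e) * ennreal (indicator {0..1 - \<rho>} (1 + (-1) * t) * (1 + (-1) * t) powr (\<tau> - 1))"
 have "(\<integral>\<^sup>+ t \<in> {0<..<1}. ennreal ((1 - t) powr (\<tau> - 1) * (1 - t * \<rho>) powr ?e) \<partial>lborel)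
   \<le> (\<integral>\<^sup>+ t. ?f t + ?g t \<partial>lborel)"
 proof (rule nn_integral_mono)
  fix t :: real
  show "ennreal ((1 - t) powr (\<tau> - 1) * (1 - t * \<rho>) powr ?e) * indicator {0<..<1} t \<le> ?f t + ?g t"
  proof (cases "t \<in> {0<..<1}")
   case False
   then show ?thesis by simp
  next
   case True
   then have t01: "0 < t" "t < 1" by auto
   show ?thesis
   proof (cases "t \<le> \<rho>")
    case True
    have "t * \<rho> \<le> t * 1" using t01 r by (intro mult_left_mono) auto
    then have "(1 - t * \<rho>) powr ?e \<le> (1 - t) powr ?e"
     using t01 k t by (intro powr_mono2') auto
    then have "(1 - t) powr (\<tau> - 1) * (1 - t * \<rho>) powr ?e \<le> (1 - t) powr (\<tau> - 1) * (1 - t) powr ?e"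
     by (intro mult_left_mono) auto
    also have "\<dots> = (1 - t) powr ((\<tau> - 1) + - (\<kappa> + \<tau>))" by (rule powr_add[symmetric])
    also have "(\<tau> - 1) + - (\<kappa> + \<tau>) = - \<kappa> - 1" by simp
    finally have "ennreal ((1 - t) powr (\<tau> - 1) * (1 - t * \<rho>) powr ?e) \<le> ?f t"
     using True t01 by (simp add: ennreal_leI)
    then show ?thesis using t01 by (simp add: add_increasing2)
   next
    case False
    have "t * \<rho> \<le> 1 * \<rho>" using t01 r by (intro mult_right_mono) auto
    then have "(1 - t * \<rho>) powr ?e \<le> (1 - \<rho>) powr ?e"
     using r k t by (intro powr_mono2') auto
    then have "(1 - t) powr (\<tau> - 1) * (1 - t * \<rho>) powr ?e \<le> (1 - \<rho>) powr ?e * (1 - t) powr (\<tau> - 1)"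
     using mult_right_mono[OF _ powr_ge_zero[of "1 - t" "\<tau> - 1"]] by (metis mult.commute)
    then have "ennreal ((1 - t) powr (\<tau> - 1) * (1 - t * \<rho>) powr ?e) \<le> ?g t"
     using False t01 by (simp add: ennreal_mult[symmetric] ennreal_leI)
    then show ?thesis using t01 by (simp add: add_increasing)
   qed
  qed
 qed
 also have "\<dots> = (\<integral>\<^sup>+ t. ?f t \<partial>lborel) + (\<integral>\<^sup>+ t. ?g t \<partial>lborel)"
  by (rule nn_integral_add) auto
 also have "(\<integral>\<^sup>+ t. ?f t \<partial>lborel) \<le> ennreal (1 / \<kappa> * (1 - \<rho>) powr (- \<kappa>))"
 proof -
  have "(\<integral>\<^sup>+ t. ennreal ((1 - t) powr (- \<kappa> - 1)) * indicator {0..\<rho>} t \<partial>lborel)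
    = ennreal ((1 - \<rho>) powr (- \<kappa>) / \<kappa> - (1 - 0) powr (- \<kappa>) / \<kappa>)"
  proof (rule nn_integral_FTC_Icc[where F = "\<lambda>t. (1 - t) powr (- \<kappa>) / \<kappa>"])
   fix x :: real assume x: "x \<in> {0..\<rho>}"
   have "((\<lambda>t. (1 - t) powr (- \<kappa>)) has_real_derivative ((- \<kappa>) * (1 - x) powr (- \<kappa> - 1) * (- 1))) (at x)"
    by (rule DERIV_chain2[OF has_real_derivative_powr]) (use x r in \<open>auto intro!: derivative_eq_intros\<close>)
   then have "((\<lambda>t. (1 - t) powr (- \<kappa>) / \<kappa>) has_real_derivative ((- \<kappa>) * (1 - x) powr (- \<kappa> - 1) * (- 1) / \<kappa>)) (at x)"
    by (rule DERIV_cdivide)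
   then show "((\<lambda>t. (1 - t) powr (- \<kappa>) / \<kappa>) has_real_derivative (1 - x) powr (- \<kappa> - 1)) (at x)"
    using k by simp
  qed (use r in auto)
  moreover have "ennreal (indicator {0..\<rho>} t * (1 - t) powr (- \<kappa> - 1)) = ennreal ((1 - t) powr (- \<kappa> - 1)) * indicator {0..\<rho>} t" for t
   by (simp add: indicator_def)
  ultimately show ?thesis using k by (simp add: ennreal_leI)
 qed
 also have "(\<integral>\<^sup>+ t. ?g t \<partial>lborel) = ennreal ((1 - \<rho>) powr ?e) * ennreal ((1 - \<rho>) powr \<tau> / \<tau>)"
 proof -
  have "(\<integral>\<^sup>+ x. ennreal (indicator {0..1 - \<rho>} x * x powr (\<tau> - 1)) \<partial>lborel)
    = ennreal \<bar>-1\<bar> * (\<integral>\<^sup>+ t. ennreal (indicator {0..1 - \<rho>} (1 + (-1) * t) * (1 + (-1) * t) powr (\<tau> - 1)) \<partial>lborel)"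
   by (rule nn_integral_real_affine) auto
  moreover have "(\<integral>\<^sup>+ x. ennreal (indicator {0..1 - \<rho>} x * x powr (\<tau> - 1)) \<partial>lborel) = ennreal ((1 - \<rho>) powr \<tau> / \<tau>)"
   using nn_integral_powr_from_0[of "\<tau> - 1" "1 - \<rho>"] r t by simp
  ultimately show ?thesis by (subst nn_integral_cmult) auto
 qed
 also have "\<dots> = ennreal (1 / \<tau> * (1 - \<rho>) powr (- \<kappa>))"
 proof -
  have "(1 - \<rho>) powr ?e * ((1 - \<rho>) powr \<tau> / \<tau>) = 1 / \<tau> * (1 - \<rho>) powr (- (\<kappa> + \<tau>) + \<tau>)"
   by (simp only: powr_add) simp
  then show ?thesis using t by (simp add: ennreal_mult[symmetric])
 qed
 finally have "(\<integral>\<^sup>+ t \<in> {0<..<1}. ennreal ((1 - t) powr (\<tau> - 1) * (1 - t * \<rho>) powr ?e) \<partial>lborel)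
   \<le> ennreal (1 / \<kappa> * (1 - \<rho>) powr (- \<kappa>)) + ennreal (1 / \<tau> * (1 - \<rho>) powr (- \<kappa>))"
  by (simp add: add_mono)
 also have "\<dots> = ennreal ((1 / \<tau> + 1 / \<kappa>) * (1 - \<rho>) powr (- \<kappa>))"
  using k t by (simp add: ennreal_plus[symmetric] algebra_simps del: ennreal_plus)
 finally show ?thesis .
qed

lemma beta_weight_moment:
 assumes a: "a > 0" and t: "\<tau> > 0"
 shows "has_bochner_integral lborel (\<lambda>t. indicator {0<..<1} t * (t powr (a - 1) * (1 - t) powr (\<tau> - 1)) * t ^ k) (Beta (real k + a) \<tau>)"
proof (rule has_bochner_integral_nn_integral)
 have "((\<lambda>t. t powr (real k + a - 1) * (1 - t) powr (\<tau> - 1)) has_integral Beta (real k + a) \<tau>) {0..1}"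
  by (rule has_integral_Beta_real) (use a t in auto)
 then have "((\<lambda>t. t powr (real k + a - 1) * (1 - t) powr (\<tau> - 1)) has_integral Beta (real k + a) \<tau>) {0<..<1}"
  by (simp add: has_integral_Icc_iff_Ioo)
 then have "((\<lambda>t. if t \<in> {0<..<1} then t powr (real k + a - 1) * (1 - t) powr (\<tau> - 1) else 0) has_integral Beta (real k + a) \<tau>) UNIV"
  by (simp only: has_integral_restrict_UNIV)
 also have "(\<lambda>t. if t \<in> {0<..<1} then t powr (real k + a - 1) * (1 - t) powr (\<tau> - 1) else 0)
   = (\<lambda>t. indicator {0<..<1} t * (t powr (a - 1) * (1 - t) powr (\<tau> - 1)) * t ^ k)"
 proof
  fix t :: real
  show "(if t \<in> {0<..<1} then t powr (real k + a - 1) * (1 - t) powr (\<tau> - 1) else 0)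
    = indicator {0<..<1} t * (t powr (a - 1) * (1 - t) powr (\<tau> - 1)) * t ^ k"
  proof (cases "t \<in> {0<..<1}")
   case True
   then have "t powr (real k + a - 1) = t powr real k * t powr (a - 1)"
    by (simp add: powr_add[symmetric] algebra_simps)
   then show ?thesis using True by (simp add: powr_realpow)
  qed simp
 qed
 finally have "((\<lambda>t. indicator {0<..<1} t * (t powr (a - 1) * (1 - t) powr (\<tau> - 1)) * t ^ k) has_integral Beta (real k + a) \<tau>) UNIV" .
 then show "(\<integral>\<^sup>+ t. ennreal (indicator {0<..<1} t * (t powr (a - 1) * (1 - t) powr (\<tau> - 1)) * t ^ k) \<partial>lborel) = ennreal (Beta (real k + a) \<tau>)"
  by (intro nn_integral_has_integral_lborel) (auto simp: indicator_def)
 show "0 \<le> Beta (real k + a) \<tau>" using a t by (simp add: Beta_def less_imp_le add_nonneg_pos)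
qed (auto simp: indicator_def)

text \<open>
 The quotient of Gamma functions is the reciprocal of a Beta integral up to the factor \<open>Gamma
 \<tau>\<close>. So the undifferentiated series at \<open>\<rho>\<close> is an average of the differentiated
 one at \<open>t \<rho>\<close> with weight \<open>t powr (a - 1) * (1 - t) powr (\<tau> - 1)\<close>.
\<close>

lemma fractional_integration_bound:
 fixes v :: "nat \<Rightarrow> complex"
 assumes a: "a \<ge> 1" and t: "\<tau> > 0" and k: "\<kappa> > 0" and A: "A \<ge> 0"
  and v: "\<And>r. 0 \<le> r \<Longrightarrow> r < 1 \<Longrightarrow> summable (\<lambda>k. norm (v k) * r ^ k)"
  and W: "\<And>r. 0 \<le> r \<Longrightarrow> r < 1 \<Longrightarrow>
   summable (\<lambda>k. norm (of_real (Gamma (real k + a + \<tau>) / Gamma (real k + a)) * v k) * r ^ k)"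
  and bound: "\<And>r. 0 \<le> r \<Longrightarrow> r < 1 \<Longrightarrow>
   cmod (\<Sum>k. of_real (r ^ k) * (of_real (Gamma (real k + a + \<tau>) / Gamma (real k + a)) * v k)) \<le> A * (1 - r) powr (- (\<kappa> + \<tau>))"
  and r: "0 \<le> \<rho>" "\<rho> < 1"
 shows "cmod (\<Sum>k. of_real (\<rho> ^ k) * v k) \<le> (1 / \<tau> + 1 / \<kappa>) / Gamma \<tau> * A * (1 - \<rho>) powr (- \<kappa>)"
proof -
 let ?F = "(1 / \<tau> + 1 / \<kappa>) * (1 - \<rho>) powr (- \<kappa>)"
 have a0: "a > 0" using a by simp
 define g where "g k = Gamma (real k + a + \<tau>) / Gamma (real k + a)" for k
 have g0: "g k > 0" for k using a0 t by (simp add: g_def)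
 define w where "w t = indicator {0<..<1} t * (t powr (a - 1) * (1 - t) powr (\<tau> - 1))" for t :: real
 have w0: "w t \<ge> 0" for t by (auto simp: w_def indicator_def)
 have Bg: "g k * Beta (real k + a) \<tau> = Gamma \<tau>" for k
 proof -
  have "Gamma (real k + a) > 0" "Gamma (real k + a + \<tau>) > 0"
   using a0 t by (auto intro!: Gamma_real_pos add_nonneg_pos)
  then show ?thesis by (simp add: g_def Beta_def)
 qed
 have mom: "has_bochner_integral lborel (\<lambda>t. w t * t ^ k) (Beta (real k + a) \<tau>)" for k
  unfolding w_def by (rule beta_weight_moment[OF a0 t])
 define h where "h k t = of_real (w t * t ^ k) * (of_real (g k * \<rho> ^ k) * v k)" for k t
 have hint: "has_bochner_integral lborel (h k) (of_real (Gamma \<tau>) * (of_real (\<rho> ^ k) * v k))" for k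
 proof -
  have "has_bochner_integral lborel (h k) (of_real (Beta (real k + a) \<tau>) * (of_real (g k * \<rho> ^ k) * v k))"
   unfolding h_def by (intro has_bochner_integral_mult_left has_bochner_integral_of_real mom)
  also have "of_real (Beta (real k + a) \<tau>) * (of_real (g k * \<rho> ^ k) * v k) = of_real (g k * Beta (real k + a) \<tau>) * (of_real (\<rho> ^ k) * v k)"
   by (simp add: mult_ac)
  finally show ?thesis unfolding Bg .
 qed
 have hnorm: "norm (h k t) = w t * (norm (of_real (g k) * v k) * (t * \<rho>) ^ k)" if "t \<ge> 0" for k t
  using that w0[of t] r g0[of k] by (simp add: h_def norm_mult norm_power power_mult_distrib mult_ac)
 have "(\<lambda>k. integral\<^sup>L lborel (h k)) sums (LINT t|lborel. (\<Sum>k. h k t))"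
 proof (rule sums_integral)
  show "integrable lborel (h k)" for k by (rule has_bochner_integral_iff[THEN iffD1, THEN conjunct1, OF hint])
  show "AE t in lborel. summable (\<lambda>k. norm (h k t))"
  proof (rule AE_I2)
   fix t :: real
   show "summable (\<lambda>k. norm (h k t))"
   proof (cases "t \<in> {0<..<1}")
    case True
    then have "0 \<le> t * \<rho>" "t * \<rho> < 1" using r by (auto intro: le_less_trans[OF mult_left_le_one_le])
    then have "summable (\<lambda>k. w t * (norm (of_real (g k) * v k) * (t * \<rho>) ^ k))"
     unfolding g_def by (intro summable_mult W)
    then show ?thesis using hnorm[of t] True by simp
   next
    case False
    then show ?thesis by (simp add: h_def w_def)
   qed
  qed
  have "(LINT t|lborel. norm (h k t)) = Gamma \<tau> * (norm (v k) * \<rho> ^ k)" for k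
  proof -
   have "(\<lambda>t. norm (h k t)) = (\<lambda>t. (w t * t ^ k) * (norm (of_real (g k) * v k) * \<rho> ^ k))"
   proof
    fix t :: real
    show "norm (h k t) = (w t * t ^ k) * (norm (of_real (g k) * v k) * \<rho> ^ k)"
     using hnorm[of t k] by (cases "t \<ge> 0") (auto simp: h_def w_def power_mult_distrib)
   qed
   then have "has_bochner_integral lborel (\<lambda>t. norm (h k t)) (Beta (real k + a) \<tau> * (norm (of_real (g k) * v k) * \<rho> ^ k))"
    using has_bochner_integral_mult_left[OF mom[of k]] by simp
   also have "Beta (real k + a) \<tau> * (norm (of_real (g k) * v k) * \<rho> ^ k) = (g k * Beta (real k + a) \<tau>) * (norm (v k) * \<rho> ^ k)"
    using g0[of k] by (simp add: norm_mult mult_ac)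
   finally show ?thesis unfolding Bg by (rule has_bochner_integral_integral_eq)
  qed
  then show "summable (\<lambda>k. LINT t|lborel. norm (h k t))"
   using v[OF r] by (simp add: summable_mult)
 qed
 moreover have "integral\<^sup>L lborel (h k) = of_real (Gamma \<tau>) * (of_real (\<rho> ^ k) * v k)" for k
  by (rule has_bochner_integral_integral_eq[OF hint])
 ultimately have s: "(\<lambda>k. of_real (Gamma \<tau>) * (of_real (\<rho> ^ k) * v k)) sums (LINT t|lborel. (\<Sum>k. h k t))"
  by simp
 have "summable (\<lambda>k. of_real (\<rho> ^ k) * v k)"
  by (rule summable_norm_cancel) (use v[OF r] r in \<open>simp add: norm_mult norm_power mult.commute\<close>)
 then have eq: "of_real (Gamma \<tau>) * (\<Sum>k. of_real (\<rho> ^ k) * v k) = (LINT t|lborel. (\<Sum>k. h k t))"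
  using s by (simp add: sums_iff suminf_mult)
 have G: "Gamma \<tau> > 0" using t by simp
 have "ennreal (cmod (LINT t|lborel. (\<Sum>k. h k t))) \<le> (\<integral>\<^sup>+ t. ennreal (norm (\<Sum>k. h k t)) \<partial>lborel)"
 proof (cases "integrable lborel (\<lambda>t. \<Sum>k. h k t)")
  case True
  then show ?thesis by (rule integral_norm_bound_ennreal)
 next
  case False
  then show ?thesis by (simp add: not_integrable_integral_eq)
 qed
 also have "\<dots> \<le> (\<integral>\<^sup>+ t. ennreal A * (ennreal ((1 - t) powr (\<tau> - 1) * (1 - t * \<rho>) powr (- (\<kappa> + \<tau>))) * indicator {0<..<1} t) \<partial>lborel)"
 proof (rule nn_integral_mono)
  fix t :: real
  show "ennreal (norm (\<Sum>k. h k t)) \<le> ennreal A * (ennreal ((1 - t) powr (\<tau> - 1) * (1 - t * \<rho>) powr (- (\<kappa> + \<tau>))) * indicator {0<..<1} t)"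
  proof (cases "t \<in> {0<..<1}")
   case False
   then show ?thesis by (simp add: h_def w_def)
  next
   case True
   then have tr: "0 \<le> t * \<rho>" "t * \<rho> < 1" using r by (auto intro: le_less_trans[OF mult_left_le_one_le])
   have sW: "summable (\<lambda>k. of_real ((t * \<rho>) ^ k) * (of_real (g k) * v k))"
   proof (rule summable_norm_cancel)
    have "norm (of_real ((t * \<rho>) ^ k) * (of_real (g k) * v k)) = norm (of_real (g k) * v k) * (t * \<rho>) ^ k" for k
    proof -
     have "norm (of_real p * u) = norm u * p" if "p \<ge> 0" for p and u :: complex
      using that by (simp add: norm_mult)
     from this[OF zero_le_power[OF tr(1)]] show ?thesis .
    qed
    then show "summable (\<lambda>k. norm (of_real ((t * \<rho>) ^ k) * (of_real (g k) * v k)))"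
     using W[OF tr] unfolding g_def by simp
   qed
   have "h k t = of_real (w t) * (of_real ((t * \<rho>) ^ k) * (of_real (g k) * v k))" for k
    by (simp add: h_def power_mult_distrib mult_ac)
   then have "(\<Sum>k. h k t) = of_real (w t) * (\<Sum>k. of_real ((t * \<rho>) ^ k) * (of_real (g k) * v k))"
    using sW by (simp add: suminf_mult)
   then have "norm (\<Sum>k. h k t) = w t * cmod (\<Sum>k. of_real ((t * \<rho>) ^ k) * (of_real (g k) * v k))"
    using w0[of t] by (simp add: norm_mult)
   also have "\<dots> \<le> (1 - t) powr (\<tau> - 1) * (A * (1 - t * \<rho>) powr (- (\<kappa> + \<tau>)))"
   proof (rule mult_mono)
    have "t powr (a - 1) \<le> 1" using True a by (intro powr_le1) auto
    then have "t powr (a - 1) * (1 - t) powr (\<tau> - 1) \<le> 1 * (1 - t) powr (\<tau> - 1)"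
     by (rule mult_right_mono) simp
    then show "w t \<le> (1 - t) powr (\<tau> - 1)" using True by (simp add: w_def)
    show "cmod (\<Sum>k. of_real ((t * \<rho>) ^ k) * (of_real (g k) * v k)) \<le> A * (1 - t * \<rho>) powr (- (\<kappa> + \<tau>))"
     using bound[OF tr] unfolding g_def .
   qed auto
   finally show ?thesis
    using True A by (simp add: ennreal_mult[symmetric] ennreal_leI mult_ac)
  qed
 qed
 also have "\<dots> = ennreal A * (\<integral>\<^sup>+ t \<in> {0<..<1}. ennreal ((1 - t) powr (\<tau> - 1) * (1 - t * \<rho>) powr (- (\<kappa> + \<tau>))) \<partial>lborel)"
  by (rule nn_integral_cmult) auto
 also have "\<dots> \<le> ennreal A * ennreal ?F"
  by (intro mult_left_mono nn_integral_weight_bound k t r) simp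
 also have "\<dots> = ennreal (A * ?F)"
  using A k t by (simp add: ennreal_mult)
 finally have "cmod (LINT t|lborel. (\<Sum>k. h k t)) \<le> A * ?F"
  using A k t by (subst (asm) ennreal_le_iff) auto
 then have "Gamma \<tau> * cmod (\<Sum>k. of_real (\<rho> ^ k) * v k) \<le> A * ?F"
  unfolding eq[symmetric] norm_mult using G by simp
 then have "cmod (\<Sum>k. of_real (\<rho> ^ k) * v k) \<le> A * ?F / Gamma \<tau>"
  using G by (simp add: pos_le_divide_eq mult.commute)
 then show ?thesis by (simp add: mult_ac)
qed

text \<open>
 A gliding hump. If the family were unbounded, choose members and points \<open>x n\<close> where the supremum
 \<open>K\<close> over the family exceeds \<open>4 ^ n\<close> and is attained up to the factor 2/3, and
 choose signs such that adding the \<open>n\<close>-th term never makes the sum at \<open>x n\<close> smaller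
 than this term. The tail after it is at most \<open>K (1/3)\<^sup>n / 2\<close>, less than the hump
 \<open>2/3 K (1/3)\<^sup>n\<close>, so the superposition is unbounded.
\<close>

lemma condensation_of_singularities:
 fixes t :: "'i \<Rightarrow> 'x \<Rightarrow> complex"
 assumes fin: "\<And>x. x \<in> X \<Longrightarrow> \<exists>K. \<forall>i\<in>I. cmod (t i x) \<le> K"
  and sub: "\<And>(i :: nat \<Rightarrow> 'i) e. (\<And>n. i n \<in> I) \<Longrightarrow> (\<And>n. e n = 1 \<or> e n = -1) \<Longrightarrow>
    \<exists>B. \<forall>x\<in>X. cmod (\<Sum>n. of_real (e n * (1/3) ^ n) * t (i n) x) \<le> B"
 shows "\<exists>C. \<forall>i\<in>I. \<forall>x\<in>X. cmod (t i x) \<le> C"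
proof (rule ccontr)
 assume neg: "\<not> (\<exists>C. \<forall>i\<in>I. \<forall>x\<in>X. cmod (t i x) \<le> C)"
 define K where "K x = (SUP i\<in>I. cmod (t i x))" for x
 have bdd: "bdd_above ((\<lambda>i. cmod (t i x)) ` I)" if "x \<in> X" for x
  using fin[OF that] by (auto intro: bdd_aboveI2)
 have up: "cmod (t i x) \<le> K x" if "i \<in> I" "x \<in> X" for i x
  unfolding K_def by (rule cSUP_upper[OF that(1) bdd[OF that(2)]])
 have "\<exists>i x. i \<in> I \<and> x \<in> X \<and> K x > 4 ^ n \<and> cmod (t i x) \<ge> 2/3 * K x" for n :: nat
 proof -
  obtain i x where ix: "i \<in> I" "x \<in> X" "cmod (t i x) > 4 ^ n" using neg by (metis not_le)
  have K4: "K x > 4 ^ n" using up[OF ix(1,2)] ix(3) by linarith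
  moreover have "(4::real) ^ n > 0" by simp
  ultimately have "2/3 * K x < K x" by linarith
  then obtain i' where "i' \<in> I" "2/3 * K x < cmod (t i' x)"
   using less_cSUP_iff[OF _ bdd[OF ix(2)], of "2/3 * K x"] ix(1) unfolding K_def by auto
  then show ?thesis using ix K4 by (intro exI[of _ i'] exI[of _ x]) auto
 qed
 then obtain i x where ix: "\<And>n. i n \<in> I" "\<And>n. x n \<in> X" "\<And>n. K (x n) > 4 ^ n" "\<And>n. cmod (t (i n) (x n)) \<ge> 2/3 * K (x n)"
  by metis
 define T where "T n m = t (i m) (x n)" for n m
 have "\<exists>e::nat \<Rightarrow> real. \<forall>n. (e n = 1 \<or> e n = -1) \<and>
   cmod ((\<Sum>m<n. of_real (e m * (1/3)^m) * T n m) + of_real (e n * (1/3)^n) * T n n) \<ge> (1/3)^n * cmod (T n n)"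
 proof (rule dependent_wellorder_choice)
  fix r :: real and f g :: "nat \<Rightarrow> real" and n :: nat
  assume "\<And>y. y < n \<Longrightarrow> f y = g y"
  then have "(\<Sum>m<n. of_real (f m * (1/3)^m) * T n m) = (\<Sum>m<n. of_real (g m * (1/3)^m) * T n m)"
   by (intro sum.cong) auto
  then show "((r = 1 \<or> r = -1) \<and> cmod ((\<Sum>m<n. of_real (f m * (1/3)^m) * T n m) + of_real (r * (1/3)^n) * T n n) \<ge> (1/3)^n * cmod (T n n))
   = ((r = 1 \<or> r = -1) \<and> cmod ((\<Sum>m<n. of_real (g m * (1/3)^m) * T n m) + of_real (r * (1/3)^n) * T n n) \<ge> (1/3)^n * cmod (T n n))"
   by simp
 next
  fix n :: nat and f :: "nat \<Rightarrow> real"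
  define u where "u = (\<Sum>m<n. of_real (f m * (1/3)^m) * T n m)"
  define v where "v = of_real ((1/3)^n) * T n n"
  \<comment> \<open>One of the two signs gives a sum at least as large as the new term.\<close>
  have "2 * cmod v \<le> cmod (u + v) + cmod (u - v)"
   using norm_triangle_ineq4[of "u + v" "u - v"] by (simp add: norm_mult)
  then have "cmod (u + v) \<ge> cmod v \<or> cmod (u - v) \<ge> cmod v" by linarith
  moreover have "cmod v = (1/3)^n * cmod (T n n)" by (simp add: v_def norm_mult norm_power)
  ultimately show "\<exists>r. (r = 1 \<or> r = -1) \<and> cmod ((\<Sum>m<n. of_real (f m * (1/3)^m) * T n m) + of_real (r * (1/3)^n) * T n n) \<ge> (1/3)^n * cmod (T n n)"
   unfolding u_def[symmetric]
   by (auto simp: v_def intro: exI[of _ 1] exI[of _ "-1"])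
 qed
 then obtain e :: "nat \<Rightarrow> real" where e: "\<And>n. e n = 1 \<or> e n = -1"
  and big: "\<And>n. cmod ((\<Sum>m<n. of_real (e m * (1/3)^m) * T n m) + of_real (e n * (1/3)^n) * T n n) \<ge> (1/3)^n * cmod (T n n)"
  by blast
 obtain B where B: "\<And>x. x \<in> X \<Longrightarrow> cmod (\<Sum>n. of_real (e n * (1/3) ^ n) * t (i n) x) \<le> B"
  using sub[of i e] ix(1) e by blast
 have "(4/3) ^ n / 6 \<le> B" for n
 proof -
  define a where "a m = of_real (e m * (1/3)^m) * T n m" for m
  have Kn: "K (x n) > 0" using ix(3)[of n] zero_less_power[of "4::real" n] by linarith
  have na: "cmod (a m) \<le> K (x n) * (1/3) ^ m" for m
  proof -
   have "\<bar>e m\<bar> = 1" using e[of m] by auto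
   then have "cmod (a m) = (1/3)^m * cmod (T n m)" by (simp add: a_def norm_mult norm_power abs_mult)
   also have "\<dots> \<le> (1/3)^m * K (x n)"
    unfolding T_def by (intro mult_left_mono up ix) simp
   finally show ?thesis by (simp add: mult.commute)
  qed
  have sg: "summable (\<lambda>m. K (x n) * (1/3) ^ m :: real)" by (intro summable_mult summable_geometric) simp
  have sa: "summable a" by (rule summable_comparison_test'[OF sg na])
  have tail: "cmod (\<Sum>m. a (m + Suc n)) \<le> K (x n) * (1/3) ^ n / 2"
  proof -
   have sg': "(\<lambda>m. (K (x n) * (1/3) ^ Suc n) * (1/3) ^ m) sums ((K (x n) * (1/3) ^ Suc n) * (1 / (1 - 1/3)))"
    by (intro sums_mult geometric_sums) simp
   have na': "cmod (a (m + Suc n)) \<le> (K (x n) * (1/3) ^ Suc n) * (1/3) ^ m" for m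
    using na[of "m + Suc n"] by (simp add: power_add mult_ac)
   have sn: "summable (\<lambda>m. cmod (a (m + Suc n)))"
    by (rule summable_comparison_test'[OF sums_summable[OF sg']]) (use na' in simp)
   have "cmod (\<Sum>m. a (m + Suc n)) \<le> (\<Sum>m. cmod (a (m + Suc n)))" by (rule summable_norm[OF sn])
   also have "\<dots> \<le> (\<Sum>m. (K (x n) * (1/3) ^ Suc n) * (1/3) ^ m)"
    by (rule suminf_le[OF na' sn sums_summable[OF sg']])
   also have "\<dots> = (K (x n) * (1/3) ^ Suc n) * (1 / (1 - 1/3))" using sg' by (simp only: sums_iff)
   also have "\<dots> = K (x n) * (1/3) ^ n / 2" by simp
   finally show ?thesis .
  qed
  have "suminf a = (\<Sum>m. a (m + Suc n)) + (\<Sum>m<Suc n. a m)"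
   by (rule suminf_split_initial_segment[OF sa])
  then have "cmod (\<Sum>m<Suc n. a m) \<le> cmod (suminf a) + cmod (\<Sum>m. a (m + Suc n))"
   by (metis add_diff_cancel_left' norm_triangle_ineq4)
  moreover have "cmod (\<Sum>m<Suc n. a m) \<ge> (1/3)^n * cmod (T n n)"
   using big[of n] by (simp add: a_def)
  moreover have "(1/3)^n * cmod (T n n) \<ge> (1/3)^n * (2/3 * K (x n))"
   unfolding T_def by (intro mult_left_mono ix) simp
  moreover have "cmod (suminf a) \<le> B"
   using B[OF ix(2)[of n]] by (simp add: a_def[abs_def] T_def)
  ultimately have "(1/3)^n * (2/3 * K (x n)) \<le> B + K (x n) * (1/3) ^ n / 2"
   using tail by linarith
  then have "(1/3)^n * K (x n) / 6 \<le> B" by (simp add: field_simps)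
  moreover have "(1/3)^n * 4 ^ n \<le> (1/3)^n * K (x n)"
   using ix(3)[of n] by (intro mult_left_mono) auto
  moreover have "(1/3)^n * 4 ^ n = (4/3 :: real) ^ n" by (simp flip: power_mult_distrib)
  ultimately show ?thesis by linarith
 qed
 moreover obtain n where "6 * B < (4/3 :: real) ^ n"
  using real_arch_pow[of "4/3" "6 * B"] by auto
 ultimately show False by (metis divide_le_eq_numeral1(1) mult.commute not_le)
qed

section \<open>Growth of derivatives of Poisson integrals\<close>

lemma norm_integral_le:
 fixes f :: "'b \<Rightarrow> 'c::{banach, second_countable_topology}"
 assumes g: "integrable M g" and le: "\<And>z. z \<in> space M \<Longrightarrow> norm (f z) \<le> g z"
 shows "norm (integral\<^sup>L M f) \<le> integral\<^sup>L M g"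
proof (cases "integrable M f")
 case True
 have "norm (integral\<^sup>L M f) \<le> (\<integral>x. norm (f x) \<partial>M)" by (rule integral_norm_bound)
 also have "\<dots> \<le> integral\<^sup>L M g" by (rule integral_mono) (use True g le in auto)
 finally show ?thesis .
next
 case False
 have "0 \<le> integral\<^sup>L M g"
  using le norm_ge_zero order_trans by (intro bochner_integral_nonneg) blast
 then show ?thesis using False by (simp add: not_integrable_integral_eq)
qed

text \<open>
 A function represented by a kernel below a multiple of the Poisson kernel is below the same multiple of a
 Poisson average. All comparisons of \<open>L\<^sup>q\<close> means are made through this.
\<close>

lemma poisson_avg_dominates:
 fixes \<phi> :: "'a::euclidean_space \<Rightarrow> complex"
 assumes \<phi>: "bounded_measurable \<phi>" and y: "y \<in> sphere 0 1" and b: "0 \<le> b" "b < 1"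
  and eq: "of_real (surface_area TYPE('a)) * w = (LINT z|surface. of_real (Q z) * \<phi> z)"
  and Q: "\<And>z. z \<in> sphere 0 1 \<Longrightarrow> \<bar>Q z\<bar> \<le> C * poisson_ratio (b *\<^sub>R y) z"
 shows "cmod w \<le> C * poisson_avg b \<phi> y"
proof -
 let ?\<sigma> = "surface_area TYPE('a)" and ?P = "poisson_ratio (b *\<^sub>R y)"
 have nb: "norm (b *\<^sub>R y) < 1" using y b by simp
 have "bounded_measurable (\<lambda>z. complex_of_real (?P z))"
  by (intro bounded_measurable_continuous continuous_on_of_real continuous_on_poisson_ratio nb)
 from integrable_norm[OF bounded_measurable_mult_integrable[OF this \<phi>]]
 have int: "integrable surface (\<lambda>z. ?P z * cmod (\<phi> z))"
  using nb poisson_ratio_nonneg[of "b *\<^sub>R y"] by (simp add: norm_mult)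
 have "?\<sigma> * cmod w = cmod (of_real ?\<sigma> * w)" by (simp add: norm_mult less_imp_le)
 also have "\<dots> \<le> (LINT z|surface. C * (?P z * cmod (\<phi> z)))"
  unfolding eq
 proof (rule norm_integral_le[OF integrable_mult_right[OF int]])
  show "norm (of_real (Q z) * \<phi> z) \<le> C * (?P z * cmod (\<phi> z))" if "z \<in> space surface" for z
   using mult_right_mono[OF Q, of z "cmod (\<phi> z)"] that by (simp add: norm_mult mult.assoc)
 qed
 also have "\<dots> = ?\<sigma> * (C * poisson_avg b \<phi> y)" unfolding poisson_avg_def by simp
 finally show ?thesis by (rule mult_left_le_imp_le) simp
qed

lemma subexponential_neg_binomial:
 assumes "l \<ge> 0" shows "subexponential (neg_binomial_coeff l)"
proof (rule subexponentialI)
 fix R :: real assume R: "0 < R" "R < 1"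
 have "summable (\<lambda>k. neg_binomial_coeff l k * R ^ k)"
  using assms R by (intro neg_binomial_summable) auto
 then have "Bseq (\<lambda>k. neg_binomial_coeff l k * R ^ k)"
  using convergent_imp_Bseq convergent_def summable_LIMSEQ_zero by blast
 then obtain B where B: "\<And>k. norm (neg_binomial_coeff l k * R ^ k) \<le> B" by (auto simp: Bseq_def)
 have "norm (neg_binomial_coeff l k) \<le> B / R ^ k" for k
  using B[of k] R by (simp add: pos_le_divide_eq abs_mult)
 then show "\<exists>C. \<forall>k. norm (neg_binomial_coeff l k) \<le> C / R ^ k" by blast
qed

text \<open>
 Quotients of successive terms are at most those of the coefficients of \<open>(1 - X) powr (- (s +
 1))\<close>.
\<close>

lemma subexponential_Gamma_ratio:
 fixes x s :: real
 assumes x: "x \<ge> 1" and s: "s \<ge> 0"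
 shows "subexponential (\<lambda>k. Gamma (real k + x + s) / Gamma (real k + x))"
proof -
 define g where "g k = Gamma (real k + x + s) / Gamma (real k + x)" for k
 have gp: "g k > 0" for k
  unfolding g_def using x s by (intro divide_pos_pos Gamma_real_pos) auto
 have rec: "g (Suc k) = g k * ((real k + x + s) / (real k + x))" for k
 proof -
  have "Gamma (real (Suc k) + x + s) = (real k + x + s) * Gamma (real k + x + s)"
   using Gamma_plus1[of "real k + x + s"] x s by (auto simp: add_ac nonpos_Ints_def)
  moreover have "Gamma (real (Suc k) + x) = (real k + x) * Gamma (real k + x)"
   using Gamma_plus1[of "real k + x"] x by (auto simp: add_ac nonpos_Ints_def)
  ultimately show ?thesis
   unfolding g_def times_divide_times_eq by (simp only: mult.commute)
 qed
 have le: "g k \<le> g 0 * neg_binomial_coeff (s + 1) k" for k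
 proof (induction k)
  case 0
  then show ?case by (simp add: neg_binomial_coeff_def)
 next
  case (Suc k)
  have "(real k + x + s) / (real k + x) \<le> (s + 1 + real k) / real (Suc k)"
   using x s mult_right_mono[OF x s] by (simp add: field_simps)
  then have "g (Suc k) \<le> (g 0 * neg_binomial_coeff (s + 1) k) * ((s + 1 + real k) / real (Suc k))"
   unfolding rec using Suc gp[of k] gp[of 0] x s
   by (intro mult_mono mult_nonneg_nonneg neg_binomial_coeff_nonneg) auto
  also have "\<dots> = g 0 * ((s + 1 + real k) * neg_binomial_coeff (s + 1) k / real (Suc k))" by simp
  also have "\<dots> = g 0 * neg_binomial_coeff (s + 1) (Suc k)"
   unfolding neg_binomial_coeff_Suc[symmetric] by simp
  finally show ?case .
 qed
 have "subexponential (\<lambda>k. g 0 * neg_binomial_coeff (s + 1) k)"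
  using s by (intro subexponential_mult subexponential_const subexponential_neg_binomial) simp
 then have "subexponential g"
  by (rule subexponential_mono) (use le gp in \<open>auto simp: less_imp_le intro: order_trans[OF _ abs_ge_self]\<close>)
 then show ?thesis by (simp add: g_def[abs_def])
qed

lemma subexponential_pochhammer:
 "subexponential (\<lambda>k. pochhammer (real k + x) N)"
proof (induction N)
 case 0
 then show ?case by (simp add: subexponential_const)
next
 case (Suc N)
 show ?case unfolding pochhammer_Suc
  by (intro subexponential_mult Suc subexponential_sum subexponential_of_nat subexponential_const)
qed

text \<open>
 A radius factors into two radii whose distances to 1 are both at least half of \<open>1 - r\<close>.
\<close>

lemma half_radius:
 fixes r :: real
 assumes "0 \<le> r" "r < 1"
 obtains R b where "1/2 \<le> R" "R < 1" "0 \<le> b" "b < 1" "b * R = r" "1 - R = (1 - r) / 2" "(1 - r) / 2 \<le> 1 - b"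
proof
 define R where "R = (1 + r) / 2"
 show "1/2 \<le> R" "R < 1" "1 - R = (1 - r) / 2" using assms by (auto simp: R_def field_simps)
 have R: "0 < R" "R < 1" using assms by (auto simp: R_def)
 show "0 \<le> r / R" "r / R * R = r" using assms R by auto
 show "r / R < 1" using assms R by (simp add: R_def)
 have "1 - r / R = ((1 - r) / 2) / R" using R by (simp add: field_simps R_def)
 also have "\<dots> \<ge> (1 - r) / 2"
  using R assms by (simp add: le_divide_eq mult_left_le)
 finally show "(1 - r) / 2 \<le> 1 - r / R" .
qed

context sh_basis
begin

text \<open>
 Radial multipliers: the same factor for all coefficients of one order.
\<close>

definition weighted :: "(nat \<Rightarrow> real) \<Rightarrow> (nat \<Rightarrow> nat \<Rightarrow> complex) \<Rightarrow> nat \<Rightarrow> nat \<Rightarrow> complex" where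
 "weighted w a k j = of_real (w k) * a k j"

lemma part_weighted: "part (weighted w a) k y = of_real (w k) * part a k y"
 by (simp add: part_def weighted_def sum_distrib_left mult.assoc)

lemma row_weighted: "row (weighted w a) k = \<bar>w k\<bar> * row a k"
 by (simp add: row_def weighted_def norm_mult sum_distrib_left)

lemma subexponential_weighted:
 assumes "subexponential w" "subexponential (row a)"
 shows "subexponential (row (weighted w a))"
proof -
 have "subexponential (\<lambda>k. w k * row a k)" using assms by (rule subexponential_mult)
 then show ?thesis by (rule subexponential_mono) (simp add: row_weighted abs_mult)
qed

lemma row_mult_le: "row (\<lambda>k j. a k j * b k j) k \<le> row a k * row b k"
proof -
 have "row (\<lambda>k j. a k j * b k j) k \<le> (\<Sum>j=1..d k. cmod (a k j) * row b k)"
  unfolding row_def norm_mult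
  by (intro sum_mono mult_left_mono member_le_sum) auto
 then show ?thesis by (simp add: row_def sum_distrib_right)
qed

lemma subexponential_row_mult:
 assumes "subexponential (row a)" "subexponential (row b)"
 shows "subexponential (row (\<lambda>k j. a k j * b k j))"
 by (rule subexponential_mono[OF subexponential_mult[OF assms]])
  (use row_mult_le row_nonneg in \<open>auto simp: abs_mult\<close>)

lemma row_Y_le: "y \<in> sphere 0 1 \<Longrightarrow> row (\<lambda>k j. of_real (Y k j y)) k \<le> real (d k) * Y_bound k"
 unfolding row_def using Y_le_bound by (simp add: sum_bounded_above[of "{1..d k}" _ "Y_bound k", simplified])

lemma subexponential_row_Y: "y \<in> sphere 0 1 \<Longrightarrow> subexponential (row (\<lambda>k j. of_real (Y k j y)))"
 by (rule subexponential_mono[OF subexponential_mult[OF subexponential_dim subexponential_Y_bound]])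
  (use row_Y_le row_nonneg Y_bound_nonneg in \<open>auto simp: abs_mult\<close>)

definition moment :: "('a \<Rightarrow> complex) \<Rightarrow> nat \<Rightarrow> nat \<Rightarrow> complex" where
 "moment \<phi> k j = (LINT z|surface. \<phi> z * of_real (Y k j z))"

lemma bounded_measurable_Y: "j \<in> {1..d k} \<Longrightarrow> bounded_measurable (\<lambda>z. complex_of_real (Y k j z))"
 by (intro bounded_measurable_continuous continuous_on_of_real continuous_on_Y)

lemma moment_le:
 assumes \<phi>: "bounded_measurable \<phi>" and j: "j \<in> {1..d k}"
 shows "cmod (moment \<phi> k j) \<le> (LINT z|surface. cmod (\<phi> z)) * Y_bound k"
proof -
 have "cmod (moment \<phi> k j) \<le> (LINT z|surface. cmod (\<phi> z) * Y_bound k)"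
  unfolding moment_def
 proof (rule norm_integral_le)
  show "integrable surface (\<lambda>z. cmod (\<phi> z) * Y_bound k)"
   using integrable_cmod_powr[OF \<phi>, of 1] by simp
  show "norm (\<phi> z * of_real (Y k j z)) \<le> cmod (\<phi> z) * Y_bound k" if "z \<in> space surface" for z
   using Y_le_bound[OF j] that by (auto simp: norm_mult intro!: mult_left_mono)
 qed
 then show ?thesis by simp
qed

lemma row_moment_le:
 assumes \<phi>: "bounded_measurable \<phi>"
 shows "row (moment \<phi>) k \<le> (LINT z|surface. cmod (\<phi> z)) * (real (d k) * Y_bound k)"
proof -
 have "row (moment \<phi>) k \<le> (\<Sum>j=1..d k. (LINT z|surface. cmod (\<phi> z)) * Y_bound k)"
  unfolding row_def by (intro sum_mono moment_le \<phi>)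
 then show ?thesis by (simp add: mult_ac)
qed

lemma subexponential_row_moment:
 assumes \<phi>: "bounded_measurable \<phi>"
 shows "subexponential (row (moment \<phi>))"
proof -
 have "subexponential (\<lambda>k. (LINT z|surface. cmod (\<phi> z)) * (real (d k) * Y_bound k))"
  by (intro subexponential_mult subexponential_const subexponential_dim subexponential_Y_bound)
 then show ?thesis
  by (rule subexponential_mono) (metis abs_ge_self abs_of_nonneg order_trans real_norm_def row_moment_le[OF \<phi>] row_nonneg)
qed

lemma zonal_moment_eq:
 assumes \<phi>: "bounded_measurable \<phi>" and y: "y \<in> sphere 0 1"
 shows "(LINT z|surface. \<phi> z * of_real (zonal k z y)) = of_real (surface_area TYPE('a)) * part (moment \<phi>) k y"
proof -
 have "(LINT z|surface. \<phi> z * of_real (zonal k z y))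
   = (LINT z|surface. (\<Sum>j=1..d k. (of_real (surface_area TYPE('a)) * of_real (Y k j y)) * (\<phi> z * of_real (Y k j z))))"
  by (intro bochner_integral_cong refl)
   (simp add: addition_theorem[OF _ y] sum_distrib_left mult_ac)
 also have "\<dots> = (\<Sum>j=1..d k. (LINT z|surface. (of_real (surface_area TYPE('a)) * of_real (Y k j y)) * (\<phi> z * of_real (Y k j z))))"
  by (rule bochner_integral_sum)
   (intro integrable_mult_right bounded_measurable_mult_integrable \<phi> bounded_measurable_Y)
 also have "\<dots> = of_real (surface_area TYPE('a)) * part (moment \<phi>) k y"
  unfolding integral_mult_right_zero by (simp add: moment_def part_def sum_distrib_left mult_ac)
 finally show ?thesis .
qed

lemma bounded_measurable_sh_series:
 assumes a: "subexponential (row a)" and r: "0 \<le> r" "r < 1"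
 shows "bounded_measurable (\<lambda>y. series a (r *\<^sub>R y))"
 using sh_series_bound[OF a r] measurable_sh_series[OF a r] unfolding bounded_measurable_def by metis

lemma poisson_extension_le:
 assumes \<phi>: "bounded_measurable \<phi>" and y: "y \<in> sphere 0 1" and b: "0 \<le> b" "b < 1"
 shows "cmod (series (moment \<phi>) (b *\<^sub>R y)) \<le> poisson_avg b \<phi> y"
proof -
 let ?\<sigma> = "surface_area TYPE('a)"
 obtain B where B: "\<And>z. z \<in> sphere 0 1 \<Longrightarrow> cmod (\<phi> z) \<le> B" and m: "\<phi> \<in> borel_measurable surface"
  using bounded_measurableE[OF \<phi>] by metis
 have nb: "norm (b *\<^sub>R y) < 1" using y b by simp
 have h: "of_real (b ^ k) * (LINT z|surface. \<phi> z * of_real (zonal k z y)) = of_real ?\<sigma> * (of_real (b ^ k) * part (moment \<phi>) k y)" for k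
  unfolding zonal_moment_eq[OF \<phi> y] by (simp only: mult_ac)
 have "(\<lambda>k. of_real ?\<sigma> * (of_real (b ^ k) * part (moment \<phi>) k y))
   sums (LINT z|surface. of_real (poisson_ratio (b *\<^sub>R y) z) * \<phi> z)"
  using poisson_integral_sums[OF m B y b] unfolding h .
 moreover have "(\<lambda>k. of_real ?\<sigma> * (of_real (b ^ k) * part (moment \<phi>) k y)) sums (of_real ?\<sigma> * series (moment \<phi>) (b *\<^sub>R y))"
  by (intro sums_mult sh_series_polar subexponential_row_moment \<phi> y b)
 ultimately have eq: "of_real ?\<sigma> * series (moment \<phi>) (b *\<^sub>R y) = (LINT z|surface. of_real (poisson_ratio (b *\<^sub>R y) z) * \<phi> z)"
  using sums_unique2 by blast
 have "cmod (series (moment \<phi>) (b *\<^sub>R y)) \<le> 1 * poisson_avg b \<phi> y"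
  by (rule poisson_avg_dominates[OF \<phi> y b eq]) (use nb poisson_ratio_nonneg[of "b *\<^sub>R y"] in simp)
 then show ?thesis by simp
qed

lemma euler_growth_step:
 assumes a: "subexponential (row a)" and y: "y \<in> sphere 0 1" and b: "0 \<le> b" "b < 1" and R: "0 \<le> R" "R < 1" and c: "c \<ge> 0"
 shows "cmod (series (weighted (\<lambda>k. real k + c) a) ((b * R) *\<^sub>R y))
   \<le> (c + real DIM('a) + 2) / (1 - b) * poisson_avg b (\<lambda>z. series a (R *\<^sub>R z)) y"
proof -
 let ?ea = "weighted (\<lambda>k. real k + c) a"
 let ?\<sigma> = "surface_area TYPE('a)" and ?\<phi> = "\<lambda>z. series a (R *\<^sub>R z)"
 let ?Q = "\<lambda>z. (\<Sum>k. (real k + c) * b ^ k * zonal k y z)"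
 have \<phi>: "bounded_measurable ?\<phi>" by (rule bounded_measurable_sh_series[OF a R])
 have w: "subexponential (\<lambda>k. real k + c)"
  by (intro subexponential_sum subexponential_of_nat subexponential_const)
 have bR: "0 \<le> b * R" "b * R < 1" using b R by (auto intro: le_less_trans[OF mult_left_le_one_le])
 have h: "of_real ((real k + c) * b ^ k) * (LINT z|surface. ?\<phi> z * of_real (zonal k z y))
   = of_real ?\<sigma> * (of_real ((b * R) ^ k) * part ?ea k y)" for k
  unfolding sh_series_zonal_moment[OF a R y] part_weighted by (simp add: power_mult_distrib mult_ac)
 have "(\<lambda>k. of_real ?\<sigma> * (of_real ((b * R) ^ k) * part ?ea k y))
   sums (LINT z|surface. of_real (?Q z) * ?\<phi> z)"
  using weighted_zonal_integral_sums[OF \<phi> w y b] unfolding h .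
 moreover have "(\<lambda>k. of_real ?\<sigma> * (of_real ((b * R) ^ k) * part ?ea k y))
   sums (of_real ?\<sigma> * series ?ea ((b * R) *\<^sub>R y))"
  by (intro sums_mult sh_series_polar subexponential_weighted w a y bR)
 ultimately have eq: "of_real ?\<sigma> * series ?ea ((b * R) *\<^sub>R y) = (LINT z|surface. of_real (?Q z) * ?\<phi> z)"
  using sums_unique2 by blast
 show ?thesis
  by (rule poisson_avg_dominates[OF \<phi> y b eq]) (rule poisson_euler_bound[OF y _ b c])
qed

lemma sphere_Lq_sh_series_mono:
 assumes a: "subexponential (row a)" and q: "q \<ge> 1" and r: "0 \<le> r" "r \<le> R" "R < 1"
 shows "sphere_Lq q (\<lambda>y. series a (r *\<^sub>R y)) \<le> sphere_Lq q (\<lambda>y. series a (R *\<^sub>R y))"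
proof (cases "r = R")
 case False
 then have R: "0 < R" "r < R" using r by auto
 define b where "b = r / R"
 have b: "0 \<le> b" "b < 1" "R * b = r" using r R by (auto simp: b_def)
 have \<phi>: "bounded_measurable (\<lambda>z. series a (R *\<^sub>R z))"
  by (rule bounded_measurable_sh_series[OF a]) (use R r in auto)
 have "sphere_Lq q (\<lambda>y. series a (r *\<^sub>R y)) \<le> 1 * sphere_Lq q (\<lambda>y. series a (R *\<^sub>R y))"
 proof (rule sphere_Lq_le_poisson_avg[OF \<phi> _ b(1,2) q])
  show "bounded_measurable (\<lambda>y. series a (r *\<^sub>R y))"
   by (rule bounded_measurable_sh_series[OF a]) (use r in auto)
  fix y :: 'a assume y: "y \<in> sphere 0 1"
  have nb: "norm (b *\<^sub>R y) < 1" using y b by simp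
  let ?\<sigma> = "surface_area TYPE('a)"
  have eq: "of_real ?\<sigma> * series a (r *\<^sub>R y) = (LINT z|surface. of_real (poisson_ratio (b *\<^sub>R y) z) * series a (R *\<^sub>R z))"
   using sh_series_poisson[OF a _ _ _, of R "b *\<^sub>R y"] R r nb b(3) by simp
  show "cmod (series a (r *\<^sub>R y)) \<le> 1 * poisson_avg b (\<lambda>y. series a (R *\<^sub>R y)) y"
   by (rule poisson_avg_dominates[OF \<phi> y b(1,2) eq]) (use nb poisson_ratio_nonneg[of "b *\<^sub>R y"] in simp)
 qed simp
 then show ?thesis by simp
qed simp

text \<open>
 Induction on \<open>N\<close>: each further factor \<open>k + c\<close> is an Euler derivative, estimated
 between the radii \<open>r\<close> and half-way to the boundary, which costs one factor \<open>1 / (1 -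
 r)\<close>.
\<close>

lemma pochhammer_growth:
 assumes q: "q \<ge> 1"
 shows "\<exists>C>0. \<forall>\<phi> r. bounded_measurable \<phi> \<longrightarrow> 0 \<le> r \<longrightarrow> r < 1 \<longrightarrow>
  sphere_Lq q (\<lambda>y. series (weighted (\<lambda>k. pochhammer (real k + real DIM('a) / 2) N) (moment \<phi>)) (r *\<^sub>R y))
   \<le> C / (1 - r) ^ N * sphere_Lq q \<phi>"
proof (induction N)
 case 0
 have w: "weighted (\<lambda>k. pochhammer (real k + real DIM('a) / 2) 0) a = a" for a
  by (simp add: weighted_def fun_eq_iff)
 have "sphere_Lq q (\<lambda>y. series (moment \<phi>) (r *\<^sub>R y)) \<le> 1 * sphere_Lq q \<phi>"
  if "bounded_measurable \<phi>" "0 \<le> r" "r < 1" for \<phi> r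
  by (rule sphere_Lq_le_poisson_avg[OF that(1) bounded_measurable_sh_series[OF subexponential_row_moment[OF that(1)] that(2,3)] that(2,3) q])
   (use poisson_extension_le[OF that(1) _ that(2,3)] in auto)
 then show ?case unfolding w by (intro exI[of _ 1]) auto
next
 case (Suc N)
 then obtain C where C: "C > 0" and IH: "\<And>\<phi> r. bounded_measurable \<phi> \<Longrightarrow> 0 \<le> r \<Longrightarrow> r < 1 \<Longrightarrow>
  sphere_Lq q (\<lambda>y. series (weighted (\<lambda>k. pochhammer (real k + real DIM('a) / 2) N) (moment \<phi>)) (r *\<^sub>R y))
   \<le> C / (1 - r) ^ N * sphere_Lq q \<phi>" by blast
 define c where "c = real DIM('a) / 2 + real N"
 define M where "M = c + real DIM('a) + 2"
 have M: "M > 0" "c \<ge> 0" by (auto simp: M_def c_def add_nonneg_pos)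
 have step: "sphere_Lq q (\<lambda>y. series (weighted (\<lambda>k. pochhammer (real k + real DIM('a) / 2) (Suc N)) (moment \<phi>)) (r *\<^sub>R y))
   \<le> (M * C * 2 ^ Suc N) / (1 - r) ^ Suc N * sphere_Lq q \<phi>"
  if \<phi>: "bounded_measurable \<phi>" and r: "0 \<le> r" "r < 1" for \<phi> r
 proof -
  let ?a = "weighted (\<lambda>k. pochhammer (real k + real DIM('a) / 2) N) (moment \<phi>)"
  have a: "subexponential (row ?a)"
   by (intro subexponential_weighted subexponential_pochhammer subexponential_row_moment \<phi>)
  have w: "weighted (\<lambda>k. pochhammer (real k + real DIM('a) / 2) (Suc N)) (moment \<phi>) = weighted (\<lambda>k. real k + c) ?a"
   by (simp add: weighted_def fun_eq_iff pochhammer_Suc c_def mult_ac add_ac)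
  obtain R b where Rb: "1/2 \<le> R" "R < 1" "0 \<le> b" "b < 1" "b * R = r" "1 - R = (1 - r) / 2" "(1 - r) / 2 \<le> 1 - b"
   using half_radius[OF r] by metis
  have R0: "0 \<le> R" using Rb by simp
  have aw: "subexponential (row (weighted (\<lambda>k. real k + c) ?a))"
   by (intro subexponential_weighted a subexponential_sum subexponential_of_nat subexponential_const)
  have "sphere_Lq q (\<lambda>y. series (weighted (\<lambda>k. real k + c) ?a) (r *\<^sub>R y))
    \<le> (M / (1 - b)) * sphere_Lq q (\<lambda>y. series ?a (R *\<^sub>R y))"
  proof (rule sphere_Lq_le_poisson_avg[OF bounded_measurable_sh_series[OF a R0 Rb(2)] bounded_measurable_sh_series[OF aw r] Rb(3,4) q])
   show "M / (1 - b) \<ge> 0" using M Rb by simp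
   show "cmod (series (weighted (\<lambda>k. real k + c) ?a) (r *\<^sub>R y)) \<le> M / (1 - b) * poisson_avg b (\<lambda>y. series ?a (R *\<^sub>R y)) y"
    if "y \<in> sphere 0 1" for y
    using euler_growth_step[OF a that Rb(3,4) R0 Rb(2) M(2)] unfolding Rb(5) M_def .
  qed
  also have "\<dots> \<le> (M / ((1 - r) / 2)) * (C / ((1 - r) / 2) ^ N * sphere_Lq q \<phi>)"
  proof (rule mult_mono)
   show "M / (1 - b) \<le> M / ((1 - r) / 2)"
    using M Rb r by (intro divide_left_mono mult_pos_pos) auto
   show "sphere_Lq q (\<lambda>y. series ?a (R *\<^sub>R y)) \<le> C / ((1 - r) / 2) ^ N * sphere_Lq q \<phi>"
    using IH[OF \<phi> R0 Rb(2)] unfolding Rb(6) .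
  qed (use M r in \<open>auto simp: sphere_Lq_nonneg\<close>)
  also have "\<dots> = (M * C * 2 ^ Suc N) / (1 - r) ^ Suc N * sphere_Lq q \<phi>"
   using r by (simp add: power_divide)
  finally show ?thesis unfolding w .
 qed
 show ?case
  by (intro exI[of _ "M * C * 2 ^ Suc N"]) (use M C step in auto)
qed

lemma moment_pairing:
 assumes \<phi>: "bounded_measurable \<phi>" and a: "subexponential (row a)" and r: "0 \<le> r" "r < 1"
 shows "(\<lambda>k. of_real (r ^ k) * (\<Sum>j=1..d k. a k j * moment \<phi> k j)) sums (LINT z|surface. \<phi> z * series a (r *\<^sub>R z))"
proof -
 obtain B where B: "B \<ge> 0" "\<And>z. z \<in> sphere 0 1 \<Longrightarrow> cmod (\<phi> z) \<le> B" and m: "\<phi> \<in> borel_measurable surface"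
  using bounded_measurableE[OF \<phi>] by metis
 let ?h = "\<lambda>k z. \<phi> z * (of_real (r ^ k) * part a k z)"
 have "(\<lambda>k. LINT z|surface. ?h k z) sums (LINT z|surface. (\<Sum>k. ?h k z))"
 proof (rule surface_integral_sums)
  show "?h k \<in> borel_measurable surface" for k using m measurable_part by measurable
  show "summable (\<lambda>k. B * (r ^ k * (row a k * Y_bound k)))"
   by (intro summable_mult part_summable a r)
  show "norm (?h k z) \<le> B * (r ^ k * (row a k * Y_bound k))" if z: "z \<in> sphere 0 1" for k z
   unfolding norm_mult[of "\<phi> z"] using B(2)[OF z] norm_term_le[OF z r(1), of k a] B(1)
   by (intro mult_mono) auto
 qed
 moreover have "(LINT z|surface. (\<Sum>k. ?h k z)) = (LINT z|surface. \<phi> z * series a (r *\<^sub>R z))"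
 proof (rule bochner_integral_cong[OF refl])
  fix z :: 'a assume "z \<in> space surface"
  then have "(\<lambda>k. ?h k z) sums (\<phi> z * series a (r *\<^sub>R z))"
   by (intro sums_mult sh_series_polar a r) simp
  then show "(\<Sum>k. ?h k z) = \<phi> z * series a (r *\<^sub>R z)" by (simp add: sums_iff)
 qed
 moreover have "(LINT z|surface. ?h k z) = of_real (r ^ k) * (\<Sum>j=1..d k. a k j * moment \<phi> k j)" for k
 proof -
  have "(LINT z|surface. ?h k z) = (LINT z|surface. (\<Sum>j=1..d k. (of_real (r ^ k) * a k j) * (\<phi> z * of_real (Y k j z))))"
   by (intro bochner_integral_cong refl) (simp add: part_def sum_distrib_left mult_ac)
  also have "\<dots> = (\<Sum>j=1..d k. (LINT z|surface. (of_real (r ^ k) * a k j) * (\<phi> z * of_real (Y k j z))))"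
   by (rule bochner_integral_sum)
    (intro integrable_mult_right bounded_measurable_mult_integrable \<phi> bounded_measurable_Y)
  also have "\<dots> = of_real (r ^ k) * (\<Sum>j=1..d k. a k j * moment \<phi> k j)"
   unfolding integral_mult_right_zero by (simp add: moment_def sum_distrib_left mult_ac)
  finally show ?thesis .
 qed
 ultimately show ?thesis by simp
qed

end

section \<open>The kernel condition and its sufficiency\<close>

lemma sphere_norm_cong:
 assumes eq: "\<And>z. z \<in> sphere 0 1 \<Longrightarrow> u z = v z" and u: "u \<in> borel_measurable surface"
 shows "sphere_norm q u = sphere_norm q v"
proof -
 have v: "v \<in> borel_measurable surface"
  using u measurable_cong[of surface u v borel] eq by simp
 have "esssup surface (\<lambda>x. ennreal (cmod (u x))) = esssup surface (\<lambda>x. ennreal (cmod (v x)))"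
  by (rule esssup_AE_cong) (use u v eq in \<open>auto intro!: AE_I2\<close>)
 moreover have "(\<integral>\<^sup>+ x. ennreal (cmod (u x) powr enn2real q) \<partial>surface) = (\<integral>\<^sup>+ x. ennreal (cmod (v x) powr enn2real q) \<partial>surface)"
  by (rule nn_integral_cong) (use eq in simp)
 ultimately show ?thesis by (simp add: sphere_norm_def)
qed

lemma ennreal_powr_ennreal: "0 \<le> x \<Longrightarrow> ennreal_powr (ennreal x) a = ennreal (x powr a)"
 by (simp add: ennreal_powr_def)

lemma integral_mean_eq:
 assumes f: "continuous_on (ball 0 1) f" and r: "0 \<le> r" "r < 1" and q: "q > 0"
 shows "bounded_measurable (\<lambda>y. f (r *\<^sub>R y))" "integral_mean q f r = ennreal (sphere_Lq q (\<lambda>y. f (r *\<^sub>R y)))"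
proof -
 show "bounded_measurable (\<lambda>y. f (r *\<^sub>R y))"
  using bounded_on_sphere[OF f r] bounded_measurable_continuous by metis
 then show "integral_mean q f r = ennreal (sphere_Lq q (\<lambda>y. f (r *\<^sub>R y)))"
  unfolding integral_mean_def by (rule sphere_norm_finite) (rule q)
qed

lemma boundary_weight_lower:
 fixes r R e :: real
 assumes R: "1/2 \<le> R" "R < 1" and r: "R < r" "r < (1 + R) / 2"
 shows "(1 - r\<^sup>2) powr e * r ^ n \<ge> min ((1/2) powr e) (2 powr e) * (1/2) ^ n * (1 - R) powr e"
proof -
 have r1: "0 < r" "r < 1" using R r by auto
 have f: "1 - r\<^sup>2 = (1 - r) * (1 + r)" by (simp add: power2_eq_square algebra_simps)
 have "(1 - R) / 2 \<le> (1 - r) * 1" using r by (simp add: field_simps)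
 also have "\<dots> \<le> (1 - r) * (1 + r)" using r1 by (intro mult_left_mono) auto
 finally have lo: "(1 - R) / 2 \<le> 1 - r\<^sup>2" unfolding f .
 have hi: "1 - r\<^sup>2 \<le> (1 - R) * 2" unfolding f using r r1 by (intro mult_mono) auto
 have "min ((1/2) powr e) (2 powr e) * (1 - R) powr e \<le> (1 - r\<^sup>2) powr e"
 proof (cases "e \<ge> 0")
  case True
  have "min ((1/2) powr e) (2 powr e) * (1 - R) powr e \<le> (1/2) powr e * (1 - R) powr e"
   by (intro mult_right_mono) auto
  also have "\<dots> = ((1 - R) / 2) powr e" using R by (simp add: powr_mult[symmetric])
  also have "\<dots> \<le> (1 - r\<^sup>2) powr e" using lo True R by (intro powr_mono2) auto
  finally show ?thesis .
 next
  case False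
  have "min ((1/2) powr e) (2 powr e) * (1 - R) powr e \<le> 2 powr e * (1 - R) powr e"
   by (intro mult_right_mono) auto
  also have "\<dots> = ((1 - R) * 2) powr e" unfolding powr_mult by (rule mult.commute)
  also have "\<dots> \<le> (1 - r\<^sup>2) powr e" using hi lo False R by (intro powr_mono2') auto
  finally show ?thesis .
 qed
 moreover have "(1/2) ^ n \<le> r ^ n" using R r by (intro power_mono) auto
 ultimately have "(min ((1/2) powr e) (2 powr e) * (1 - R) powr e) * (1/2) ^ n \<le> (1 - r\<^sup>2) powr e * r ^ n"
  by (intro mult_mono) auto
 then show ?thesis by (simp add: mult_ac)
qed

context sh_basis
begin

lemma sh_series_cong:
 "(\<And>k j. j \<in> {1..d k} \<Longrightarrow> a k j = b k j) \<Longrightarrow> series a = series b"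
 by (simp add: sh_series_def sh_term_def fun_eq_iff)

lemma harmonic_eq_sh_series:
 assumes "harmonic_on (ball 0 1) f" "x \<in> ball 0 1"
 shows "f x = series (sh_coeff d Y f) x"
 using harmonic_expansion(1)[OF assms] by (simp add: sh_series_def sums_iff)

lemma sh_coeff_sh_series:
 assumes "subexponential (row a)" "j \<in> {1..d k}"
 shows "sh_coeff d Y (series a) k j = a k j"
 using sh_coeff_eq[OF sh_series_sums[OF assms(1)], of k j] assms(2) by auto

text \<open>
 The means increase with the radius, so the part of the norm integral over \<open>(R, (1 + R) / 2)\<close>
 already controls the mean at \<open>R\<close>.
\<close>

lemma B_space_growth:
 fixes f :: "'a \<Rightarrow> complex"
 assumes f: "f \<in> B_space p q \<alpha>" and p: "p > 0" and q: "q \<ge> 1" and \<alpha>: "\<alpha> > 0"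
 obtains M where "M \<ge> 0" "\<And>R. 1/2 \<le> R \<Longrightarrow> R < 1 \<Longrightarrow> sphere_Lq q (\<lambda>y. f (R *\<^sub>R y)) \<le> M * (1 - R) powr (- \<alpha>)"
proof -
 have H: "harmonic_on (ball 0 1) f" using f by (simp add: B_space_def harmonic_ball_def)
 have cf: "continuous_on (ball 0 1) f" by (rule harmonic_on_imp_continuous[OF H])
 have sub: "subexponential (row (sh_coeff d Y f))" by (rule harmonic_expansion(3)[OF H])
 define L where "L r = sphere_Lq q (\<lambda>y. f (r *\<^sub>R y))" for r
 have L0: "L r \<ge> 0" for r by (simp add: L_def sphere_Lq_nonneg)
 have Leq: "L r = sphere_Lq q (\<lambda>y. series (sh_coeff d Y f) (r *\<^sub>R y))" if "0 \<le> r" "r < 1" for r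
  unfolding L_def sphere_Lq_def
  by (intro arg_cong[of _ _ "\<lambda>I. I powr (1 / q)"] bochner_integral_cong refl)
   (use harmonic_eq_sh_series[OF H] that in simp)
 have Lmono: "L r \<le> L R" if "0 \<le> r" "r \<le> R" "R < 1" for r R
  using sphere_Lq_sh_series_mono[OF sub q that] Leq[of r] Leq[of R] that by simp
 define n where "n = DIM('a) - 1"
 define e where "e = \<alpha> * p - 1"
 define J where "J = (\<integral>\<^sup>+ r \<in> {0<..<1}. ennreal_powr (integral_mean q f r) p * ennreal ((1 - r\<^sup>2) powr e * r ^ n) \<partial>lborel)"
 have "J \<noteq> \<infinity>"
  using f unfolding B_space_def J_def e_def n_def by (auto simp: ennreal_powr_def split: if_splits)
 then obtain J' where J': "J = ennreal J'" "J' \<ge> 0" by (cases J) auto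
 define c0 where "c0 = min ((1/2) powr e) (2 powr e) * (1/2) ^ n"
 have c0: "c0 > 0" by (simp add: c0_def)
 define M where "M = (2 * J' / c0) powr (1 / p)"
 show thesis
 proof
  show "M \<ge> 0" by (simp add: M_def)
  fix R :: real assume R: "1/2 \<le> R" "R < 1"
  define v where "v = L R powr p * (c0 * (1 - R) powr e)"
  have v0: "v \<ge> 0" using c0 by (simp add: v_def)
  have "ennreal (v * ((1 - R) / 2)) = (\<integral>\<^sup>+ r. ennreal v * indicator {R<..<(1 + R) / 2} r \<partial>lborel)"
  proof -
   have "(1 + R) / 2 - R = (1 - R) / 2" by (simp add: field_simps)
   then show ?thesis using R v0 by (simp add: nn_integral_cmult_indicator ennreal_mult[symmetric])
  qed
  also have "\<dots> \<le> J"
   unfolding J_def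
  proof (rule nn_integral_mono)
   fix r :: real
   show "ennreal v * indicator {R<..<(1 + R) / 2} r
     \<le> ennreal_powr (integral_mean q f r) p * ennreal ((1 - r\<^sup>2) powr e * r ^ n) * indicator {0<..<1} r"
   proof (cases "r \<in> {R<..<(1 + R) / 2}")
    case True
    then have r: "R < r" "r < (1 + R) / 2" "0 < r" "r < 1" using R by auto
    have "integral_mean q f r = ennreal (L r)"
     unfolding L_def by (rule integral_mean_eq[OF cf]) (use r q in auto)
    then have im: "ennreal_powr (integral_mean q f r) p = ennreal (L r powr p)"
     using L0 by (simp add: ennreal_powr_ennreal)
    have "v \<le> L r powr p * ((1 - r\<^sup>2) powr e * r ^ n)"
     unfolding v_def
    proof (rule mult_mono)
     show "L R powr p \<le> L r powr p"
      using Lmono[of R r] R r L0 p by (intro powr_mono2) auto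
     show "c0 * (1 - R) powr e \<le> (1 - r\<^sup>2) powr e * r ^ n"
      unfolding c0_def by (rule boundary_weight_lower[OF R r(1,2)])
    qed (use c0 in auto)
    then show ?thesis using True r by (simp add: im ennreal_mult[symmetric] ennreal_leI)
   qed simp
  qed
  finally have vJ: "v * ((1 - R) / 2) \<le> J'" unfolding J'(1) using J'(2) by (simp add: ennreal_le_iff)
  have e1: "(1 - R) powr e * (1 - R) = (1 - R) powr (\<alpha> * p)"
  proof -
   have "(1 - R) powr e * (1 - R) powr 1 = (1 - R) powr (e + 1)" by (rule powr_add[symmetric])
   then show ?thesis using R by (simp add: e_def)
  qed
  have "L R powr p * c0 * (1 - R) powr (\<alpha> * p) \<le> 2 * J'"
   using vJ unfolding e1[symmetric] v_def by (simp add: mult_ac)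
  then have "L R powr p \<le> (2 * J' / c0) * (1 - R) powr (- (\<alpha> * p))"
   using c0 R by (simp add: powr_minus divide_simps mult_ac)
  then have "(L R powr p) powr (1 / p) \<le> ((2 * J' / c0) * (1 - R) powr (- (\<alpha> * p))) powr (1 / p)"
   using p by (intro powr_mono2) auto
  also have "\<dots> = M * (1 - R) powr (- \<alpha>)"
   unfolding M_def powr_mult powr_powr using p by simp
  finally show "sphere_Lq q (\<lambda>y. f (R *\<^sub>R y)) \<le> M * (1 - R) powr (- \<alpha>)"
   using p L0[of R] by (simp add: powr_powr L_def)
 qed
qed

text \<open>
 The multiplier of the fractional derivative of order \<open>s\<close>.
\<close>

definition frac_weight :: "real \<Rightarrow> nat \<Rightarrow> real" where
 "frac_weight s k = Gamma (real k + real DIM('a) / 2 + s) / (Gamma (real k + real DIM('a) / 2) * Gamma s)"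

lemma subexponential_frac_weight:
 assumes "DIM('a) \<ge> 2" "s > 0"
 shows "subexponential (frac_weight s)"
proof -
 have "subexponential (\<lambda>k. Gamma (real k + real DIM('a) / 2 + s) / Gamma (real k + real DIM('a) / 2) * (1 / Gamma s))"
  using assms by (intro subexponential_mult subexponential_const subexponential_Gamma_ratio) auto
 then show ?thesis by (simp add: frac_weight_def[abs_def])
qed

text \<open>
 The fractional derivative of order \<open>s\<close> of the multiplier applied to the Poisson integral of
 \<open>\<phi>\<close>.
\<close>

abbreviation frac_series :: "real \<Rightarrow> (nat \<Rightarrow> nat \<Rightarrow> complex) \<Rightarrow> ('a \<Rightarrow> complex) \<Rightarrow> 'a \<Rightarrow> complex" where
 "frac_series s c \<phi> \<equiv> series (weighted (frac_weight s) (\<lambda>k j. c k j * moment \<phi> k j))"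

text \<open>
 The dual form of the kernel condition. Bounded functions suffice as test functions, and for them all series
 converge.
\<close>

definition frac_multiplier_bound :: "(nat \<Rightarrow> nat \<Rightarrow> complex) \<Rightarrow> real \<Rightarrow> real \<Rightarrow> real \<Rightarrow> real \<Rightarrow> bool" where
 "frac_multiplier_bound c q s \<kappa> C \<longleftrightarrow> (\<forall>\<phi> \<rho> y. bounded_measurable \<phi> \<longrightarrow> 0 \<le> \<rho> \<longrightarrow> \<rho> < 1 \<longrightarrow> y \<in> sphere 0 1 \<longrightarrow>
   cmod (frac_series s c \<phi> (\<rho> *\<^sub>R y)) \<le> C * (1 - \<rho>) powr (- \<kappa>) * sphere_Lq q \<phi>)"

lemma frac_multiplier_boundD:
 assumes "frac_multiplier_bound c q s \<kappa> C" "bounded_measurable \<phi>" "y \<in> sphere 0 1" "0 \<le> \<rho>" "\<rho> < 1"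
 shows "cmod (frac_series s c \<phi> (\<rho> *\<^sub>R y)) \<le> C * (1 - \<rho>) powr (- \<kappa>) * sphere_Lq q \<phi>"
 using assms unfolding frac_multiplier_bound_def by simp

lemma sh_coeff_poisson:
 assumes y: "y \<in> sphere 0 1" and j: "j \<in> {1..d k}"
 shows "sh_coeff d Y (poisson y) k j = of_real (Y k j y)"
proof -
 have "sh_term d Y (\<lambda>k j. of_real (Y k j y)) x sums poisson y x" if x: "x \<in> ball 0 1" for x
 proof -
  have "(\<lambda>k. zonal k x y) sums poisson_ratio x y"
   unfolding poisson_ratio_def by (rule zonal_sums) (use x y in auto)
  then have "(\<lambda>k. complex_of_real (1 / surface_area TYPE('a) * zonal k x y)) sums of_real (1 / surface_area TYPE('a) * poisson_ratio x y)"
   by (intro sums_of_real sums_mult)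
  moreover have "complex_of_real (1 / surface_area TYPE('a) * zonal k x y) = sh_term d Y (\<lambda>k j. of_real (Y k j y)) x k" for k
  proof -
   have "zonal k x y = norm x ^ k * zonal k (sphere_point x) y"
    using sphere_point(2)[of x] zonal_scale[of k "norm x" "sphere_point x" y] by simp
   also have "zonal k (sphere_point x) y = surface_area TYPE('a) * (\<Sum>j=1..d k. Y k j (sphere_point x) * Y k j y)"
    by (rule addition_theorem[OF sphere_point(1) y])
   finally show ?thesis by (simp add: sh_term_def mult_ac)
  qed
  ultimately show ?thesis
   by (simp add: poisson_def poisson_ratio_def surface_area_def sums_def)
 qed
 from sh_coeff_eq[OF this, of k j] show ?thesis using j by simp
qed

text \<open>
 The kernel is symmetric in \<open>x'\<close> and \<open>y\<close>; read as an expansion in \<open>x'\<close>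
 it can be integrated against \<open>\<phi>\<close>.
\<close>

lemma frac_deriv_kernel:
 assumes dim: "DIM('a) \<ge> 2" and s: "s > 0" and c: "subexponential (row c)"
  and g: "\<And>x. x \<in> ball 0 1 \<Longrightarrow> sh_term d Y c x sums g x"
  and x': "x' \<in> sphere 0 1" and y: "y \<in> sphere 0 1" and \<rho>: "0 \<le> \<rho>" "\<rho> < 1"
 shows "frac_deriv d Y s (harm_conv d Y g (poisson x')) (\<rho> *\<^sub>R y)
   = series (weighted (frac_weight s) (\<lambda>k j. c k j * of_real (Y k j y))) (\<rho> *\<^sub>R x')"
proof -
 let ?a = "\<lambda>x k j. c k j * complex_of_real (Y k j x)"
 have a: "subexponential (row (?a x))" if "x \<in> sphere 0 1" for x
  by (intro subexponential_row_mult c subexponential_row_Y that)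
 have gc: "sh_coeff d Y g k j = c k j" if "j \<in> {1..d k}" for k j
  using sh_coeff_eq[of c g k j] g that by simp
 have hc: "harm_conv d Y g (poisson x') = series (?a x')"
  unfolding harm_conv_def
  by (rule sh_series_cong) (simp only: gc sh_coeff_poisson[OF x'])
 have "frac_deriv d Y s (harm_conv d Y g (poisson x')) = series (weighted (frac_weight s) (?a x'))"
  unfolding frac_deriv_def hc
  by (rule sh_series_cong) (simp add: weighted_def frac_weight_def sh_coeff_sh_series[OF a[OF x']])
 moreover have "series (weighted (frac_weight s) (?a x')) (\<rho> *\<^sub>R y) = series (weighted (frac_weight s) (?a y)) (\<rho> *\<^sub>R x')"
 proof -
  have w: "subexponential (row (weighted (frac_weight s) (?a x)))" if "x \<in> sphere 0 1" for x
   by (intro subexponential_weighted subexponential_frac_weight dim s a that)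
  have "part (weighted (frac_weight s) (?a x')) k y = part (weighted (frac_weight s) (?a y)) k x'" for k
   by (simp add: part_weighted) (simp add: part_def mult_ac)
  then show ?thesis
   using sh_series_polar[OF w[OF x'] y \<rho>] sh_series_polar[OF w[OF y] x' \<rho>] by (simp add: sums_iff)
 qed
 ultimately show ?thesis by simp
qed

lemma frac_kernel_pairing:
 assumes dim: "DIM('a) \<ge> 2" and s: "s > 0" and c: "subexponential (row c)"
  and \<phi>: "bounded_measurable \<phi>" and y: "y \<in> sphere 0 1" and \<rho>: "0 \<le> \<rho>" "\<rho> < 1"
 shows "(LINT z|surface. \<phi> z * series (weighted (frac_weight s) (\<lambda>k j. c k j * of_real (Y k j y))) (\<rho> *\<^sub>R z))
   = frac_series s c \<phi> (\<rho> *\<^sub>R y)"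
proof -
 let ?a = "weighted (frac_weight s) (\<lambda>k j. c k j * complex_of_real (Y k j y))"
 let ?b = "weighted (frac_weight s) (\<lambda>k j. c k j * moment \<phi> k j)"
 have a: "subexponential (row ?a)"
  by (intro subexponential_weighted subexponential_frac_weight dim s subexponential_row_mult c subexponential_row_Y y)
 have b: "subexponential (row ?b)"
  by (intro subexponential_weighted subexponential_frac_weight dim s subexponential_row_mult c subexponential_row_moment \<phi>)
 have "(\<Sum>j=1..d k. ?a k j * moment \<phi> k j) = part ?b k y" for k
  by (simp add: part_def weighted_def mult_ac)
 then show ?thesis
  using moment_pairing[OF \<phi> a \<rho>] sh_series_polar[OF b y \<rho>] by (simp add: sums_iff)
qed

text \<open>
 Duality on the sphere for each fixed \<open>\<rho>\<close> and \<open>y\<close>, with constants independent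
 of both.
\<close>

lemma sup_condition_iff:
 assumes dim: "DIM('a) \<ge> 2" and s: "s > 0" and c: "subexponential (row c)"
  and g: "associated_harmonic d Y c g"
  and q: "1 \<le> q" "1 / ennreal q + 1 / q' = 1"
 shows "(SUP \<rho>\<in>{0..<1}. SUP y'\<in>sphere 0 1. ennreal ((1 - \<rho>) powr \<kappa>) *
    sphere_norm q' (\<lambda>x'. frac_deriv d Y s (harm_conv d Y g (poisson x')) (\<rho> *\<^sub>R y'))) < \<infinity>
   \<longleftrightarrow> (\<exists>C\<ge>0. frac_multiplier_bound c q s \<kappa> C)"
proof -
 have gs: "sh_term d Y c x sums g x" if "x \<in> ball 0 1" for x
  using g that by (simp add: associated_harmonic_def)
 define k where "k \<rho> y z = series (weighted (frac_weight s) (\<lambda>k j. c k j * of_real (Y k j y))) (\<rho> *\<^sub>R z)" for \<rho> :: real and y z :: 'a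
 have km: "bounded_measurable (k \<rho> y)" if "y \<in> sphere 0 1" "0 \<le> \<rho>" "\<rho> < 1" for \<rho> y
  unfolding k_def using that
  by (intro bounded_measurable_sh_series subexponential_weighted subexponential_frac_weight dim s
    subexponential_row_mult c subexponential_row_Y)
 have pair: "(LINT z|surface. \<phi> z * k \<rho> y z) = frac_series s c \<phi> (\<rho> *\<^sub>R y)"
  if "bounded_measurable \<phi>" "y \<in> sphere 0 1" "0 \<le> \<rho>" "\<rho> < 1" for \<phi> \<rho> y
  unfolding k_def by (rule frac_kernel_pairing[OF dim s c that])
 have norm_eq: "sphere_norm q' (\<lambda>x'. frac_deriv d Y s (harm_conv d Y g (poisson x')) (\<rho> *\<^sub>R y)) = sphere_norm q' (k \<rho> y)"
  if "y \<in> sphere 0 1" "0 \<le> \<rho>" "\<rho> < 1" for \<rho> y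
 proof (rule sphere_norm_cong[symmetric])
  show "k \<rho> y \<in> borel_measurable surface" using km[OF that] by (simp add: bounded_measurable_def)
  show "k \<rho> y z = frac_deriv d Y s (harm_conv d Y g (poisson z)) (\<rho> *\<^sub>R y)" if "z \<in> sphere 0 1" for z
   unfolding k_def using frac_deriv_kernel[OF dim s c gs that \<open>y \<in> sphere 0 1\<close> \<open>0 \<le> \<rho>\<close> \<open>\<rho> < 1\<close>] by simp
 qed
 let ?S = "SUP \<rho>\<in>{0..<1}. SUP y'\<in>sphere 0 1. ennreal ((1 - \<rho>) powr \<kappa>) *
    sphere_norm q' (\<lambda>x'. frac_deriv d Y s (harm_conv d Y g (poisson x')) (\<rho> *\<^sub>R y'))"
 show ?thesis
 proof
  assume "?S < \<infinity>"
  then obtain C where C: "?S = ennreal C" "C \<ge> 0" by (cases ?S) auto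
  have "frac_multiplier_bound c q s \<kappa> C"
   unfolding frac_multiplier_bound_def
  proof (intro allI impI)
   fix \<phi> :: "'a \<Rightarrow> complex" and \<rho> :: real and y :: 'a assume \<phi>: "bounded_measurable \<phi>" and \<rho>: "0 \<le> \<rho>" "\<rho> < 1" and y: "y \<in> sphere 0 1"
   have pos: "(1 - \<rho>) powr \<kappa> > 0" using \<rho> by simp
   have "ennreal ((1 - \<rho>) powr \<kappa>) * sphere_norm q' (k \<rho> y) \<le> ?S"
    unfolding norm_eq[OF y \<rho>, symmetric]
    by (rule SUP_upper2[of \<rho>], use \<rho> in simp, rule SUP_upper[OF y])
   then have le: "ennreal ((1 - \<rho>) powr \<kappa>) * sphere_norm q' (k \<rho> y) \<le> ennreal C" unfolding C .
   have "sphere_norm q' (k \<rho> y) = ennreal ((1 - \<rho>) powr (- \<kappa>)) * (ennreal ((1 - \<rho>) powr \<kappa>) * sphere_norm q' (k \<rho> y))"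
    using \<rho> by (simp add: mult.assoc[symmetric] ennreal_mult[symmetric] powr_add[symmetric])
   also have "\<dots> \<le> ennreal ((1 - \<rho>) powr (- \<kappa>)) * ennreal C"
    by (intro mult_left_mono le) simp
   also have "\<dots> = ennreal (C * (1 - \<rho>) powr (- \<kappa>))"
    using C by (simp add: ennreal_mult[symmetric] mult.commute)
   finally have "sphere_norm q' (k \<rho> y) \<le> ennreal (C * (1 - \<rho>) powr (- \<kappa>))" .
   moreover have "C * (1 - \<rho>) powr (- \<kappa>) \<ge> 0" using C by simp
   ultimately have "cmod (LINT (z::'a)|surface. \<phi> z * k \<rho> y z) \<le> C * (1 - \<rho>) powr (- \<kappa>) * sphere_Lq q \<phi>"
    by (intro sphere_norm_duality_upper[OF q km[OF y \<rho>] \<phi>])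
   then 
   show "cmod (frac_series s c \<phi> (\<rho> *\<^sub>R y)) \<le> C * (1 - \<rho>) powr (- \<kappa>) * sphere_Lq q \<phi>"
    unfolding pair[OF \<phi> y \<rho>] .
  qed
  then show "\<exists>C\<ge>0. frac_multiplier_bound c q s \<kappa> C" using C by blast
 next
  assume "\<exists>C\<ge>0. frac_multiplier_bound c q s \<kappa> C"
  then obtain C where C: "C \<ge> 0" "frac_multiplier_bound c q s \<kappa> C" by blast
  have "?S \<le> ennreal C"
  proof (intro SUP_least)
   fix \<rho> :: real and y :: 'a assume "\<rho> \<in> {0..<1}" and y: "y \<in> sphere 0 1"
   then have \<rho>: "0 \<le> \<rho>" "\<rho> < 1" by auto
   have "sphere_norm q' (k \<rho> y) \<le> ennreal (C * (1 - \<rho>) powr (- \<kappa>))"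
   proof (rule sphere_norm_duality_lower[OF q km[OF y \<rho>]])
    fix \<phi> :: "'a \<Rightarrow> complex" assume \<phi>: "bounded_measurable \<phi>"
    show "cmod (LINT z|surface. \<phi> z * k \<rho> y z) \<le> C * (1 - \<rho>) powr (- \<kappa>) * sphere_Lq q \<phi>"
     using C(2) \<phi> \<rho> y unfolding pair[OF \<phi> y \<rho>] frac_multiplier_bound_def by blast
   qed (use C in simp)
   then have "ennreal ((1 - \<rho>) powr \<kappa>) * sphere_norm q' (k \<rho> y) \<le> ennreal ((1 - \<rho>) powr \<kappa>) * ennreal (C * (1 - \<rho>) powr (- \<kappa>))"
    by (intro mult_left_mono) auto
   also have "\<dots> = ennreal (C * ((1 - \<rho>) powr \<kappa> * (1 - \<rho>) powr (- \<kappa>)))"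
    using C by (simp add: ennreal_mult[symmetric] mult_ac)
   also have "(1 - \<rho>) powr \<kappa> * (1 - \<rho>) powr (- \<kappa>) = 1" using \<rho> by (simp add: powr_add[symmetric])
   finally show "ennreal ((1 - \<rho>) powr \<kappa>) * sphere_norm q' (\<lambda>x'. frac_deriv d Y s (harm_conv d Y g (poisson x')) (\<rho> *\<^sub>R y)) \<le> ennreal C"
    unfolding norm_eq[OF y \<rho>] by simp
  qed
  then show "?S < \<infinity>" by (rule le_less_trans) simp
 qed
qed

lemma A_infI:
 fixes f :: "'a \<Rightarrow> complex"
 assumes H: "harmonic_on (ball 0 1) f" and b: "\<beta> > 0"
  and C: "\<And>\<rho> y. 0 \<le> \<rho> \<Longrightarrow> \<rho> < 1 \<Longrightarrow> y \<in> sphere 0 1 \<Longrightarrow> cmod (f (\<rho> *\<^sub>R y)) \<le> C * (1 - \<rho>) powr (- \<beta>)"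
 shows "f \<in> A_inf \<beta>"
proof -
 have "(SUP x\<in>ball 0 1. ennreal ((1 - (norm x)\<^sup>2) powr \<beta> * cmod (f x))) \<le> ennreal (2 powr \<beta> * C)"
 proof (rule SUP_least)
  fix x :: 'a assume x: "x \<in> ball 0 1"
  define \<rho> where "\<rho> = norm x"
  have \<rho>: "0 \<le> \<rho>" "\<rho> < 1" using x by (auto simp: \<rho>_def)
  have fx: "cmod (f x) \<le> C * (1 - \<rho>) powr (- \<beta>)"
   using C[OF \<rho> sphere_point(1)[of x]] sphere_point(2)[of x] by (simp add: \<rho>_def)
  have "1 - \<rho>\<^sup>2 = (1 - \<rho>) * (1 + \<rho>)" by (simp add: power2_eq_square algebra_simps)
  also have "\<dots> \<le> (1 - \<rho>) * 2" using \<rho> by (intro mult_left_mono) auto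
  finally have "(1 - \<rho>\<^sup>2) powr \<beta> \<le> ((1 - \<rho>) * 2) powr \<beta>"
   using \<rho> b by (intro powr_mono2) (auto simp: power_le_one)
  then have "(1 - \<rho>\<^sup>2) powr \<beta> * cmod (f x) \<le> ((1 - \<rho>) * 2) powr \<beta> * (C * (1 - \<rho>) powr (- \<beta>))"
   using fx by (intro mult_mono) auto
  also have "\<dots> = 2 powr \<beta> * C * ((1 - \<rho>) powr \<beta> * (1 - \<rho>) powr (- \<beta>))"
   unfolding powr_mult by (simp only: mult_ac)
  also have "(1 - \<rho>) powr \<beta> * (1 - \<rho>) powr (- \<beta>) = 1" using \<rho> by (simp add: powr_add[symmetric])
  finally show "ennreal ((1 - (norm x)\<^sup>2) powr \<beta> * cmod (f x)) \<le> ennreal (2 powr \<beta> * C)"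
   unfolding \<rho>_def by (intro ennreal_leI) simp
 qed
 then have "(SUP x\<in>ball 0 1. ennreal ((1 - (norm x)\<^sup>2) powr \<beta> * cmod (f x))) < \<infinity>"
  by (rule le_less_trans) simp
 then show ?thesis using H by (simp add: A_inf_def harmonic_ball_def)
qed

lemma part_series_summable:
 assumes a: "subexponential (row a)" and y: "y \<in> sphere 0 1" and r: "0 \<le> r" "r < 1"
 shows "summable (\<lambda>k. norm (part a k y) * r ^ k)"
proof (rule summable_comparison_test'[OF part_summable[OF a r]])
 show "norm (norm (part a k y) * r ^ k) \<le> r ^ k * (row a k * Y_bound k)" for k
  using norm_term_le[OF y r(1), of k a] r by (simp add: norm_mult norm_power mult.commute)
qed

text \<open>
 Apply the bound to \<open>\<phi> = f (R \<cdot>)\<close> at the radius \<open>\<rho>\<close> with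
 \<open>\<rho> R = r\<close>, both factors being half-way to the boundary, and remove the fractional
 derivative by fractional integration.
\<close>

theorem multiplier_sufficient:
 assumes dim: "DIM('a) \<ge> 2" and s: "s > 0" and c: "subexponential (row c)"
  and p: "p > 0" and q: "q \<ge> 1" and \<alpha>: "\<alpha> > 0" and \<beta>: "\<beta> > 0" and \<kappa>: "\<kappa> = s + \<beta> - \<alpha>" "\<kappa> > 0"
  and C: "C \<ge> 0" "frac_multiplier_bound c q s \<kappa> C"
 shows "c \<in> multipliers d Y (B_space p q \<alpha>) (A_inf \<beta>)"
 unfolding multipliers_def mem_Collect_eq
proof (intro ballI conjI)
 fix f :: "'a \<Rightarrow> complex" assume f: "f \<in> B_space p q \<alpha>"
 have H: "harmonic_on (ball 0 1) f" using f by (simp add: B_space_def harmonic_ball_def)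
 have cf: "continuous_on (ball 0 1) f" by (rule harmonic_on_imp_continuous[OF H])
 define b where "b = sh_coeff d Y f"
 have b: "subexponential (row b)" unfolding b_def by (rule harmonic_expansion(3)[OF H])
 define a where "a k j = c k j * b k j" for k j
 have a: "subexponential (row a)" unfolding a_def[abs_def] by (rule subexponential_row_mult[OF c b])
 let ?wa = "weighted (frac_weight s) a"
 have wa: "subexponential (row ?wa)"
  by (intro subexponential_weighted subexponential_frac_weight dim s a)
 show "sh_convergent d Y (\<lambda>k j. c k j * sh_coeff d Y f k j)"
  using sh_series_sums[OF a] unfolding sh_convergent_def a_def[abs_def] b_def by (auto simp: sums_iff)
 obtain M where M: "M \<ge> 0" "\<And>R. 1/2 \<le> R \<Longrightarrow> R < 1 \<Longrightarrow> sphere_Lq q (\<lambda>y. f (R *\<^sub>R y)) \<le> M * (1 - R) powr (- \<alpha>)"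
  using B_space_growth[OF f p q \<alpha>] by metis
 define A where "A = C * M * 2 powr (\<kappa> + \<alpha>)"
 have A0: "A \<ge> 0" using C M by (simp add: A_def)
 have W: "cmod (series ?wa (r *\<^sub>R y)) \<le> A * (1 - r) powr (- (\<beta> + s))"
  if r: "0 \<le> r" "r < 1" and y: "y \<in> sphere 0 1" for r y
 proof -
  obtain R \<rho> where R: "1/2 \<le> R" "R < 1" "0 \<le> \<rho>" "\<rho> < 1" "\<rho> * R = r" "1 - R = (1 - r) / 2" "(1 - r) / 2 \<le> 1 - \<rho>"
   using half_radius[OF r] by metis
  define \<phi> where "\<phi> z = f (R *\<^sub>R z)" for z
  have R0: "0 < R" "0 \<le> R" using R by auto
  have \<phi>: "bounded_measurable \<phi>"
   unfolding \<phi>_def using integral_mean_eq(1)[OF cf R0(2) R(2), of 1] by simp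
  have mom: "moment \<phi> k j = of_real (R ^ k) * b k j" if "j \<in> {1..d k}" for k j
   unfolding moment_def \<phi>_def b_def using harmonic_expansion(2)[OF H R0(1) R(2) that] by simp
  have wm: "subexponential (row (weighted (frac_weight s) (\<lambda>k j. c k j * moment \<phi> k j)))"
   by (intro subexponential_weighted subexponential_frac_weight dim s subexponential_row_mult c subexponential_row_moment \<phi>)
  have "part (weighted (frac_weight s) (\<lambda>k j. c k j * moment \<phi> k j)) k y = of_real (R ^ k) * part ?wa k y" for k
   by (simp add: part_def weighted_def mom a_def sum_distrib_left mult_ac)
  then have "of_real (\<rho> ^ k) * part (weighted (frac_weight s) (\<lambda>k j. c k j * moment \<phi> k j)) k y = of_real (r ^ k) * part ?wa k y" for k
   by (simp add: R(5)[symmetric] power_mult_distrib mult_ac)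
  then have "series ?wa (r *\<^sub>R y) = frac_series s c \<phi> (\<rho> *\<^sub>R y)"
   using sh_series_polar[OF wm y R(3,4)] sh_series_polar[OF wa y r] by (simp add: sums_iff)
  then have "cmod (series ?wa (r *\<^sub>R y)) \<le> C * (1 - \<rho>) powr (- \<kappa>) * sphere_Lq q \<phi>"
   using frac_multiplier_boundD[OF C(2) \<phi> y R(3,4)] by (simp only:)
  also have "\<dots> \<le> (C * ((1 - r) / 2) powr (- \<kappa>)) * (M * ((1 - r) / 2) powr (- \<alpha>))"
  proof (rule mult_mono)
   show "C * (1 - \<rho>) powr (- \<kappa>) \<le> C * ((1 - r) / 2) powr (- \<kappa>)"
    using R r \<kappa> C by (intro mult_left_mono powr_mono2') auto
   show "sphere_Lq q \<phi> \<le> M * ((1 - r) / 2) powr (- \<alpha>)"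
    unfolding \<phi>_def using M(2)[OF R(1,2)] unfolding R(6) .
  qed (use C M in \<open>auto simp: sphere_Lq_nonneg\<close>)
  also have "\<dots> = C * M * (((1 - r) / 2) powr (- \<kappa>) * ((1 - r) / 2) powr (- \<alpha>))" by (simp only: mult_ac)
  also have "((1 - r) / 2) powr (- \<kappa>) * ((1 - r) / 2) powr (- \<alpha>) = ((1 - r) / 2) powr (- (\<kappa> + \<alpha>))"
   by (simp add: powr_add[symmetric])
  also have "\<dots> = (1 - r) powr (- (\<kappa> + \<alpha>)) * 2 powr (\<kappa> + \<alpha>)"
   unfolding powr_divide powr_minus_divide[of 2] by simp
  finally show ?thesis unfolding A_def \<kappa>(1) by (simp add: mult_ac add_ac)
 qed
 define G where "G = Gamma s"
 have G: "G > 0" using s by (simp add: G_def)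
 have "seq_conv d Y c f = series a"
  unfolding seq_conv_def by (rule sh_series_cong) (simp add: a_def b_def)
 moreover have "series a \<in> A_inf \<beta>"
 proof (rule A_infI[OF sh_series_harmonic[OF a] \<beta>])
  fix \<rho> :: real and y :: 'a assume \<rho>: "0 \<le> \<rho>" "\<rho> < 1" and y: "y \<in> sphere 0 1"
  define v where "v k = part a k y" for k
  have lam: "of_real (Gamma (real k + real DIM('a) / 2 + s) / Gamma (real k + real DIM('a) / 2)) * v k = of_real G * part ?wa k y" for k
   using G by (simp add: part_weighted frac_weight_def v_def G_def)
  have "cmod (\<Sum>k. of_real (\<rho> ^ k) * v k) \<le> (1 / s + 1 / \<beta>) / Gamma s * (G * A) * (1 - \<rho>) powr (- \<beta>)"
  proof (rule fractional_integration_bound[where a = "real DIM('a) / 2" and \<tau> = s and \<kappa> = \<beta> and v = v and A = "G * A"])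
   show "real DIM('a) / 2 \<ge> 1" using dim by simp
   show "G * A \<ge> 0" using G A0 by simp
   show "summable (\<lambda>k. norm (v k) * r ^ k)" if "0 \<le> r" "r < 1" for r
    unfolding v_def by (rule part_series_summable[OF a y that])
   show "summable (\<lambda>k. norm (of_real (Gamma (real k + real DIM('a) / 2 + s) / Gamma (real k + real DIM('a) / 2)) * v k) * r ^ k)" if "0 \<le> r" "r < 1" for r
    unfolding lam using summable_mult[OF part_series_summable[OF wa y that], of G] G by (simp add: norm_mult mult_ac)
   show "cmod (\<Sum>k. of_real (r ^ k) * (of_real (Gamma (real k + real DIM('a) / 2 + s) / Gamma (real k + real DIM('a) / 2)) * v k)) \<le> G * A * (1 - r) powr (- (\<beta> + s))" if r: "0 \<le> r" "r < 1" for r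
   proof -
    have "(\<lambda>k. of_real G * (of_real (r ^ k) * part ?wa k y)) sums (of_real G * series ?wa (r *\<^sub>R y))"
     by (rule sums_mult[OF sh_series_polar[OF wa y r]])
    then have "(\<Sum>k. of_real (r ^ k) * (of_real G * part ?wa k y)) = of_real G * series ?wa (r *\<^sub>R y)"
     by (simp add: sums_iff mult_ac)
    then show ?thesis unfolding lam using W[OF r y] G by (simp add: norm_mult)
   qed
  qed (use s \<beta> \<rho> in auto)
  then show "cmod (series a (\<rho> *\<^sub>R y)) \<le> ((1 / s + 1 / \<beta>) / Gamma s * (G * A)) * (1 - \<rho>) powr (- \<beta>)"
   using sh_series_polar[OF a y \<rho>] by (simp add: sums_iff v_def)
 qed
 ultimately show "seq_conv d Y c f \<in> A_inf \<beta>" by simp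
qed

end

section \<open>Superpositions of test functions\<close>

lemma suminf_eq_integral_count_space:
 fixes f :: "nat \<Rightarrow> 'b::{banach, second_countable_topology}"
 assumes "summable (\<lambda>n. norm (f n))"
 shows "integrable (count_space UNIV) f" "integral\<^sup>L (count_space UNIV) f = suminf f"
 using assms by (auto simp: integrable_count_space_nat_iff integral_count_space_nat)

lemma jensen_series:
 fixes w x :: "nat \<Rightarrow> real"
 assumes w: "\<And>n. w n \<ge> 0" "w sums W" "W > 0" and x: "\<And>n. 0 \<le> x n" "\<And>n. x n \<le> B" and q: "q \<ge> 1"
 shows "(\<Sum>n. w n * x n) powr q \<le> W powr (q - 1) * (\<Sum>n. w n * x n powr q)"
  and "summable (\<lambda>n. w n * x n)" "summable (\<lambda>n. w n * x n powr q)"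
proof -
 have ws: "summable w" using w(2) by (rule sums_summable)
 have s: "summable (\<lambda>n. w n * u n)" if "\<And>n. 0 \<le> u n" "\<And>n. u n \<le> K" for u K
  by (rule summable_comparison_test'[OF summable_mult2[OF ws, of K]])
   (use that w in \<open>auto intro!: mult_left_mono\<close>)
 show sx: "summable (\<lambda>n. w n * x n)" by (rule s[OF x])
 show sq: "summable (\<lambda>n. w n * x n powr q)"
  by (rule s[where K = "B powr q"]) (use x q in \<open>auto intro!: powr_mono2\<close>)
 have eq: "(\<integral>n. w n / W * u n \<partial>count_space UNIV) = (\<Sum>n. w n * u n) / W" if "summable (\<lambda>n. w n * u n)" "\<And>n. u n \<ge> 0" for u
 proof -
  have "summable (\<lambda>n. norm (w n / W * u n))" using summable_divide[OF that(1), of W] w that(2) by (simp add: abs_mult)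
  then have "(\<integral>n. w n / W * u n \<partial>count_space UNIV) = (\<Sum>n. w n / W * u n)"
   by (rule suminf_eq_integral_count_space)
  also have "\<dots> = (\<Sum>n. w n * u n) / W" using suminf_divide[OF that(1), of W] by simp
  finally show ?thesis .
 qed
 have "(\<integral>n. w n / W * x n \<partial>count_space UNIV) powr q \<le> (\<integral>n. w n / W * x n powr q \<partial>count_space UNIV)"
 proof (rule jensen_powr[OF _ _ _ _ _ _ q])
  show "integrable (count_space UNIV) (\<lambda>n. w n / W)"
   using summable_divide[OF ws, of W] w by (simp add: integrable_count_space_nat_iff)
  show "(\<integral>n. w n / W \<partial>count_space UNIV) = 1"
   using eq[of "\<lambda>_. 1"] ws w by (simp add: sums_iff)
 qed (use w x in auto)
 then have "((\<Sum>n. w n * x n) / W) powr q \<le> (\<Sum>n. w n * x n powr q) / W"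
  by (simp only: eq[OF sx x(1)] eq[OF sq powr_ge_zero])
 then have "W powr q * ((\<Sum>n. w n * x n) / W) powr q \<le> W powr q * ((\<Sum>n. w n * x n powr q) / W)"
  by (intro mult_left_mono) auto
 also have "W powr q * ((\<Sum>n. w n * x n) / W) powr q = (\<Sum>n. w n * x n) powr q"
  unfolding powr_mult[symmetric] using w by simp
 also have "W powr q * ((\<Sum>n. w n * x n powr q) / W) = W powr (q - 1) * (\<Sum>n. w n * x n powr q)"
  using w by (simp add: powr_diff)
 finally show "(\<Sum>n. w n * x n) powr q \<le> W powr (q - 1) * (\<Sum>n. w n * x n powr q)" .
qed

text \<open>
 Minkowski's inequality for series, from Jensen's inequality with the weights \<open>w n * \<psi> n\<close>.
 The bound \<open>B\<close> only serves integrability.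
\<close>

lemma sphere_Lq_suminf_le:
 fixes h :: "nat \<Rightarrow> 'a::euclidean_space \<Rightarrow> complex"
 assumes h: "\<And>n. bounded_measurable (h n)" "\<And>n z. z \<in> sphere 0 1 \<Longrightarrow> cmod (h n z) \<le> B * \<psi> n"
  and f: "bounded_measurable f" "\<And>z. z \<in> sphere 0 1 \<Longrightarrow> cmod (f z) \<le> (\<Sum>n. w n * cmod (h n z))"
  and L: "\<And>n. sphere_Lq q (h n) \<le> \<psi> n" and \<psi>: "\<And>n. \<psi> n > 0"
  and w: "\<And>n. w n > 0" "summable (\<lambda>n. w n * \<psi> n)" and q: "q \<ge> 1"
 shows "sphere_Lq q f \<le> (\<Sum>n. w n * \<psi> n)"
proof -
 define W where "W = (\<Sum>n. w n * \<psi> n)"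
 have W: "(\<lambda>n. w n * \<psi> n) sums W" unfolding W_def using w(2) by (rule summable_sums)
 have W0: "W > 0" unfolding W_def by (rule suminf_pos[OF w(2)]) (use w \<psi> in simp)
 define g where "g n z = w n * \<psi> n * (cmod (h n z) / \<psi> n) powr q" for n z
 have point: "cmod (f z) powr q \<le> W powr (q - 1) * (\<Sum>n. g n z)" "summable (\<lambda>n. g n z)" if z: "z \<in> sphere 0 1" for z
 proof -
  have x: "0 \<le> cmod (h n z) / \<psi> n" "cmod (h n z) / \<psi> n \<le> B" for n
   using h(2)[OF z, of n] \<psi>[of n] by (auto simp: divide_le_eq less_imp_le)
  have wp: "w n * \<psi> n \<ge> 0" for n using w(1)[of n] \<psi>[of n] by simp
  note J = jensen_series[where x = "\<lambda>n. cmod (h n z) / \<psi> n", OF wp W W0 x q]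
  have "w n * \<psi> n * (cmod (h n z) / \<psi> n) = w n * cmod (h n z)" for n
   using \<psi>[of n] by (simp add: less_imp_neq[symmetric])
  then have "(\<Sum>n. w n * cmod (h n z)) powr q \<le> W powr (q - 1) * (\<Sum>n. g n z)"
   using J(1) unfolding g_def by (simp only:)
  moreover have "cmod (f z) powr q \<le> (\<Sum>n. w n * cmod (h n z)) powr q"
   using f(2)[OF z] q by (intro powr_mono2) auto
  ultimately show "cmod (f z) powr q \<le> W powr (q - 1) * (\<Sum>n. g n z)" by simp
  show "summable (\<lambda>n. g n z)" using J(3) by (simp add: g_def)
 qed
 have hm[measurable]: "h n \<in> borel_measurable surface" for n using h(1)[of n] by (simp add: bounded_measurable_def)
 have gm[measurable]: "g n \<in> borel_measurable surface" for n unfolding g_def by measurable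
 have g0: "g n z \<ge> 0" for n z using w(1)[of n] \<psi>[of n] by (simp add: g_def less_imp_le)
 have gi: "(\<integral>\<^sup>+ z. ennreal (g n z) \<partial>surface) \<le> ennreal (w n * \<psi> n)" for n
 proof -
  have "g n z = (w n * \<psi> n / \<psi> n powr q) * cmod (h n z) powr q" for z
   by (simp add: g_def powr_divide)
  then have "ennreal (g n z) = ennreal (w n * \<psi> n / \<psi> n powr q) * ennreal (cmod (h n z) powr q)" for z
   using w(1)[of n] \<psi>[of n] by (simp only: ennreal_mult powr_ge_zero) (simp add: ennreal_mult[symmetric])
  then have "(\<integral>\<^sup>+ z. ennreal (g n z) \<partial>surface) = ennreal (w n * \<psi> n / \<psi> n powr q) * (\<integral>\<^sup>+ z. ennreal (cmod (h n z) powr q) \<partial>surface)"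
   by (simp add: nn_integral_cmult)
  also have "(\<integral>\<^sup>+ z. ennreal (cmod (h n z) powr q) \<partial>surface) = ennreal (sphere_Lq q (h n) powr q)"
   using q by (subst sphere_Lq_powr) (auto intro!: nn_integral_eq_integral integrable_cmod_powr h)
  also have "\<dots> \<le> ennreal (\<psi> n powr q)"
   using L[of n] q by (intro ennreal_leI powr_mono2) (auto simp: sphere_Lq_nonneg)
  finally have "(\<integral>\<^sup>+ z. ennreal (g n z) \<partial>surface) \<le> ennreal (w n * \<psi> n / \<psi> n powr q) * ennreal (\<psi> n powr q)"
   by (simp add: mult_left_mono)
  also have "\<dots> = ennreal (w n * \<psi> n)"
   using w(1)[of n] \<psi>[of n] by (simp add: ennreal_mult[symmetric])
  finally show ?thesis .
 qed
 show ?thesis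
  unfolding W_def[symmetric]
 proof (rule sphere_Lq_le[OF _ f(1)])
  have "ennreal (LINT z|surface. cmod (f z) powr q) = (\<integral>\<^sup>+ z. ennreal (cmod (f z) powr q) \<partial>surface)"
   by (rule nn_integral_eq_integral[symmetric]) (use integrable_cmod_powr[OF f(1)] q in auto)
  also have "\<dots> \<le> (\<integral>\<^sup>+ z. ennreal (W powr (q - 1)) * (\<Sum>n. ennreal (g n z)) \<partial>surface)"
  proof (rule nn_integral_mono)
   fix z :: 'a assume "z \<in> space surface"
   then have z: "z \<in> sphere 0 1" by simp
   have "ennreal (cmod (f z) powr q) \<le> ennreal (W powr (q - 1)) * ennreal (\<Sum>n. g n z)"
    using point(1)[OF z] suminf_nonneg[OF point(2)[OF z] g0] by (simp add: ennreal_mult[symmetric] ennreal_leI)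
   then show "ennreal (cmod (f z) powr q) \<le> ennreal (W powr (q - 1)) * (\<Sum>n. ennreal (g n z))"
    using suminf_ennreal2[OF g0 point(2)[OF z]] by simp
  qed
  also have "\<dots> = ennreal (W powr (q - 1)) * (\<Sum>n. \<integral>\<^sup>+ z. ennreal (g n z) \<partial>surface)"
   by (subst nn_integral_cmult) (auto simp: nn_integral_suminf)
  also have "\<dots> \<le> ennreal (W powr (q - 1)) * (\<Sum>n. ennreal (w n * \<psi> n))"
   by (intro mult_left_mono suminf_le gi) auto
  also have "(\<Sum>n. ennreal (w n * \<psi> n)) = ennreal W"
   unfolding W_def by (rule suminf_ennreal2) (use w \<psi> in \<open>auto simp: less_imp_le\<close>)
  also have "ennreal (W powr (q - 1)) * ennreal W = ennreal (W powr q)"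
   using W0 by (simp add: ennreal_mult[symmetric] powr_diff)
  finally show "(LINT z|surface. cmod (f z) powr q) \<le> W powr q" by (simp add: ennreal_le_iff)
 qed (use q W0 in auto)
qed

lemma integral_cmod_le_sphere_Lq:
 assumes q: "q \<ge> 1"
 shows "\<exists>H\<ge>0. \<forall>\<phi> :: 'a::euclidean_space \<Rightarrow> complex. bounded_measurable \<phi> \<longrightarrow> (LINT z|surface. cmod (\<phi> z)) \<le> H * sphere_Lq q \<phi>"
proof -
 define \<sigma> where "\<sigma> = surface_area TYPE('a)"
 have \<sigma>: "\<sigma> > 0" by (simp add: \<sigma>_def)
 have "(LINT z|surface. cmod (\<phi> z)) \<le> (\<sigma> * (1 / \<sigma>) powr (1 / q)) * sphere_Lq q \<phi>" if \<phi>: "bounded_measurable \<phi>" for \<phi> :: "'a \<Rightarrow> complex"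
 proof -
  obtain B where B: "B \<ge> 0" "\<And>z. z \<in> sphere 0 1 \<Longrightarrow> cmod (\<phi> z) \<le> B" and [measurable]: "\<phi> \<in> borel_measurable surface"
   using bounded_measurableE[OF \<phi>] by metis
  have "(LINT z|surface. 1 / \<sigma> * cmod (\<phi> z)) powr q \<le> (LINT z|surface. 1 / \<sigma> * cmod (\<phi> z) powr q)"
   by (rule jensen_powr[OF _ _ _ _ _ _ q, where B = B]) (use B \<sigma> in \<open>auto simp: surface_area_def \<sigma>_def\<close>)
  then have "((LINT z|surface. cmod (\<phi> z)) / \<sigma>) powr q \<le> 1 / \<sigma> * sphere_Lq q \<phi> powr q"
   using q by (simp add: sphere_Lq_powr)
  then have "(((LINT z|surface. cmod (\<phi> z)) / \<sigma>) powr q) powr (1 / q) \<le> (1 / \<sigma> * sphere_Lq q \<phi> powr q) powr (1 / q)"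
   using q by (intro powr_mono2) auto
  moreover have "(((LINT z|surface. cmod (\<phi> z)) / \<sigma>) powr q) powr (1 / q) = (LINT z|surface. cmod (\<phi> z)) / \<sigma>"
   using q \<sigma> by (simp add: powr_powr bochner_integral_nonneg)
  moreover have "(1 / \<sigma> * sphere_Lq q \<phi> powr q) powr (1 / q) = (1 / \<sigma>) powr (1 / q) * sphere_Lq q \<phi>"
   unfolding powr_mult powr_powr using q by (simp add: sphere_Lq_nonneg)
  ultimately show ?thesis using \<sigma> by (simp add: divide_le_eq mult_ac)
 qed
 then show ?thesis using \<sigma> by (intro exI[of _ "\<sigma> * (1 / \<sigma>) powr (1 / q)"]) auto
qed

lemma sphere_Lq_scale:
 assumes "q > 0"
 shows "sphere_Lq q (\<lambda>z. of_real u * \<phi> z) = \<bar>u\<bar> * sphere_Lq q \<phi>"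
 using assms by (simp add: sphere_Lq_def norm_mult powr_mult powr_powr)

lemma suminf_swap:
 fixes h :: "nat \<Rightarrow> nat \<Rightarrow> complex"
 assumes h: "\<And>k n. cmod (h k n) \<le> A k * w n" and A: "summable A" and w: "summable w" "\<And>n. w n \<ge> 0"
 shows "(\<lambda>n. \<Sum>k. h k n) sums (\<Sum>k. \<Sum>n. h k n)"
proof -
 have hn: "summable (\<lambda>n. norm (h k n))" for k
  by (rule summable_comparison_test'[OF summable_mult[OF w(1), of "A k"]]) (use h in auto)
 have hk: "summable (\<lambda>k. norm (h k n))" for n
  by (rule summable_comparison_test'[OF summable_mult2[OF A, of "w n"]]) (use h in auto)
 have le: "(\<Sum>n. norm (h k n)) \<le> A k * suminf w" for k
  using suminf_le[OF h hn summable_mult[OF w(1)]] suminf_mult[OF w(1)] by simp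
 have "(\<lambda>k. integral\<^sup>L (count_space UNIV) (h k)) sums (\<integral>n. (\<Sum>k. h k n) \<partial>count_space UNIV)"
 proof (rule sums_integral)
  show "integrable (count_space UNIV) (h k)" for k by (rule suminf_eq_integral_count_space(1)[OF hn])
  show "AE n in count_space UNIV. summable (\<lambda>k. norm (h k n))" using hk by simp
  have "(\<integral>n. norm (h k n) \<partial>count_space UNIV) = (\<Sum>n. norm (h k n))" for k
   using suminf_eq_integral_count_space(2)[of "\<lambda>n. norm (h k n)"] hn by simp
  moreover have "summable (\<lambda>k. \<Sum>n. norm (h k n))"
   by (rule summable_comparison_test'[OF summable_mult2[OF A, of "suminf w"]])
    (use le suminf_nonneg[OF hn] in auto)
  ultimately show "summable (\<lambda>k. \<integral>n. norm (h k n) \<partial>count_space UNIV)" by simp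
 qed
 moreover have "integral\<^sup>L (count_space UNIV) (h k) = (\<Sum>n. h k n)" for k
  by (rule suminf_eq_integral_count_space(2)[OF hn])
 moreover have s: "summable (\<lambda>n. norm (\<Sum>k. h k n))"
 proof (rule summable_comparison_test'[OF summable_mult[OF w(1), of "suminf A"]])
  fix n
  have "norm (\<Sum>k. h k n) \<le> (\<Sum>k. norm (h k n))" by (rule summable_norm[OF hk])
  also have "\<dots> \<le> suminf A * w n"
   using suminf_le[OF h hk summable_mult2[OF A]] suminf_mult2[OF A] by simp
  finally show "norm (norm (\<Sum>k. h k n)) \<le> suminf A * w n" by simp
 qed
 moreover have "(\<integral>n. (\<Sum>k. h k n) \<partial>count_space UNIV) = (\<Sum>n. \<Sum>k. h k n)"
  by (rule suminf_eq_integral_count_space(2)[OF s])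
 ultimately show ?thesis using summable_norm_cancel[OF s] by (simp add: sums_iff)
qed

text \<open>
 By Jensen the \<open>p\<close>-th power of the sum is at most a weighted sum of \<open>p\<close>-th powers.
 The weighted integral of each of them is bounded uniformly in \<open>r n\<close>, since \<open>(1 - r n) powr
 (\<nu> - \<alpha>)\<close> compensates exactly what the integral loses.
\<close>

lemma B_spaceI:
 fixes f :: "'a::euclidean_space \<Rightarrow> complex" and r :: "nat \<Rightarrow> real"
 assumes H: "harmonic_on (ball 0 1) f" and p: "p \<ge> 1" and q: "q > 0" and \<alpha>: "\<alpha> > 0" and \<nu>: "\<nu> > \<alpha>" and K: "K > 0"
  and r: "\<And>n. 0 \<le> r n" "\<And>n. r n < 1"
  and L: "\<And>R. 0 < R \<Longrightarrow> R < 1 \<Longrightarrow> sphere_Lq q (\<lambda>y. f (R *\<^sub>R y))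
   \<le> (\<Sum>n. (1/3) ^ n * (K * (1 - r n) powr (\<nu> - \<alpha>) * (1 - R * r n) powr (- \<nu>)))"
 shows "f \<in> B_space p q \<alpha>"
proof -
 have cf: "continuous_on (ball 0 1) f" by (rule harmonic_on_imp_continuous[OF H])
 define e where "e = \<alpha> * p - 1"
 define E where "E = max 1 (2 powr e)"
 define N where "N = DIM('a) - 1"
 define \<psi> where "\<psi> n R = K * (1 - r n) powr (\<nu> - \<alpha>) * (1 - R * r n) powr (- \<nu>)" for n and R :: real
 define M where "M = (3/2) powr (p - 1) * E * K powr p"
 define g where "g n R = ((1 - R) powr (\<alpha> * p - 1) * (1 - R * r n) powr (- ((\<nu> - \<alpha>) * p + \<alpha> * p)))" for n and R :: real
 define v where "v n = M * ((1/3) ^ n * (1 - r n) powr ((\<nu> - \<alpha>) * p))" for n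
 have M: "M \<ge> 0" "E \<ge> 0" by (auto simp: M_def E_def)
 have geo: "(\<lambda>n. (1/3 :: real) ^ n) sums (3/2)"
  using geometric_sums[of "1/3 :: real"] by simp
 have point: "ennreal_powr (integral_mean q f R) p * ennreal ((1 - R\<^sup>2) powr e * R ^ N) \<le> (\<Sum>n. ennreal (v n * g n R))"
  if R: "0 < R" "R < 1" for R
 proof -
  have rR: "1 - R \<le> 1 - R * r n" "0 < 1 - R * r n" for n
  proof -
   have "R * r n \<le> R" using r(2)[of n] R by simp
   then show "1 - R \<le> 1 - R * r n" "0 < 1 - R * r n" using R by linarith+
  qed
  have \<psi>0: "0 \<le> \<psi> n R" for n using K by (simp add: \<psi>_def)
  have \<psi>B: "\<psi> n R \<le> K * 1 * (1 - R) powr (- \<nu>)" for n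
   unfolding \<psi>_def
  proof (intro mult_mono)
   show "(1 - r n) powr (\<nu> - \<alpha>) \<le> 1" using r[of n] \<nu> by (intro powr_le1) auto
   show "(1 - R * r n) powr (- \<nu>) \<le> (1 - R) powr (- \<nu>)" using rR[of n] R \<alpha> \<nu> by (intro powr_mono2') auto
  qed (use K in auto)
  have J: "(\<Sum>n. (1/3) ^ n * \<psi> n R) powr p \<le> (3/2) powr (p - 1) * (\<Sum>n. (1/3) ^ n * \<psi> n R powr p)"
   "summable (\<lambda>n. (1/3) ^ n * \<psi> n R)" "summable (\<lambda>n. (1/3) ^ n * \<psi> n R powr p)"
   using jensen_series[OF _ geo _ \<psi>0 \<psi>B p] by auto
  define L where "L = sphere_Lq q (\<lambda>y. f (R *\<^sub>R y))"
  have "L powr p \<le> (\<Sum>n. (1/3) ^ n * \<psi> n R) powr p"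
   using L[OF R] p unfolding L_def \<psi>_def by (intro powr_mono2) (auto simp: sphere_Lq_nonneg)
  also note J(1)
  finally have Lp: "L powr p \<le> (3/2) powr (p - 1) * (\<Sum>n. (1/3) ^ n * \<psi> n R powr p)" .
  have wt: "(1 - R\<^sup>2) powr e * R ^ N \<le> E * (1 - R) powr e * 1"
  proof (intro mult_mono)
   have f: "1 - R\<^sup>2 = (1 + R) * (1 - R)" by (simp add: power2_eq_square algebra_simps)
   have "(1 + R) powr e \<le> E"
   proof (cases "e \<ge> 0")
    case True
    then have "(1 + R) powr e \<le> 2 powr e" using R by (intro powr_mono2) auto
    then show ?thesis by (simp add: E_def)
   next
    case False
    then have "(1 + R) powr e \<le> 1 powr e" using R by (intro powr_mono2') auto
    then show ?thesis by (simp add: E_def)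
   qed
   then show "(1 - R\<^sup>2) powr e \<le> E * (1 - R) powr e"
    unfolding f powr_mult by (intro mult_right_mono) auto
   show "R ^ N \<le> 1" using R by (simp add: power_le_one)
  qed (use M R in auto)
  have summand: "(3/2) powr (p - 1) * ((1/3) ^ n * \<psi> n R powr p) * (E * (1 - R) powr e) = v n * g n R" for n
  proof -
   have "\<psi> n R powr p = K powr p * (1 - r n) powr ((\<nu> - \<alpha>) * p) * (1 - R * r n) powr (- \<nu> * p)"
    unfolding \<psi>_def powr_mult powr_powr ..
   moreover have "- \<nu> * p = - ((\<nu> - \<alpha>) * p + \<alpha> * p)" by (simp add: algebra_simps)
   ultimately show ?thesis unfolding v_def g_def M_def e_def by simp
  qed
  have "L powr p * ((1 - R\<^sup>2) powr e * R ^ N) \<le> ((3/2) powr (p - 1) * (\<Sum>n. (1/3) ^ n * \<psi> n R powr p)) * (E * (1 - R) powr e)"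
  proof (rule mult_mono[OF Lp])
   show "(1 - R\<^sup>2) powr e * R ^ N \<le> E * (1 - R) powr e" using wt by simp
   show "0 \<le> (3/2) powr (p - 1) * (\<Sum>n. (1/3) ^ n * \<psi> n R powr p)"
    by (intro mult_nonneg_nonneg suminf_nonneg J) auto
  qed (use R in auto)
  also have "\<dots> = (\<Sum>n. (3/2) powr (p - 1) * ((1/3) ^ n * \<psi> n R powr p) * (E * (1 - R) powr e))"
   using suminf_mult[OF J(3)] suminf_mult2[OF summable_mult[OF J(3)]] by simp
  finally have le: "L powr p * ((1 - R\<^sup>2) powr e * R ^ N) \<le> (\<Sum>n. v n * g n R)" unfolding summand .
  have sv: "summable (\<lambda>n. v n * g n R)"
   unfolding summand[symmetric] by (intro summable_mult2 summable_mult J(3))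
  have "integral_mean q f R = ennreal L"
   unfolding L_def by (rule integral_mean_eq[OF cf]) (use R q in auto)
  then have "ennreal_powr (integral_mean q f R) p * ennreal ((1 - R\<^sup>2) powr e * R ^ N) = ennreal (L powr p * ((1 - R\<^sup>2) powr e * R ^ N))"
   using R by (simp add: ennreal_powr_ennreal L_def sphere_Lq_nonneg ennreal_mult)
  also have "\<dots> \<le> ennreal (\<Sum>n. v n * g n R)" by (rule ennreal_leI[OF le])
  also have "\<dots> = (\<Sum>n. ennreal (v n * g n R))"
   by (rule suminf_ennreal2[symmetric, OF _ sv]) (use M in \<open>simp add: v_def g_def\<close>)
  finally show ?thesis .
 qed
 define \<tau> where "\<tau> = \<alpha> * p"
 define \<kappa> where "\<kappa> = (\<nu> - \<alpha>) * p"
 have \<tau>\<kappa>: "\<tau> > 0" "\<kappa> > 0" using \<alpha> \<nu> p by (auto simp: \<tau>_def \<kappa>_def)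
 have v0: "v n \<ge> 0" for n using M by (simp add: v_def)
 have gm: "(\<lambda>R. ennreal (g n R) * indicator {0<..<1} R) \<in> borel_measurable lborel" for n
  unfolding g_def by auto
 have "(\<integral>\<^sup>+ R \<in> {0<..<1}. ennreal_powr (integral_mean q f R) p * ennreal ((1 - R\<^sup>2) powr e * R ^ N) \<partial>lborel)
   \<le> (\<integral>\<^sup>+ R. (\<Sum>n. ennreal (v n) * (ennreal (g n R) * indicator {0<..<1} R)) \<partial>lborel)"
 proof (rule nn_integral_mono)
  fix R :: real
  show "ennreal_powr (integral_mean q f R) p * ennreal ((1 - R\<^sup>2) powr e * R ^ N) * indicator {0<..<1} R
    \<le> (\<Sum>n. ennreal (v n) * (ennreal (g n R) * indicator {0<..<1} R))"
   using point[of R] v0 by (auto simp: indicator_def ennreal_mult g_def)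
 qed
 also have "\<dots> = (\<Sum>n. \<integral>\<^sup>+ R. ennreal (v n) * (ennreal (g n R) * indicator {0<..<1} R) \<partial>lborel)"
  by (rule nn_integral_suminf) (use gm in measurable)
 also have "\<dots> \<le> (\<Sum>n. ennreal (M * (1 / \<tau> + 1 / \<kappa>) * (1/3) ^ n))"
 proof (rule suminf_le)
  fix n
  have "(\<integral>\<^sup>+ R. ennreal (v n) * (ennreal (g n R) * indicator {0<..<1} R) \<partial>lborel)
    = ennreal (v n) * (\<integral>\<^sup>+ R \<in> {0<..<1}. ennreal (g n R) \<partial>lborel)"
   by (rule nn_integral_cmult[OF gm])
  also have "\<dots> \<le> ennreal (v n) * ennreal ((1 / \<tau> + 1 / \<kappa>) * (1 - r n) powr (- \<kappa>))"
   unfolding g_def \<tau>_def[symmetric] \<kappa>_def[symmetric]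
   by (intro mult_left_mono nn_integral_weight_bound \<tau>\<kappa> r) simp
  also have "\<dots> = ennreal (M * (1 / \<tau> + 1 / \<kappa>) * (1/3) ^ n * ((1 - r n) powr \<kappa> * (1 - r n) powr (- \<kappa>)))"
  proof -
   have "v n = M * ((1/3) ^ n * (1 - r n) powr \<kappa>)" by (simp add: v_def \<kappa>_def)
   then show ?thesis using v0[of n] \<tau>\<kappa> by (simp add: ennreal_mult[symmetric] mult_ac)
  qed
  also have "(1 - r n) powr \<kappa> * (1 - r n) powr (- \<kappa>) = 1" using r[of n] by (simp add: powr_add[symmetric])
  finally show "(\<integral>\<^sup>+ R. ennreal (v n) * (ennreal (g n R) * indicator {0<..<1} R) \<partial>lborel) \<le> ennreal (M * (1 / \<tau> + 1 / \<kappa>) * (1/3) ^ n)"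
   by simp
 qed auto
 also have "\<dots> = ennreal (\<Sum>n. M * (1 / \<tau> + 1 / \<kappa>) * (1/3) ^ n)"
  by (rule suminf_ennreal2) (use M \<tau>\<kappa> in \<open>auto intro!: summable_mult\<close>)
 also have "\<dots> < \<infinity>" by simp
 finally have "(\<integral>\<^sup>+ R \<in> {0<..<1}. ennreal_powr (integral_mean q f R) p * ennreal ((1 - R\<^sup>2) powr e * R ^ N) \<partial>lborel) < \<infinity>" .
 then show ?thesis
  unfolding B_space_def e_def N_def using H by (simp add: harmonic_ball_def ennreal_powr_def less_top)
qed

context sh_basis
begin

lemma sh_series_le:
 assumes D: "subexponential D" and a: "\<And>k. row a k \<le> D k" and x: "x \<in> ball 0 1"
 shows "cmod (series a x) \<le> (\<Sum>k. norm x ^ k * (D k * Y_bound k))"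
proof -
 have D0: "D k \<ge> 0" for k using a[of k] row_nonneg[of a k] by simp
 have ra: "subexponential (row a)"
  by (rule subexponential_mono[OF D]) (use a D0 row_nonneg in auto)
 have sD: "summable (\<lambda>k. norm x ^ k * (D k * Y_bound k))"
  using subexponential_summable[OF subexponential_mult[OF D subexponential_Y_bound], of "norm x"] x D0 Y_bound_nonneg
  by (simp add: abs_mult mult_ac)
 have le: "norm (sh_term d Y a x k) \<le> norm x ^ k * (D k * Y_bound k)" for k
 proof -
  have "norm (sh_term d Y a x k) \<le> norm x ^ k * (row a k * Y_bound k)"
   unfolding sh_term_eq by (rule norm_term_le) (use sphere_point in auto)
  also have "\<dots> \<le> norm x ^ k * (D k * Y_bound k)"
   by (intro mult_left_mono mult_right_mono a Y_bound_nonneg) auto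
  finally show ?thesis .
 qed
 have sn: "summable (\<lambda>k. norm (sh_term d Y a x k))"
  by (rule summable_comparison_test'[OF sD]) (use le in simp)
 have "cmod (series a x) \<le> (\<Sum>k. norm (sh_term d Y a x k))"
  unfolding sh_series_def by (rule summable_norm[OF sn])
 also have "\<dots> \<le> (\<Sum>k. norm x ^ k * (D k * Y_bound k))"
  by (rule suminf_le[OF le sn sD])
 finally show ?thesis .
qed

text \<open>
 Absolute convergence of the double series allows exchanging the sum over the family with the expansion.
\<close>

lemma sh_series_superposition:
 fixes w :: "nat \<Rightarrow> real"
 assumes D: "subexponential D" and b: "\<And>n k. row (b n) k \<le> D k" and w: "summable (\<lambda>n. \<bar>w n\<bar>)"
 shows "subexponential (row (\<lambda>k j. \<Sum>n. of_real (w n) * b n k j))"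
  and "x \<in> ball 0 1 \<Longrightarrow> (\<lambda>n. of_real (w n) * series (b n) x) sums series (\<lambda>k j. \<Sum>n. of_real (w n) * b n k j) x"
proof -
 let ?a = "\<lambda>k j. \<Sum>n. of_real (w n) * b n k j"
 have D0: "D k \<ge> 0" for k using b[of undefined k] row_nonneg[of "b undefined" k] by linarith
 have rb: "subexponential (row (b n))" for n
  by (rule subexponential_mono[OF D]) (use b D0 row_nonneg in auto)
 have bj: "cmod (b n k j) \<le> D k" if "j \<in> {1..d k}" for n k j
 proof -
  have "cmod (b n k j) \<le> row (b n) k" unfolding row_def by (rule member_le_sum) (use that in auto)
  then show ?thesis using b[of n k] by linarith
 qed
 have wb: "norm (of_real (w n) * b n k j) \<le> D k * \<bar>w n\<bar>" if "j \<in> {1..d k}" for n k j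
  using mult_left_mono[OF bj[OF that, of n], of "\<bar>w n\<bar>"] by (simp add: norm_mult mult.commute)
 have wbn: "summable (\<lambda>n. norm (of_real (w n) * b n k j))" if "j \<in> {1..d k}" for k j
  by (rule summable_comparison_test'[OF summable_mult[OF w, of "D k"]]) (use wb[OF that] in simp)
 have ale: "cmod (?a k j) \<le> D k * (\<Sum>n. \<bar>w n\<bar>)" if j: "j \<in> {1..d k}" for k j
 proof -
  have "cmod (?a k j) \<le> (\<Sum>n. norm (of_real (w n) * b n k j))" by (rule summable_norm[OF wbn[OF j]])
  also have "\<dots> \<le> (\<Sum>n. D k * \<bar>w n\<bar>)"
   by (rule suminf_le[OF wb[OF j] wbn[OF j] summable_mult[OF w]])
  also have "\<dots> = D k * (\<Sum>n. \<bar>w n\<bar>)" by (rule suminf_mult[OF w])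
  finally show ?thesis .
 qed
 have rowa: "row ?a k \<le> real (d k) * (D k * (\<Sum>n. \<bar>w n\<bar>))" for k
 proof -
  have "row ?a k \<le> (\<Sum>j=1..d k. D k * (\<Sum>n. \<bar>w n\<bar>))"
   unfolding row_def by (rule sum_mono) (rule ale)
  then show ?thesis by simp
 qed
 have "subexponential (\<lambda>k. real (d k) * (D k * (\<Sum>n. \<bar>w n\<bar>)))"
  by (intro subexponential_mult subexponential_dim D subexponential_const)
 then show ra: "subexponential (row ?a)"
 proof (rule subexponential_mono)
  fix k show "norm (row ?a k) \<le> norm (real (d k) * (D k * (\<Sum>n. \<bar>w n\<bar>)))"
   unfolding real_norm_def abs_of_nonneg[OF row_nonneg] by (rule order_trans[OF rowa abs_ge_self])
 qed
 assume x: "x \<in> ball 0 1"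
 define y where "y = sphere_point x"
 have y: "y \<in> sphere 0 1" unfolding y_def by (rule sphere_point)
 define h where "h k n = of_real (norm x ^ k) * (of_real (w n) * part (b n) k y)" for k n
 have h: "cmod (h k n) \<le> norm x ^ k * (D k * Y_bound k) * \<bar>w n\<bar>" for k n
 proof -
  have "cmod (h k n) = \<bar>w n\<bar> * norm (of_real (norm x ^ k) * part (b n) k y)"
   by (simp add: h_def norm_mult)
  also have "\<dots> \<le> \<bar>w n\<bar> * (norm x ^ k * (row (b n) k * Y_bound k))"
   by (intro mult_left_mono norm_term_le y) auto
  also have "\<dots> \<le> \<bar>w n\<bar> * (norm x ^ k * (D k * Y_bound k))"
   by (intro mult_left_mono mult_right_mono b Y_bound_nonneg) auto
  finally show ?thesis by (simp only: mult_ac)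
 qed
 have sD: "summable (\<lambda>k. norm x ^ k * (D k * Y_bound k))"
  using subexponential_summable[OF subexponential_mult[OF D subexponential_Y_bound], of "norm x"] x D0 Y_bound_nonneg
  by (simp add: abs_mult mult_ac)
 have s: "(\<lambda>n. \<Sum>k. h k n) sums (\<Sum>k. \<Sum>n. h k n)"
  by (rule suminf_swap[OF h sD w]) simp
 have "(\<Sum>k. h k n) = of_real (w n) * series (b n) x" for n
 proof -
  have "(\<lambda>k. of_real (w n) * sh_term d Y (b n) x k) sums (of_real (w n) * series (b n) x)"
   by (rule sums_mult[OF sh_series_sums[OF rb x]])
  then have "(\<lambda>k. h k n) sums (of_real (w n) * series (b n) x)"
   unfolding sh_term_eq y_def[symmetric] h_def by (simp only: mult_ac)
  then show ?thesis by (simp add: sums_iff)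
 qed
 moreover have "(\<Sum>n. h k n) = sh_term d Y ?a x k" for k
 proof -
  have "(\<lambda>n. \<Sum>j=1..d k. of_real (w n) * b n k j * of_real (Y k j y)) sums (\<Sum>j=1..d k. ?a k j * of_real (Y k j y))"
   by (intro sums_sum sums_mult2 summable_sums summable_norm_cancel[OF wbn])
  then have "(\<lambda>n. of_real (norm x ^ k) * (\<Sum>j=1..d k. of_real (w n) * b n k j * of_real (Y k j y))) sums (of_real (norm x ^ k) * part ?a k y)"
   unfolding part_def by (rule sums_mult)
  moreover have "of_real (norm x ^ k) * (\<Sum>j=1..d k. of_real (w n) * b n k j * of_real (Y k j y)) = h k n" for n
   unfolding h_def part_def by (simp only: sum_distrib_left mult.assoc)
  ultimately show ?thesis unfolding sh_term_eq y_def[symmetric] by (simp only: sums_iff)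
 qed
 ultimately show "(\<lambda>n. of_real (w n) * series (b n) x) sums series ?a x"
  using s unfolding sh_series_def[of d Y ?a] by (simp only:)
qed

text \<open>
 A quotient of Gamma functions with integer increment \<open>N\<close>, hence a product of \<open>N\<close>
 Euler operators.
\<close>

definition poch :: "nat \<Rightarrow> nat \<Rightarrow> real" where
 "poch N k = pochhammer (real k + real DIM('a) / 2) N"

text \<open>
 The factor \<open>r ^ k\<close> dilates by \<open>r\<close>, the power of \<open>1 - r\<close> normalises the
 result in the mixed norm.
\<close>

definition test_coeff :: "nat \<Rightarrow> real \<Rightarrow> ('a \<Rightarrow> complex) \<Rightarrow> real \<Rightarrow> nat \<Rightarrow> nat \<Rightarrow> complex" where
 "test_coeff N \<alpha> \<phi> r = weighted (\<lambda>k. r ^ k * (1 - r) powr (real N - \<alpha>)) (weighted (poch N) (moment \<phi>))"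

lemma subexponential_poch: "subexponential (poch N)"
 unfolding poch_def[abs_def] by (rule subexponential_pochhammer)

lemma row_test_coeff_le:
 assumes q: "q \<ge> 1"
 obtains D where "subexponential D"
  "\<And>\<phi> r k. bounded_measurable \<phi> \<Longrightarrow> sphere_Lq q \<phi> \<le> 1 \<Longrightarrow> 0 \<le> r \<Longrightarrow> r < 1 \<Longrightarrow>
    row (test_coeff N \<alpha> \<phi> r) k \<le> (1 - r) powr (real N - \<alpha>) * D k"
proof -
 obtain H where H: "H \<ge> 0" "\<And>\<phi> :: 'a \<Rightarrow> complex. bounded_measurable \<phi> \<Longrightarrow> (LINT z|surface. cmod (\<phi> z)) \<le> H * sphere_Lq q \<phi>"
  using integral_cmod_le_sphere_Lq[OF q, where 'a = 'a] by metis
 define D where "D k = \<bar>poch N k\<bar> * (H * (real (d k) * Y_bound k))" for k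
 have "subexponential (\<lambda>k. \<bar>poch N k\<bar>)"
  by (rule subexponential_mono[OF subexponential_poch[of N]]) simp
 then have "subexponential D"
  unfolding D_def[abs_def] by (intro subexponential_mult subexponential_const subexponential_dim subexponential_Y_bound)
 moreover have "row (test_coeff N \<alpha> \<phi> r) k \<le> (1 - r) powr (real N - \<alpha>) * D k"
  if \<phi>: "bounded_measurable \<phi>" and L: "sphere_Lq q \<phi> \<le> 1" and r: "0 \<le> r" "r < 1" for \<phi> r k
 proof -
  have "row (moment \<phi>) k \<le> (LINT z|surface. cmod (\<phi> z)) * (real (d k) * Y_bound k)" by (rule row_moment_le[OF \<phi>])
  also have "\<dots> \<le> H * (real (d k) * Y_bound k)"
  proof (rule mult_right_mono)
   show "(LINT z|surface. cmod (\<phi> z)) \<le> H"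
    using H(2)[OF \<phi>] mult_left_mono[OF L H(1)] by simp
  qed (use Y_bound_nonneg in simp)
  finally have m: "row (moment \<phi>) k \<le> H * (real (d k) * Y_bound k)" .
  have "row (test_coeff N \<alpha> \<phi> r) k = (1 - r) powr (real N - \<alpha>) * (r ^ k * (\<bar>poch N k\<bar> * row (moment \<phi>) k))"
   using r by (simp add: test_coeff_def row_weighted abs_mult)
  also have "\<dots> \<le> (1 - r) powr (real N - \<alpha>) * (1 * D k)"
   unfolding D_def using r row_nonneg
   by (intro mult_left_mono mult_mono m) (auto simp: power_le_one)
  finally show ?thesis by simp
 qed
 ultimately show thesis using that by blast
qed

lemma sh_series_test_coeff:
 assumes a: "subexponential (row a)" and y: "y \<in> sphere 0 1" and R: "0 \<le> R" "R < 1" and r: "0 \<le> r" "r < 1"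
 shows "series (weighted (\<lambda>k. r ^ k * u) a) (R *\<^sub>R y) = of_real u * series a ((r * R) *\<^sub>R y)"
proof -
 have sr: "subexponential (\<lambda>k. r ^ k * u)"
  by (intro subexponential_mult subexponential_const, rule subexponential_mono[OF subexponential_const[of "1::real"]])
   (use r in \<open>simp add: power_le_one\<close>)
 have rR: "0 \<le> r * R" "r * R < 1" using r R by (auto intro: le_less_trans[OF mult_left_le_one_le])
 have "(\<lambda>k. of_real u * (of_real ((r * R) ^ k) * part a k y)) sums (of_real u * series a ((r * R) *\<^sub>R y))"
  by (intro sums_mult sh_series_polar a y rR)
 moreover have "of_real u * (of_real ((r * R) ^ k) * part a k y) = of_real (R ^ k) * part (weighted (\<lambda>k. r ^ k * u) a) k y" for k
  by (simp add: part_weighted power_mult_distrib mult_ac)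
 ultimately show ?thesis
  using sums_unique2[OF sh_series_polar[OF subexponential_weighted[OF sr a] y R]] by simp
qed

text \<open>
 At radius \<open>R\<close> the dilation moves a test function to radius \<open>R * r\<close>, so the growth
 estimate gives its mean the bound \<open>\<psi> n\<close> that \<open>B_spaceI\<close> asks for.
\<close>

lemma test_superposition_in_B_space:
 assumes p: "p \<ge> 1" and q: "q \<ge> 1" and \<alpha>: "\<alpha> > 0" and N: "real N > \<alpha>"
  and \<phi>: "\<And>n. bounded_measurable (\<phi> n)" "\<And>n. sphere_Lq q (\<phi> n) \<le> 1"
  and r: "\<And>n. 0 \<le> r n" "\<And>n. r n < 1" and e: "\<And>n. e n = 1 \<or> e n = (-1 :: real)"
 shows "series (\<lambda>k j. \<Sum>n. of_real (e n * (1/3) ^ n) * test_coeff N \<alpha> (\<phi> n) (r n) k j) \<in> B_space p q \<alpha>"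
proof -
 define b where "b n = test_coeff N \<alpha> (\<phi> n) (r n)" for n
 define \<theta> where "\<theta> n = (1 - r n) powr (real N - \<alpha>)" for n
 define m where "m n = weighted (poch N) (moment (\<phi> n))" for n
 define w where "w n = e n * (1/3) ^ n" for n
 define a where "a k j = (\<Sum>n. of_real (w n) * b n k j)" for k j
 have \<theta>: "0 < \<theta> n" "\<theta> n \<le> 1" for n
  using r[of n] N by (auto simp: \<theta>_def intro: powr_le1)
 obtain D where D: "subexponential D" "\<And>n k. row (b n) k \<le> \<theta> n * D k"
  using row_test_coeff_le[OF q, of N \<alpha>] \<phi> r unfolding b_def \<theta>_def by metis
 have D0: "D k \<ge> 0" for k
  using D(2)[of 0 k] row_nonneg[of "b 0" k] \<theta>(1)[of 0] by (metis order_trans zero_le_mult_iff not_le)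
 have bD: "row (b n) k \<le> D k" for n k
  using D(2)[of n k] mult_right_mono[OF \<theta>(2)[of n] D0[of k]] by simp
 have wabs: "\<bar>w n\<bar> = (1/3) ^ n" for n using e[of n] by (auto simp: w_def abs_mult)
 have ws: "summable (\<lambda>n. \<bar>w n\<bar>)" unfolding wabs by simp
 have rm: "subexponential (row (m n))" for n
  unfolding m_def by (intro subexponential_weighted subexponential_poch subexponential_row_moment \<phi>)
 have rb: "subexponential (row (b n))" for n
  by (rule subexponential_mono[OF D(1)]) (use bD D0 row_nonneg in auto)
 have ra: "subexponential (row a)" unfolding a_def[abs_def] by (rule sh_series_superposition(1)[OF D(1) bD ws])
 obtain C where C: "C > 0" "\<And>\<phi> r. bounded_measurable \<phi> \<Longrightarrow> 0 \<le> r \<Longrightarrow> r < 1 \<Longrightarrow>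
  sphere_Lq q (\<lambda>y. series (weighted (poch N) (moment \<phi>)) (r *\<^sub>R y)) \<le> C / (1 - r) ^ N * sphere_Lq q \<phi>"
  using pochhammer_growth[OF q, of N] unfolding poch_def[abs_def] by metis
 have "series a \<in> B_space p q \<alpha>"
 proof (rule B_spaceI[OF sh_series_harmonic[OF ra] p _ \<alpha> N C(1) r])
  fix R :: real assume R: "0 < R" "R < 1"
  have R0: "0 \<le> R" using R by simp
  define \<psi> where "\<psi> n = C * \<theta> n * (1 - R * r n) powr (- real N)" for n
  have rR: "0 \<le> R * r n" "R * r n \<le> R" "R * r n < 1" for n
  proof -
   show "R * r n \<le> R" using r(2)[of n] R by simp
   then show "R * r n < 1" using R by linarith
  qed (use r R in simp)
  \<comment> \<open>Keeps the quotient of the pointwise bound and \<open>\<psi> n\<close> bounded although \<open>\<theta> n\<close> may tend to 0.\<close>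
  have \<psi>low: "C * \<theta> n \<le> \<psi> n" for n
  proof -
   have "(1 - R * r n) powr (- real N) \<ge> 1 powr (- real N)"
    using rR[of n] by (intro powr_mono2') auto
   then show ?thesis using C(1) \<theta>(1)[of n] by (simp add: \<psi>_def)
  qed
  have \<psi>0: "\<psi> n > 0" for n using \<psi>low[of n] mult_pos_pos[OF C(1) \<theta>(1)[of n]] by linarith
  have \<psi>up: "\<psi> n \<le> C * 1 * (1 - R) powr (- real N)" for n
   unfolding \<psi>_def
  proof (intro mult_mono)
   show "(1 - R * r n) powr (- real N) \<le> (1 - R) powr (- real N)"
    using rR[of n] R by (intro powr_mono2') auto
  qed (use C \<theta>[of n] in auto)
  define h where "h n z = series (b n) (R *\<^sub>R z)" for n z
  define S where "S = (\<Sum>k. R ^ k * (D k * Y_bound k))"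
  have heq: "h n z = of_real (\<theta> n) * series (m n) ((r n * R) *\<^sub>R z)" if "z \<in> sphere 0 1" for n z
   unfolding h_def b_def test_coeff_def m_def[symmetric] \<theta>_def
   by (rule sh_series_test_coeff[OF rm that R0 R(2) r])
  have hb: "cmod (h n z) \<le> (S / C) * \<psi> n" if z: "z \<in> sphere 0 1" for n z
  proof -
   have sD: "subexponential (\<lambda>k. \<theta> n * D k)" by (intro subexponential_mult subexponential_const D)
   have sm: "summable (\<lambda>k. R ^ k * (D k * Y_bound k))"
    using subexponential_summable[OF subexponential_mult[OF D(1) subexponential_Y_bound] R0 R(2)] D0 Y_bound_nonneg
    by (simp add: abs_mult mult_ac)
   have S0: "S \<ge> 0" unfolding S_def by (rule suminf_nonneg[OF sm]) (use R D0 Y_bound_nonneg in simp)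
   have "cmod (h n z) \<le> (\<Sum>k. norm (R *\<^sub>R z) ^ k * (\<theta> n * D k * Y_bound k))"
    unfolding h_def by (rule sh_series_le[OF sD D(2)]) (use z R in simp)
   also have "(\<lambda>k. norm (R *\<^sub>R z) ^ k * (\<theta> n * D k * Y_bound k)) = (\<lambda>k. \<theta> n * (R ^ k * (D k * Y_bound k)))"
    using z R by (simp add: fun_eq_iff mult_ac)
   also have "(\<Sum>k. \<theta> n * (R ^ k * (D k * Y_bound k))) = \<theta> n * S"
    unfolding S_def by (rule suminf_mult[OF sm])
   also have "\<dots> = (S / C) * (C * \<theta> n)" using C by simp
   also have "\<dots> \<le> (S / C) * \<psi> n" by (intro mult_left_mono \<psi>low) (use S0 C in simp)
   finally show ?thesis .
  qed
  have "sphere_Lq q (\<lambda>z. series a (R *\<^sub>R z)) \<le> (\<Sum>n. (1/3) ^ n * \<psi> n)"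
  proof (rule sphere_Lq_suminf_le[OF _ hb _ _ _ \<psi>0 _ _ q])
   show "bounded_measurable (h n)" for n
    unfolding h_def by (rule bounded_measurable_sh_series[OF rb R0 R(2)])
   show "bounded_measurable (\<lambda>z. series a (R *\<^sub>R z))"
    by (rule bounded_measurable_sh_series[OF ra R0 R(2)])
   show "cmod (series a (R *\<^sub>R z)) \<le> (\<Sum>n. (1/3) ^ n * cmod (h n z))" if z: "z \<in> sphere 0 1" for z
   proof -
    have "(\<lambda>n. of_real (w n) * h n z) sums series a (R *\<^sub>R z)"
     unfolding h_def a_def[abs_def] by (rule sh_series_superposition(2)[OF D(1) bD ws]) (use z R in simp)
    moreover have nw: "norm (of_real (w n) * h n z) = (1/3) ^ n * cmod (h n z)" for n
     by (simp add: norm_mult wabs)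
    moreover have "summable (\<lambda>n. norm (of_real (w n) * h n z))"
    proof (rule summable_comparison_test'[OF summable_mult2[OF ws, of "S / C * (C * 1 * (1 - R) powr (- real N))"]])
     fix n
     have "0 \<le> (S / C) * \<psi> n" using hb[OF z, of n] norm_ge_zero order_trans by blast
     then have "0 \<le> S / C" using \<psi>0[of n] unfolding zero_le_mult_iff[of "S / C"] by linarith
     then have "cmod (h n z) \<le> S / C * (C * 1 * (1 - R) powr (- real N))"
      using hb[OF z, of n] mult_left_mono[OF \<psi>up[of n]] order_trans by blast
     then have "(1/3) ^ n * cmod (h n z) \<le> (1/3) ^ n * (S / C * (C * 1 * (1 - R) powr (- real N)))"
      by (rule mult_left_mono) simp
     then show "norm (norm (of_real (w n) * h n z)) \<le> \<bar>w n\<bar> * (S / C * (C * 1 * (1 - R) powr (- real N)))"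
      unfolding nw wabs by (subst real_norm_def, subst abs_of_nonneg) auto
    qed
    ultimately show ?thesis
     using summable_norm[of "\<lambda>n. of_real (w n) * h n z"] by (simp only: sums_iff)
   qed
   show "sphere_Lq q (h n) \<le> \<psi> n" for n
   proof -
    have "sphere_Lq q (h n) = sphere_Lq q (\<lambda>z. of_real (\<theta> n) * series (m n) ((r n * R) *\<^sub>R z))"
     unfolding sphere_Lq_def
     by (intro arg_cong[of _ _ "\<lambda>I. I powr (1 / q)"] bochner_integral_cong refl) (simp add: heq)
    also have "\<dots> = \<theta> n * sphere_Lq q (\<lambda>z. series (m n) ((r n * R) *\<^sub>R z))"
     using q \<theta>[of n] by (subst sphere_Lq_scale) auto
    also have "\<dots> \<le> \<theta> n * (C / (1 - r n * R) ^ N * 1)"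
    proof (rule mult_left_mono)
     have rR': "0 \<le> r n * R" "r n * R < 1" using rR[of n] by (simp_all add: mult.commute)
     have "sphere_Lq q (\<lambda>z. series (m n) ((r n * R) *\<^sub>R z)) \<le> C / (1 - r n * R) ^ N * sphere_Lq q (\<phi> n)"
      unfolding m_def by (rule C(2)[OF \<phi>(1) rR'])
     also have "\<dots> \<le> C / (1 - r n * R) ^ N * 1"
      by (rule mult_left_mono[OF \<phi>(2)]) (use C rR' in simp)
     finally show "sphere_Lq q (\<lambda>z. series (m n) ((r n * R) *\<^sub>R z)) \<le> C / (1 - r n * R) ^ N * 1" .
    qed (use \<theta>[of n] in simp)
    also have "\<dots> = \<psi> n"
     using rR[of n] by (simp add: \<psi>_def powr_minus powr_realpow divide_inverse mult_ac)
    finally show ?thesis .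
   qed
   show "summable (\<lambda>n. (1/3) ^ n * \<psi> n)"
    by (rule summable_comparison_test'[OF summable_mult2[OF ws, of "C * 1 * (1 - R) powr (- real N)"]])
     (use \<psi>up \<psi>0 in \<open>auto simp: wabs abs_mult less_imp_le intro!: mult_left_mono\<close>)
  qed auto
  then show "sphere_Lq q (\<lambda>z. series a (R *\<^sub>R z)) \<le> (\<Sum>n. (1/3) ^ n * (C * (1 - r n) powr (real N - \<alpha>) * (1 - R * r n) powr (- real N)))"
   by (simp only: \<psi>_def \<theta>_def)
 qed (use q in simp)
 then show ?thesis by (simp only: a_def[abs_def] w_def b_def)
qed

end

section \<open>Necessity of the kernel condition\<close>

lemma A_infE:
 fixes f :: "'a::euclidean_space \<Rightarrow> complex"
 assumes "f \<in> A_inf \<beta>"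
 obtains B where "\<And>x. x \<in> ball 0 1 \<Longrightarrow> (1 - (norm x)\<^sup>2) powr \<beta> * cmod (f x) \<le> B"
proof -
 let ?S = "SUP x\<in>ball 0 1. ennreal ((1 - (norm x)\<^sup>2) powr \<beta> * cmod (f x))"
 have "?S < \<infinity>" using assms by (simp add: A_inf_def)
 then obtain B where B: "?S = ennreal B" "B \<ge> 0" by (cases ?S) auto
 have "(1 - (norm x)\<^sup>2) powr \<beta> * cmod (f x) \<le> B" if "x \<in> ball 0 1" for x
 proof -
  have "ennreal ((1 - (norm x)\<^sup>2) powr \<beta> * cmod (f x)) \<le> ?S" by (rule SUP_upper[OF that])
  then show ?thesis unfolding B(1) using B(2) by (simp add: ennreal_le_iff)
 qed
 then show thesis by (rule that)
qed

context sh_basis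
begin

text \<open>
 Gliding hump for the family of weighted values of \<open>c\<close> applied to a test function, indexed by
 \<open>\<phi>\<close> and \<open>r\<close>.
\<close>

lemma test_family_bounded:
 assumes c: "subexponential (row c)" and mult: "c \<in> multipliers d Y (B_space p q \<alpha>) (A_inf \<beta>)"
  and p: "p \<ge> 1" and q: "q \<ge> 1" and \<alpha>: "\<alpha> > 0" and \<beta>: "\<beta> > 0" and N: "real N > \<alpha>"
 obtains C where "\<And>\<phi> r x. bounded_measurable \<phi> \<Longrightarrow> sphere_Lq q \<phi> \<le> 1 \<Longrightarrow> 0 \<le> r \<Longrightarrow> r < 1 \<Longrightarrow> x \<in> ball 0 1 \<Longrightarrow>
  (1 - (norm x)\<^sup>2) powr \<beta> * cmod (series (\<lambda>k j. c k j * test_coeff N \<alpha> \<phi> r k j) x) \<le> C"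
proof -
 define I where "I = {(\<phi> :: 'a \<Rightarrow> complex, r :: real). bounded_measurable \<phi> \<and> sphere_Lq q \<phi> \<le> 1 \<and> 0 \<le> r \<and> r < 1}"
 define b where "b i = test_coeff N \<alpha> (fst i) (snd i)" for i
 define t where "t i x = of_real ((1 - (norm x)\<^sup>2) powr \<beta>) * series (\<lambda>k j. c k j * b i k j) x" for i x
 obtain D where D: "subexponential D"
  "\<And>\<phi> r k. bounded_measurable \<phi> \<Longrightarrow> sphere_Lq q \<phi> \<le> 1 \<Longrightarrow> 0 \<le> r \<Longrightarrow> r < 1 \<Longrightarrow>
    row (test_coeff N \<alpha> \<phi> r) k \<le> (1 - r) powr (real N - \<alpha>) * D k"
  using row_test_coeff_le[OF q, of N \<alpha>] by metis
 have "bounded_measurable (\<lambda>_ :: 'a. 0)" by (rule bounded_measurableI[where B = 0]) auto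
 then have D0: "D k \<ge> 0" for k
  using D(2)[of "\<lambda>_. 0" 0 k] row_nonneg[of "test_coeff N \<alpha> (\<lambda>_. 0) 0" k] q
  by (simp add: sphere_Lq_def)
 have bD: "row (b i) k \<le> D k" if "i \<in> I" for i k
 proof -
  have i: "bounded_measurable (fst i)" "sphere_Lq q (fst i) \<le> 1" "0 \<le> snd i" "snd i < 1"
   using that by (auto simp: I_def)
  have "(1 - snd i) powr (real N - \<alpha>) \<le> 1" using i N by (intro powr_le1) auto
  then show ?thesis unfolding b_def using D(2)[OF i, of k] mult_right_mono[OF _ D0[of k]] by fastforce
 qed
 have cb: "row (\<lambda>k j. c k j * b i k j) k \<le> row c k * D k" if "i \<in> I" for i k
  by (rule order_trans[OF row_mult_le mult_left_mono[OF bD[OF that] row_nonneg]])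
 have cD: "subexponential (\<lambda>k. row c k * D k)" by (intro subexponential_mult c D)
 have "\<exists>C. \<forall>i\<in>I. \<forall>x\<in>ball 0 1. cmod (t i x) \<le> C"
 proof (rule condensation_of_singularities)
  fix x :: 'a assume x: "x \<in> ball 0 1"
  have "cmod (t i x) \<le> (1 - (norm x)\<^sup>2) powr \<beta> * (\<Sum>k. norm x ^ k * (row c k * D k * Y_bound k))" if "i \<in> I" for i
   unfolding t_def norm_mult norm_of_real abs_of_nonneg[OF powr_ge_zero]
   by (intro mult_left_mono sh_series_le cD cb that x) auto
  then show "\<exists>K. \<forall>i\<in>I. cmod (t i x) \<le> K" by blast
 next
  fix i :: "nat \<Rightarrow> ('a \<Rightarrow> complex) \<times> real" and e :: "nat \<Rightarrow> real"
  assume i: "\<And>n. i n \<in> I" and e: "\<And>n. e n = 1 \<or> e n = -1"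
  define w where "w n = e n * (1/3) ^ n" for n
  define a where "a k j = (\<Sum>n. of_real (w n) * b (i n) k j)" for k j
 let ?ca = "\<lambda>k j. \<Sum>n. of_real (w n) * (c k j * b (i n) k j)"
  have i': "bounded_measurable (fst (i n))" "sphere_Lq q (fst (i n)) \<le> 1" "0 \<le> snd (i n)" "snd (i n) < 1" for n
   using i[of n] by (auto simp: I_def)
  have "\<bar>w n\<bar> = (1/3) ^ n" for n using e[of n] by (auto simp: w_def abs_mult)
  then have ws: "summable (\<lambda>n. \<bar>w n\<bar>)" by simp
  have ra: "subexponential (row a)"
   unfolding a_def[abs_def] by (rule sh_series_superposition(1)[OF D(1) bD[OF i] ws])
  have "series a \<in> B_space p q \<alpha>"
   unfolding a_def[abs_def] w_def b_def by (rule test_superposition_in_B_space[OF p q \<alpha> N i' e])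
  then have "seq_conv d Y c (series a) \<in> A_inf \<beta>" using mult by (simp add: multipliers_def)
  moreover have "seq_conv d Y c (series a) = series ?ca"
   unfolding seq_conv_def
  proof (rule sh_series_cong)
   fix k j assume j: "j \<in> {1..d k}"
   have "cmod (b (i n) k j) \<le> D k" for n
   proof -
    have "cmod (b (i n) k j) \<le> row (b (i n)) k" unfolding row_def by (rule member_le_sum) (use j in auto)
    then show ?thesis using bD[OF i, of n k] by linarith
   qed
   then have "norm (of_real (w n) * b (i n) k j) \<le> \<bar>w n\<bar> * D k" for n
    unfolding norm_mult norm_of_real by (intro mult_left_mono) auto
   then have "summable (\<lambda>n. of_real (w n) * b (i n) k j)"
    by (rule summable_comparison_test'[OF summable_mult2[OF ws]])
   from suminf_mult[OF this, of "c k j"]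
   show "c k j * sh_coeff d Y (series a) k j = (\<Sum>n. of_real (w n) * (c k j * b (i n) k j))"
    unfolding sh_coeff_sh_series[OF ra j] a_def by (simp add: mult.left_commute)
  qed
  ultimately obtain B where B: "\<And>x. x \<in> ball 0 1 \<Longrightarrow>
   (1 - (norm x)\<^sup>2) powr \<beta> * cmod (series ?ca x) \<le> B"
   by (metis A_infE)
  have "cmod (\<Sum>n. of_real (e n * (1/3) ^ n) * t (i n) x) \<le> B" if x: "x \<in> ball 0 1" for x
  proof -
   have "(\<lambda>n. of_real (w n) * series (\<lambda>k j. c k j * b (i n) k j) x)
     sums series ?ca x"
    by (rule sh_series_superposition(2)[OF cD cb[OF i] ws x])
   then have "(\<lambda>n. of_real ((1 - (norm x)\<^sup>2) powr \<beta>) * (of_real (w n) * series (\<lambda>k j. c k j * b (i n) k j) x))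
     sums (of_real ((1 - (norm x)\<^sup>2) powr \<beta>) * series ?ca x)"
    by (rule sums_mult)
   then have "(\<lambda>n. of_real (e n * (1/3) ^ n) * t (i n) x)
     sums (of_real ((1 - (norm x)\<^sup>2) powr \<beta>) * series ?ca x)"
    unfolding t_def w_def[symmetric] by (simp only: mult.left_commute)
   then show ?thesis using B[OF x] by (simp add: sums_iff norm_mult)
  qed
  then show "\<exists>B. \<forall>x\<in>ball 0 1. cmod (\<Sum>n. of_real (e n * (1/3) ^ n) * t (i n) x) \<le> B" by blast
 qed
 then obtain C where C: "\<And>i x. i \<in> I \<Longrightarrow> x \<in> ball 0 1 \<Longrightarrow> cmod (t i x) \<le> C" by blast
 show thesis
 proof (rule that)
  fix \<phi> :: "'a \<Rightarrow> complex" and r :: real and x :: 'a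
  assume "bounded_measurable \<phi>" "sphere_Lq q \<phi> \<le> 1" "0 \<le> r" "r < 1" and x: "x \<in> ball 0 1"
  then have "(\<phi>, r) \<in> I" by (simp add: I_def)
  from C[OF this x] show "(1 - (norm x)\<^sup>2) powr \<beta> * cmod (series (\<lambda>k j. c k j * test_coeff N \<alpha> \<phi> r k j) x) \<le> C"
   by (simp add: t_def b_def norm_mult)
 qed
qed

lemma moment_scale: "moment (\<lambda>z. of_real u * \<phi> z) k j = of_real u * moment \<phi> k j"
 unfolding moment_def mult.assoc by simp

text \<open>
 Evaluating the test function for \<open>r\<close> at a point of norm \<open>r = sqrt \<rho>\<close> balances
 the two weights, as \<open>1 - r\<close> and \<open>1 - \<rho>\<close> are comparable. To pass from the unit
 ball to general \<open>\<phi>\<close>, including those of norm zero, divide by the norm plus a small number.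
\<close>

lemma poch_multiplier_bound:
 assumes c: "subexponential (row c)" and mult: "c \<in> multipliers d Y (B_space p q \<alpha>) (A_inf \<beta>)"
  and p: "p \<ge> 1" and q: "q \<ge> 1" and \<alpha>: "\<alpha> > 0" and \<beta>: "\<beta> > 0" and N: "real N > \<alpha>"
 obtains C where "C > 0" "\<And>\<phi> \<rho> y. bounded_measurable \<phi> \<Longrightarrow> 0 \<le> \<rho> \<Longrightarrow> \<rho> < 1 \<Longrightarrow> y \<in> sphere 0 1 \<Longrightarrow>
  cmod (series (weighted (poch N) (\<lambda>k j. c k j * moment \<phi> k j)) (\<rho> *\<^sub>R y)) \<le> C * (1 - \<rho>) powr (- (real N + \<beta> - \<alpha>)) * sphere_Lq q \<phi>"
proof -
 obtain C where C: "\<And>\<phi> r x. bounded_measurable \<phi> \<Longrightarrow> sphere_Lq q \<phi> \<le> 1 \<Longrightarrow> 0 \<le> r \<Longrightarrow> r < 1 \<Longrightarrow> x \<in> ball 0 1 \<Longrightarrow>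
  (1 - (norm x)\<^sup>2) powr \<beta> * cmod (series (\<lambda>k j. c k j * test_coeff N \<alpha> \<phi> r k j) x) \<le> C"
 proof (rule test_family_bounded[OF c mult p q \<alpha> \<beta> N], goal_cases)
  case (1 C)
  show ?case by (rule 1(1)) (rule 1(2))
 qed
 define S where "S \<phi> = series (weighted (poch N) (\<lambda>k j. c k j * moment \<phi> k j))" for \<phi>
 define C' where "C' = max 1 C * 2 powr (real N - \<alpha>)"
 define \<kappa> where "\<kappa> = real N + \<beta> - \<alpha>"
 have C': "C' > 0" by (simp add: C'_def)
 have rw: "subexponential (row (weighted (poch N) (\<lambda>k j. c k j * moment \<phi> k j)))" if "bounded_measurable \<phi>" for \<phi>
  by (intro subexponential_weighted subexponential_poch subexponential_row_mult c subexponential_row_moment that)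
 have unit: "cmod (S \<phi> (\<rho> *\<^sub>R y)) \<le> C' * (1 - \<rho>) powr (- \<kappa>)"
  if \<phi>: "bounded_measurable \<phi>" "sphere_Lq q \<phi> \<le> 1" and \<rho>: "0 \<le> \<rho>" "\<rho> < 1" and y: "y \<in> sphere 0 1" for \<phi> \<rho> y
 proof -
  define r where "r = sqrt \<rho>"
  have r: "0 \<le> r" "r < 1" "r * r = \<rho>" using \<rho> by (auto simp: r_def)
  have half: "(1 - \<rho>) / 2 \<le> 1 - r"
  proof -
   have "1 - \<rho> = (1 - r) * (1 + r)" using r(3) by (simp add: algebra_simps)
   also have "\<dots> \<le> (1 - r) * 2" using r by (intro mult_left_mono) auto
   finally show ?thesis by simp
  qed
  have "(\<lambda>k j. c k j * test_coeff N \<alpha> \<phi> r k j)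
    = weighted (\<lambda>k. r ^ k * (1 - r) powr (real N - \<alpha>)) (weighted (poch N) (\<lambda>k j. c k j * moment \<phi> k j))"
   by (simp add: test_coeff_def weighted_def fun_eq_iff mult_ac)
  then have "series (\<lambda>k j. c k j * test_coeff N \<alpha> \<phi> r k j) (r *\<^sub>R y) = of_real ((1 - r) powr (real N - \<alpha>)) * S \<phi> (\<rho> *\<^sub>R y)"
   using sh_series_test_coeff[OF rw[OF \<phi>(1)] y r(1,2) r(1,2)] by (simp only: S_def r(3))
  moreover have "(1 - (norm (r *\<^sub>R y))\<^sup>2) powr \<beta> * cmod (series (\<lambda>k j. c k j * test_coeff N \<alpha> \<phi> r k j) (r *\<^sub>R y)) \<le> C"
   by (rule C[OF \<phi> r(1,2)]) (use y r in simp)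
  moreover have "(norm (r *\<^sub>R y))\<^sup>2 = \<rho>" using y r by (simp add: power2_eq_square)
  ultimately have bd: "(1 - \<rho>) powr \<beta> * ((1 - r) powr (real N - \<alpha>) * cmod (S \<phi> (\<rho> *\<^sub>R y))) \<le> C"
   by (simp add: norm_mult)
  have "(1 - \<rho>) powr \<kappa> * cmod (S \<phi> (\<rho> *\<^sub>R y)) = (1 - \<rho>) powr \<beta> * ((2 * ((1 - \<rho>) / 2)) powr (real N - \<alpha>) * cmod (S \<phi> (\<rho> *\<^sub>R y)))"
  proof -
   have "\<kappa> = \<beta> + (real N - \<alpha>)" by (simp add: \<kappa>_def)
   then have "(1 - \<rho>) powr \<kappa> = (1 - \<rho>) powr \<beta> * (1 - \<rho>) powr (real N - \<alpha>)" by (simp only: powr_add)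
   moreover have "2 * ((1 - \<rho>) / 2) = 1 - \<rho>" by simp
   ultimately show ?thesis by (simp only: mult.assoc)
  qed
  also have "\<dots> = 2 powr (real N - \<alpha>) * ((1 - \<rho>) powr \<beta> * (((1 - \<rho>) / 2) powr (real N - \<alpha>) * cmod (S \<phi> (\<rho> *\<^sub>R y))))"
   unfolding powr_mult by (simp only: mult_ac)
  also have "\<dots> \<le> 2 powr (real N - \<alpha>) * ((1 - \<rho>) powr \<beta> * ((1 - r) powr (real N - \<alpha>) * cmod (S \<phi> (\<rho> *\<^sub>R y))))"
   using half \<rho> N by (intro mult_left_mono mult_right_mono powr_mono2) auto
  also have "\<dots> \<le> 2 powr (real N - \<alpha>) * max 1 C"
   using bd by (intro mult_left_mono) auto
  finally have "(1 - \<rho>) powr \<kappa> * cmod (S \<phi> (\<rho> *\<^sub>R y)) \<le> C'" by (simp add: C'_def mult.commute)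
  then show ?thesis using \<rho> by (simp add: powr_minus field_simps)
 qed
 have "cmod (S \<phi> (\<rho> *\<^sub>R y)) \<le> C' * (1 - \<rho>) powr (- \<kappa>) * sphere_Lq q \<phi>"
  if \<phi>: "bounded_measurable \<phi>" and \<rho>: "0 \<le> \<rho>" "\<rho> < 1" and y: "y \<in> sphere 0 1" for \<phi> \<rho> y
 proof (rule field_le_epsilon)
  fix \<epsilon> :: real assume \<epsilon>: "\<epsilon> > 0"
  define A where "A = C' * (1 - \<rho>) powr (- \<kappa>)"
  have A: "A > 0" using C' \<rho> by (simp add: A_def)
  \<comment> \<open>A positive stand-in for the norm; the summand is \<open>\<epsilon>\<close> divided by the constant of the claim.\<close>
  define T where "T = sphere_Lq q \<phi> + \<epsilon> / A"
  have T: "T > 0" "sphere_Lq q \<phi> \<le> T"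
   unfolding T_def using A \<epsilon> sphere_Lq_nonneg[of q \<phi>] by (auto simp: add_nonneg_pos)
  define u where "u = 1 / T"
  have u: "u > 0" using T by (simp add: u_def)
  have \<phi>u: "bounded_measurable (\<lambda>z. of_real u * \<phi> z)"
  proof -
   obtain B where B: "B \<ge> 0" "\<And>z. z \<in> sphere 0 1 \<Longrightarrow> cmod (\<phi> z) \<le> B" and m: "\<phi> \<in> borel_measurable surface"
    using bounded_measurableE[OF \<phi>] by metis
   show ?thesis
    by (rule bounded_measurableI[where B = "u * B"]) (use m B u in \<open>auto simp: norm_mult\<close>)
  qed
  have "sphere_Lq q (\<lambda>z. of_real u * \<phi> z) \<le> 1"
   using T u q by (subst sphere_Lq_scale) (auto simp: u_def)
  from unit[OF \<phi>u this \<rho> y] have le: "cmod (S (\<lambda>z. of_real u * \<phi> z) (\<rho> *\<^sub>R y)) \<le> A" by (simp only: A_def)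
  have Su: "S (\<lambda>z. of_real u * \<phi> z) (\<rho> *\<^sub>R y) = of_real u * S \<phi> (\<rho> *\<^sub>R y)"
  proof -
   have "(\<lambda>k. of_real u * (of_real (\<rho> ^ k) * part (weighted (poch N) (\<lambda>k j. c k j * moment \<phi> k j)) k y)) sums (of_real u * S \<phi> (\<rho> *\<^sub>R y))"
    unfolding S_def by (intro sums_mult sh_series_polar rw \<phi> y \<rho>)
   moreover have "of_real u * (of_real (\<rho> ^ k) * part (weighted (poch N) (\<lambda>k j. c k j * moment \<phi> k j)) k y)
     = of_real (\<rho> ^ k) * part (weighted (poch N) (\<lambda>k j. c k j * moment (\<lambda>z. of_real u * \<phi> z) k j)) k y" for k
    unfolding moment_scale part_def weighted_def by (simp add: sum_distrib_left mult_ac)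
   ultimately show ?thesis
    using sums_unique2[OF sh_series_polar[OF rw[OF \<phi>u] y \<rho>]] by (simp only: S_def)
  qed
  have "cmod (S \<phi> (\<rho> *\<^sub>R y)) \<le> A * T"
   using le u unfolding Su by (simp add: norm_mult norm_divide u_def divide_le_eq)
  also have "A * T = A * sphere_Lq q \<phi> + \<epsilon>" using A by (simp add: T_def distrib_left)
  finally show "cmod (S \<phi> (\<rho> *\<^sub>R y)) \<le> C' * (1 - \<rho>) powr (- \<kappa>) * sphere_Lq q \<phi> + \<epsilon>" by (simp only: A_def)
 qed
 then show thesis using that[OF C'] by (simp only: S_def \<kappa>_def)
qed

text \<open>
 The Pochhammer factor splits as the fractional weight of order \<open>s\<close> times a quotient of Gamma
 functions of order \<open>\<tau> = N - s\<close>, and the latter is removed by fractional integration.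
\<close>

theorem multiplier_necessary:
 assumes dim: "DIM('a) \<ge> 2" and s: "s > 0" and c: "subexponential (row c)"
  and mult: "c \<in> multipliers d Y (B_space p q \<alpha>) (A_inf \<beta>)"
  and p: "p \<ge> 1" and q: "q \<ge> 1" and \<alpha>: "\<alpha> > 0" and \<beta>: "\<beta> > 0" and \<kappa>: "\<kappa> = s + \<beta> - \<alpha>" "\<kappa> > 0"
 shows "\<exists>C\<ge>0. frac_multiplier_bound c q s \<kappa> C"
proof -
 \<comment> \<open>Above \<open>\<alpha>\<close> for the test functions, above \<open>s\<close> so that \<open>\<tau> = N - s\<close> is a legitimate order of integration.\<close>
 obtain N :: nat where N: "max s \<alpha> < real N" using reals_Archimedean2 by blast
 then have N': "real N > s" "real N > \<alpha>" by auto
 obtain C where C: "C > 0" "\<And>\<phi> \<rho> y. bounded_measurable \<phi> \<Longrightarrow> 0 \<le> \<rho> \<Longrightarrow> \<rho> < 1 \<Longrightarrow> y \<in> sphere 0 1 \<Longrightarrow>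
  cmod (series (weighted (poch N) (\<lambda>k j. c k j * moment \<phi> k j)) (\<rho> *\<^sub>R y)) \<le> C * (1 - \<rho>) powr (- (real N + \<beta> - \<alpha>)) * sphere_Lq q \<phi>"
 proof (rule poch_multiplier_bound[OF c mult p q \<alpha> \<beta> N'(2)], goal_cases)
  case (1 C)
  show ?case by (rule 1(1)[OF 1(2)]) (rule 1(3))
 qed
 define h where "h = real DIM('a) / 2"
 define \<tau> where "\<tau> = real N - s"
 define G where "G = Gamma s"
 have G: "G > 0" using s by (simp add: G_def)
 have h: "h \<ge> 1" using dim by (simp add: h_def)
 have \<tau>: "\<tau> > 0" using N' by (simp add: \<tau>_def)
 define C' where "C' = (1 / \<tau> + 1 / \<kappa>) / Gamma \<tau> * C / G"
 have "frac_multiplier_bound c q s \<kappa> C'"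
  unfolding frac_multiplier_bound_def
 proof (intro allI impI)
  fix \<phi> :: "'a \<Rightarrow> complex" and \<rho> :: real and y :: 'a
  assume \<phi>: "bounded_measurable \<phi>" and \<rho>: "0 \<le> \<rho>" "\<rho> < 1" and y: "y \<in> sphere 0 1"
  define a where "a k j = c k j * moment \<phi> k j" for k j
 let ?fa = "weighted (frac_weight s) a"
  have ra: "subexponential (row a)"
   unfolding a_def[abs_def] by (intro subexponential_row_mult c subexponential_row_moment \<phi>)
  have rf: "subexponential (row ?fa)"
   by (intro subexponential_weighted subexponential_frac_weight dim s ra)
  have rp: "subexponential (row (weighted (poch N) a))"
   by (intro subexponential_weighted subexponential_poch ra)
  define v where "v k = of_real G * part ?fa k y" for k
  have lam: "of_real (Gamma (real k + (h + s) + \<tau>) / Gamma (real k + (h + s))) * v k = part (weighted (poch N) a) k y" for k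
  proof -
   have x: "real k + h > 0" using h by (simp add: add_nonneg_pos)
   have g0: "Gamma (real k + h + s) > 0" "Gamma (real k + h) > 0" using x s by auto
   have "real k + h \<notin> \<int>\<^sub>\<le>\<^sub>0" using x by (auto simp: nonpos_Ints_def)
   then have "poch N k = Gamma (real k + h + real N) / Gamma (real k + h)"
    unfolding poch_def h_def[symmetric] by (rule pochhammer_Gamma)
   then have "Gamma (real k + (h + s) + \<tau>) / Gamma (real k + (h + s)) * (G * frac_weight s k) = poch N k"
    using g0 G by (simp add: frac_weight_def h_def[symmetric] G_def[symmetric] \<tau>_def add.assoc[symmetric])
   then have "complex_of_real (Gamma (real k + (h + s) + \<tau>) / Gamma (real k + (h + s)) * (G * frac_weight s k)) = of_real (poch N k)"
    by (simp only:)
   then show ?thesis unfolding v_def part_weighted of_real_mult by (simp only: mult.assoc[symmetric])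
  qed
  have "cmod (\<Sum>k. of_real (\<rho> ^ k) * v k) \<le> (1 / \<tau> + 1 / \<kappa>) / Gamma \<tau> * (C * sphere_Lq q \<phi>) * (1 - \<rho>) powr (- \<kappa>)"
  proof (rule fractional_integration_bound[where a = "h + s"])
   show "h + s \<ge> 1" using h s by simp
   show "C * sphere_Lq q \<phi> \<ge> 0" using C by (simp add: sphere_Lq_nonneg)
   show "summable (\<lambda>k. norm (v k) * r ^ k)" if "0 \<le> r" "r < 1" for r
    unfolding v_def using summable_mult[OF part_series_summable[OF rf y that], of G] G by (simp add: norm_mult mult_ac)
   show "summable (\<lambda>k. norm (of_real (Gamma (real k + (h + s) + \<tau>) / Gamma (real k + (h + s))) * v k) * r ^ k)" if "0 \<le> r" "r < 1" for r
    unfolding lam by (rule part_series_summable[OF rp y that])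
   show "cmod (\<Sum>k. of_real (r ^ k) * (of_real (Gamma (real k + (h + s) + \<tau>) / Gamma (real k + (h + s))) * v k))
     \<le> C * sphere_Lq q \<phi> * (1 - r) powr (- (\<kappa> + \<tau>))" if r: "0 \<le> r" "r < 1" for r
   proof -
    have "\<kappa> + \<tau> = real N + \<beta> - \<alpha>" by (simp add: \<kappa>(1) \<tau>_def)
    moreover have "(\<Sum>k. of_real (r ^ k) * part (weighted (poch N) a) k y) = series (weighted (poch N) a) (r *\<^sub>R y)"
     using sh_series_polar[OF rp y r] by (simp only: sums_iff)
    ultimately show ?thesis unfolding lam using C(2)[OF \<phi> r y] by (simp only: a_def[abs_def] mult_ac)
   qed
  qed (use \<tau> \<kappa> \<rho> in auto)
  moreover have "(\<Sum>k. of_real (\<rho> ^ k) * v k) = of_real G * series ?fa (\<rho> *\<^sub>R y)"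
  proof -
   have "(\<lambda>k. of_real G * (of_real (\<rho> ^ k) * part ?fa k y)) sums (of_real G * series ?fa (\<rho> *\<^sub>R y))"
    by (rule sums_mult[OF sh_series_polar[OF rf y \<rho>]])
   then show ?thesis unfolding v_def by (simp only: mult.left_commute sums_iff)
  qed
  ultimately have "G * cmod (series ?fa (\<rho> *\<^sub>R y)) \<le> (1 / \<tau> + 1 / \<kappa>) / Gamma \<tau> * (C * sphere_Lq q \<phi>) * (1 - \<rho>) powr (- \<kappa>)"
   using G by (simp add: norm_mult)
  then have "cmod (series ?fa (\<rho> *\<^sub>R y)) \<le> (1 / \<tau> + 1 / \<kappa>) / Gamma \<tau> * (C * sphere_Lq q \<phi>) * (1 - \<rho>) powr (- \<kappa>) / G"
   using G by (simp only: pos_le_divide_eq mult.commute)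
  also have "\<dots> = C' * (1 - \<rho>) powr (- \<kappa>) * sphere_Lq q \<phi>" by (simp add: C'_def)
  finally show "cmod (frac_series s c \<phi> (\<rho> *\<^sub>R y)) \<le> C' * (1 - \<rho>) powr (- \<kappa>) * sphere_Lq q \<phi>"
   by (simp only: a_def[abs_def])
 qed
 moreover have "C' \<ge> 0" using \<tau> \<kappa> C G by (simp add: C'_def)
 ultimately show ?thesis by blast
qed

end

section \<open>Characterisation of the multipliers\<close>

text \<open>
 The hypothesis on \<open>m\<close> gives a positive order \<open>m + 1\<close> and a positive exponent
 \<open>m + 1 + \<beta> - \<alpha>\<close>; the growth of \<open>c\<close> needed for convergence comes from
 the harmonicity of \<open>g\<close>.
\<close>

theorem theorem9:
  fixes d :: "nat \<Rightarrow> nat"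
    and Y :: "nat \<Rightarrow> nat \<Rightarrow> 'a::euclidean_space \<Rightarrow> real"
    and p q \<alpha> \<beta> m :: real
    and q' :: ennreal
    and c :: "nat \<Rightarrow> nat \<Rightarrow> complex"
    and g :: "'a \<Rightarrow> complex"
  assumes "DIM('a) \<ge> 2"
    and "sh_orthonormal_basis d Y"
    and "1 < p" and "1 \<le> q" and "\<alpha> > 0" and "\<beta> > 0"
    and "1 / ennreal q + 1 / q' = 1"
    and "m > max (\<alpha> - \<beta> - 1) (\<beta> - 1)"
    and "associated_harmonic d Y c g"
  shows "c \<in> multipliers d Y (B_space p q \<alpha>) (A_inf \<beta>) \<longleftrightarrow>
    (SUP \<rho>\<in>{0..<1}. SUP y'\<in>sphere 0 1.
       ennreal ((1 - \<rho>) powr (m + 1 + \<beta> - \<alpha>)) *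
       sphere_norm q' (\<lambda>x'. frac_deriv d Y (m + 1) (harm_conv d Y g (poisson x')) (\<rho> *\<^sub>R y'))) < \<infinity>"
proof -
  interpret sh_basis d Y by unfold_locales (rule assms(2))
  have g: "harmonic_on (ball 0 1) g" "\<And>x. x \<in> ball 0 1 \<Longrightarrow> sh_term d Y c x sums g x"
    using assms(9) by (auto simp: associated_harmonic_def harmonic_ball_def)
  have c: "subexponential (row c)"
    using harmonic_expansion(3)[OF g(1)] sh_coeff_outside(1)[OF g(2)] by simp
  have s: "m + 1 > 0" and \<kappa>: "m + 1 + \<beta> - \<alpha> > 0" using assms(5,6,8) by auto
  have p: "p > 0" "p \<ge> 1" using assms(3) by auto
  note condition = sup_condition_iff[OF assms(1) s c assms(9,4,7), of "m + 1 + \<beta> - \<alpha>"]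
  show ?thesis
  proof (rule iffI, goal_cases)
    case 1
    show ?case
      by (rule iffD2[OF condition]) (rule multiplier_necessary[OF assms(1) s c 1 p(2) assms(4,5,6) refl \<kappa>])
  next
    case 2
    then obtain C where "C \<ge> 0" "frac_multiplier_bound c q (m + 1) (m + 1 + \<beta> - \<alpha>) C"
      unfolding condition by blast
    then show ?case by (rule multiplier_sufficient[OF assms(1) s c p(1) assms(4,5,6) refl \<kappa>])
  qed
qed

end
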